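(* Let $n\ge 4$ and $1\le k\le n-1$ be integers. The orbits of the map $T_{n,k}:\mathcal{C}(n,k)\to\mathcal{C}(n,k)$ have compact closure in $\mathcal{C}(n,k)$; that is, for every $x\in\mathcal{C}(n,k)$ the closure in $\mathcal{C}(n,k)$ of $\{T_{n,k}^m(x): m\in\mathbb{Z}\}$ is compact.
   Context: Notation: for distinct points $a,b\in\mathbb{RP}^2$, $(ab)$ is the line through them, and $(ab)(cd)$ is the intersection of the lines $(ab)$ and $(cd)$. A projective transformation is an element of $PGL_3(\mathbb{R})$ acting on $\mathbb{RP}^2$. A (strictly) convex polygon in $\mathbb{RP}^2$ is the image of a (strictly) convex polygon of $\mathbb{R}^2\subset\mathbb{RP}^2$ under a projective transformation. Pentagram map: for a bi-infinite polygonal path $P=(P_j)_{j\in\mathbb{Z}}$ in $\mathbb{RP}^2$ (consecutive vertices joined by segments), $T(P)$ is the path with vertices $T(P)_{j+1/2}=(P_{j-1}P_{j+1})(P_jP_{j+2})$, the edge from $T(P)_{j-1/2}$ to $T(P)_{j+1/2}$ being contained in the diagonal $P_{j-1}P_{j+1}$. Iterating, $T^m(P)$ has vertices $T^m(P)_i$ indexed by $i\in\mathbb{Z}+\frac m2$; for even $m$ it is again indexed by $\mathbb{Z}$. Pentagram spirals: $P$ is a weak pentagram spiral if for some integer $k>0$ the map $T^k$ is defined on $P$ and $T^k(P)=P$ as unlabeled paths; the smallest such $k$ is the order of $P$. A PLC (properly locally convex) pentagram spiral is a weak pentagram spiral $P$ of order $k$ such that the paths $T^j(P)$, $j=0,\dots,k-1$,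 are embedded, locally convex and pairwise disjoint. Locally convex means that each edge together with short adjacent pieces of its two neighboring edges lies on the boundary of a convex set, with a genuine turn at each vertex. The spiral is labeled when its vertices are labeled by consecutive integers increasing as one moves inwards along the spiral (the direction in which the pentagram map moves the path), equivalently when a distinguished vertex $P_1$ is chosen. There is then a whole or half integer $\mu$ with $T^{2k}(P)_j=P_{j+2\mu}$ for all $j$; put $n=\mu-\frac k2$. The type of $P$ is $(n,k)$. $\mathcal{C}(n,k)$ is the space of labeled PLC pentagram spirals of type $(n,k)$ modulo label-preserving projective equivalence. The map $T_{n,k}$ is the shift: $T_{n,k}(P)$ is the same unlabeled spiral with $T_{n,k}(P)_j=P_{j+1}$. Topology of $\mathcal{C}(n,k)$: labeled spirals are identified with seeds, and $\mathcal{C}(n,k)$ with the manifold of projective classes of seeds of type $(n,k)$. A seed of type $(n,k)$ is a pair $(A,B)$, where $A=(A_1,\dots,A_n)$ is a strictly convex $n$-gon in $\mathbb{RP}^2$ and $B=(B_{n-k+1},\dots,B_n)$ with $B_j$ in the interior of the edge $A_jA_{j+1}$ (indices mod $n$). In terms of seeds, the same map is $T_{n,k}(A,B)=(A^*,B^* )$ with $A_i^*=A_{i+1}$ for $1\le i\le n-k$; $A_i^*=B_i$ for $n-k+1\le i\le n$; $B_n^*=(A_1A_2^* )(A_n^*A_1^* )$; and $B_j^*=(A_{j+1}B_{j+1}^* )(A_j^*A_{j+1}^* )$ for $j=n-1,n-2,\dots,n-k+1$ in this order; it is invertible on seeds of type $(n,k)$. The labeled spiral corresponding to a seed $(A,B)$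 has as its vertex $P_{q+1}$ the first vertex of the polygon of the seed $T_{n,k}^q(A,B)$, for $q\in\mathbb{Z}$ (so $P_1=A_1$), and as its edge $P_{q+1}P_{q+2}$ the first edge of that polygon. *)

theory Defs
  imports "HOL-Analysis.Analysis"
begin

section \<open>The real projective plane\<close>

typedef rp2 = "{span {v} | v :: real^3. v \<noteq> 0}"
  by (rule exI[of _ "span {axis 1 1}"]) (auto simp: axis_eq_0_iff)

definition proj :: "real^3 \<Rightarrow> rp2" where
  "proj v = Abs_rp2 (span {v})"

text \<open>The topology is the quotient topology of the punctured space.\<close>

instantiation rp2 :: topological_space
begin

definition open_rp2 :: "rp2 set \<Rightarrow> bool" where
  "open_rp2 U \<longleftrightarrow> open {v. v \<noteq> 0 \<and> proj v \<in> U}"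

instance
proof
  have "{v :: real^3. v \<noteq> 0 \<and> proj v \<in> UNIV} = - {0}" by auto
  then show "open (UNIV :: rp2 set)" by (simp add: open_rp2_def open_Compl)
next
  fix S T :: "rp2 set"
  assume "open S" "open T"
  moreover have "{v. v \<noteq> 0 \<and> proj v \<in> S \<inter> T}
      = {v. v \<noteq> 0 \<and> proj v \<in> S} \<inter> {v. v \<noteq> 0 \<and> proj v \<in> T}" by auto
  ultimately show "open (S \<inter> T)" by (simp only: open_rp2_def open_Int)
next
  fix K :: "rp2 set set"
  assume "\<forall>S\<in>K. open S"
  moreover have "{v. v \<noteq> 0 \<and> proj v \<in> \<Union>K} = (\<Union>S\<in>K. {v. v \<noteq> 0 \<and> proj v \<in> S})" by auto
  ultimately show "open (\<Union>K)" by (simp only: open_rp2_def) auto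
qed

end

definition pline :: "rp2 \<Rightarrow> rp2 \<Rightarrow> rp2 set" where
  "pline a b = {x. Rep_rp2 x \<subseteq> span (Rep_rp2 a \<union> Rep_rp2 b)}"

definition pmeet :: "rp2 set \<Rightarrow> rp2 set \<Rightarrow> rp2" where
  "pmeet l m = (THE x. x \<in> l \<and> x \<in> m)"

definition papply :: "real^3^3 \<Rightarrow> rp2 \<Rightarrow> rp2" where
  "papply M x = Abs_rp2 ((\<lambda>v. M *v v) ` Rep_rp2 x)"

definition affine_pt :: "real^2 \<Rightarrow> rp2" where
  "affine_pt x = proj (vector [x $ 1, x $ 2, 1])"

text \<open>Two distinct points of the projective plane are joined by two segments;
  replacing one of the two representing vectors by its negative exchanges them.\<close>

definition seg :: "real^3 \<Rightarrow> real^3 \<Rightarrow> rp2 set" where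
  "seg u v = {proj (s *\<^sub>R u + t *\<^sub>R v) | s t. 0 \<le> s \<and> 0 \<le> t \<and> 0 < s + t}"

definition is_segment :: "rp2 \<Rightarrow> rp2 \<Rightarrow> rp2 set \<Rightarrow> bool" where
  "is_segment a b S \<longleftrightarrow> a \<noteq> b \<and>
     (\<exists>u v. u \<noteq> 0 \<and> v \<noteq> 0 \<and> proj u = a \<and> proj v = b \<and> S = seg u v)"

section \<open>Polygonal paths and the pentagram map\<close>

text \<open>\<open>edge P j\<close> is the chosen segment from \<open>vert P j\<close> to \<open>vert P (j + 1)\<close>.\<close>

datatype ppath = PPath (vert: "int \<Rightarrow> rp2") (edge: "int \<Rightarrow> rp2 set")

definition polygonal_path :: "ppath \<Rightarrow> bool" where
  "polygonal_path P \<longleftrightarrow> (\<forall>j. is_segment (vert P j) (vert P (j + 1)) (edge P j))"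

definition path_set :: "ppath \<Rightarrow> rp2 set" where
  "path_set P = (\<Union>j. edge P j)"

text \<open>The diagonal from \<open>vert P (j - 1)\<close> to \<open>vert P (j + 1)\<close>: of the two segments,
  the one that bounds a triangle together with the edges of \<open>P\<close> at \<open>vert P j\<close>.\<close>

definition diagonal :: "ppath \<Rightarrow> int \<Rightarrow> rp2 set \<Rightarrow> bool" where
  "diagonal P j D \<longleftrightarrow> (\<exists>u v w. u \<noteq> 0 \<and> v \<noteq> 0 \<and> w \<noteq> 0 \<and>
     proj u = vert P (j - 1) \<and> proj v = vert P j \<and> proj w = vert P (j + 1) \<and>
     edge P (j - 1) = seg u v \<and> edge P j = seg v w \<and> D = seg u w)"

text \<open>\<open>pentagram P Q\<close>: the map \<open>T\<close> is defined on \<open>P\<close>, and \<open>Q = T(P)\<close>. The half-integer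
  labels are stored with an offset: \<open>vert Q j\<close> is \<open>T(P)\<^sub>j\<^sub>+\<^sub>1\<^sub>/\<^sub>2\<close>. Consequently, if
  \<open>(pentagram ^^ m) P Q\<close>, then \<open>vert Q j\<close> is the vertex of \<open>T\<^sup>m(P)\<close> with label \<open>j + m/2\<close>.\<close>

definition pentagram :: "ppath \<Rightarrow> ppath \<Rightarrow> bool" where
  "pentagram P Q \<longleftrightarrow> polygonal_path P \<and> polygonal_path Q \<and>
     (\<forall>j. vert P (j - 1) \<noteq> vert P (j + 1) \<and> vert P j \<noteq> vert P (j + 2) \<and>
          pline (vert P (j - 1)) (vert P (j + 1)) \<noteq> pline (vert P j) (vert P (j + 2)) \<and>
          vert Q j = pmeet (pline (vert P (j - 1)) (vert P (j + 1)))
                           (pline (vert P j) (vert P (j + 2))) \<and>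
          (\<exists>D. diagonal P j D \<and> edge Q (j - 1) \<subseteq> D))"

text \<open>Equality of unlabeled paths: equality up to a relabeling of the vertices that preserves
  or reverses their order.\<close>

definition same_unlabeled :: "ppath \<Rightarrow> ppath \<Rightarrow> bool" where
  "same_unlabeled P Q \<longleftrightarrow> (\<exists>m.
     (\<forall>j. vert Q j = vert P (m + j) \<and> edge Q j = edge P (m + j)) \<or>
     (\<forall>j. vert Q j = vert P (m - j) \<and> edge Q j = edge P (m - j - 1)))"

definition embedded :: "ppath \<Rightarrow> bool" where
  "embedded P \<longleftrightarrow>
     (\<forall>j. edge P j \<inter> edge P (j + 1) = {vert P (j + 1)}) \<and>
     (\<forall>i j. i + 2 \<le> j \<longrightarrow> edge P i \<inter> edge P j = {})"

definition locally_convex_path :: "ppath \<Rightarrow> bool" where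
  "locally_convex_path P \<longleftrightarrow> (\<forall>j.
     vert P (j + 1) \<notin> pline (vert P (j - 1)) (vert P j) \<and>
     (\<exists>a b S S' M (K :: (real^2) set).
        is_segment a (vert P j) S \<and> S \<subseteq> edge P (j - 1) \<and>
        is_segment (vert P (j + 1)) b S' \<and> S' \<subseteq> edge P (j + 1) \<and>
        invertible M \<and> convex K \<and>
        S \<union> edge P j \<union> S' \<subseteq> (\<lambda>x. papply M (affine_pt x)) ` frontier K))"

section \<open>Pentagram spirals\<close>

definition returns :: "nat \<Rightarrow> ppath \<Rightarrow> bool" where
  "returns k P \<longleftrightarrow> (\<exists>Q. (pentagram ^^ k) P Q \<and> same_unlabeled P Q)"

definition weak_spiral :: "nat \<Rightarrow> ppath \<Rightarrow> bool" where
  "weak_spiral k P \<longleftrightarrow> 0 < k \<and> returns k P \<and> (\<forall>j. 0 < j \<and> j < k \<longrightarrow> \<not> returns j P)"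

definition PLC_spiral :: "nat \<Rightarrow> ppath \<Rightarrow> bool" where
  "PLC_spiral k P \<longleftrightarrow> weak_spiral k P \<and>
     (\<forall>j<k. \<forall>Q. (pentagram ^^ j) P Q \<longrightarrow> embedded Q \<and> locally_convex_path Q) \<and>
     (\<forall>i<k. \<forall>j<k. i \<noteq> j \<longrightarrow> (\<forall>Q R. (pentagram ^^ i) P Q \<longrightarrow> (pentagram ^^ j) P R \<longrightarrow>
        path_set Q \<inter> path_set R = {}))"

text \<open>The integer \<open>M\<close> is \<open>2\<mu>\<close> in \<open>T\<^sup>2\<^sup>k(P)\<^sub>j = P\<^sub>j\<^sub>+\<^sub>2\<^sub>\<mu>\<close>, and the last equation is
  \<open>n = \<mu> - k/2\<close>. It makes \<open>M\<close> positive for \<open>k > 0\<close>, so the labels increase in the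
  direction in which the pentagram map moves the path, that is, inwards.\<close>

definition labeled_type :: "nat \<Rightarrow> nat \<Rightarrow> ppath \<Rightarrow> bool" where
  "labeled_type n k P \<longleftrightarrow> (\<exists>Q M. (pentagram ^^ (2 * k)) P Q \<and>
     (\<forall>j. vert Q (j - int k) = vert P (j + M)) \<and> 2 * int n = M - int k)"

definition labeled_PLC_spirals :: "nat \<Rightarrow> nat \<Rightarrow> ppath set" where
  "labeled_PLC_spirals n k = {P. PLC_spiral k P \<and> labeled_type n k P}"

definition proj_class :: "ppath \<Rightarrow> ppath set" where
  "proj_class P = {Q. \<exists>M. invertible M \<and>
     (\<forall>j. vert Q j = papply M (vert P j) \<and> edge Q j = papply M ` edge P j)}"

definition shift_path :: "ppath \<Rightarrow> ppath" where
  "shift_path P = PPath (\<lambda>j. vert P (j + 1)) (\<lambda>j. edge P (j + 1))"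

text \<open>The map \<open>T\<^sub>n\<^sub>,\<^sub>k\<close> on projective classes of labeled spirals.\<close>

definition shift_class :: "ppath set \<Rightarrow> ppath set" where
  "shift_class X = shift_path ` X"

text \<open>Integer iterates of a bijection \<open>f\<close> of \<open>S\<close>.\<close>

definition int_iter :: "'a set \<Rightarrow> ('a \<Rightarrow> 'a) \<Rightarrow> int \<Rightarrow> 'a \<Rightarrow> 'a" where
  "int_iter S f q x =
     (if 0 \<le> q then (f ^^ nat q) x else (inv_into S f ^^ nat (- q)) x)"

section \<open>Seeds\<close>

definition nxt :: "nat \<Rightarrow> nat \<Rightarrow> nat" where
  "nxt n i = (if i = n then 1 else i + 1)"

definition strictly_convex_polygon :: "nat \<Rightarrow> (nat \<Rightarrow> real^2) \<Rightarrow> bool" where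
  "strictly_convex_polygon n p \<longleftrightarrow> 3 \<le> n \<and> inj_on p {1..n} \<and>
     (\<forall>i\<in>{1..n}. p i extreme_point_of (convex hull (p ` {1..n})) \<and>
        closed_segment (p i) (p (nxt n i)) edge_of (convex hull (p ` {1..n})))"

type_synonym seed = "(nat \<Rightarrow> rp2) \<times> (nat \<Rightarrow> rp2)"

definition seeds :: "nat \<Rightarrow> nat \<Rightarrow> seed set" where
  "seeds n k = {(A, B). A \<in> extensional {1..n} \<and> B \<in> extensional {n - k + 1..n} \<and>
     (\<exists>M p. invertible M \<and> strictly_convex_polygon n p \<and>
        (\<forall>i\<in>{1..n}. A i = papply M (affine_pt (p i))) \<and>
        (\<forall>j\<in>{n - k + 1..n}. \<exists>b\<in>open_segment (p j) (p (nxt n j)).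
            B j = papply M (affine_pt b)))}"

definition seed_topology :: "nat \<Rightarrow> nat \<Rightarrow> seed topology" where
  "seed_topology n k = subtopology
     (prod_topology (product_topology (\<lambda>_. euclidean) {1..n})
                    (product_topology (\<lambda>_. euclidean) {n - k + 1..n})) (seeds n k)"

text \<open>\<open>new_B n A A' m\<close> is \<open>B\<^sup>*\<close> at index \<open>n - m\<close>, where \<open>A' = A\<^sup>*\<close>.\<close>

primrec new_B :: "nat \<Rightarrow> (nat \<Rightarrow> rp2) \<Rightarrow> (nat \<Rightarrow> rp2) \<Rightarrow> nat \<Rightarrow> rp2" where
  "new_B n A A' 0 = pmeet (pline (A 1) (A' 2)) (pline (A' n) (A' 1))"
| "new_B n A A' (Suc m) =
     pmeet (pline (A (n - m)) (new_B n A A' m)) (pline (A' (n - Suc m)) (A' (n - m)))"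

definition seed_map :: "nat \<Rightarrow> nat \<Rightarrow> seed \<Rightarrow> seed" where
  "seed_map n k = (\<lambda>(A, B).
     let A' = (\<lambda>i\<in>{1..n}. if i \<le> n - k then A (i + 1) else B i)
     in (A', \<lambda>j\<in>{n - k + 1..n}. new_B n A A' (n - j)))"

text \<open>For \<open>n \<ge> 4\<close> the edges of a convex polygon in the projective plane are determined by its
  vertices in cyclic order, so the description below is then unique.\<close>

definition first_edge :: "nat \<Rightarrow> (nat \<Rightarrow> rp2) \<Rightarrow> rp2 set" where
  "first_edge n A = (THE S. \<exists>M p. invertible M \<and> strictly_convex_polygon n p \<and>
     (\<forall>i\<in>{1..n}. A i = papply M (affine_pt (p i))) \<and>
     S = (\<lambda>x. papply M (affine_pt x)) ` closed_segment (p 1) (p 2))"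

text \<open>The seed \<open>seed_map\<^sup>q s\<close> contributes the vertex and the edge with label \<open>q + 1\<close>.\<close>

definition seed_spiral :: "nat \<Rightarrow> nat \<Rightarrow> seed \<Rightarrow> ppath" where
  "seed_spiral n k s = PPath
     (\<lambda>j. fst (int_iter (seeds n k) (seed_map n k) (j - 1) s) 1)
     (\<lambda>j. first_edge n (fst (int_iter (seeds n k) (seed_map n k) (j - 1) s)))"

section \<open>The space of spirals\<close>

text \<open>Labeled spirals are identified with seeds, so the spirals of the space are the labeled PLC
  spirals of type \<open>(n, k)\<close> that correspond to a seed of that type. The requirement is not
  vacuous: for example, a logarithmic spiral \<open>P\<^sub>j = \<lambda>\<^sup>j\<close> with \<open>T(P)\<^sub>j\<^sub>+\<^sub>1\<^sub>/\<^sub>2 = P\<^sub>j\<^sub>+\<^sub>1\<^sub>0\<close> that winds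
  about twice while its label increases by 10 has order 1, is embedded and locally convex, and
  satisfies the equation for type \<open>(9, 1)\<close>, but comes from no seed.\<close>

definition spiral_seeds :: "nat \<Rightarrow> nat \<Rightarrow> seed set" where
  "spiral_seeds n k = {s \<in> seeds n k. seed_spiral n k s \<in> labeled_PLC_spirals n k}"

definition spiral_class :: "nat \<Rightarrow> nat \<Rightarrow> seed \<Rightarrow> ppath set" where
  "spiral_class n k s = proj_class (seed_spiral n k s)"

definition spiral_space :: "nat \<Rightarrow> nat \<Rightarrow> ppath set set" where
  "spiral_space n k = {proj_class P | P.
     P \<in> labeled_PLC_spirals n k \<and> (\<exists>s\<in>seeds n k. P = seed_spiral n k s)}"

text \<open>The quotient topology of the space of seeds.\<close>

definition spiral_topology :: "nat \<Rightarrow> nat \<Rightarrow> ppath set topology" where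
  "spiral_topology n k = topology (\<lambda>U. U \<subseteq> spiral_space n k \<and>
     openin (subtopology (seed_topology n k) (spiral_seeds n k))
            {s \<in> spiral_seeds n k. spiral_class n k s \<in> U})"

lemma openin_spiral_topology:
  "openin (spiral_topology n k) U \<longleftrightarrow> U \<subseteq> spiral_space n k \<and>
     openin (subtopology (seed_topology n k) (spiral_seeds n k))
            {s \<in> spiral_seeds n k. spiral_class n k s \<in> U}"
proof -
  let ?X = "subtopology (seed_topology n k) (spiral_seeds n k)"
  let ?f = "\<lambda>U. {s \<in> spiral_seeds n k. spiral_class n k s \<in> U}"
  have "?f (S \<inter> T) = ?f S \<inter> ?f T" for S T by auto
  moreover have "?f (\<Union>K) = (\<Union>S\<in>K. ?f S)" for K by auto
  ultimately have "istopology (\<lambda>U. U \<subseteq> spiral_space n k \<and> openin ?X (?f U))"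
    unfolding istopology_def by (auto simp only: intro!: openin_Int openin_Union)
  then show ?thesis unfolding spiral_topology_def by simp
qed

lemma topspace_spiral_topology: "topspace (spiral_topology n k) = spiral_space n k"
proof -
  have sub: "spiral_seeds n k \<subseteq> topspace (seed_topology n k)"
    by (auto simp: spiral_seeds_def seed_topology_def seeds_def PiE_def)
  have "{s \<in> spiral_seeds n k. spiral_class n k s \<in> spiral_space n k} = spiral_seeds n k"
    by (auto simp: spiral_seeds_def spiral_class_def spiral_space_def)
  then have "openin (spiral_topology n k) (spiral_space n k)"
    using sub openin_topspace[of "subtopology (seed_topology n k) (spiral_seeds n k)"]
    by (simp add: openin_spiral_topology inf_absorb2)
  then show ?thesis
    by (meson openin_spiral_topology openin_subset openin_topspace subset_antisym)
qed

end

theory Submission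
  imports Defs
begin

text \<open>Lifts of the vertices of a seed to vectors of \<open>real^3\<close> can be chosen with positive
  determinants. Then the vertices of each of the spirals \<open>P, T(P), \<dots>, T\<^sup>k(P)\<close> lift to a row of
  vectors with positive consecutive determinants, and the corner invariants \<open>\<xi>\<close>, \<open>\<eta>\<close> and the cross
  ratio \<open>\<theta>\<close> of the rows lie in \<open>(0, 1]\<close>. Under the pentagram map the logarithms of \<open>\<xi>\<close> and \<open>\<eta>\<close> are
  conserved densities with current \<open>log \<theta>\<close>. Since \<open>T\<^sup>k(P)\<close> is a shift of \<open>P\<close>, summation around a closed
  curve yields a constant of motion, which bounds \<open>\<xi>\<close>, \<open>\<eta>\<close> and \<open>\<theta>\<close> away from 0 along the whole orbit.

  A row is determined up to projective transformations by \<open>\<xi>\<close> and \<open>\<eta>\<close>, so the orbit lies in the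
  image \<open>K\<close> of a compact set of normalized rows; the lower bounds keep limits of these rows
  nondegenerate, so that they still come from seeds. Finally \<open>K\<close> is closed, because coordinates
  with respect to the frame \<open>A\<^sub>1, \<dots>, A\<^sub>4\<close> map the projective classes injectively and continuously
  into a Hausdorff space.\<close>

section \<open>Brackets\<close>

text \<open>Compactness is argued on rows and not on polygons. A row with all consecutive
  determinants equal to 1 obeys a linear recursion of third order whose coefficients are bounded
  step by step through \<xi> and \<eta>. Each vector then stays in a ball whose radius depends on
  its label only, and no bound uniform in the label is needed for a product of balls to be compact.
  The price is that convexity of the polygon and the return after \<open>k\<close> steps have to be
  restated as closed conditions on a single row. One constant of motion bounds many quantities at
  once because all its factors are at most 1: a product of numbers in (0, 1] lies below each factor.
  These upper bounds are the reason for the work on signs; they require determinants of vertices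
  taken from different polygons of the orbit. The points of the space are subject to the PLC
  condition, which involves infinitely many edges and could be lost in a limit. It is therefore
  proved for every seed, so that only nondegeneracy of the seed has to survive.\<close>

definition br :: "real^3 \<Rightarrow> real^3 \<Rightarrow> real^3 \<Rightarrow> real" where
  "br a b c = a$1 * (b$2 * c$3 - b$3 * c$2) - a$2 * (b$1 * c$3 - b$3 * c$1)
     + a$3 * (b$1 * c$2 - b$2 * c$1)"

text \<open>Points strictly inside a segment, in lifted form: the signs of the two vectors record
  which of the two projective segments is meant.\<close>

definition ocone :: "real^3 \<Rightarrow> real^3 \<Rightarrow> real^3 \<Rightarrow> bool" where
  "ocone a b x \<longleftrightarrow> (\<exists>s>0. \<exists>t>0. x = s *\<^sub>R a + t *\<^sub>R b)"

lemma br_add [simp]: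
  "br (a + a') b c = br a b c + br a' b c"
  "br a (b + b') c = br a b c + br a b' c"
  "br a b (c + c') = br a b c + br a b c'"
  by (simp_all add: br_def algebra_simps)

lemma br_diff [simp]:
  "br (a - a') b c = br a b c - br a' b c"
  "br a (b - b') c = br a b c - br a b' c"
  "br a b (c - c') = br a b c - br a b c'"
  by (simp_all add: br_def algebra_simps)

lemma br_minus [simp]:
  "br (- a) b c = - br a b c" "br a (- b) c = - br a b c" "br a b (- c) = - br a b c"
  by (simp_all add: br_def algebra_simps)

lemma br_scale [simp]:
  "br (s *\<^sub>R a) b c = s * br a b c"
  "br a (s *\<^sub>R b) c = s * br a b c"
  "br a b (s *\<^sub>R c) = s * br a b c"
  by (simp_all add: br_def algebra_simps)

lemma br_same [simp]: "br a a b = 0" "br a b a = 0" "br b a a = 0"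
  by (simp_all add: br_def algebra_simps)

lemma br_zero [simp]: "br 0 a b = 0" "br a 0 b = 0" "br a b 0 = 0"
  by (simp_all add: br_def)

lemma br_rot: "br b c a = br a b c"
  by (simp add: br_def algebra_simps)

lemma br_swap: "br b a c = - br a b c" "br a c b = - br a b c" "br c b a = - br a b c"
  by (simp_all add: br_def algebra_simps)

text \<open>Cramer's relation between four vectors of a 3-space, arranged so that for a convex
  quadrilateral both sides are positive combinations: they are two expressions for the crossing
  point of the diagonals.\<close>

lemma br_quad_rel:
  "br x2 x3 x4 *\<^sub>R x1 + br x1 x2 x4 *\<^sub>R x3 = br x1 x3 x4 *\<^sub>R x2 + br x1 x2 x3 *\<^sub>R x4"
  by (simp add: vec_eq_iff forall_3 br_def algebra_simps)

text \<open>The three-term Grassmann-Pluecker relation, a planar identity after projection from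
  \<open>p\<close>. Inequalities between products of brackets are read off from it.\<close>

lemma br_pluecker: "br p a c * br p b d = br p a b * br p c d + br p a d * br p b c"
  unfolding br_def by algebra

lemma br_mult: "br (M *v a) (M *v b) (M *v c) = det M * br a b c"
  unfolding br_def det_3 by (simp add: matrix_vector_mult_def sum_3) algebra

lemma continuous_on_br [continuous_intros]:
  assumes "continuous_on S f" "continuous_on S g" "continuous_on S h"
  shows "continuous_on S (\<lambda>x. br (f x) (g x) (h x))"
  unfolding br_def by (intro continuous_intros assms)

lemma br_nonzero_imp:
  assumes "br a b c \<noteq> 0"
  shows "a \<noteq> 0" "b \<noteq> 0" "c \<noteq> 0"
  using assms by auto

lemma br_basis:
  assumes "br a b c \<noteq> 0"
  shows "x = (br x b c / br a b c) *\<^sub>R a + (br a x c / br a b c) *\<^sub>R b + (br a b x / br a b c) *\<^sub>R c"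
proof -
  have "br a b c *\<^sub>R x = br x b c *\<^sub>R a + br a x c *\<^sub>R b + br a b x *\<^sub>R c"
    by (simp add: vec_eq_iff forall_3 br_def algebra_simps)
  then have "(1 / br a b c) *\<^sub>R (br a b c *\<^sub>R x)
     = (1 / br a b c) *\<^sub>R (br x b c *\<^sub>R a + br a x c *\<^sub>R b + br a b x *\<^sub>R c)" by simp
  then show ?thesis using assms by (simp add: scaleR_add_right)
qed

text \<open>The hypothesis says that the cross product of \<open>a\<close> and \<open>b\<close>
  vanishes, and it is enough to test this on the standard basis.\<close>

lemma dep_or_third:
  assumes "\<And>c. br a b c = 0" "a \<noteq> 0"
  shows "\<exists>s. b = s *\<^sub>R a"
proof -
  have e: "br a b (vector [1,0,0]) = 0" "br a b (vector [0,1,0]) = 0" "br a b (vector [0,0,1]) = 0"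
    using assms(1) by auto
  then have m: "a$2 * b$3 = a$3 * b$2" "a$1 * b$3 = a$3 * b$1" "a$1 * b$2 = a$2 * b$1"
    by (simp_all add: br_def vector_3 algebra_simps)
  consider "a$1 \<noteq> 0" | "a$2 \<noteq> 0" | "a$3 \<noteq> 0"
    using assms(2) by (auto simp: vec_eq_iff forall_3)
  then show ?thesis
  proof cases
    case 1 show ?thesis by (rule exI[of _ "b$1 / a$1"]) (use 1 m in \<open>auto simp: vec_eq_iff forall_3 field_simps\<close>)
  next
    case 2 show ?thesis by (rule exI[of _ "b$2 / a$2"]) (use 2 m in \<open>auto simp: vec_eq_iff forall_3 field_simps\<close>)
  next
    case 3 show ?thesis by (rule exI[of _ "b$3 / a$3"]) (use 3 m in \<open>auto simp: vec_eq_iff forall_3 field_simps\<close>)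
  qed
qed

lemma br_zero_span:
  assumes "br a b x = 0" "br a b c \<noteq> 0"
  shows "\<exists>s t. x = s *\<^sub>R a + t *\<^sub>R b"
  using br_basis[OF assms(2), of x] assms(1) by auto

text \<open>Linear independence, phrased with a third vector because it usually arises from a
  positive bracket.\<close>

definition indep2 :: "real^3 \<Rightarrow> real^3 \<Rightarrow> bool" where
  "indep2 a b \<longleftrightarrow> (\<exists>c. br a b c \<noteq> 0)"

lemma indep2I: "br a b c \<noteq> 0 \<Longrightarrow> indep2 a b"
  by (auto simp: indep2_def)

lemma indep2I': "br a c b \<noteq> 0 \<Longrightarrow> indep2 a b" "br c a b \<noteq> 0 \<Longrightarrow> indep2 a b"
  by (metis br_swap(2) indep2_def neg_equal_0_iff_equal, metis br_rot indep2_def)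

lemma indep2_zero:
  assumes "indep2 a b" "s *\<^sub>R a + t *\<^sub>R b = 0"
  shows "s = 0" "t = 0"
proof -
  obtain c where c: "br a b c \<noteq> 0" using assms(1) by (auto simp: indep2_def)
  have "br (s *\<^sub>R a + t *\<^sub>R b) b c = 0" "br a (s *\<^sub>R a + t *\<^sub>R b) c = 0" using assms(2) by auto
  then show "s = 0" "t = 0" using c by auto
qed

lemma indep2_unique:
  assumes "indep2 a b" "s *\<^sub>R a + t *\<^sub>R b = s' *\<^sub>R a + t' *\<^sub>R b"
  shows "s = s'" "t = t'"
proof -
  have "(s - s') *\<^sub>R a + (t - t') *\<^sub>R b = 0" using assms(2) by (simp add: algebra_simps)
  then show "s = s'" "t = t'" using indep2_zero[OF assms(1)] by fastforce+
qed

lemma indep2_span: "indep2 a b \<Longrightarrow> br a b x = 0 \<Longrightarrow> \<exists>s t. x = s *\<^sub>R a + t *\<^sub>R b"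
  by (auto simp: indep2_def intro: br_zero_span)

lemma indep2_nonzero: "indep2 a b \<Longrightarrow> a \<noteq> 0 \<and> b \<noteq> 0"
  by (auto simp: indep2_def)

lemma indep2_not: "\<not> indep2 a b \<Longrightarrow> a \<noteq> 0 \<Longrightarrow> \<exists>s. b = s *\<^sub>R a"
  by (auto simp: indep2_def intro: dep_or_third)

section \<open>Points and lines in homogeneous coordinates\<close>

lemma Rep_proj: "v \<noteq> 0 \<Longrightarrow> Rep_rp2 (proj v) = span {v}"
  unfolding proj_def by (rule Abs_rp2_inverse) auto

lemma proj_cases: obtains v where "v \<noteq> 0" "x = proj v"
proof -
  obtain v where "v \<noteq> 0" "Rep_rp2 x = span {v}" using Rep_rp2[of x] by auto
  then show thesis using that by (metis Rep_rp2_inverse proj_def)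
qed

lemma proj_eq_iff:
  assumes "v \<noteq> 0" "w \<noteq> 0"
  shows "proj v = proj w \<longleftrightarrow> (\<exists>c. c \<noteq> 0 \<and> w = c *\<^sub>R v)"
proof
  assume "proj v = proj w"
  then have "span {v} = span {w}" using Rep_proj assms by metis
  then have "w \<in> span {v}" using span_base[of w "{w}"] by simp
  then obtain c where "w = c *\<^sub>R v" by (auto simp: span_singleton)
  then show "\<exists>c. c \<noteq> 0 \<and> w = c *\<^sub>R v" using assms by auto
next
  assume "\<exists>c. c \<noteq> 0 \<and> w = c *\<^sub>R v"
  then obtain c where c: "c \<noteq> 0" "w = c *\<^sub>R v" by auto
  have "span {c *\<^sub>R v} = span {v}"
    unfolding span_singleton using c(1)
    by (auto simp: image_iff) (metis nonzero_eq_divide_eq)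
  then show "proj v = proj w" by (simp add: proj_def c)
qed

lemma proj_scale: "c \<noteq> 0 \<Longrightarrow> proj (c *\<^sub>R v) = proj v"
  by (cases "v = 0") (auto simp: proj_eq_iff[symmetric] intro: proj_eq_iff[THEN iffD2, symmetric])

lemma proj_minus: "proj (- v) = proj v"
  using proj_scale[of "-1" v] by simp

lemma proj_neq_indep2:
  assumes "a \<noteq> 0" "b \<noteq> 0"
  shows "proj a \<noteq> proj b \<longleftrightarrow> indep2 a b"
proof
  assume n: "proj a \<noteq> proj b"
  show "indep2 a b"
  proof (rule ccontr)
    assume "\<not> indep2 a b"
    then obtain s where s: "b = s *\<^sub>R a" using indep2_not assms by blast
    then have "s \<noteq> 0" using assms by auto
    then show False using n s proj_scale by auto
  qed
next
  assume i: "indep2 a b"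
  show "proj a \<noteq> proj b"
  proof
    assume "proj a = proj b"
    then obtain c where "b = c *\<^sub>R a" using proj_eq_iff assms by blast
    then show False using i by (auto simp: indep2_def)
  qed
qed

lemma pline_iff:
  assumes "indep2 a b" "x \<noteq> 0"
  shows "proj x \<in> pline (proj a) (proj b) \<longleftrightarrow> br a b x = 0"
proof -
  have nz: "a \<noteq> 0" "b \<noteq> 0" using indep2_nonzero assms by auto
  have "span (span {a} \<union> span {b}) = span {a, b}"
  proof (rule antisym)
    show "span (span {a} \<union> span {b}) \<subseteq> span {a, b}"
      by (intro span_minimal Un_least span_mono subspace_span) auto
    show "span {a, b} \<subseteq> span (span {a} \<union> span {b})"
      by (intro span_mono) (auto intro: span_base)
  qed
  then have "proj x \<in> pline (proj a) (proj b) \<longleftrightarrow> span {x} \<subseteq> span {a, b}"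
    using nz assms by (simp add: pline_def Rep_proj)
  also have "\<dots> \<longleftrightarrow> x \<in> span {a, b}"
    using span_minimal[of "{x}" "span {a, b}"] span_base[of x "{x}"] by auto
  also have "\<dots> \<longleftrightarrow> (\<exists>s t. x = s *\<^sub>R a + t *\<^sub>R b)"
    by (simp add: span_insert[of a "{b}"] span_singleton image_iff diff_eq_eq add.commute)
  also have "\<dots> \<longleftrightarrow> br a b x = 0"
    using indep2_span[OF assms(1)] by auto
  finally show ?thesis .
qed

text \<open>The last hypothesis makes the lines distinct: in coordinates along \<open>c\<close> and
  \<open>d\<close> a common point solves one linear equation with a nonzero coefficient. It is thus
  unique up to scaling, as \<open>THE\<close> requires.\<close>

lemma pmeet_eqI:
  assumes i: "indep2 a b" "indep2 c d" and x: "x \<noteq> 0" "br a b x = 0" "br c d x = 0"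
    and ne: "br a b c \<noteq> 0 \<or> br a b d \<noteq> 0"
  shows "pmeet (pline (proj a) (proj b)) (pline (proj c) (proj d)) = proj x"
  unfolding pmeet_def
proof (rule the_equality)
  show "proj x \<in> pline (proj a) (proj b) \<and> proj x \<in> pline (proj c) (proj d)"
    using assms pline_iff by auto
next
  fix y assume y: "y \<in> pline (proj a) (proj b) \<and> y \<in> pline (proj c) (proj d)"
  obtain v where v: "v \<noteq> 0" "y = proj v" by (rule proj_cases)
  have "br a b v = 0" "br c d v = 0" using y v pline_iff i by auto
  then obtain s t s' t' where st: "x = s *\<^sub>R c + t *\<^sub>R d" "v = s' *\<^sub>R c + t' *\<^sub>R d"
    using indep2_span[OF i(2)] x(3) by meson
  have e: "s * br a b c + t * br a b d = 0" "s' * br a b c + t' * br a b d = 0"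
    using x(2) \<open>br a b v = 0\<close> st by auto
  then have "(s * t' - s' * t) * br a b c = 0" "(s * t' - s' * t) * br a b d = 0" by algebra+
  then have "s * t' = s' * t" using ne by auto
  then have "\<not> indep2 x v" 
    unfolding indep2_def st by (simp add: br_swap(1)[of d c] algebra_simps)
  then show "y = proj x" using proj_neq_indep2 v x by metis
qed

lemma pline_neqI:
  assumes "indep2 a b" "indep2 c d" "br a b c \<noteq> 0 \<or> br a b d \<noteq> 0"
  shows "pline (proj a) (proj b) \<noteq> pline (proj c) (proj d)"
proof
  assume e: "pline (proj a) (proj b) = pline (proj c) (proj d)"
  have "proj c \<in> pline (proj c) (proj d)" "proj d \<in> pline (proj c) (proj d)"
    using pline_iff assms indep2_nonzero by auto
  then show False using e pline_iff assms indep2_nonzero by metis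
qed

lemma invertible_mult_zero: "invertible M \<Longrightarrow> (M *v v = 0) = (v = (0 :: real^3))"
  by (metis invertible_def matrix_left_invertible_ker matrix_vector_mult_0_right)

lemma injective_matrix:
  fixes f :: "real^3 \<Rightarrow> real^3"
  assumes "linear f" and "\<And>x. f x = 0 \<Longrightarrow> x = 0"
  obtains M where "invertible M" "\<And>x. M *v x = f x"
proof
  show M: "matrix f *v x = f x" for x
    using matrix_works[of f x] assms(1) by (simp add: linear_matrix_vector_mul_eq)
  have "x = 0" if "matrix f *v x = 0" for x using that assms(2) by (simp only: M)
  then show "invertible (matrix f)"
    by (metis invertible_left_inverse matrix_left_invertible_ker)
qed

lemma papply_proj:
  assumes "invertible M" "v \<noteq> 0"
  shows "papply M (proj v) = proj (M *v v)"
proof -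
  have "(\<lambda>v. M *v v) ` span {v} = span {M *v v}"
    unfolding span_singleton by (auto simp: image_iff matrix_vector_mult_scaleR)
  then show ?thesis unfolding papply_def Rep_proj[OF assms(2)] by (simp add: proj_def)
qed

lemma affine_vec_nonzero: "vector [x, y, 1] \<noteq> (0 :: real^3)"
  by (metis vector_3(3) zero_index zero_neq_one)

lemma proj_in_seg_iff:
  assumes "indep2 u v" "x \<noteq> 0"
  shows "proj x \<in> seg u v \<longleftrightarrow> (\<exists>c s t. c \<noteq> 0 \<and> 0 \<le> s \<and> 0 \<le> t \<and> x = c *\<^sub>R (s *\<^sub>R u + t *\<^sub>R v))"
proof
  assume "proj x \<in> seg u v"
  then obtain s t where st: "proj x = proj (s *\<^sub>R u + t *\<^sub>R v)" "0 \<le> s" "0 \<le> t" "0 < s + t"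
    by (auto simp: seg_def)
  have "s *\<^sub>R u + t *\<^sub>R v \<noteq> 0" using indep2_zero[OF assms(1)] st by fastforce
  then show "\<exists>c s t. c \<noteq> 0 \<and> 0 \<le> s \<and> 0 \<le> t \<and> x = c *\<^sub>R (s *\<^sub>R u + t *\<^sub>R v)"
    using st proj_eq_iff assms(2) by metis
next
  assume "\<exists>c s t. c \<noteq> 0 \<and> 0 \<le> s \<and> 0 \<le> t \<and> x = c *\<^sub>R (s *\<^sub>R u + t *\<^sub>R v)"
  then obtain c s t where st: "c \<noteq> 0" "0 \<le> s" "0 \<le> t" "x = c *\<^sub>R (s *\<^sub>R u + t *\<^sub>R v)" by auto
  then have "0 < s + t" using assms(2) by (cases "s = 0"; cases "t = 0") auto
  then show "proj x \<in> seg u v" unfolding seg_def using st proj_scale by blast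
qed

lemma seg_scale:
  assumes "c > 0" "d > 0"
  shows "seg (c *\<^sub>R u) (d *\<^sub>R v) = seg u v"
proof -
  have *: "seg (c *\<^sub>R u) (d *\<^sub>R v) \<subseteq> seg u v" if "c > 0" "d > 0" for c d u v
  proof
    fix x assume "x \<in> seg (c *\<^sub>R u) (d *\<^sub>R v)"
    then obtain s t where "0 \<le> s" "0 \<le> t" "0 < s + t" "x = proj ((s * c) *\<^sub>R u + (t * d) *\<^sub>R v)"
      by (auto simp: seg_def)
    moreover from calculation have "0 < s * c + t * d"
      using that by (cases "s = 0") (auto intro: add_pos_nonneg)
    ultimately show "x \<in> seg u v" unfolding seg_def mem_Collect_eq using that
      by (intro exI[of _ "s * c"] exI[of _ "t * d"]) auto
  qed
  have "seg u v = seg ((1/c) *\<^sub>R (c *\<^sub>R u)) ((1/d) *\<^sub>R (d *\<^sub>R v))" using assms by simp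
  also have "\<dots> \<subseteq> seg (c *\<^sub>R u) (d *\<^sub>R v)" by (rule *) (use assms in auto)
  finally show ?thesis using *[OF assms] by auto
qed

lemma seg_minus: "seg (- u) (- v) = seg u v"
proof -
  have "s *\<^sub>R (- u) + t *\<^sub>R (- v) = - (s *\<^sub>R u + t *\<^sub>R v)" for s t by simp
  then show ?thesis unfolding seg_def by (simp only: proj_minus)
qed

text \<open>Only a change of the sign of exactly one of the two vectors leads to the complementary
  segment.\<close>

lemma seg_scale_sign:
  assumes "c * d > 0"
  shows "seg (c *\<^sub>R u) (d *\<^sub>R v) = seg u v"
proof (cases "c > 0")
  case True
  then show ?thesis using assms seg_scale by (simp add: zero_less_mult_iff)
next
  case False
  then have "- c > 0" "- d > 0" using assms by (auto simp: zero_less_mult_iff)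
  then have "seg ((-c) *\<^sub>R u) ((-d) *\<^sub>R v) = seg u v" by (rule seg_scale)
  then show ?thesis using seg_minus[of "c *\<^sub>R u" "d *\<^sub>R v"] by simp
qed

lemma papply_seg:
  assumes "invertible M" "indep2 u v"
  shows "papply M ` seg u v = seg (M *v u) (M *v v)"
proof -
  have "papply M (proj (s *\<^sub>R u + t *\<^sub>R v)) = proj (s *\<^sub>R (M *v u) + t *\<^sub>R (M *v v))"
    if "0 < s + t" for s t
  proof -
    have "s *\<^sub>R u + t *\<^sub>R v \<noteq> 0" using indep2_zero[OF assms(2)] that by fastforce
    then show ?thesis using assms(1)
      by (simp add: papply_proj matrix_vector_right_distrib matrix_vector_mult_scaleR)
  qed
  then show ?thesis unfolding seg_def by (auto simp: image_iff) metis+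
qed

section \<open>Convex polygons in homogeneous coordinates\<close>

text \<open>For lifts of the vertices of a polygon this is strict convexity (\<open>convex_posc\<close>, \<open>posc_convex\<close>).
  Brackets are invariant under cyclic rotation, so the periodic labelling causes no change of sign.\<close>

definition posc :: "nat \<Rightarrow> (nat \<Rightarrow> real^3) \<Rightarrow> bool" where
  "posc n v \<longleftrightarrow> (\<forall>i. v (i + n) = v i) \<and>
     (\<forall>i j k. i < j \<and> j < k \<and> k < i + n \<longrightarrow> 0 < br (v i) (v j) (v k))"

text \<open>Continues the labels \<open>1\<close> to \<open>n\<close> of a seed periodically; the
  residue 0 stands for the label \<open>n\<close>.\<close>

definition pext :: "nat \<Rightarrow> (nat \<Rightarrow> 'a) \<Rightarrow> nat \<Rightarrow> 'a" where
  "pext n u i = u (if i mod n = 0 then n else i mod n)"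

lemma pext_period [simp]: "pext n u (i + n) = pext n u i"
  by (simp add: pext_def)

lemma pext_id [simp]: "1 \<le> i \<Longrightarrow> i \<le> n \<Longrightarrow> pext n u i = u i"
  by (cases "i = n") (auto simp: pext_def)

lemma period_mult:
  assumes "\<And>i. v (i + n) = v i"
  shows "v (i + q * n) = v (i::nat)"
proof (induction q)
  case (Suc q)
  have "v (i + Suc q * n) = v (i + q * n + n)" by (simp add: algebra_simps)
  then show ?case using assms Suc by simp
qed simp

lemma period_mod:
  assumes "\<And>i. v (i + n) = v i"
  shows "v (i mod n) = v (i::nat)"
  using period_mult[where v = v and n = n and i = "i mod n" and q = "i div n", OF assms] by (simp add: mod_div_mult_eq)

lemma period_cong:
  assumes "\<And>i. v (i + n) = v i" "i mod n = j mod n"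
  shows "v i = v (j::nat)"
  using period_mod[where v = v and n = n, OF assms(1)] assms(2) by metis

lemma poscD: "posc n v \<Longrightarrow> i < j \<Longrightarrow> j < k \<Longrightarrow> k < i + n \<Longrightarrow> 0 < br (v i) (v j) (v k)"
  by (simp add: posc_def)

lemma posc_period: "posc n v \<Longrightarrow> v (i + n) = v i"
  by (simp add: posc_def)

text \<open>Coinciding labels, including \<open>k = i + n\<close>, repeat a vector and make the
  bracket 0.\<close>

lemma posc_nonneg:
  assumes "posc n v" "i \<le> j" "j \<le> k" "k \<le> i + n"
  shows "0 \<le> br (v i) (v j) (v k)"
proof -
  consider "i = j" | "j = k" | "k = i + n" | "i < j" "j < k" "k < i + n"
    using assms by linarith
  then show ?thesis using assms posc_period[OF assms(1)] poscD[OF assms(1)]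
    by cases (auto simp: less_imp_le)
qed

lemma posc_nonzero: "posc n v \<Longrightarrow> 3 \<le> n \<Longrightarrow> v i \<noteq> 0"
  using poscD[of n v i "i+1" "i+2"] by (auto simp: br_def)

lemma posc_indep2:
  assumes "posc n v" "i < j" "j < i + n" "3 \<le> n"
  shows "indep2 (v i) (v j)"
proof (cases "j = i + 1")
  case True
  then show ?thesis using poscD[of n v i "i+1" "i+2"] assms by (intro indep2I[where c = "v (i+2)"]) auto
next
  case False
  then show ?thesis using poscD[of n v i "i+1" j] assms by (intro indep2I'[where c = "v (i+1)"]) auto
qed

text \<open>In the plane of directions at \<open>v i\<close> the successive directions turn left and stay
  to the left of the first one, so any two of them are in order.\<close>

lemma posc_of_edges:
  assumes per: "\<And>i. v (i + n) = v i"
    and e: "\<And>i j. i + 1 < j \<Longrightarrow> j < i + n \<Longrightarrow> 0 < br (v i) (v (i + 1)) (v j)"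
  shows "posc n v"
proof -
  have "0 < br (v i) (v j) (v k)" if "i < j" "j < k" "k < i + n" for i j k
    using that
  proof (induction k arbitrary: j)
    case (Suc k)
    have s: "0 < br (v i) (v k) (v (Suc k))" if "i + 1 \<le> k"
    proof -
      have "0 < br (v k) (v (k + 1)) (v (i + n))" using e[of k "i + n"] Suc that by simp
      then show ?thesis by (simp add: per br_rot)
    qed
    show ?case
    proof (cases "j = k \<or> j = i + 1")
      case True
      then show ?thesis using s e[of i "Suc k"] Suc by auto
    next
      case False
      then have 1: "0 < br (v i) (v j) (v k)" using Suc by simp
      have 2: "0 < br (v i) (v (i+1)) (v j)" "0 < br (v i) (v (i+1)) (v k)"
        "0 < br (v i) (v (i+1)) (v (Suc k))"
        using e[of i j] e[of i k] e[of i "Suc k"] Suc False by simp_all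
      have "0 < br (v i) (v (i+1)) (v k) * br (v i) (v j) (v (Suc k))"
        unfolding br_pluecker[of "v i" "v (i+1)" "v k" "v j" "v (Suc k)"]
        using 1 2 s Suc by (intro add_pos_pos mult_pos_pos) auto
      then show ?thesis using 2 by (simp add: zero_less_mult_iff)
    qed
  qed simp
  then show ?thesis using per by (simp add: posc_def)
qed

text \<open>Reducing the labels modulo \<open>n\<close> rotates the triple, and rotation does not
  change a bracket. The predicate \<open>Q\<close> is a parameter so that strict and weak positivity
  are both covered.\<close>

lemma cyclic_bracket:
  fixes v :: "nat \<Rightarrow> real^3"
  assumes per: "\<And>i. v (i + n) = v i" and n: "0 < n"
    and p: "\<And>i j k. 1 \<le> i \<Longrightarrow> i < j \<Longrightarrow> j < k \<Longrightarrow> k \<le> n \<Longrightarrow> Q (br (v i) (v j) (v k))"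
    and h: "i < j" "j < k" "k < i + n"
  shows "Q (br (v i) (v j) (v k))"
proof -
  have main: "Q (br (v i) (v j) (v k))" if h: "1 \<le> i" "i \<le> n" "i < j" "j < k" "k < i + n" for i j k
  proof -
    have big: "v x = v (x - n)" if "n < x" for x using per[of "x - n"] that by simp
    consider "k \<le> n" | "j \<le> n" "n < k" | "n < j" by linarith
    then show ?thesis
    proof cases
      case 1 then show ?thesis using h p by simp
    next
      case 2
      then have "Q (br (v (k - n)) (v i) (v j))" using h by (intro p) auto
      then show ?thesis using 2 big[of k] br_rot[of "v i" "v j" "v (k - n)"] by simp
    next
      case 3
      then have "Q (br (v (j - n)) (v (k - n)) (v i))" using h by (intro p) auto
      then show ?thesis using 3 h big[of j] big[of k] br_rot[of "v (j - n)" "v (k - n)" "v i"] by simp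
    qed
  qed
  show ?thesis
  proof (cases "i = 0")
    case True
    have "Q (br (v n) (v (j + n)) (v (k + n)))" using main[of n "j + n" "k + n"] h n True by simp
    then show ?thesis using per[of 0] per True by simp
  next
    case False
    define q where "q = (i - 1) div n"
    have q: "q * n \<le> i - 1" "i - 1 < q * n + n"
      using dividend_less_div_times[OF n, of "i - 1"] by (simp_all add: q_def add.commute)
    have "Q (br (v (i - q * n)) (v (j - q * n)) (v (k - q * n)))"
      by (rule main) (use q h False in auto)
    moreover have "v x = v (x - q * n)" if "q * n \<le> x" for x
      using period_mult[where v = v and n = n and i = "x - q * n" and q = q, OF per] that by simp
    ultimately show ?thesis using q h False by auto
  qed
qed

lemma posc_pext:
  assumes "3 \<le> n" and p: "\<And>i j k. 1 \<le> i \<Longrightarrow> i < j \<Longrightarrow> j < k \<Longrightarrow> k \<le> n \<Longrightarrow> 0 < br (u i) (u j) (u k)"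
  shows "posc n (pext n u)"
proof -
  have "0 < br (pext n u i) (pext n u j) (pext n u k)" if h: "i < j" "j < k" "k < i + n" for i j k
    by (rule cyclic_bracket[where Q = "\<lambda>x. 0 < x" and n = n, OF _ _ _ h]) (use p assms(1) in auto)
  then show ?thesis by (simp add: posc_def)
qed

text \<open>A factor common to three vectors enters cubed, so \<open>sgn (det M)\<close> undoes a
  reversal of orientation.\<close>

lemma posc_scale:
  assumes "posc n u" "invertible M"
  shows "\<exists>\<sigma>. \<sigma> \<noteq> 0 \<and> posc n (\<lambda>i. \<sigma> *\<^sub>R (M *v u i))"
proof (intro exI conjI)
  have d: "det M \<noteq> 0" using assms(2) by (simp add: invertible_det_nz)
  then show "sgn (det M) \<noteq> 0" by (simp add: sgn_0_0)
  show "posc n (\<lambda>i. sgn (det M) *\<^sub>R (M *v u i))"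
    using assms(1) d unfolding posc_def
    by (auto simp: br_mult sgn_real_def intro!: mult_pos_pos mult_neg_pos)
qed

text \<open>A triple of labels fixes the sign of a product of three factors. With four labels, two
  triples that share a pair can be compared, which gives the sign of a product of two factors; in a
  triangle two signs could be flipped together.\<close>

lemma posc_lift_unique:
  assumes "posc n v" "posc n v'" "4 \<le> n" and eq: "\<And>i. proj (v i) = proj (v' i)"
  shows "\<exists>c. (\<forall>i. v' i = c i *\<^sub>R v i) \<and> (\<forall>i j. 0 < c i * c j)"
proof -
  have nz: "v i \<noteq> 0" "v' i \<noteq> 0" for i using assms posc_nonzero by auto
  then have "\<exists>c. c \<noteq> 0 \<and> v' i = c *\<^sub>R v i" for i using proj_eq_iff eq by metis
  then obtain c where c: "\<And>i. c i \<noteq> 0" "\<And>i. v' i = c i *\<^sub>R v i" by metis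
  have t: "0 < c i * c j * c k" if "i < j" "j < k" "k < i + n" for i j k
  proof -
    have "0 < br (v' i) (v' j) (v' k)" "0 < br (v i) (v j) (v k)"
      using poscD assms that by blast+
    then have "0 < (c i * c j * c k) * br (v i) (v j) (v k)" unfolding c by (simp add: mult_ac)
    then show ?thesis using \<open>0 < br (v i) (v j) (v k)\<close> by (rule zero_less_mult_pos2)
  qed
  have s: "0 < c i * c (i + 1)" for i
  proof -
    have "0 < c i * c (i+1) * c (i+2)" "0 < c i * c (i+1) * c (i+3)"
      "0 < c i * c (i+2) * c (i+3)" "0 < c (i+1) * c (i+2) * c (i+3)"
      using assms(3) by (intro t; simp)+
    from mult_pos_pos[OF this(3) this(4)]
    have "0 < (c i * c (i+1)) * ((c (i+2) * c (i+3)) * (c (i+2) * c (i+3)))" by (simp add: mult_ac)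
    then show ?thesis by (metis mult_nonpos_nonneg zero_le_square not_le)
  qed
  have z: "0 < c 0 * c i" for i
  proof (induction i)
    case (Suc i)
    then show ?case using s[of i] by (simp add: zero_less_mult_iff) argo
  next
    case 0
    show ?case by (metis c(1) not_real_square_gt_zero)
  qed
  have "0 < c i * c j" for i j using z[of i] z[of j] by (simp add: zero_less_mult_iff) argo
  then show ?thesis using c by blast
qed

lemma mod_pos_range: "0 < (n::nat) \<Longrightarrow> (if i mod n = 0 then n else i mod n) \<in> {1..n}"
  by (auto simp: Suc_leI mod_less_divisor less_imp_le)

lemma range_extend:
  assumes "0 < (n::nat)"
    and "\<And>i. 1 \<le> i \<Longrightarrow> i \<le> n \<Longrightarrow> P i" and "\<And>i j. i mod n = j mod n \<Longrightarrow> P i \<Longrightarrow> P j"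
  shows "P i"
proof -
  define r where "r = (if i mod n = 0 then n else i mod n)"
  have "r \<in> {1..n}" using mod_pos_range[OF assms(1), of i] by (simp add: r_def)
  moreover have "r mod n = i mod n" by (simp add: r_def)
  ultimately show ?thesis using assms(2,3) by (metis atLeastAtMost_iff)
qed

lemma posc_edge_nonneg:
  assumes v: "posc n v" and n: "0 < n"
  shows "0 \<le> br (v i) (v (i + 1)) (v l)"
proof -
  \<comment> \<open>The representative of \<open>l\<close> modulo \<open>n\<close> in the window
    from \<open>i + 1\<close> to \<open>i + n\<close>; the summand \<open>n * (i + 1)\<close> keeps
    the subtraction from truncating.\<close>
  define r where "r = i + 1 + (l + n * (i + 1) - (i + 1)) mod n"
  have le: "i + 1 \<le> l + n * (i + 1)" using mult_le_mono1[of 1 n "i + 1"] n by simp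
  have "r mod n = (i + 1 + (l + n * (i + 1) - (i + 1))) mod n" unfolding r_def by (rule mod_add_right_eq)
  also have "\<dots> = (l + n * (i + 1)) mod n" using le by (simp only: le_add_diff_inverse)
  also have "\<dots> = l mod n" by (rule mod_mult_self2)
  finally have "v r = v l" using period_cong[where v = v and n = n, OF posc_period[OF v]] by blast
  moreover have "i + 1 \<le> r" by (simp add: r_def)
  moreover have "r \<le> i + n"
    using mod_less_divisor[OF n, of "l + n * (i + 1) - (i + 1)"] unfolding r_def by linarith
  ultimately show ?thesis using posc_nonneg[OF v, of i "i+1" r] by simp
qed

text \<open>Each of the two edge functionals is nonnegative on the polygon and vanishes at no vertex
  but the ends of its edge, and for \<open>n \<ge> 4\<close> the two edges have no common end. The
  line where the sum vanishes misses the polygon and can serve as the line at infinity.\<close>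

lemma posc_functional:
  assumes v: "posc n v" and n: "4 \<le> n"
  shows "0 < br (v 1) (v 2) (v i) + br (v 3) (v 4) (v i)"
proof (rule range_extend[where P = "\<lambda>i. 0 < br (v 1) (v 2) (v i) + br (v 3) (v 4) (v i)" and n = n])
  fix i :: nat assume i: "1 \<le> i" "i \<le> n"
  have nn: "0 \<le> br (v 1) (v 2) (v i)" "0 \<le> br (v 3) (v 4) (v i)"
    using posc_edge_nonneg[OF v, of 1 i] posc_edge_nonneg[OF v, of 3 i] n by (simp_all add: numeral_2_eq_2)
  show "0 < br (v 1) (v 2) (v i) + br (v 3) (v 4) (v i)"
  proof (cases "3 \<le> i")
    case True
    then have "0 < br (v 1) (v 2) (v i)" using i by (intro poscD[OF v]) auto
    then show ?thesis using nn by simp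
  next
    case False
    then have "0 < br (v i) (v 3) (v 4)" using i n by (intro poscD[OF v]) auto
    then show ?thesis using nn by (simp add: br_rot)
  qed
next
  fix i j :: nat assume "i mod n = j mod n" "0 < br (v 1) (v 2) (v i) + br (v 3) (v 4) (v i)"
  then show "0 < br (v 1) (v 2) (v j) + br (v 3) (v 4) (v j)"
    using period_cong[where v = v and n = n, OF posc_period[OF v]] by metis
qed (use n in simp)

section \<open>Affine convex polygons and their positive lifts\<close>

definition hom :: "real^2 \<Rightarrow> real^3" where
  "hom x = vector [x$1, x$2, 1]"

lemma affine_pt_hom: "affine_pt x = proj (hom x)"
  by (simp add: affine_pt_def hom_def)

lemma hom_nonzero [simp]: "hom x \<noteq> 0"
  unfolding hom_def by (rule affine_vec_nonzero)

lemma hom_comb: "s + t = 1 \<Longrightarrow> hom (s *\<^sub>R x + t *\<^sub>R y) = s *\<^sub>R hom x + t *\<^sub>R hom y"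
  by (simp add: hom_def vec_eq_iff forall_3)

lemma hom_inj: "hom x = hom y \<longleftrightarrow> x = y"
  by (auto simp: hom_def vec_eq_iff forall_3 forall_2)

lemma hom_indep2: "x \<noteq> y \<Longrightarrow> indep2 (hom x) (hom y)"
proof (rule ccontr)
  assume "x \<noteq> y" "\<not> indep2 (hom x) (hom y)"
  then obtain s where s: "hom y = s *\<^sub>R hom x" using indep2_not by force
  then have "s = 1" by (simp add: hom_def vec_eq_iff forall_3)
  then show False using s hom_inj \<open>x \<noteq> y\<close> by simp
qed

lemma nxt_in: "i \<in> {1..n} \<Longrightarrow> nxt n i \<in> {1..n}"
  by (auto simp: nxt_def)

lemma pext_nxt: "i \<in> {1..n} \<Longrightarrow> pext n u (i + 1) = u (nxt n i)"
  using pext_period[of n u 1] by (cases "i = n") (auto simp: nxt_def add.commute)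

text \<open>A supporting line of the edge, made homogeneous, is a linear functional \<open>F\<close>
  that vanishes at both ends and is positive at the other vertices; it is a multiple of the bracket
  with the edge. Only a product of two brackets has a known sign, as the orientation of the polygon
  is not prescribed.\<close>

lemma convex_edge_sign:
  assumes c: "strictly_convex_polygon n p" and i: "i \<in> {1..n}"
    and j: "j \<in> {1..n} - {i, nxt n i}" and l: "l \<in> {1..n} - {i, nxt n i}"
  shows "0 < br (hom (p i)) (hom (p (nxt n i))) (hom (p j)) * br (hom (p i)) (hom (p (nxt n i))) (hom (p l))"
proof -
  let ?C = "convex hull (p ` {1..n})" and ?q = "p (nxt n i)"
  have n3: "3 \<le> n" and inj: "inj_on p {1..n}" using c by (auto simp: strictly_convex_polygon_def)
  have ne: "p i \<noteq> ?q"
    using inj i nxt_in[OF i] n3 by (auto simp: inj_on_eq_iff nxt_def)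
  have "closed_segment (p i) ?q face_of ?C"
    using c i by (auto simp: strictly_convex_polygon_def edge_of_def)
  then have "closed_segment (p i) ?q exposed_face_of ?C"
    by (subst exposed_face_of_polyhedron) (auto intro: polyhedron_convex_hull)
  then obtain a b where ab: "?C \<subseteq> {x. a \<bullet> x \<le> b}" "closed_segment (p i) ?q = ?C \<inter> {x. a \<bullet> x = b}"
    by (auto simp: exposed_face_of_def)
  define F :: "real^3 \<Rightarrow> real" where "F y = b * y$3 - a$1 * y$1 - a$2 * y$2" for y
  have F: "F (hom x) = b - a \<bullet> x" for x by (simp add: F_def hom_def inner_vec_def sum_2)
  have Flin: "F (s *\<^sub>R x + t *\<^sub>R y) = s * F x + t * F y" for s t x y
    by (simp add: F_def algebra_simps)
  have "p i \<in> closed_segment (p i) ?q" "?q \<in> closed_segment (p i) ?q" by auto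
  then have F0: "F (hom (p i)) = 0" "F (hom ?q) = 0" using ab(2) F by auto
  have pos: "0 < F (hom (p m))" if m: "m \<in> {1..n} - {i, nxt n i}" for m
  proof -
    have ext: "p m extreme_point_of ?C" using c m by (auto simp: strictly_convex_polygon_def)
    have "p m \<notin> closed_segment (p i) ?q"
    proof
      assume "p m \<in> closed_segment (p i) ?q"
      moreover have "p m \<noteq> p i" "p m \<noteq> ?q"
        using inj i nxt_in[OF i] m by (auto simp: inj_on_eq_iff)
      ultimately have "p m \<in> open_segment (p i) ?q" by (simp add: open_segment_def)
      moreover have "p i \<in> ?C" "?q \<in> ?C" using i nxt_in[OF i] by (auto intro: hull_inc)
      ultimately show False using ext by (auto simp: extreme_point_of_def)
    qed
    moreover have "p m \<in> ?C" using m by (auto intro: hull_inc)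
    ultimately show ?thesis using ab F by force
  qed
  have ind: "indep2 (hom (p i)) (hom ?q)" by (rule hom_indep2[OF ne])
  have nz: "br (hom (p i)) (hom ?q) (hom (p m)) \<noteq> 0" if m: "m \<in> {1..n} - {i, nxt n i}" for m
  proof
    assume "br (hom (p i)) (hom ?q) (hom (p m)) = 0"
    then obtain s t where "hom (p m) = s *\<^sub>R hom (p i) + t *\<^sub>R hom ?q" using indep2_span[OF ind] by blast
    then show False using pos[OF m] F0 Flin by simp
  qed
  let ?b = "\<lambda>m. br (hom (p i)) (hom ?q) (hom (p m))"
  have "hom (p l) = (br (hom (p l)) (hom ?q) (hom (p j)) / ?b j) *\<^sub>R hom (p i)
     + (br (hom (p i)) (hom (p l)) (hom (p j)) / ?b j) *\<^sub>R hom ?q + (?b l / ?b j) *\<^sub>R hom (p j)"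
    by (rule br_basis[OF nz[OF j]])
  then have "F (hom (p l)) = F ((br (hom (p l)) (hom ?q) (hom (p j)) / ?b j) *\<^sub>R hom (p i)
     + 1 *\<^sub>R ((br (hom (p i)) (hom (p l)) (hom (p j)) / ?b j) *\<^sub>R hom ?q + (?b l / ?b j) *\<^sub>R hom (p j)))"
    by (simp add: add.assoc)
  also have "\<dots> = (?b l / ?b j) * F (hom (p j))" unfolding Flin F0 by simp
  finally have "0 < ?b l / ?b j" using pos[OF j] pos[OF l] by (metis zero_less_mult_pos2)
  then show ?thesis by (simp add: zero_less_divide_iff zero_less_mult_iff) argo
qed

lemma convex_posc:
  assumes c: "strictly_convex_polygon n p" and n: "4 \<le> n"
  shows "\<exists>\<sigma>. \<sigma> \<noteq> 0 \<and> posc n (pext n (\<lambda>i. \<sigma> *\<^sub>R hom (p i)))"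
proof -
  define u where "u = pext n (\<lambda>i. hom (p i))"
  have per: "u (i + n) = u i" for i by (simp add: u_def)
  define r where "r i = (if i mod n = 0 then n else i mod n)" for i
  have r: "r i \<in> {1..n}" "u i = hom (p (r i))" for i
    using mod_pos_range[of n i] n by (simp_all add: r_def u_def pext_def)
  have r1: "r (i + 1) = nxt n (r i)" for i
  proof -
    have "i mod n \<noteq> n" using mod_less_divisor[of n i] n by linarith
    then show ?thesis using n by (auto simp: r_def nxt_def mod_Suc)
  qed
  have rne: "r i \<noteq> r j" if "i < j" "j < i + n" for i j
  proof
    assume "r i = r j"
    moreover have "i mod n < n" "j mod n < n" using n by auto
    ultimately have "i mod n = j mod n" unfolding r_def by (metis less_irrefl)
    then have "n dvd j - i" using that by (metis mod_eq_dvd_iff_nat less_imp_le)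
    then show False using that by (auto dest: dvd_imp_le)
  qed
  have sg: "0 < br (u i) (u (i+1)) (u j) * br (u i) (u (i+1)) (u l)"
    if "i + 1 < j" "j < i + n" "i + 1 < l" "l < i + n" for i j l
    unfolding r(2) r1
    by (rule convex_edge_sign[OF c r(1)]) (use r(1) rne[of i j] rne[of i l] rne[of "i+1" j] rne[of "i+1" l] that in \<open>auto simp: r1[symmetric]\<close>)
  define e where "e i = br (u i) (u (i+1)) (u (i+2))" for i
  \<comment> \<open>The triple \<open>i\<close>, \<open>i + 1\<close>, \<open>i + 2\<close> belongs
    to the edge at \<open>i\<close> and, rotated with \<open>i + n\<close> in place of
    \<open>i\<close>, also to the edge at \<open>i + 1\<close>. So neighbouring edges see the
    polygon on the same side.\<close>
  have ee: "0 < e i * e (i+1)" for i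
  proof -
    have "0 < br (u (i+1)) (u (i+1+1)) (u (i + 3)) * br (u (i+1)) (u (i+1+1)) (u (i + n))"
      using n by (intro sg) auto
    then show ?thesis by (simp add: e_def per br_rot mult.commute numeral_3_eq_3 add.commute)
  qed
  have e0: "0 < e 0 * e i" for i
  proof (induction i)
    case 0
    show ?case using ee[of 0] by (metis mult_eq_0_iff not_real_square_gt_zero less_irrefl)
  next
    case (Suc i)
    from Suc ee[of i] show ?case by (simp add: zero_less_mult_iff) argo
  qed
  define s where "s = sgn (e 0)"
  have s: "s * s * s * e 0 > 0" "s \<noteq> 0" using e0[of 0] by (auto simp: s_def sgn_real_def zero_less_mult_iff)
  have "pext n (\<lambda>i. s *\<^sub>R hom (p i)) = (\<lambda>i. s *\<^sub>R u i)" by (simp add: u_def pext_def fun_eq_iff)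
  moreover have "posc n (\<lambda>i. s *\<^sub>R u i)"
  proof (rule posc_of_edges)
    fix i j assume "i + 1 < j" "j < i + n"
    then have "0 < e i * br (u i) (u (i+1)) (u j)" unfolding e_def by (intro sg) auto
    then have "0 < s * s * s * br (u i) (u (i+1)) (u j)"
      using e0[of i] s by (simp add: zero_less_mult_iff) argo
    then show "0 < br (s *\<^sub>R u i) (s *\<^sub>R u (i+1)) (s *\<^sub>R u j)" by (simp add: mult.assoc)
  qed (simp add: per)
  ultimately show ?thesis using s by metis
qed

lemma br_hom_inner:
  "br P Q (hom x) = vector [P$2 * Q$3 - P$3 * Q$2, P$3 * Q$1 - P$1 * Q$3] \<bullet> x + (P$1 * Q$2 - P$2 * Q$1)"
  by (simp add: br_def hom_def inner_vec_def sum_2 algebra_simps)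

lemma posc_convex:
  assumes n: "3 \<le> n" and pos: "posc n (pext n (\<lambda>i. c i *\<^sub>R hom (p i)))"
    and c: "\<And>i j. i \<in> {1..n} \<Longrightarrow> j \<in> {1..n} \<Longrightarrow> 0 < c i * c j"
  shows "strictly_convex_polygon n p"
proof -
  define u where "u = pext n (\<lambda>i. c i *\<^sub>R hom (p i))"
  let ?C = "convex hull (p ` {1..n})"
  define r where "r i = (if i mod n = 0 then n else i mod n)" for i
  have r: "r i \<in> {1..n}" "u i = c (r i) *\<^sub>R hom (p (r i))" for i
    using mod_pos_range[of n i] n by (simp_all add: r_def u_def pext_def)
  have inj: "inj_on p {1..n}"
  proof (rule inj_onI, rule ccontr)
    fix x y assume xy: "x \<in> {1..n}" "y \<in> {1..n}" "p x = p y" "x \<noteq> y"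
    have "indep2 (u (min x y)) (u (max x y))"
      unfolding u_def by (rule posc_indep2[OF pos]) (use xy n in \<open>auto simp: min_def max_def\<close>)
    moreover have "u x = c x *\<^sub>R hom (p x)" "u y = c y *\<^sub>R hom (p y)" using xy by (auto simp: u_def)
    ultimately show False using xy by (auto simp: indep2_def min_def max_def split: if_splits)
  qed
  have face: "closed_segment (p i) (p (nxt n i)) face_of ?C" if i: "i \<in> {1..n}" for i
  proof -
    let ?q = "p (nxt n i)"
    have ui: "u i = c i *\<^sub>R hom (p i)" "u (i+1) = c (nxt n i) *\<^sub>R hom ?q"
      using i pext_nxt[OF i] by (simp_all add: u_def)
    have posj: "0 < c i * br (hom (p i)) (hom ?q) (hom (p j))"
      if j: "j \<in> {1..n}" "j \<noteq> i" "j \<noteq> nxt n i" for j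
    proof -
      have b: "0 < br (u i) (u (i+1)) (u j)"
      proof (cases "i < j")
        case True
        then show ?thesis unfolding u_def by (intro poscD[OF pos]) (use i j in \<open>auto simp: nxt_def split: if_splits\<close>)
      next
        case False
        have "0 < br (u i) (u (i+1)) (u (j + n))"
          unfolding u_def by (intro poscD[OF pos]) (use False i j in \<open>auto simp: nxt_def split: if_splits\<close>)
        then show ?thesis by (simp add: u_def)
      qed
      have uj: "u j = c j *\<^sub>R hom (p j)" using j by (simp add: u_def)
      have "0 < (c i * br (hom (p i)) (hom ?q) (hom (p j))) * (c (nxt n i) * c j)"
        using b unfolding ui uj by (simp add: mult_ac)
      moreover have "0 < c (nxt n i) * c j" using c j nxt_in[OF i] by auto
      ultimately show ?thesis by (rule zero_less_mult_pos2)
    qed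
    \<comment> \<open>\<open>a\<close> and \<open>b\<close> are the coefficients of the affine
      function \<open>c i * br (hom (p i)) (hom ?q) (hom x)\<close> of \<open>x\<close>; the factor
      \<open>c i\<close> makes it nonnegative on the polygon whichever sign the weights have in
      common.\<close>
    define a where "a = c i *\<^sub>R (vector [hom (p i)$2 * hom ?q$3 - hom (p i)$3 * hom ?q$2,
      hom (p i)$3 * hom ?q$1 - hom (p i)$1 * hom ?q$3] :: real^2)"
    define b where "b = - c i * (hom (p i)$1 * hom ?q$2 - hom (p i)$2 * hom ?q$1)"
    have ab: "c i * br (hom (p i)) (hom ?q) (hom x) = a \<bullet> x - b" for x
      unfolding br_hom_inner a_def b_def by (simp add: algebra_simps)
    have on: "a \<bullet> p i = b" "a \<bullet> ?q = b" using ab[of "p i"] ab[of ?q] by auto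
    have off: "b < a \<bullet> p j" if "j \<in> {1..n}" "j \<noteq> i" "j \<noteq> nxt n i" for j
      using posj[OF that] ab[of "p j"] by simp
    have "p ` {1..n} \<subseteq> {x. a \<bullet> x \<ge> b}" using on off by (force simp: less_imp_le)
    then have sub: "?C \<subseteq> {x. a \<bullet> x \<ge> b}"
      by (intro hull_minimal convex_halfspace_ge)
    then have f: "(?C \<inter> {x. a \<bullet> x = b}) face_of ?C"
      by (intro face_of_Int_supporting_hyperplane_ge) auto
    \<comment> \<open>A face of a hull is the hull of some of the generators, and only the two ends
      of the edge lie on the supporting line.\<close>
    obtain S where S: "S \<subseteq> p ` {1..n}" "?C \<inter> {x. a \<bullet> x = b} = convex hull S"
      using face_of_convex_hull_subset[OF _ f] finite_imp_compact by (metis finite_atLeastAtMost finite_imageI)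
    have "S \<subseteq> {p i, ?q}"
    proof
      fix x assume x: "x \<in> S"
      then have "x \<in> ?C \<inter> {x. a \<bullet> x = b}" using S(2) hull_inc by metis
      then have "a \<bullet> x = b" by simp
      moreover obtain j where "j \<in> {1..n}" "x = p j" using S x by auto
      ultimately show "x \<in> {p i, ?q}" using off by fastforce
    qed
    then have "?C \<inter> {x. a \<bullet> x = b} \<subseteq> closed_segment (p i) ?q"
      unfolding S(2) segment_convex_hull by (rule hull_mono)
    moreover have "closed_segment (p i) ?q \<subseteq> ?C \<inter> {x. a \<bullet> x = b}"
      by (rule closed_segment_subset) (use on i nxt_in[OF i] in \<open>auto intro!: hull_inc convex_Int convex_hyperplane\<close>)
    ultimately have "?C \<inter> {x. a \<bullet> x = b} = closed_segment (p i) ?q" by (rule antisym)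
    then show ?thesis using f by metis
  qed
  have edge: "closed_segment (p i) (p (nxt n i)) edge_of ?C" if i: "i \<in> {1..n}" for i
  proof -
    have "p i \<noteq> p (nxt n i)" using inj i nxt_in[OF i] n by (auto simp: inj_on_eq_iff nxt_def)
    then show ?thesis using face[OF i] by (simp add: edge_of_def segment_convex_hull aff_dim_convex_hull)
  qed
  have ext: "p i extreme_point_of ?C" if i: "i \<in> {1..n}" for i
  proof -
    define h where "h = (if i = 1 then n else i - 1)"
    have h: "h \<in> {1..n}" "nxt n h = i" using i n by (auto simp: h_def nxt_def)
    let ?q = "p (nxt n i)"
    have ne: "p h \<noteq> ?q" "p i \<noteq> ?q" "p h \<noteq> p i" using inj h i nxt_in[OF i] n by (auto simp: inj_on_eq_iff h_def nxt_def)
    \<comment> \<open>The vertex is extreme because it is the intersection of two faces, the edges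
      that meet in it.\<close>
    have "closed_segment (p h) (p i) \<inter> closed_segment (p i) ?q = {p i}"
    proof (intro equalityI subsetI)
      fix x assume x: "x \<in> closed_segment (p h) (p i) \<inter> closed_segment (p i) ?q"
      obtain s where s: "x = (1 - s) *\<^sub>R p h + s *\<^sub>R p i" using x by (auto simp: in_segment)
      obtain t where t: "x = (1 - t) *\<^sub>R p i + t *\<^sub>R ?q" using x unfolding Int_iff in_segment by blast
      note st = s t
      then have hx: "hom x = (1 - s) *\<^sub>R hom (p h) + s *\<^sub>R hom (p i)" "hom x = (1 - t) *\<^sub>R hom (p i) + t *\<^sub>R hom ?q"
        by (metis hom_comb diff_add_cancel add.commute)+
      have b: "br (hom (p h)) (hom (p i)) (hom ?q) \<noteq> 0"
      proof -
        have "0 < br (u h) (u (h+1)) (u (h+2))" unfolding u_def by (rule poscD[OF pos]) (use n in auto)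
        moreover have "u (h+1) = c i *\<^sub>R hom (p i)" using pext_nxt[OF h(1)] h by (simp add: u_def)
        moreover have "u (h+2) = c (nxt n i) *\<^sub>R hom ?q"
        proof -
          have "h + 2 = n + (i + 1) \<or> h + 2 = i + 1" using h by (auto simp: nxt_def split: if_splits)
          then have "(h + 2) mod n = (i + 1) mod n" by (elim disjE) (simp_all only: mod_add_self1)
          moreover have "u (j + n) = u j" for j by (simp add: u_def)
          ultimately have "u (h+2) = u (i+1)" using period_cong[where v = u and n = n] by blast
          then show ?thesis using pext_nxt[OF i] by (simp add: u_def)
        qed
        moreover have "u h = c h *\<^sub>R hom (p h)" using h by (simp add: u_def)
        ultimately show ?thesis by auto
      qed
      have "br (hom (p h)) (hom (p i)) (hom x) = t * br (hom (p h)) (hom (p i)) (hom ?q)" using hx(2) by simp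
      moreover have "br (hom (p h)) (hom (p i)) (hom x) = 0" using hx(1) by simp
      ultimately have "t = 0" using b by simp
      then show "x \<in> {p i}" using st by simp
    qed auto
    then have "{p i} face_of ?C" using face_of_Int[OF face[OF h(1)] face[OF i]] h by simp
    then show ?thesis by (simp add: face_of_singleton)
  qed
  show ?thesis unfolding strictly_convex_polygon_def using n inj edge ext by auto
qed

section \<open>Seeds and the seed map\<close>

text \<open>When \<open>v\<close> lifts the polygon of a seed, \<open>w\<close> in \<open>adv\<close> lifts the polygon \<open>A\<^sup>*\<close> of the next one, whose
  vertices with \<open>mut\<close> indices are the points \<open>B\<^sub>i\<close>, and \<open>z\<close> in \<open>diagc\<close> lifts the polygon after that:
  the line through \<open>A\<^sub>i\<^sub>+\<^sub>1\<close> and \<open>B\<^sup>*\<^sub>i\<^sub>+\<^sub>1\<close> passes through \<open>B\<^sup>*\<^sub>i\<close>.\<close>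

definition mut :: "nat \<Rightarrow> nat \<Rightarrow> nat \<Rightarrow> bool" where
  "mut n k i \<longleftrightarrow> i mod n = 0 \<or> n - k < i mod n"

definition adv :: "nat \<Rightarrow> nat \<Rightarrow> (nat \<Rightarrow> real^3) \<Rightarrow> (nat \<Rightarrow> real^3) \<Rightarrow> bool" where
  "adv n k v w \<longleftrightarrow> (\<forall>i. w (i + n) = w i) \<and>
     (\<forall>i. (mut n k i \<longrightarrow> ocone (v i) (v (i + 1)) (w i)) \<and> (\<not> mut n k i \<longrightarrow> w i = v (i + 1)))"

definition diagc :: "nat \<Rightarrow> nat \<Rightarrow> (nat \<Rightarrow> real^3) \<Rightarrow> (nat \<Rightarrow> real^3) \<Rightarrow> bool" where
  "diagc n k v z \<longleftrightarrow> (\<forall>i. mut n k i \<longrightarrow> ocone (v (i + 1)) (z (i + 1)) (z i))"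

definition seed_of :: "nat \<Rightarrow> nat \<Rightarrow> (nat \<Rightarrow> real^3) \<Rightarrow> (nat \<Rightarrow> real^3) \<Rightarrow> seed" where
  "seed_of n k v w = (\<lambda>i\<in>{1..n}. proj (v i), \<lambda>j\<in>{n - k + 1..n}. proj (w j))"

definition lift :: "nat \<Rightarrow> nat \<Rightarrow> (nat \<Rightarrow> real^3) \<Rightarrow> (nat \<Rightarrow> real^3) \<Rightarrow> seed \<Rightarrow> bool" where
  "lift n k v w s \<longleftrightarrow> posc n v \<and> adv n k v w \<and> s = seed_of n k v w"

lemma mut_period [simp]: "mut n k (i + n) = mut n k i"
  by (simp add: mut_def)

lemma mut_small: "1 \<le> k \<Longrightarrow> 1 \<le> i \<Longrightarrow> i \<le> n \<Longrightarrow> mut n k i \<longleftrightarrow> n - k < i"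
  by (cases "i = n") (auto simp: mut_def)

lemma oconeI: "0 < s \<Longrightarrow> 0 < t \<Longrightarrow> ocone a b (s *\<^sub>R a + t *\<^sub>R b)"
  by (auto simp: ocone_def)

lemma oconeE:
  assumes "ocone a b x"
  obtains s t where "0 < s" "0 < t" "x = s *\<^sub>R a + t *\<^sub>R b"
  using assms by (auto simp: ocone_def)

lemma ocone_br: "ocone a b x \<Longrightarrow> br a b x = 0" "ocone a b x \<Longrightarrow> br a x b = 0" "ocone a b x \<Longrightarrow> br x a b = 0"
  by (auto simp: ocone_def)

lemma ocone_mult: "ocone a b x \<Longrightarrow> ocone (M *v a) (M *v b) (M *v x)"
  by (elim oconeE) (auto simp: matrix_vector_right_distrib matrix_vector_mult_scaleR intro: oconeI)

lemma ocone_scale: "c \<noteq> 0 \<Longrightarrow> ocone a b x \<Longrightarrow> ocone (c *\<^sub>R a) (c *\<^sub>R b) (c *\<^sub>R x)"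
  unfolding ocone_def by (metis scaleR_add_right scaleR_left_commute)

lemma adv_mut: "adv n k v w \<Longrightarrow> mut n k i \<Longrightarrow> ocone (v i) (v (i + 1)) (w i)"
  by (simp add: adv_def)

lemma adv_imm: "adv n k v w \<Longrightarrow> \<not> mut n k i \<Longrightarrow> w i = v (i + 1)"
  by (simp add: adv_def)

text \<open>Treats moved and carried-over vertices alike, so that positivity arguments need no case
  distinction. The coefficient \<open>t\<close> is always positive because no vertex stays at
  \<open>v i\<close>.\<close>

lemma adv_coeffs:
  assumes "adv n k v w"
  shows "\<exists>c t. \<forall>i. 0 \<le> c i \<and> 0 < t i \<and> w i = c i *\<^sub>R v i + t i *\<^sub>R v (i + 1) \<and> (mut n k i \<longrightarrow> 0 < c i)"
proof -
  have "\<exists>c t. 0 \<le> c \<and> 0 < t \<and> w i = c *\<^sub>R v i + t *\<^sub>R v (i + 1) \<and> (mut n k i \<longrightarrow> 0 < c)" for i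
  proof (cases "mut n k i")
    case True
    then have "ocone (v i) (v (i + 1)) (w i)" using assms by (simp add: adv_def)
    then show ?thesis by (auto simp: ocone_def intro: less_imp_le)
  next
    case False
    then have "w i = v (i + 1)" using assms by (simp add: adv_def)
    then show ?thesis using False by (metis add_0 less_eq_real_def scaleR_one scaleR_zero_left zero_less_one)
  qed
  then show ?thesis by metis
qed

lemma adv_period: "adv n k v w \<Longrightarrow> w (i + n) = w i"
  by (simp add: adv_def)

text \<open>The bracket expands into eight nonnegative terms, and the one with all three
  coefficients \<open>t\<close> is positive.\<close>

lemma adv_posc:
  assumes v: "posc n v" and a: "adv n k v w"
  shows "posc n w"
proof -
  obtain c t where ct: "\<And>i. 0 \<le> c i" "\<And>i. 0 < t i" "\<And>i. w i = c i *\<^sub>R v i + t i *\<^sub>R v (i + 1)"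
    using adv_coeffs[OF a] by metis
  have "0 < br (w i) (w j) (w l)" if "i < j" "j < l" "l < i + n" for i j l
  proof -
    have "0 < t l * (t j * (t i * br (v (i+1)) (v (j+1)) (v (l+1))))"
      using ct(2) poscD[OF v, of "i+1" "j+1" "l+1"] that by simp
    moreover have nn: "0 \<le> br (v i) (v j) (v l)" "0 \<le> br (v i) (v j) (v (l+1))"
      "0 \<le> br (v i) (v (j+1)) (v l)" "0 \<le> br (v i) (v (j+1)) (v (l+1))"
      "0 \<le> br (v (i+1)) (v j) (v l)" "0 \<le> br (v (i+1)) (v j) (v (l+1))"
      "0 \<le> br (v (i+1)) (v (j+1)) (v l)"
      by (rule posc_nonneg[OF v]; use that in simp)+
    ultimately show ?thesis unfolding ct(3)[of i] ct(3)[of j] ct(3)[of l]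
      by (simp add: distrib_left add_nonneg_pos ct(1) less_imp_le[OF ct(2)])
  qed
  then show ?thesis using adv_period[OF a] by (simp add: posc_def)
qed

lemma quad_cross:
  assumes "0 < br x1 x2 x3" "0 < br x1 x2 x4" "0 < br x1 x3 x4" "0 < br x2 x3 x4"
  defines "z \<equiv> br x2 x3 x4 *\<^sub>R x1 + br x1 x2 x4 *\<^sub>R x3"
  shows "ocone x1 x3 z" "ocone x2 x4 z"
proof -
  show "ocone x1 x3 z" using assms by (auto intro: oconeI)
  have "z = br x1 x3 x4 *\<^sub>R x2 + br x1 x2 x3 *\<^sub>R x4" unfolding z_def by (rule br_quad_rel)
  then show "ocone x2 x4 z" using assms by (auto intro: oconeI)
qed

text \<open>The new mark is the crossing of the diagonals of the quadrilateral \<open>w i\<close>,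
  \<open>v (i + 1)\<close>, \<open>w (i + 1)\<close>, \<open>zz\<close>, whose convexity is shown by
  the four inequalities. The coefficient \<open>x\<close> may vanish because the recursion for the
  marks starts at a vertex of the polygon.\<close>

lemma next_step:
  assumes v: "posc n v" and n: "4 \<le> n" and a: "adv n k v w" and m: "mut n k i"
    and z: "zz = x *\<^sub>R w (i + 1) + y *\<^sub>R w (i + 2)" "0 \<le> x" "0 < y"
  shows "\<exists>z. ocone (w i) (w (i + 1)) z \<and> ocone (v (i + 1)) zz z"
proof -
  obtain c t where ct: "\<And>i. 0 \<le> c i" "\<And>i. 0 < t i" "\<And>i. w i = c i *\<^sub>R v i + t i *\<^sub>R v (i + 1)"
     "\<And>i. mut n k i \<Longrightarrow> 0 < c i"
    using adv_coeffs[OF a] by metis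
  have ci: "0 < c i" using ct(4) m by simp
  have w: "posc n w" by (rule adv_posc[OF v a])
  have p: "0 < br (v i) (v (i+1)) (v (i+2))" "0 < br (v i) (v (i+1)) (v (i+3))"
    "0 < br (v (i+1)) (v (i+2)) (v (i+3))"
    using n by (intro poscD[OF v]; simp)+
  have pw: "0 < br (w i) (w (i+1)) (w (i+2))" using n by (intro poscD[OF w]; simp)
  have w1: "w i = c i *\<^sub>R v i + t i *\<^sub>R v (i+1)" "w (i+1) = c (i+1) *\<^sub>R v (i+1) + t (i+1) *\<^sub>R v (i+2)"
    "w (i+2) = c (i+2) *\<^sub>R v (i+2) + t (i+2) *\<^sub>R v (i+3)"
    using ct(3)[of i] ct(3)[of "i+1"] ct(3)[of "i+2"] by (simp_all add: numeral_2_eq_2 numeral_3_eq_3)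
  have "br (w i) (v (i+1)) (w (i+1)) = c i * (t (i+1) * br (v i) (v (i+1)) (v (i+2)))"
    unfolding w1 by simp
  then have 1: "0 < br (w i) (v (i+1)) (w (i+1))" using ci ct(2) p by simp
  have "br (v (i+1)) (w (i+1)) zz = y * (t (i+1) * (t (i+2) * br (v (i+1)) (v (i+2)) (v (i+3))))"
    unfolding z w1 by simp
  then have 2: "0 < br (v (i+1)) (w (i+1)) zz" using z ct(2) p by simp
  have "br (w i) (v (i+1)) zz = c i * (x * (t (i+1) * br (v i) (v (i+1)) (v (i+2))) +
     y * (c (i+2) * br (v i) (v (i+1)) (v (i+2)) + t (i+2) * br (v i) (v (i+1)) (v (i+3))))"
    unfolding z w1 by (simp add: algebra_simps)
  then have 3: "0 < br (w i) (v (i+1)) zz"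
    using ci z ct(1,2) p by (simp add: add_nonneg_pos less_imp_le)
  have 4: "0 < br (w i) (w (i+1)) zz" unfolding z using z pw by simp
  show ?thesis using quad_cross[OF 1 3 4 2] by blast
qed

lemma next_exists:
  assumes v: "posc n v" and n: "4 \<le> n" "1 \<le> k" "k \<le> n - 1" and a: "adv n k v w"
  shows "\<exists>z. adv n k w z \<and> diagc n k v z"
proof -
  \<comment> \<open>\<open>f m\<close> becomes \<open>z (n + 1 - m)\<close>. The start is
    \<open>w 2\<close>: the label \<open>n + 1\<close> is the label 1, whose vertex is carried over
    since \<open>k \<le> n - 1\<close>.\<close>
  define f where "f = rec_nat (w 2) (\<lambda>m zz. SOME z. ocone (w (n - m)) (w (n - m + 1)) z \<and> ocone (v (n - m + 1)) zz z)"
  have f0: "f 0 = w 2" and fS: "\<And>m. f (Suc m) = (SOME z. ocone (w (n - m)) (w (n - m + 1)) z \<and> ocone (v (n - m + 1)) (f m) z)"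
    by (simp_all add: f_def)
  have w2: "w (n + 2) = w 2" using adv_period[OF a, of 2] by (simp add: add.commute)
  have step: "ocone (w (n - m)) (w (n - m + 1)) (f (Suc m)) \<and> ocone (v (n - m + 1)) (f m) (f (Suc m))"
    if e: "\<exists>x y. 0 \<le> x \<and> 0 < y \<and> f m = x *\<^sub>R w (n - m + 1) + y *\<^sub>R w (n - m + 2)" and "m < k" for m
  proof -
    obtain x y where xy: "0 \<le> x" "0 < y" "f m = x *\<^sub>R w (n - m + 1) + y *\<^sub>R w (n - m + 2)" using e by blast
    have "mut n k (n - m)" using that n by (subst mut_small) auto
    from next_step[OF v n(1) a this xy(3,1,2)] show ?thesis unfolding fS by (rule someI_ex)
  qed
  have form: "\<exists>x y. 0 \<le> x \<and> 0 < y \<and> f m = x *\<^sub>R w (n - m + 1) + y *\<^sub>R w (n - m + 2)" if "m < k" for m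
    using that
  proof (induction m)
    case 0
    show ?case by (rule exI[of _ 0], rule exI[of _ 1]) (use f0 w2 in simp)
  next
    case (Suc m)
    then have "ocone (w (n - m)) (w (n - m + 1)) (f (Suc m))" using step by simp
    moreover have "n - m = n - Suc m + 1" "n - m + 1 = n - Suc m + 2" using Suc n by auto
    ultimately show ?case by (auto simp: ocone_def intro: less_imp_le)
  qed
  define z where "z = pext n (\<lambda>i. if n - k < i then f (n + 1 - i) else w (i + 1))"
  have zper: "z (i + n) = z i" for i by (simp add: z_def)
  have zs: "z i = f (n + 1 - i)" if "n - k < i" "1 \<le> i" "i \<le> n" for i using that by (simp add: z_def)
  have zi: "z i = w (i + 1)" if "\<not> n - k < i" "1 \<le> i" "i \<le> n" for i using that by (simp add: z_def)
  have z1: "z (n + 1) = f 0" using zper[of 1] zi[of 1] n f0 by (simp add: add.commute numeral_2_eq_2)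
  have main: "((mut n k i \<longrightarrow> ocone (w i) (w (i + 1)) (z i)) \<and> (\<not> mut n k i \<longrightarrow> z i = w (i + 1))) \<and>
     (mut n k i \<longrightarrow> ocone (v (i + 1)) (z (i + 1)) (z i))" if i: "1 \<le> i" "i \<le> n" for i
  proof (cases "n - k < i")
    case True
    define m where "m = n - i"
    have m: "m < k" "n - m = i" "z i = f (Suc m)" using True i n zs[OF True i] by (auto simp: m_def Suc_diff_le)
    have "z (i + 1) = f m"
    proof (cases "i = n")
      case True then show ?thesis using z1 m_def by simp
    next
      case False then show ?thesis using zs[of "i+1"] True i by (simp add: m_def)
    qed
    then show ?thesis using step[OF form[OF m(1)] m(1)] m True mut_small[OF n(2) i] by simp
  next
    case False
    then show ?thesis using zi i mut_small[OF n(2) i] by simp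
  qed
  have all: "((mut n k i \<longrightarrow> ocone (w i) (w (i + 1)) (z i)) \<and> (\<not> mut n k i \<longrightarrow> z i = w (i + 1))) \<and>
     (mut n k i \<longrightarrow> ocone (v (i + 1)) (z (i + 1)) (z i))" for i
  proof -
    define r where "r = (if i mod n = 0 then n else i mod n)"
    have r: "r \<in> {1..n}" using mod_pos_range[of n i] n by (simp add: r_def)
    have rm: "r mod n = i mod n" by (simp add: r_def)
    then have r1: "(r + 1) mod n = (i + 1) mod n" by (metis mod_add_left_eq)
    have "mut n k r = mut n k i" by (simp add: mut_def rm)
    moreover have "w r = w i" "w (r+1) = w (i+1)" "z r = z i" "z (r+1) = z (i+1)" "v (r+1) = v (i+1)"
      using period_cong[where v = w and n = n, OF adv_period[OF a]]
        period_cong[where v = z and n = n, OF zper] period_cong[where v = v and n = n, OF posc_period[OF v]] rm r1 by blast+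
    ultimately show ?thesis using main[of r] r by (metis atLeastAtMost_iff)
  qed
  then have "adv n k w z" "diagc n k v z" using zper by (simp_all add: adv_def diagc_def)
  then show ?thesis by blast
qed

lemma adv_nonzero: "posc n v \<Longrightarrow> adv n k v w \<Longrightarrow> 3 \<le> n \<Longrightarrow> w i \<noteq> 0"
  using adv_posc posc_nonzero by blast

lemma step_nondegenerate:
  assumes v: "posc n v" and n: "4 \<le> n" and a: "adv n k v w" and az: "adv n k w z" and m: "mut n k i"
  shows "0 < br (w i) (v (i+1)) (w (i+1))" "indep2 (v (i+1)) (z (i+1))"
proof -
  obtain c t where ct: "\<And>i. 0 \<le> c i" "\<And>i. 0 < t i" "\<And>i. w i = c i *\<^sub>R v i + t i *\<^sub>R v (i + 1)"
     "\<And>i. mut n k i \<Longrightarrow> 0 < c i"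
    using adv_coeffs[OF a] by metis
  obtain c' t' where ct': "\<And>i. 0 \<le> c' i" "\<And>i. 0 < t' i" "\<And>i. z i = c' i *\<^sub>R w i + t' i *\<^sub>R w (i + 1)"
    using adv_coeffs[OF az] by metis
  have p: "0 < br (v i) (v (i+1)) (v (i+2))" "0 < br (v (i+1)) (v (i+2)) (v (i+3))"
    using n by (intro poscD[OF v]; simp)+
  have w1: "w i = c i *\<^sub>R v i + t i *\<^sub>R v (i+1)" "w (i+1) = c (i+1) *\<^sub>R v (i+1) + t (i+1) *\<^sub>R v (i+2)"
    "w (i+2) = c (i+2) *\<^sub>R v (i+2) + t (i+2) *\<^sub>R v (i+3)"
    using ct(3)[of i] ct(3)[of "i+1"] ct(3)[of "i+2"] by (simp_all add: numeral_2_eq_2 numeral_3_eq_3)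
  have "br (w i) (v (i+1)) (w (i+1)) = c i * (t (i+1) * br (v i) (v (i+1)) (v (i+2)))"
    unfolding w1 by simp
  then show "0 < br (w i) (v (i+1)) (w (i+1))" using ct(4)[OF m] ct(2) p by simp
  have "z (i+1) = c' (i+1) *\<^sub>R w (i+1) + t' (i+1) *\<^sub>R w (i+2)" using ct'(3)[of "i+1"] by (simp add: numeral_2_eq_2)
  then have "br (v (i+1)) (w (i+1)) (z (i+1)) = t' (i+1) * (t (i+1) * (t (i+2) * br (v (i+1)) (v (i+2)) (v (i+3))))"
    unfolding w1 by simp
  then show "indep2 (v (i+1)) (z (i+1))" using p ct(2)[of "i+1"] ct(2)[of "i+2"] ct'(2)[of "i+1"]
    by (intro indep2I'(1)[where c = "w (i+1)"]) auto
qed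

text \<open>The lines in \<open>new_B\<close> pass through \<open>v (i + 1)\<close>,
  \<open>z (i + 1)\<close> and through \<open>w i\<close>, \<open>w (i + 1)\<close>;
  \<open>diagc\<close> and \<open>adv\<close> place \<open>z i\<close> on both. The index
  \<open>m\<close> of the recursion counts down from the label \<open>n\<close>.\<close>

lemma seed_map_lift:
  assumes l: "lift n k v w s" and n: "4 \<le> n" "1 \<le> k" "k \<le> n - 1"
    and az: "adv n k w z" and d: "diagc n k v z"
  shows "lift n k w z (seed_map n k s)"
proof -
  have v: "posc n v" and a: "adv n k v w" and s: "s = seed_of n k v w" using l by (auto simp: lift_def)
  have w: "posc n w" by (rule adv_posc[OF v a])
  define A where "A = (\<lambda>i\<in>{1..n}. proj (v i))"
  define A' where "A' = (\<lambda>i\<in>{1..n}. proj (w i))"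
  have A': "(\<lambda>i\<in>{1..n}. if i \<le> n - k then A (i + 1) else proj (w i)) = A'"
  proof (rule ext)
    fix i show "(\<lambda>i\<in>{1..n}. if i \<le> n - k then A (i + 1) else proj (w i)) i = A' i"
    proof (cases "i \<in> {1..n} \<and> i \<le> n - k")
      case True
      then have "w i = v (i + 1)" using a mut_small[of k i n] n(2) by (auto simp: adv_def)
      moreover have "i + 1 \<le> n" using True n by auto
      ultimately show ?thesis using True n by (simp add: A_def A'_def)
    qed (simp add: A'_def)
  qed
  have meet: "pmeet (pline (proj (v (i+1))) (proj (z (i+1)))) (pline (proj (w i)) (proj (w (i+1)))) = proj (z i)"
    if m: "mut n k i" for i
  proof (rule pmeet_eqI)
    show "indep2 (v (i+1)) (z (i+1))" by (rule step_nondegenerate[OF v n(1) a az m])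
    show "indep2 (w i) (w (i+1))" by (rule posc_indep2[OF w]) (use n in auto)
    show "z i \<noteq> 0" using adv_nonzero[OF w az] n by auto
    show "br (v (i+1)) (z (i+1)) (z i) = 0" using d m ocone_br by (auto simp: diagc_def)
    show "br (w i) (w (i+1)) (z i) = 0" using adv_mut[OF az m] ocone_br by blast
    show "br (v (i+1)) (z (i+1)) (w i) \<noteq> 0 \<or> br (v (i+1)) (z (i+1)) (w (i+1)) \<noteq> 0"
    proof (rule ccontr)
      assume c: "\<not> ?thesis"
      have i: "indep2 (v (i+1)) (z (i+1))" by (rule step_nondegenerate[OF v n(1) a az m])
      obtain a b where ab: "w i = a *\<^sub>R v (i+1) + b *\<^sub>R z (i+1)" using indep2_span[OF i] c by blast
      obtain a' b' where ab': "w (i+1) = a' *\<^sub>R v (i+1) + b' *\<^sub>R z (i+1)" using indep2_span[OF i] c by blast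
      have "br (w i) (v (i+1)) (w (i+1)) = 0" unfolding ab ab' by simp
      then show False using step_nondegenerate(1)[OF v n(1) a az m] by simp
    qed
  qed
  have z1: "z (n + 1) = w 2"
  proof -
    have "z 1 = w 2" using az mut_small[of k 1 n] n by (simp add: adv_def numeral_2_eq_2)
    then show ?thesis using adv_period[OF az, of 1] by (simp add: add.commute)
  qed
  have nb: "new_B n A A' m = proj (z (n - m))" if "m < k" for m
    using that
  proof (induction m)
    case 0
    have "v (n + 1) = v 1" "w (n + 1) = w 1" using posc_period[OF v, of 1] posc_period[OF w, of 1] by (simp_all add: add.commute)
    then show ?case using meet[of n] z1 n by (simp add: A_def A'_def mut_def)
  next
    case (Suc m)
    define i where "i = n - Suc m"
    have i: "n - m = i + 1" "1 \<le> i" "i + 1 \<le> n" using Suc n by (auto simp: i_def)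
    have m: "mut n k i" using Suc n i by (subst mut_small) (auto simp: i_def)
    have "new_B n A A' (Suc m) = pmeet (pline (A (n - m)) (proj (z (n - m)))) (pline (A' i) (A' (n - m)))"
      using Suc by (simp add: i_def)
    moreover have "A (n - m) = proj (v (i+1))" "A' i = proj (w i)" "A' (n - m) = proj (w (i+1))"
      using i by (simp_all add: A_def A'_def)
    ultimately show ?case using meet[OF m] i i_def by metis
  qed
  have "seed_map n k s = (A', \<lambda>j\<in>{n - k + 1..n}. new_B n A A' (n - j))"
  proof -
    have "(\<lambda>i\<in>{1..n}. if i \<le> n - k then A (i + 1) else (\<lambda>j\<in>{n - k + 1..n}. proj (w j)) i)
       = (\<lambda>i\<in>{1..n}. if i \<le> n - k then A (i + 1) else proj (w i))"
      by (rule ext) auto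
    from trans[OF this A'] show ?thesis
      unfolding s seed_map_def seed_of_def A_def[symmetric] prod.case Let_def by (rule arg_cong)
  qed
  also have "\<dots> = seed_of n k w z"
  proof -
    have "(\<lambda>j\<in>{n - k + 1..n}. new_B n A A' (n - j)) = (\<lambda>j\<in>{n - k + 1..n}. proj (z j))"
    proof (rule ext)
      fix j show "(\<lambda>j\<in>{n - k + 1..n}. new_B n A A' (n - j)) j = (\<lambda>j\<in>{n - k + 1..n}. proj (z j)) j"
        using nb[of "n - j"] n by (cases "j \<in> {n - k + 1..n}") auto
    qed
    then show ?thesis by (simp add: seed_of_def A'_def)
  qed
  finally show ?thesis using w az by (simp add: lift_def)
qed

lemma adv_rangeI:
  assumes n: "1 \<le> k" "0 < n" and v: "\<And>i. v (i + n) = v i" and w: "\<And>i. w (i + n) = w i"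
    and m: "\<And>i. n - k < i \<Longrightarrow> 1 \<le> i \<Longrightarrow> i \<le> n \<Longrightarrow> ocone (v i) (v (i + 1)) (w i)"
    and f: "\<And>i. 1 \<le> i \<Longrightarrow> i \<le> n - k \<Longrightarrow> w i = v (i + 1)"
  shows "adv n k v w"
proof -
  let ?P = "\<lambda>i. (mut n k i \<longrightarrow> ocone (v i) (v (i + 1)) (w i)) \<and> (\<not> mut n k i \<longrightarrow> w i = v (i + 1))"
  have "?P i" for i
  proof (rule range_extend[where P = ?P, OF n(2)])
    fix i assume "1 \<le> i" "i \<le> n" then show "?P i" using m f mut_small[OF n(1)] by auto
  next
    fix i j assume h: "i mod n = j mod n" and P: "?P i"
    have "(i + 1) mod n = (j + 1) mod n" using h by (metis mod_add_left_eq)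
    then have "v i = v j" "v (i+1) = v (j+1)" "w i = w j"
      using period_cong[where v = v and n = n, OF v] period_cong[where v = w and n = n, OF w] h by blast+
    moreover have "mut n k i = mut n k j" using h by (simp add: mut_def)
    ultimately show "?P j" using P by simp
  qed
  then show ?thesis using w by (simp add: adv_def)
qed

lemma diagc_rangeI:
  assumes n: "1 \<le> k" "0 < n" and v: "\<And>i. v (i + n) = v i" and z: "\<And>i. z (i + n) = z i"
    and m: "\<And>i. n - k < i \<Longrightarrow> 1 \<le> i \<Longrightarrow> i \<le> n \<Longrightarrow> ocone (v (i + 1)) (z (i + 1)) (z i)"
  shows "diagc n k v z"
proof -
  let ?P = "\<lambda>i. mut n k i \<longrightarrow> ocone (v (i + 1)) (z (i + 1)) (z i)"
  have "?P i" for i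
  proof (rule range_extend[where P = ?P, OF n(2)])
    fix i assume "1 \<le> i" "i \<le> n" then show "?P i" using m mut_small[OF n(1)] by auto
  next
    fix i j assume h: "i mod n = j mod n" and P: "?P i"
    have "(i + 1) mod n = (j + 1) mod n" using h by (metis mod_add_left_eq)
    then have "z i = z j" "v (i+1) = v (j+1)" "z (i+1) = z (j+1)"
      using period_cong[where v = v and n = n, OF v] period_cong[where v = z and n = n, OF z] h by blast+
    moreover have "mut n k i = mut n k j" using h by (simp add: mut_def)
    ultimately show "?P j" using P by simp
  qed
  then show ?thesis by (simp add: diagc_def)
qed

text \<open>One common factor \<open>\<tau> * \<sigma>\<close> lifts the vertices and the marks, so
  that the convex combinations defining the marks become positive combinations of the lifts.\<close>

lemma seeds_lift:
  assumes s: "s \<in> seeds n k" and n: "4 \<le> n" "1 \<le> k" "k \<le> n - 1"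
  shows "\<exists>v w. lift n k v w s"
proof -
  obtain A B M p where sAB: "s = (A, B)" and ext: "A \<in> extensional {1..n}" "B \<in> extensional {n - k + 1..n}"
    and M: "invertible M" and c: "strictly_convex_polygon n p"
    and A: "\<And>i. i \<in> {1..n} \<Longrightarrow> A i = papply M (affine_pt (p i))"
    and B: "\<And>j. j \<in> {n - k + 1..n} \<Longrightarrow> \<exists>b\<in>open_segment (p j) (p (nxt n j)). B j = papply M (affine_pt b)"
    using s unfolding seeds_def by blast
  obtain b where b: "\<And>j. j \<in> {n - k + 1..n} \<Longrightarrow> b j \<in> open_segment (p j) (p (nxt n j)) \<and> B j = papply M (affine_pt (b j))"
    using B by metis
  obtain \<sigma> where \<sigma>: "\<sigma> \<noteq> 0" "posc n (pext n (\<lambda>i. \<sigma> *\<^sub>R hom (p i)))" using convex_posc[OF c n(1)] by blast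
  define u where "u = pext n (\<lambda>i. \<sigma> *\<^sub>R hom (p i))"
  obtain \<tau> where \<tau>: "\<tau> \<noteq> 0" "posc n (\<lambda>i. \<tau> *\<^sub>R (M *v u i))" using posc_scale[OF \<sigma>(2) M] unfolding u_def by blast
  define v where "v i = \<tau> *\<^sub>R (M *v u i)" for i
  have "v = (\<lambda>i. \<tau> *\<^sub>R (M *v u i))" by (simp add: fun_eq_iff v_def)
  then have v: "posc n v" using \<tau>(2) by simp
  define w where "w = pext n (\<lambda>j. if n - k < j then (\<tau> * \<sigma>) *\<^sub>R (M *v hom (b j)) else v (j + 1))"
  have vi: "v i = (\<tau> * \<sigma>) *\<^sub>R (M *v hom (p i))" if "1 \<le> i" "i \<le> n" for i
    using that by (simp add: v_def u_def matrix_vector_mult_scaleR)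
  have vi1: "v (i + 1) = (\<tau> * \<sigma>) *\<^sub>R (M *v hom (p (nxt n i)))" if "1 \<le> i" "i \<le> n" for i
    using pext_nxt[of i n "\<lambda>i. \<sigma> *\<^sub>R hom (p i)"] that by (simp add: v_def u_def matrix_vector_mult_scaleR)
  have Mnz: "M *v hom x \<noteq> 0" for x by (simp add: invertible_mult_zero[OF M])
  have a: "adv n k v w"
  proof (rule adv_rangeI)
    fix i assume i: "n - k < i" "1 \<le> i" "i \<le> n"
    then have "b i \<in> open_segment (p i) (p (nxt n i))" using b by auto
    then obtain t where t: "0 < t" "t < 1" "b i = (1 - t) *\<^sub>R p i + t *\<^sub>R p (nxt n i)"
      by (auto simp: in_segment)
    then have "ocone (hom (p i)) (hom (p (nxt n i))) (hom (b i))"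
      using hom_comb[of "1 - t" t] by (auto intro: oconeI)
    then have "ocone (v i) (v (i + 1)) ((\<tau> * \<sigma>) *\<^sub>R (M *v hom (b i)))"
      unfolding vi[OF i(2,3)] vi1[OF i(2,3)] by (intro ocone_scale ocone_mult) (use \<tau> \<sigma> in auto)
    then show "ocone (v i) (v (i + 1)) (w i)" using i by (simp add: w_def)
  qed (use n in \<open>auto simp: v_def u_def w_def\<close>)
  have "s = seed_of n k v w"
  proof -
    have "A i = (\<lambda>i\<in>{1..n}. proj (v i)) i" for i
      using A[of i] ext(1) vi[of i] \<tau> \<sigma> papply_proj[OF M hom_nonzero]
      by (cases "i \<in> {1..n}") (auto simp: affine_pt_hom proj_scale extensional_def)
    moreover have "B i = (\<lambda>j\<in>{n - k + 1..n}. proj (w j)) i" for i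
      using b[of i] ext(2) \<tau> \<sigma> papply_proj[OF M hom_nonzero] n
      by (cases "i \<in> {n - k + 1..n}") (auto simp: affine_pt_hom proj_scale extensional_def w_def)
    ultimately show ?thesis unfolding sAB seed_of_def by blast
  qed
  then show ?thesis using v a by (auto simp: lift_def)
qed

lemma lift_seeds:
  assumes l: "lift n k v w s" and n: "4 \<le> n" "1 \<le> k" "k \<le> n - 1"
  shows "s \<in> seeds n k"
proof -
  have v: "posc n v" and a: "adv n k v w" and s: "s = seed_of n k v w" using l by (auto simp: lift_def)
  \<comment> \<open>\<open>g\<close> is positive at all vertices, so taking it as the third
    coordinate moves the polygon into the affine plane; the other two coordinates only have to
    complete it to an isomorphism.\<close>
  define g where "g x = br (v 1) (v 2) x + br (v 3) (v 4) x" for x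
  define L :: "real^3 \<Rightarrow> real^3" where "L x = vector [br (v 1) (v 2) x, br (v 2) (v 3) x, g x]" for x
  have lin: "linear L" by (rule linearI) (simp_all add: L_def g_def vec_eq_iff forall_3 algebra_simps)
  have p4: "0 < br (v 1) (v 2) (v 3)" "0 < br (v 2) (v 3) (v 4)"
    using n by (intro poscD[OF v]; simp)+
  have L0: "x = 0" if "L x = 0" for x
  proof -
    have e: "br (v 1) (v 2) x = 0" "br (v 2) (v 3) x = 0" "br (v 3) (v 4) x = 0"
      using that by (auto simp: L_def g_def vec_eq_iff forall_3)
    obtain c d where cd: "x = c *\<^sub>R v 1 + d *\<^sub>R v 2" using br_zero_span[OF e(1), of "v 3"] p4 by auto
    have "c = 0" using e(2) p4 unfolding cd by (simp add: br_rot)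
    moreover have "br (v 3) (v 4) (v 2) = br (v 2) (v 3) (v 4)" by (rule br_rot)
    ultimately have "d = 0" using e(3) p4 unfolding cd by simp
    with \<open>c = 0\<close> show ?thesis by (simp add: cd)
  qed
  obtain N where Ninv: "invertible N" and N: "\<And>x. N *v x = L x" using injective_matrix[OF lin L0] by blast
  from Ninv obtain M where M: "N ** M = mat 1" "M ** N = mat 1" by (auto simp: invertible_def)
  have MN: "M *v (N *v x) = x" for x by (simp add: matrix_vector_mul_assoc M)
  have Minv: "invertible M" unfolding invertible_def using M by blast
  have gp: "0 < g (v i)" for i using posc_functional[OF v n(1)] by (simp add: g_def)
  define p :: "nat \<Rightarrow> real^2" where "p i = vector [L (v i) $ 1 / g (v i), L (v i) $ 2 / g (v i)]" for i
  have hp: "hom (p i) = (1 / g (v i)) *\<^sub>R (N *v v i)" for i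
    using gp[of i] by (simp add: hom_def p_def N vec_eq_iff forall_3) (simp add: L_def)
  have pn: "p (nxt n i) = p (i + 1)" for i
    using posc_period[OF v, of 1] by (simp add: p_def nxt_def add.commute)
  obtain \<tau> where \<tau>: "\<tau> \<noteq> 0" "posc n (\<lambda>i. \<tau> *\<^sub>R (N *v v i))" using posc_scale[OF v Ninv] by blast
  have c: "strictly_convex_polygon n p"
  proof (rule posc_convex[where c = "\<lambda>i. \<tau> * g (v i)"])
    have "pext n (\<lambda>i. (\<tau> * g (v i)) *\<^sub>R hom (p i)) = (\<lambda>i. \<tau> *\<^sub>R (N *v v i))"
    proof
      fix i
      define r where "r = (if i mod n = 0 then n else i mod n)"
      have r: "r \<in> {1..n}" using mod_pos_range[of n i] n by (simp add: r_def)
      have "r mod n = i mod n" by (simp add: r_def)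
      then have "v r = v i" using period_cong[where v = v and n = n, OF posc_period[OF v]] by blast
      moreover have "pext n (\<lambda>i. (\<tau> * g (v i)) *\<^sub>R hom (p i)) i = (\<tau> * g (v r)) *\<^sub>R hom (p r)"
        by (simp add: pext_def r_def)
      ultimately show "pext n (\<lambda>i. (\<tau> * g (v i)) *\<^sub>R hom (p i)) i = \<tau> *\<^sub>R (N *v v i)"
        using r hp[of r] gp[of r] by simp
    qed
    then show "posc n (pext n (\<lambda>i. (\<tau> * g (v i)) *\<^sub>R hom (p i)))" using \<tau>(2) by simp
    show "0 < \<tau> * g (v i) * (\<tau> * g (v j))" if "i \<in> {1..n}" "j \<in> {1..n}" for i j
    proof -
      have "0 < \<tau> * \<tau>" using \<tau>(1) not_real_square_gt_zero by blast
      then have "0 < (\<tau> * \<tau>) * (g (v i) * g (v j))" 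
        by (rule mult_pos_pos) (use gp[of i] gp[of j] that in simp)
      then show ?thesis by (simp add: mult_ac)
    qed
  qed (use n in simp)
  have Ai: "proj (v i) = papply M (affine_pt (p i))" if "i \<in> {1..n}" for i
  proof -
    have "papply M (affine_pt (p i)) = proj (M *v hom (p i))"
      by (simp add: affine_pt_hom papply_proj[OF Minv])
    also have "M *v hom (p i) = (1 / g (v i)) *\<^sub>R v i"
      using that by (simp add: hp matrix_vector_mult_scaleR MN)
    also have "proj \<dots> = proj (v i)" by (rule proj_scale) (use gp[of i] that in auto)
    finally show ?thesis by simp
  qed
  have Bj: "\<exists>b\<in>open_segment (p j) (p (nxt n j)). proj (w j) = papply M (affine_pt b)"
    if j: "j \<in> {n - k + 1..n}" for j
  proof -
    have "mut n k j" using j n by (subst mut_small) auto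
    then obtain s t where st: "0 < s" "0 < t" "w j = s *\<^sub>R v j + t *\<^sub>R v (j + 1)"
      using adv_mut[OF a] oconeE by metis
    define G where "G = s * g (v j) + t * g (v (j + 1))"
    have gj: "0 < g (v j)" "0 < g (v (j + 1))" using gp j by auto
    then have G: "0 < G" unfolding G_def using st by (intro add_pos_pos mult_pos_pos)
    \<comment> \<open>The barycentric weight of \<open>w j\<close> on its edge after the vertices
      have been rescaled by \<open>g\<close>.\<close>
    define r where "r = t * g (v (j + 1)) / G"
    have r: "0 < r" "r < 1" "1 - r = s * g (v j) / G"
      using G gj st by (auto simp: r_def field_simps) (simp_all add: G_def)
    define b where "b = (1 - r) *\<^sub>R p j + r *\<^sub>R p (nxt n j)"
    have "hom b = (1 - r) *\<^sub>R hom (p j) + r *\<^sub>R hom (p (j + 1))" unfolding b_def pn by (rule hom_comb) simp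
    also have "\<dots> = (1 / G) *\<^sub>R (N *v w j)"
      using hp[of j] hp[of "j+1"] j gj G unfolding st(3) r(3) unfolding r_def
      by (simp add: matrix_vector_right_distrib matrix_vector_mult_scaleR scaleR_add_right)
    finally have hb: "hom b = (1 / G) *\<^sub>R (N *v w j)" .
    have "papply M (affine_pt b) = proj (M *v hom b)"
      by (simp add: affine_pt_hom papply_proj[OF Minv])
    also have "M *v hom b = (1 / G) *\<^sub>R w j" by (simp add: hb matrix_vector_mult_scaleR MN)
    also have "proj \<dots> = proj (w j)" by (rule proj_scale) (use G in auto)
    finally have "proj (w j) = papply M (affine_pt b)" by simp
    moreover have "p j \<noteq> p (nxt n j)"
      using c j nxt_in[of j n] n by (auto simp: strictly_convex_polygon_def inj_on_eq_iff nxt_def)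
    then have "b \<in> open_segment (p j) (p (nxt n j))" using r b_def by (auto simp: in_segment)
    ultimately show ?thesis by blast
  qed
  have "\<exists>M p. invertible M \<and> strictly_convex_polygon n p \<and>
        (\<forall>i\<in>{1..n}. (\<lambda>i\<in>{1..n}. proj (v i)) i = papply M (affine_pt (p i))) \<and>
        (\<forall>j\<in>{n - k + 1..n}. \<exists>b\<in>open_segment (p j) (p (nxt n j)).
            (\<lambda>j\<in>{n - k + 1..n}. proj (w j)) j = papply M (affine_pt b))"
    using Minv c Ai Bj by (intro exI[of _ M] exI[of _ p]) simp
  then show ?thesis unfolding seeds_def s seed_of_def by simp
qed

section \<open>Inverting the seed map\<close>

lemma br_exchange: "br y p q * br f e p = br f p q * br y e p + br e p q * br f y p"
  unfolding br_def by algebra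

text \<open>Moving the vertex \<open>V (i + 1)\<close> outwards along its edge at \<open>V i\<close>, up to the line
  through \<open>z\<close> and \<open>z'\<close>, keeps the polygon convex.\<close>

lemma push_out:
  assumes V: "posc n V" and n: "4 \<le> n"
    and z: "z = a *\<^sub>R V (i + 1) + b *\<^sub>R V (i + 2)" "0 < a" "0 < b"
    and z': "z' = x *\<^sub>R V (i + 2) + y *\<^sub>R V (i + 3)" "0 \<le> x" "0 < y"
  defines "Y \<equiv> br (V i) z z' *\<^sub>R V (i + 1) - br (V (i + 1)) z z' *\<^sub>R V i"
  shows "posc n (\<lambda>j. if j mod n = (i + 1) mod n then Y else V j)"
    "ocone (V i) Y (V (i + 1))" "ocone Y z' z"
proof -
  define c1 c2 c3 c4 where c_def: "c1 = br (V (i+1)) z z'" "c2 = br (V i) z z'"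
    "c3 = br (V i) (V (i+1)) z'" "c4 = br (V i) (V (i+1)) z"
  have p: "0 < br (V i) (V (i+1)) (V (i+2))" "0 < br (V i) (V (i+1)) (V (i+3))"
    "0 < br (V i) (V (i+2)) (V (i+3))" "0 < br (V (i+1)) (V (i+2)) (V (i+3))"
    using n by (intro poscD[OF V]; simp)+
  have "c1 = b * (y * br (V (i+1)) (V (i+2)) (V (i+3)))" unfolding c_def z z' by simp
  then have c1: "0 < c1" using z z' p by simp
  have "c2 = a * (x * br (V i) (V (i+1)) (V (i+2)) + y * br (V i) (V (i+1)) (V (i+3)))
     + b * (y * br (V i) (V (i+2)) (V (i+3)))" unfolding c_def z z' by (simp add: algebra_simps)
  then have c2: "0 < c2" using z z' p by (simp add: add_nonneg_pos add_pos_pos)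
  have "c3 = x * br (V i) (V (i+1)) (V (i+2)) + y * br (V i) (V (i+1)) (V (i+3))" unfolding c_def z' by simp
  then have c3: "0 < c3" using z' p by (simp add: add_nonneg_pos)
  have c4: "0 < c4" unfolding c_def z using z p by simp
  have Y1: "Y = c2 *\<^sub>R V (i + 1) - c1 *\<^sub>R V i" by (simp add: Y_def c_def)
  \<comment> \<open>The same point, now along the line through \<open>z\<close> and
    \<open>z'\<close> instead of the line of the edge.\<close>
  have Y2: "Y = c3 *\<^sub>R z - c4 *\<^sub>R z'"
    using br_quad_rel[of "V (i+1)" z z' "V i"] by (simp add: Y1 c_def algebra_simps)
  have "V (i + 1) = (c1 / c2) *\<^sub>R V i + (1 / c2) *\<^sub>R Y"
    unfolding Y1 using c2 by (simp add: scaleR_diff_right)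
  then show "ocone (V i) Y (V (i + 1))" using c1 c2 oconeI[of "c1 / c2" "1 / c2" "V i" Y] by simp
  have "z = (1 / c3) *\<^sub>R Y + (c4 / c3) *\<^sub>R z'"
    unfolding Y2 using c3 by (simp add: scaleR_diff_right)
  then show "ocone Y z' z" using c3 c4 oconeI[of "1 / c3" "c4 / c3" Y z'] by simp
  have A: "0 < br Y (V (i+2)) (V q)" if "i + 2 < q" "q \<le> i + n" for q
  proof -
    have "0 < br (V (i+1)) (V (i+2)) (V q)" "0 \<le> br (V (i+2)) (V (i+3)) (V q)"
      using that by (intro poscD[OF V] posc_nonneg[OF V]; simp)+
    moreover have "br Y (V (i+2)) (V q) = c3 * (a * br (V (i+1)) (V (i+2)) (V q)) + c4 * (y * br (V (i+2)) (V (i+3)) (V q))"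
      unfolding Y2 z z' using br_swap(1)[of "V (i+3)" "V (i+2)" "V q"] by simp
    ultimately show ?thesis using c3 c4 z z' by (simp add: add_pos_nonneg)
  qed
  have B: "0 < br Y (V q) (V i)" if "i + 1 < q" "q < i + n" for q
  proof -
    have "0 < br (V i) (V (i+1)) (V q)" using that by (intro poscD[OF V]) auto
    then show ?thesis unfolding Y1 using c2 by (simp add: br_rot)
  qed
  have T: "0 < br Y (V q) (V r)" if h: "i + 1 < q" "q < r" "r < i + 1 + n" for q r
  proof -
    consider "q = i + 2" | "r = i + n" | "i + 2 < q" "r < i + n" using h by linarith
    then show ?thesis
    proof cases
      case 1 then show ?thesis using A h by simp
    next
      case 2 then show ?thesis using B h posc_period[OF V] by simp
    next
      case 3
      have h3: "0 < br (V i) (V (i+2)) (V q)" "0 < br (V i) (V q) (V r)" "0 < br (V (i+2)) (V q) (V r)"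
        using 3 h by (intro poscD[OF V]; simp)+
      have h4: "0 < br Y (V (i+2)) (V q)" using A 3 h by simp
      have h5: "0 < br (V i) Y (V q)" using B[of q] br_rot[of Y "V q" "V i"] 3 h by simp
      have "0 < br Y (V q) (V r) * br (V i) (V (i+2)) (V q)"
        by (subst br_exchange) (intro add_pos_pos mult_pos_pos h3 h4 h5)
      then show ?thesis using h3(1) by (rule zero_less_mult_pos2)
    qed
  qed
  have per: "V (j + t * n) = V j" for j t
    using period_mult[where v = V and n = n, OF posc_period[OF V]] .
  have T': "0 < br Y (V q) (V r)" if h: "P < q" "q < r" "r < P + n" and P: "P mod n = (i + 1) mod n" for P q r
  proof (cases "i + 1 \<le> P")
    case True
    then obtain t where t: "P = i + 1 + t * n" using P by (metis mod_eq_nat1E mult.commute)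
    have "0 < br Y (V (q - t * n)) (V (r - t * n))" by (rule T) (use h t in auto)
    then show ?thesis using per[of "q - t * n" t] per[of "r - t * n" t] h t by simp
  next
    case False
    then obtain t where t: "i + 1 = P + t * n" using P by (metis mod_eq_nat1E mult.commute nat_le_linear)
    have "0 < br Y (V (q + t * n)) (V (r + t * n))" by (rule T) (use h t in auto)
    then show ?thesis using per by simp
  qed
  have ne: "q mod n \<noteq> P mod n" if "P < q" "q < P + n" for P q
  proof
    assume "q mod n = P mod n"
    then have "n dvd q - P" using that by (metis mod_eq_dvd_iff_nat less_imp_le)
    then show False using that by (auto dest: dvd_imp_le)
  qed
  let ?W = "\<lambda>j. if j mod n = (i + 1) mod n then Y else V j"
  show "posc n ?W"
    unfolding posc_def
  proof (intro conjI allI impI; (elim conjE)?)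
    fix j show "?W (j + n) = ?W j" using posc_period[OF V] by simp
  next
    fix j l m assume h: "j < l" "l < m" "m < j + n"
    have n3: "l mod n \<noteq> j mod n" "m mod n \<noteq> j mod n" "m mod n \<noteq> l mod n" using ne h by auto
    consider "j mod n = (i+1) mod n" | "l mod n = (i+1) mod n" | "m mod n = (i+1) mod n"
      | "j mod n \<noteq> (i+1) mod n" "l mod n \<noteq> (i+1) mod n" "m mod n \<noteq> (i+1) mod n" by blast
    then show "0 < br (?W j) (?W l) (?W m)"
    proof cases
      case 1
      then show ?thesis using T'[of j l m] h n3 by simp
    next
      case 2
      have "0 < br Y (V m) (V (j + n))" using T'[of l m "j + n"] h 2 by simp
      then show ?thesis using 2 n3 posc_period[OF V] br_rot[of Y "V m" "V j"] by simp
    next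
      case 3
      have "0 < br Y (V (j + n)) (V (l + n))" using T'[of m "j + n" "l + n"] h 3 by simp
      then show ?thesis using 3 n3 posc_period[OF V] br_rot[of "V j" "V l" Y] by simp
    next
      case 4
      then show ?thesis using poscD[OF V] h by simp
    qed
  qed
qed

lemma posc_shift: "posc n v \<Longrightarrow> posc n (\<lambda>i. v (i + m))"
  unfolding posc_def
proof (intro conjI allI impI; elim conjE)
  fix i assume "\<forall>i. v (i + n) = v i"
  then show "v (i + n + m) = v (i + m)" by (metis add.assoc add.commute)
next
  fix i j k
  assume "\<forall>i j k. i < j \<and> j < k \<and> k < i + n \<longrightarrow> 0 < br (v i) (v j) (v k)" "i < j" "j < k" "k < i + n"
  then show "0 < br (v (i + m)) (v (j + m)) (v (k + m))" by simp
qed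

text \<open>The vertices to be restored are found in increasing order: each lies on the line through
  the preceding one and a vertex of \<open>w\<close>, and on the line through two consecutive
  vertices of \<open>z\<close>. Restoring them one at a time keeps every intermediate polygon convex
  by \<open>push_out\<close>.\<close>

lemma prev_exists:
  assumes w: "posc n w" and a: "adv n k w z" and n: "4 \<le> n" "1 \<le> k" "k \<le> n - 1"
  shows "\<exists>v. posc n v \<and> adv n k v w \<and> diagc n k v z"
proof -
  define K where "K = n - k"
  have K: "1 \<le> K" "K + k = n" using n by (auto simp: K_def)
  define f where "f = rec_nat (w K) (\<lambda>m u. br u (z (K+1+m)) (z (K+2+m)) *\<^sub>R w (K+1+m)
     - br (w (K+1+m)) (z (K+1+m)) (z (K+2+m)) *\<^sub>R u)"
  have f0: "f 0 = w K" and fS: "\<And>m. f (Suc m) = br (f m) (z (K+1+m)) (z (K+2+m)) *\<^sub>R w (K+1+m)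
     - br (w (K+1+m)) (z (K+1+m)) (z (K+2+m)) *\<^sub>R f m"
    by (simp_all add: f_def)
  \<comment> \<open>The polygon after \<open>m\<close> restorations, still with the labels of
    \<open>w\<close>; the labels of \<open>v\<close> are larger by one.\<close>
  define V where "V m = pext n (\<lambda>j. if j \<le> K then w j else if j \<le> K + m then f (j - K) else w j)" for m
  have V0: "V 0 = w"
  proof
    fix i
    define r where "r = (if i mod n = 0 then n else i mod n)"
    have "r mod n = i mod n" by (simp add: r_def)
    then have "w r = w i" using period_cong[where v = w and n = n, OF posc_period[OF w]] by blast
    then show "V 0 i = w i" by (simp add: V_def pext_def r_def)
  qed
  have Vf: "V m (K + l) = f l" if "l \<le> m" "l \<le> k" for m l
    using that K f0 by (cases "l = 0") (auto simp: V_def)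
  have Vw: "V m j = w j" if "K + m < j" "j \<le> n" for m j using that K by (simp add: V_def)
  have VK: "V m j = w j" if "1 \<le> j" "j \<le> K" for m j using that K by (simp add: V_def)
  have Vp: "V m (j + n) = V m j" for m j by (simp add: V_def)
  have z_n: "z (i + n) = z i" for i using adv_period[OF a] .
  have w_n: "w (i + n) = w i" for i using posc_period[OF w] .
  have mutK: "mut n k (K + 1 + l)" if "l < k" for l using that K n by (subst mut_small) (auto simp: K_def)
  have main: "posc n (V m) \<and> (\<forall>l<m. ocone (f l) (f (Suc l)) (w (K+1+l)) \<and> ocone (f (Suc l)) (z (K+2+l)) (z (K+1+l)))"
    if "m \<le> k" for m
    using that
  proof (induction m)
    case 0 then show ?case using V0 w by simp
  next
    case (Suc m)
    define i where "i = K + m"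
    have i: "i + 1 \<le> n" "1 \<le> i" "i = K + m" using Suc K by (auto simp: i_def)
    have IH: "posc n (V m)" "\<And>l. l < m \<Longrightarrow> ocone (f l) (f (Suc l)) (w (K+1+l))"
       "\<And>l. l < m \<Longrightarrow> ocone (f (Suc l)) (z (K+2+l)) (z (K+1+l))" using Suc by auto
    have Vi: "V m i = f m" using Vf[of m m] Suc i by simp
    have Vi1: "V m (i + 1) = w (i + 1)" using Vw[of m "i+1"] i by simp
    have Vi2: "V m (i + 2) = w (i + 2)"
    proof (cases "i + 1 = n")
      case True
      then show ?thesis using Vp[of m 1] VK[of 1 m] w_n[of 1] K by (simp add: add.commute)
    next
      case False then show ?thesis using Vw[of m "i+2"] i by simp
    qed
    obtain a1 b1 where z1: "0 < a1" "0 < b1" "z (i+1) = a1 *\<^sub>R w (i+1) + b1 *\<^sub>R w (i+2)"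
      using adv_mut[OF a mutK[of m]] Suc i by (auto simp: ocone_def add.commute)
    have z2: "\<exists>x y. 0 \<le> x \<and> 0 < y \<and> z (i+2) = x *\<^sub>R V m (i+2) + y *\<^sub>R V m (i+3)"
    proof (cases "i + 1 = n")
      case False
      then have i2: "i + 2 \<le> n" using i by simp
      have "V m (i + 3) = w (i + 3)"
      proof (cases "i + 2 = n")
        case True
        then have e: "i + 3 = 1 + n" by simp
        show ?thesis unfolding e using Vp[of m 1] VK[of 1 m] w_n[of 1] K by simp
      next
        case False then show ?thesis using Vw[of m "i+3"] i i2 by simp
      qed
      moreover have "ocone (w (i+2)) (w (i+3)) (z (i+2))"
        using adv_mut[OF a mutK[of "m+1"]] i i2 K by (simp add: eval_nat_numeral add_ac)
      ultimately show ?thesis using Vi2 by (auto simp: ocone_def intro: less_imp_le)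
    next
      case True
      have "\<not> mut n k 1" using K n by (subst mut_small) (auto simp: K_def)
      then have "z 1 = w 2" using adv_imm[OF a, of 1] by (simp add: numeral_2_eq_2)
      then have zz: "z (i + 2) = w 2" using z_n[of 1] True by (simp add: add.commute)
      have V2: "V m (i + 2) = V m 1" "V m (i + 3) = V m 2"
        using Vp[of m 1] Vp[of m 2] True by (simp_all add: add.commute eval_nat_numeral flip: True)
      show ?thesis
      proof (cases "K = 1")
        case False
        then have "V m 2 = w 2" using VK[of 2 m] K by simp
        then show ?thesis using zz V2 by (intro exI[of _ "0::real"] conjI exI[of _ "1::real"]) auto
      next
        \<comment> \<open>Here the label \<open>i + 3\<close> wraps around to a vertex that has
          already been moved, and the old vertex \<open>w 2\<close> lies between \<open>f 0\<close>
          and the moved one, \<open>f 1\<close>.\<close>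
        case K1: True
        have "0 < m" using True i K1 n by simp
        then have "ocone (f 0) (f 1) (w 2)" using IH(2)[of 0] K1 by (simp add: numeral_2_eq_2)
        moreover have "V m 1 = f 0" "V m 2 = f 1"
          using Vf[of 0 m] Vf[of 1 m] K1 \<open>0 < m\<close> Suc by (simp_all add: numeral_2_eq_2)
        ultimately show ?thesis using zz V2 by (auto simp: ocone_def intro: less_imp_le)
      qed
    qed
    then obtain x y where xy: "0 \<le> x" "0 < y" "z (i+2) = x *\<^sub>R V m (i+2) + y *\<^sub>R V m (i+3)" by blast
    have zi: "z (i+1) = a1 *\<^sub>R V m (i+1) + b1 *\<^sub>R V m (i+2)" using z1 Vi1 Vi2 by simp
    have Y: "br (V m i) (z (i+1)) (z (i+2)) *\<^sub>R V m (i+1) - br (V m (i+1)) (z (i+1)) (z (i+2)) *\<^sub>R V m i = f (Suc m)"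
      unfolding fS Vi Vi1 by (simp add: i(3) add_ac)
    note P = push_out[OF IH(1) n(1) zi z1(1,2) xy(3,1,2), unfolded Y]
    have "(\<lambda>j. if j mod n = (i + 1) mod n then f (Suc m) else V m j) = V (Suc m)"
    proof
      fix j
      define r where "r = (if j mod n = 0 then n else j mod n)"
      have r: "r \<in> {1..n}" using mod_pos_range[of n j] n by (simp add: r_def)
      have rm: "r mod n = j mod n" by (simp add: r_def)
      then have "V m j = V m r" "V (Suc m) j = V (Suc m) r"
        using period_cong[where v = "V m" and n = n, OF Vp] period_cong[where v = "V (Suc m)" and n = n, OF Vp] by metis+
      moreover have "(j mod n = (i + 1) mod n) = (r = i + 1)"
        unfolding rm[symmetric] using r i n by (cases "r = n"; cases "i + 1 = n") auto
      moreover have "(if r = i + 1 then f (Suc m) else V m r) = V (Suc m) r"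
        using r i by (auto simp: V_def)
      ultimately show "(if j mod n = (i + 1) mod n then f (Suc m) else V m j) = V (Suc m) j" by (simp split: if_splits)
    qed
    then have "posc n (V (Suc m))" using P(1) by simp
    moreover have "ocone (f m) (f (Suc m)) (w (K+1+m))" "ocone (f (Suc m)) (z (K+2+m)) (z (K+1+m))"
      using P(2,3) Vi Vi1 i by (simp_all add: add_ac)
    ultimately show ?case using IH by (auto simp: less_Suc_eq)
  qed
  \<comment> \<open>By periodicity, adding \<open>n - 1\<close> lowers the label by one without a
    subtraction of natural numbers.\<close>
  define v where "v j = V k (j + (n - 1))" for j
  have v: "posc n v" using posc_shift[of n "V k"] main[of k] by (simp add: v_def[abs_def])
  have vS: "v (j + 1) = V k j" for j using Vp[of k j] n by (simp add: v_def)
  have vm: "v (K + 1 + l) = f l" if "l \<le> k" for l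
    using vS[of "K + l"] Vf[of l k] that by (simp add: add_ac)
  have am: "ocone (v i) (v (i+1)) (w i) \<and> ocone (v (i+1)) (z (i+1)) (z i)" if "n - k < i" "i \<le> n" for i
  proof -
    define l where "l = i - (K + 1)"
    have l: "i = K + 1 + l" "l < k" using that K by (auto simp: l_def K_def)
    have "v i = f l" "v (i + 1) = f (Suc l)" using vm[of l] vm[of "Suc l"] l by simp_all
    then show ?thesis using main[THEN conjunct2, rule_format, OF order.refl l(2)] l by simp
  qed
  have "adv n k v w"
  proof (rule adv_rangeI)
    show "w i = v (i + 1)" if "1 \<le> i" "i \<le> n - k" for i using VK[of i k] that vS by (simp add: K_def)
  qed (use n am w_n posc_period[OF v] in auto)
  moreover have "diagc n k v z"
    by (rule diagc_rangeI) (use n am z_n posc_period[OF v] in auto)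
  ultimately show ?thesis using v by blast
qed

lemma seed_map_in: "4 \<le> n \<Longrightarrow> 1 \<le> k \<Longrightarrow> k \<le> n - 1 \<Longrightarrow> s \<in> seeds n k \<Longrightarrow> seed_map n k s \<in> seeds n k"
  by (metis lift_def lift_seeds next_exists seed_map_lift seeds_lift)

lemma seed_map_surj:
  assumes n: "4 \<le> n" "1 \<le> k" "k \<le> n - 1" and s: "s \<in> seeds n k"
  shows "\<exists>s'\<in>seeds n k. seed_map n k s' = s"
proof -
  obtain w z where l: "lift n k w z s" using seeds_lift[OF s n] by blast
  then obtain v where v: "posc n v" "adv n k v w" "diagc n k v z"
    using prev_exists[OF _ _ n] by (auto simp: lift_def)
  then have lv: "lift n k v w (seed_of n k v w)" by (simp add: lift_def)
  have "lift n k w z (seed_map n k (seed_of n k v w))"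
    using seed_map_lift[OF lv n _ v(3)] l by (simp add: lift_def)
  then show ?thesis using lift_seeds[OF lv n] l by (auto simp: lift_def)
qed

lemma seed_of_eq:
  assumes n: "1 \<le> k" "0 < n" and e: "seed_of n k v w = seed_of n k v' w'"
    and per: "\<And>i. v (i + n) = v i" "\<And>i. v' (i + n) = v' i" "adv n k v w" "adv n k v' w'"
  shows "proj (v i) = proj (v' i)" "proj (w i) = proj (w' i)"
proof -
  have c: "proj (v i) = proj (v' i)" if "1 \<le> i" "i \<le> n" for i
    using fun_cong[OF arg_cong[OF e, of fst], of i] that by (simp add: seed_of_def)
  have d: "proj (w i) = proj (w' i)" if "n - k + 1 \<le> i" "i \<le> n" for i
    using fun_cong[OF arg_cong[OF e, of snd], of i] that by (simp add: seed_of_def)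
  show v: "proj (v i) = proj (v' i)" for i
  proof (rule range_extend[where P = "\<lambda>i. proj (v i) = proj (v' i)", OF n(2) c])
    fix i j :: nat assume "i mod n = j mod n" "proj (v i) = proj (v' i)"
    then show "proj (v j) = proj (v' j)"
      using period_cong[where v = v and n = n, OF per(1)] period_cong[where v = v' and n = n, OF per(2)] by metis
  qed
  show "proj (w i) = proj (w' i)"
  proof (rule range_extend[where P = "\<lambda>i. proj (w i) = proj (w' i)", OF n(2)])
    fix i :: nat assume i: "1 \<le> i" "i \<le> n"
    show "proj (w i) = proj (w' i)"
    proof (cases "n - k < i")
      case False
      then show ?thesis using adv_imm[OF per(3)] adv_imm[OF per(4)] mut_small[OF n(1) i] v by simp
    qed (use d i in auto)
  next
    fix i j :: nat assume "i mod n = j mod n" "proj (w i) = proj (w' i)"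
    then show "proj (w j) = proj (w' j)"
      using period_cong[where v = w and n = n, OF adv_period[OF per(3)]]
        period_cong[where v = w' and n = n, OF adv_period[OF per(4)]] by metis
  qed
qed

lemma seed_of_cong:
  assumes "\<And>i. proj (v i) = proj (v' i)" "\<And>i. proj (w i) = proj (w' i)"
  shows "seed_of n k v w = seed_of n k v' w'"
  using assms by (simp add: seed_of_def)

text \<open>A vertex that has been left behind is recovered as the meet of the line through
  \<open>v i\<close>, \<open>w i\<close> with the line through \<open>z i\<close>,
  \<open>z (i + 1)\<close>. The induction starts at the carried-over vertex with label
  \<open>n - k + 1\<close>.\<close>

lemma seed_map_inj:
  assumes n: "4 \<le> n" "1 \<le> k" "k \<le> n - 1"
  shows "inj_on (seed_map n k) (seeds n k)"
proof (rule inj_onI)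
  fix s s' assume s: "s \<in> seeds n k" "s' \<in> seeds n k" "seed_map n k s = seed_map n k s'"
  obtain v w where l: "lift n k v w s" using seeds_lift[OF s(1) n] by blast
  obtain v' w' where l': "lift n k v' w' s'" using seeds_lift[OF s(2) n] by blast
  have v: "posc n v" and a: "adv n k v w" and v': "posc n v'" and a': "adv n k v' w'"
    using l l' by (auto simp: lift_def)
  obtain z where z: "adv n k w z" "diagc n k v z" using next_exists[OF v n a] by blast
  obtain z' where z': "adv n k w' z'" "diagc n k v' z'" using next_exists[OF v' n a'] by blast
  have L: "lift n k w z (seed_map n k s)" "lift n k w' z' (seed_map n k s')"
    using seed_map_lift l l' n z z' by blast+
  then have w: "posc n w" "posc n w'" "seed_of n k w z = seed_of n k w' z'" using s(3) by (auto simp: lift_def)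
  have pw: "proj (w i) = proj (w' i)" and pz: "proj (z i) = proj (z' i)" for i
    using seed_of_eq[OF n(2) _ w(3) posc_period[OF w(1)] posc_period[OF w(2)] z(1) z'(1)] n by simp_all
  have meet: "pmeet (pline (proj (v i)) (proj (w i))) (pline (proj (z i)) (proj (z (i+1)))) = proj (v (i + 1))"
    if v: "posc n v" and a: "adv n k v w" and z: "adv n k w z" "diagc n k v z" and m: "mut n k i" for v w z i
  proof (rule pmeet_eqI)
    have w: "posc n w" by (rule adv_posc[OF v a])
    obtain c t where ct: "\<And>i. 0 \<le> c i" "\<And>i. 0 < t i" "\<And>i. w i = c i *\<^sub>R v i + t i *\<^sub>R v (i + 1)"
      using adv_coeffs[OF a] by metis
    obtain c' t' where ct': "\<And>i. 0 \<le> c' i" "\<And>i. 0 < t' i" "\<And>i. z i = c' i *\<^sub>R w i + t' i *\<^sub>R w (i + 1)"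
      using adv_coeffs[OF z(1)] by metis
    have p: "0 < br (v i) (v (i+1)) (v (i+2))" using n by (intro poscD[OF v]; simp)
    show "indep2 (v i) (w i)"
      by (rule indep2I[where c = "v (i+2)"]) (use ct(2,3)[of i] p in auto)
    show "indep2 (z i) (z (i+1))" by (rule posc_indep2[OF adv_posc[OF w z(1)]]) (use n in auto)
    show "v (i + 1) \<noteq> 0" using posc_nonzero[OF v] n by simp
    show "br (v i) (w i) (v (i+1)) = 0" using adv_mut[OF a m] ocone_br by blast
    show "br (z i) (z (i+1)) (v (i+1)) = 0"
      using z(2) m by (auto simp: diagc_def ocone_def br_swap(1)[of "v (Suc i)"])
    have w1: "w (i+1) = c (i+1) *\<^sub>R v (i+1) + t (i+1) *\<^sub>R v (i+2)" using ct(3)[of "i+1"] by (simp add: numeral_2_eq_2)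
    have "br (v i) (w i) (z i) = t' i * (t i * (t (i+1) * br (v i) (v (i+1)) (v (i+2))))"
      unfolding ct'(3)[of i] w1 ct(3)[of i] by simp
    then show "br (v i) (w i) (z i) \<noteq> 0 \<or> br (v i) (w i) (z (i+1)) \<noteq> 0"
      using p ct(2)[of i] ct(2)[of "i+1"] ct'(2)[of i] by simp
  qed
  define K where "K = n - k"
  have base: "proj (v (i + 1)) = proj (v' (i + 1))" if "\<not> mut n k i" for i
    using adv_imm[OF a that] adv_imm[OF a' that] pw by metis
  have ind: "proj (v (K + 1 + m)) = proj (v' (K + 1 + m))" if "m \<le> k" for m
    using that
  proof (induction m)
    case 0
    have "\<not> mut n k K" using n by (subst mut_small) (auto simp: K_def)
    then show ?case using base by simp
  next
    case (Suc m)
    have "mut n k (K + 1 + m)" using Suc n by (subst mut_small) (auto simp: K_def)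
    from meet[OF v a z this] meet[OF v' a' z' this]
    show ?case using Suc pw pz by (simp add: add_ac)
  qed
  have pv: "proj (v i) = proj (v' i)" for i
  proof (rule range_extend[where P = "\<lambda>i. proj (v i) = proj (v' i)"])
    show "0 < n" using n by simp
    fix i :: nat assume i: "1 \<le> i" "i \<le> n"
    show "proj (v i) = proj (v' i)"
    proof (cases "i \<le> K")
      case False
      then show ?thesis using ind[of "i - (K + 1)"] i n by (simp add: K_def)
    next
      case True
      show ?thesis
      proof (cases "i = 1")
        case True
        have "v (n + 1) = v 1" "v' (n + 1) = v' 1"
          using posc_period[OF v, of 1] posc_period[OF v', of 1] by (simp_all add: add.commute)
        then show ?thesis using ind[of k] True n by (simp add: K_def)
      next
        case False
        have "\<not> mut n k (i - 1)" using True False i n by (subst mut_small) (auto simp: K_def)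
        then show ?thesis using base[of "i - 1"] False i by simp
      qed
    qed
  next
    fix i j :: nat assume "i mod n = j mod n" "proj (v i) = proj (v' i)"
    then show "proj (v j) = proj (v' j)"
      using period_cong[where v = v and n = n, OF posc_period[OF v]]
        period_cong[where v = v' and n = n, OF posc_period[OF v']] by metis
  qed
  show "s = s'" using l l' seed_of_cong[OF pv pw] by (auto simp: lift_def)
qed

lemma seed_map_bij:
  assumes "4 \<le> n" "1 \<le> k" "k \<le> n - 1"
  shows "bij_betw (seed_map n k) (seeds n k) (seeds n k)"
  unfolding bij_betw_def
  using seed_map_inj[OF assms] seed_map_in[OF assms] seed_map_surj[OF assms] by (auto simp: image_iff) metis

section \<open>Integer iterates of a bijection\<close>

lemma int_iter_0 [simp]: "int_iter S f 0 x = x"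
  by (simp add: int_iter_def)

lemma int_iter_in:
  assumes "bij_betw f S S" "x \<in> S"
  shows "int_iter S f q x \<in> S"
proof -
  have "(f ^^ m) x \<in> S" "(inv_into S f ^^ m) x \<in> S" for m
    using assms by (induction m) (auto simp: bij_betw_def inv_into_into)
  then show ?thesis by (simp add: int_iter_def)
qed

lemma int_iter_Suc:
  assumes b: "bij_betw f S S" and x: "x \<in> S"
  shows "int_iter S f (q + 1) x = f (int_iter S f q x)"
proof (cases "0 \<le> q")
  case True
  then have "nat (q + 1) = Suc (nat q)" by simp
  then show ?thesis using True by (simp add: int_iter_def)
next
  case False
  define m where "m = nat (- (q + 1))"
  have m: "nat (- q) = Suc m" using False by (simp add: m_def)
  have "int_iter S f (q + 1) x = (inv_into S f ^^ m) x"
    using False by (cases "q = -1") (auto simp: int_iter_def m_def)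
  moreover have "(inv_into S f ^^ m) x \<in> S"
    using b x by (induction m) (auto simp: bij_betw_def inv_into_into)
  ultimately show ?thesis using False b
    by (simp add: int_iter_def m bij_betw_def f_inv_into_f)
qed

lemma int_iter_unique:
  assumes b: "bij_betw f S S" and g: "\<And>q. g q \<in> S" "\<And>q. g (q + 1) = f (g q)"
  shows "g q = int_iter S f q (g 0)"
proof (induction q rule: int_induct[where k = 0])
  case (step1 i)
  then show ?case using int_iter_Suc[OF b g(1)[of 0]] g(2) by simp
next
  case (step2 i)
  have "f (g (i - 1)) = f (int_iter S f (i - 1) (g 0))"
    using step2 g(2)[of "i - 1"] int_iter_Suc[OF b g(1)[of 0], of "i - 1"] by simp
  then show ?case using b g(1) int_iter_in[OF b g(1)[of 0]] by (auto simp: bij_betw_def inj_on_eq_iff)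
qed simp

lemma int_iter_add:
  assumes b: "bij_betw f S S" and x: "x \<in> S"
  shows "int_iter S f q (int_iter S f r x) = int_iter S f (q + r) x"
  using int_iter_unique[OF b, of "\<lambda>q. int_iter S f (q + r) x" q] int_iter_in[OF b x]
    int_iter_Suc[OF b x, of "_ + r"] by (simp add: add_ac)

section \<open>Homogeneous coordinates along the orbit of a seed\<close>

text \<open>\<open>H q i\<close> is the vertex \<open>i\<close> of the polygon \<open>q\<close>
  steps after a chosen seed. Time is a natural number because lifts are built forwards; any stretch
  of the two-sided orbit is reached by choosing an earlier seed.\<close>

locale spiral_lift =
  fixes n k :: nat and H :: "nat \<Rightarrow> nat \<Rightarrow> real^3"
  assumes n4: "4 \<le> n" and k1: "1 \<le> k" and kn: "k \<le> n - 1"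
    and pos0: "posc n (H 0)"
    and adv: "adv n k (H q) (H (Suc q))"
    and diag: "diagc n k (H q) (H (q + 2))"
begin

lemma pos: "posc n (H q)"
  by (induction q) (use pos0 adv adv_posc in blast)+

lemma period: "H q (i + n) = H q i"
  using posc_period[OF pos] .

text \<open>After \<open>d\<close> steps a vertex is a nonnegative combination of the vertices with
  labels \<open>a\<close> to \<open>a + d\<close>, the last one with a positive coefficient. Hence
  the range \<open>b + d \<le> i + n\<close>; the strict part follows that last term.\<close>

lemma mixed2:
  assumes "i \<le> a" "a \<le> b" "b + d \<le> i + n"
  shows "0 \<le> br (H q i) (H (q + d) a) (H (q + d) b) \<and>
    (i < a + d \<and> a < b \<and> b + d < i + n \<longrightarrow> 0 < br (H q i) (H (q + d) a) (H (q + d) b))"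
  using assms
proof (induction d arbitrary: a b)
  case 0
  then show ?case using posc_nonneg[OF pos] poscD[OF pos] by simp
next
  case (Suc d)
  obtain c t where ct: "\<And>i. 0 \<le> c i" "\<And>i. 0 < t i" "\<And>i. H (Suc (q + d)) i = c i *\<^sub>R H (q + d) i + t i *\<^sub>R H (q + d) (i + 1)"
    using adv_coeffs[OF adv] by metis
  show ?case
  proof (cases "a = b")
    case False
    let ?B = "\<lambda>a b. br (H q i) (H (q + d) a) (H (q + d) b)"
    have e: "br (H q i) (H (q + Suc d) a) (H (q + Suc d) b) =
      c a * c b * ?B a b + c a * t b * ?B a (b + 1) + t a * c b * ?B (a + 1) b + t a * t b * ?B (a + 1) (b + 1)"
      unfolding add_Suc_right ct(3)[of a] ct(3)[of b] by (simp add: algebra_simps)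
    have p: "0 \<le> ?B a b" "0 \<le> ?B a (b + 1)" "0 \<le> ?B (a + 1) b" "0 \<le> ?B (a + 1) (b + 1)"
      using Suc.IH[of a b] Suc.IH[of a "b+1"] Suc.IH[of "a+1" b] Suc.IH[of "a+1" "b+1"] Suc.prems False by simp_all
    have nn: "0 \<le> c a * c b * ?B a b" "0 \<le> c a * t b * ?B a (b + 1)" "0 \<le> t a * c b * ?B (a + 1) b"
      "0 \<le> t a * t b * ?B (a + 1) (b + 1)"
      by (intro mult_nonneg_nonneg p ct(1) less_imp_le[OF ct(2)])+
    have st: "0 < t a * t b * ?B (a + 1) (b + 1)" if "i < a + Suc d" "a < b" "b + Suc d < i + n"
      using Suc.IH[of "a+1" "b+1"] Suc.prems that ct(2)[of a] ct(2)[of b] by simp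
    show ?thesis unfolding e using nn st by (meson add_nonneg_nonneg add_nonneg_pos)
  qed simp
qed

lemma mixed:
  assumes "i \<le> a" "a \<le> b" "b + e + d \<le> i + n"
  shows "0 \<le> br (H q i) (H (q + d) a) (H (q + d + e) b) \<and>
    (i < a + d \<and> a < b + e \<and> b + e + d < i + n \<longrightarrow> 0 < br (H q i) (H (q + d) a) (H (q + d + e) b))"
  using assms
proof (induction e arbitrary: b)
  case 0
  then show ?case using mixed2 by simp
next
  case (Suc e)
  obtain c t where ct: "\<And>i. 0 \<le> c i" "\<And>i. 0 < t i" "\<And>i. H (Suc (q + d + e)) i = c i *\<^sub>R H (q + d + e) i + t i *\<^sub>R H (q + d + e) (i + 1)"
    using adv_coeffs[OF adv] by metis
  let ?B = "\<lambda>b. br (H q i) (H (q + d) a) (H (q + d + e) b)"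
  have e: "br (H q i) (H (q + d) a) (H (q + d + Suc e) b) = c b * ?B b + t b * ?B (b + 1)"
    unfolding add_Suc_right ct(3)[of b] by simp
  have p: "0 \<le> ?B b" "0 \<le> ?B (b + 1)"
    using Suc.IH[of b] Suc.IH[of "b+1"] Suc.prems by simp_all
  have nn: "0 \<le> c b * ?B b" "0 \<le> t b * ?B (b + 1)"
    by (intro mult_nonneg_nonneg p ct(1) less_imp_le[OF ct(2)])+
  have st: "0 < t b * ?B (b + 1)" if "i < a + d" "a < b + Suc e" "b + Suc e + d < i + n"
    using Suc.IH[of "b+1"] Suc.prems that ct(2)[of b] by simp
  show ?case unfolding e using nn st by (meson add_nonneg_nonneg add_nonneg_pos)
qed

lemma row_pos:
  assumes "1 \<le> d" "1 \<le> e" "d + e < n"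
  shows "0 < br (H q j) (H (q + d) j) (H (q + d + e) j)"
  using mixed[of j j j e d q] assms by simp

lemma row_nonneg:
  assumes "d + e \<le> n"
  shows "0 \<le> br (H q j) (H (q + d) j) (H (q + d + e) j)"
  using mixed[of j j j e d q] assms by simp

lemma diagD: "mut n k i \<Longrightarrow> ocone (H q (i + 1)) (H (q + 2) (i + 1)) (H (q + 2) i)"
  using diag by (simp add: diagc_def)

text \<open>\<open>row_pos\<close> with two steps of length 2 would require \<open>n > 4\<close>.
  The diagonal condition replaces the first vector by a vertex of the next row, which also covers
  \<open>n = 4\<close>.\<close>

lemma row_eps:
  assumes m: "mut n k i"
  shows "0 < br (H q (i + 1)) (H (q + 2) (i + 1)) (H (q + 4) (i + 1))"
proof -
  obtain s t where st: "0 < s" "0 < t" "H (q + 2) i = s *\<^sub>R H q (i + 1) + t *\<^sub>R H (q + 2) (i + 1)"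
    using diagD[OF m] oconeE by metis
  have "0 < br (H (q + 2) i) (H (q + 2) (i + 1)) (H (q + 4) (i + 1))"
    using mixed[of i "i+1" "i+1" 2 0 "q+2"] n4 by (simp add: eval_nat_numeral)
  then show ?thesis unfolding st(3) using st(1) by (simp add: zero_less_mult_iff)
qed

text \<open>A diagonal of one row contains an edge of the next. The second end of that edge is on it
  because it lies between the first end \<open>H (q + 2) i\<close> and the end
  \<open>H (q + 2) (i + 1)\<close> of the diagonal.\<close>

lemma row_meet:
  assumes m: "mut n k i"
  shows "ocone (H q (i + 1)) (H (q + 2) (i + 1)) (H (q + 2) i)"
    "ocone (H q (i + 1)) (H (q + 2) (i + 1)) (H (q + 3) i)"
    "ocone (H (q + 1) (i + 1)) (H (q + 3) (i + 1)) (H (q + 3) i)"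
proof -
  show 1: "ocone (H q (i + 1)) (H (q + 2) (i + 1)) (H (q + 2) i)" by (rule diagD[OF m])
  show "ocone (H (q + 1) (i + 1)) (H (q + 3) (i + 1)) (H (q + 3) i)"
    using diagD[OF m, of "q + 1"] by (simp add: eval_nat_numeral)
  obtain s t where st: "0 < s" "0 < t" "H (q + 2) i = s *\<^sub>R H q (i + 1) + t *\<^sub>R H (q + 2) (i + 1)"
    using 1 oconeE by metis
  obtain s' t' where st': "0 < s'" "0 < t'" "H (q + 3) i = s' *\<^sub>R H (q + 2) i + t' *\<^sub>R H (q + 2) (i + 1)"
    using adv_mut[OF adv[of "q + 2"] m] oconeE by (metis add_2_eq_Suc' add_Suc_right numeral_3_eq_3 numeral_2_eq_2)
  have "H (q + 3) i = (s' * s) *\<^sub>R H q (i + 1) + (s' * t + t') *\<^sub>R H (q + 2) (i + 1)"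
    unfolding st' st by (simp add: algebra_simps)
  moreover have "0 < s' * s" "0 < s' * t + t'" using st st' by (simp_all add: add_pos_pos)
  ultimately show "ocone (H q (i + 1)) (H (q + 2) (i + 1)) (H (q + 3) i)" using oconeI by metis
qed

lemma indep_step: "indep2 (H q j) (H (Suc q) j)"
proof -
  obtain c t where ct: "\<And>i. 0 \<le> c i" "\<And>i. 0 < t i" "\<And>i. H (Suc q) i = c i *\<^sub>R H q i + t i *\<^sub>R H q (i + 1)"
    using adv_coeffs[OF adv] by metis
  have "0 < br (H q j) (H q (j+1)) (H q (j+2))" using n4 by (intro poscD[OF pos]) auto
  then show ?thesis using ct(2)[of j] by (intro indep2I[where c = "H q (j+2)"]) (simp add: ct(3)[of j])
qed

text \<open>The first \<open>n - k + 1\<close> vertices of a polygon are consecutive points of one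
  spiral, so a step of the label and a step of time agree there.\<close>

lemma imm_shift: "r \<le> n - k \<Longrightarrow> H q (1 + r) = H (q + r) 1"
proof (induction r arbitrary: q)
  case (Suc r)
  have "\<not> mut n k (1 + r)" using Suc k1 n4 by (subst mut_small) auto
  then have "H (Suc q) (1 + r) = H q (1 + r + 1)" by (rule adv_imm[OF adv])
  then show ?case using Suc.IH[of "Suc q"] Suc.prems by simp
qed simp

text \<open>The label \<open>n + 1 - k\<close> is the end of the descent through the rows and at the
  same time reachable by pure shifts from the label 1. Therefore row \<open>k\<close> is row 0 with
  shifted time.\<close>

lemma row_k: "H q (n + 1 - k) = H (q + (n - k)) (n + 1)"
proof -
  have "n + 1 - k = 1 + (n - k)" using kn n4 by simp
  then show ?thesis using imm_shift[of "n - k" q] period[of "q + (n - k)" 1] by (simp add: add.commute)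
qed

lemma mut_row: "m < k \<Longrightarrow> mut n k (n - m)"
  using kn n4 k1 by (subst mut_small) auto

end

lemma spiral_lift_exists:
  assumes n: "4 \<le> n" "1 \<le> k" "k \<le> n - 1" and s: "s \<in> seeds n k"
  shows "\<exists>H. spiral_lift n k H \<and> (\<forall>q. lift n k (H q) (H (Suc q)) ((seed_map n k ^^ q) s))"
proof -
  define P where "P q = (\<lambda>(v, w). lift n k v w ((seed_map n k ^^ q) s))" for q :: nat
  have "\<exists>f. \<forall>q. P q (f q) \<and> fst (f (Suc q)) = snd (f q) \<and> diagc n k (fst (f q)) (snd (f (Suc q)))"
  proof (rule dependent_nat_choice)
    show "\<exists>x. P 0 x" using seeds_lift[OF s n] by (auto simp: P_def)
  next
    fix x q assume P: "P q x"
    obtain v w where x: "x = (v, w)" by (cases x)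
    have l: "lift n k v w ((seed_map n k ^^ q) s)" using P by (simp add: P_def x)
    then obtain z where z: "adv n k w z" "diagc n k v z" using next_exists[OF _ n] by (auto simp: lift_def)
    have "lift n k w z ((seed_map n k ^^ Suc q) s)" using seed_map_lift[OF l n z] by simp
    then show "\<exists>y. P (Suc q) y \<and> fst y = snd x \<and> diagc n k (fst x) (snd y)"
      using z by (intro exI[of _ "(w, z)"]) (simp add: P_def x)
  qed
  then obtain f where f: "\<And>q. P q (f q)" "\<And>q. fst (f (Suc q)) = snd (f q)"
    "\<And>q. diagc n k (fst (f q)) (snd (f (Suc q)))" by blast
  define H where "H q = fst (f q)" for q
  have l: "lift n k (H q) (H (Suc q)) ((seed_map n k ^^ q) s)" for q
    using f(1)[of q] f(2)[of q] by (simp add: P_def H_def case_prod_unfold)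
  have "spiral_lift n k H"
  proof
    show "posc n (H 0)" using l[of 0] by (simp add: lift_def)
    show "adv n k (H q) (H (Suc q))" for q using l[of q] by (simp add: lift_def)
    show "diagc n k (H q) (H (q + 2))" for q using f(3)[of q] f(2)[of "Suc q"] by (simp add: H_def)
  qed (use n in auto)
  then show ?thesis using l by blast
qed

definition orb :: "nat \<Rightarrow> nat \<Rightarrow> seed \<Rightarrow> int \<Rightarrow> seed" where
  "orb n k s q = int_iter (seeds n k) (seed_map n k) q s"

definition vtx :: "nat \<Rightarrow> nat \<Rightarrow> seed \<Rightarrow> int \<Rightarrow> nat \<Rightarrow> rp2" where
  "vtx n k s a m = fst (orb n k s a) (if m = 0 then 1 else n + 1 - m)"

text \<open>The choice is harmless: all lifts of a seed give the same segment, by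
  \<open>lift_unique\<close>.\<close>

definition edg :: "nat \<Rightarrow> nat \<Rightarrow> seed \<Rightarrow> int \<Rightarrow> nat \<Rightarrow> rp2 set" where
  "edg n k s a m = (SOME T. \<exists>v w. lift n k v w (orb n k s a) \<and> T = seg (v (n + 1 - m)) (w (n + 1 - m)))"

text \<open>\<open>vtx n k s a m\<close> is the vertex of \<open>T\<^sup>m(P)\<close> with label \<open>a + 1 - 3 m / 2\<close>: the polygon of the
  seed with index \<open>a\<close> meets the spirals \<open>P, T(P), \<dots>, T\<^sup>k(P) = P\<close> in its vertices
  \<open>n + 1, n, \<dots>, n + 1 - k\<close>.\<close>

lemma orb_in:
  assumes "4 \<le> n" "1 \<le> k" "k \<le> n - 1" "s \<in> seeds n k"
  shows "orb n k s q \<in> seeds n k"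
  unfolding orb_def by (rule int_iter_in[OF seed_map_bij]) (use assms in auto)

lemma orb_add_nat:
  assumes "4 \<le> n" "1 \<le> k" "k \<le> n - 1" "s \<in> seeds n k"
  shows "orb n k s (a + int q) = (seed_map n k ^^ q) (orb n k s a)"
proof (induction q)
  case (Suc q)
  have "orb n k s (a + int q + 1) = seed_map n k (orb n k s (a + int q))"
    unfolding orb_def by (rule int_iter_Suc[OF seed_map_bij]) (use assms in auto)
  then show ?case using Suc by (simp add: add_ac)
qed simp

text \<open>Positivity ties the signs within \<open>v\<close> and within \<open>w\<close>
  separately. They are linked through the carried-over vertex: \<open>w 1 = v 2\<close> is an
  equality of vectors and not only of points.\<close>

lemma lift_unique:
  assumes l: "lift n k v w s" "lift n k v' w' s" and n: "4 \<le> n" "1 \<le> k" "k \<le> n - 1"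
  shows "\<exists>c d. (\<forall>i. v' i = c i *\<^sub>R v i) \<and> (\<forall>i. w' i = d i *\<^sub>R w i) \<and> (\<forall>i j. 0 < c i * d j) \<and> (\<forall>i j. 0 < c i * c j)"
proof -
  have v: "posc n v" "posc n v'" and a: "adv n k v w" "adv n k v' w'" and e: "seed_of n k v w = seed_of n k v' w'"
    using l by (auto simp: lift_def)
  have p: "proj (v i) = proj (v' i)" "proj (w i) = proj (w' i)" for i
    using seed_of_eq[OF n(2) _ e posc_period[OF v(1)] posc_period[OF v(2)] a] n by simp_all
  have w: "posc n w" "posc n w'" using adv_posc v a by blast+
  obtain c where c: "\<And>i. v' i = c i *\<^sub>R v i" "\<And>i j. 0 < c i * c j"
    using posc_lift_unique[OF v n(1) p(1)] by blast
  obtain d where d: "\<And>i. w' i = d i *\<^sub>R w i" "\<And>i j. 0 < d i * d j"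
    using posc_lift_unique[OF w n(1) p(2)] by blast
  have "\<not> mut n k 1" using n by (subst mut_small) auto
  then have w1: "w 1 = v 2" "w' 1 = v' 2" using adv_imm[OF a(1)] adv_imm[OF a(2)] by (metis one_add_one)+
  then have "(c 2 - d 1) *\<^sub>R v 2 = 0" using c(1)[of 2] d(1)[of 1] by (simp add: scaleR_diff_left)
  moreover have "v 2 \<noteq> 0" using posc_nonzero[OF v(1)] n by simp
  ultimately have cd: "c 2 = d 1" by simp
  have "0 < c i * d j" for i j
    using c(2)[of i 2] d(2)[of j 1] cd by (simp add: zero_less_mult_iff) argo
  then show ?thesis using c d by blast
qed

lemma edg_lift:
  assumes l: "lift n k v w (orb n k s a)" and n: "4 \<le> n" "1 \<le> k" "k \<le> n - 1"
  shows "edg n k s a m = seg (v (n + 1 - m)) (w (n + 1 - m))"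
  unfolding edg_def
proof (rule some_equality)
  fix T assume "\<exists>v w. lift n k v w (orb n k s a) \<and> T = seg (v (n + 1 - m)) (w (n + 1 - m))"
  then obtain v' w' where l': "lift n k v' w' (orb n k s a)" and T: "T = seg (v' (n + 1 - m)) (w' (n + 1 - m))"
    by blast
  show "T = seg (v (n + 1 - m)) (w (n + 1 - m))"
    using lift_unique[OF l l' n] seg_scale_sign unfolding T by metis
qed (use l in blast)

lemma vtx_lift:
  assumes l: "lift n k v w (orb n k s a)" and n: "4 \<le> n" "1 \<le> k" "k \<le> n - 1" and m: "m \<le> k"
  shows "vtx n k s a m = proj (v (n + 1 - m))"
proof -
  have v: "posc n v" "orb n k s a = seed_of n k v w" using l by (auto simp: lift_def)
  show ?thesis
  proof (cases "m = 0")
    case True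
    then show ?thesis using posc_period[OF v(1), of 1] v(2) n by (simp add: vtx_def seed_of_def add.commute)
  next
    case False
    then have "n + 1 - m \<in> {1..n}" using n m by auto
    then show ?thesis using v(2) False by (simp add: vtx_def seed_of_def)
  qed
qed

lemma local_lift:
  assumes n: "4 \<le> n" "1 \<le> k" "k \<le> n - 1" and s: "s \<in> seeds n k"
  obtains H where "spiral_lift n k H" "\<And>q. lift n k (H q) (H (Suc q)) (orb n k s (a + int q))"
    "\<And>q m. m \<le> k \<Longrightarrow> vtx n k s (a + int q) m = proj (H q (n + 1 - m))"
    "\<And>q m. edg n k s (a + int q) m = seg (H q (n + 1 - m)) (H (Suc q) (n + 1 - m))"
proof -
  obtain H where H: "spiral_lift n k H" "\<And>q. lift n k (H q) (H (Suc q)) ((seed_map n k ^^ q) (orb n k s a))"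
    using spiral_lift_exists[OF n orb_in[OF n s]] by blast
  have l: "lift n k (H q) (H (Suc q)) (orb n k s (a + int q))" for q
    using H(2) by (simp add: orb_add_nat[OF n s])
  show ?thesis
    by (rule that[OF H(1) l vtx_lift[OF l n] edg_lift[OF l n]])
qed

lemma conv_lift:
  assumes c: "strictly_convex_polygon n p" and n: "4 \<le> n" and M: "invertible M"
  shows "\<exists>\<rho>. \<rho> \<noteq> 0 \<and> posc n (pext n (\<lambda>i. \<rho> *\<^sub>R (M *v hom (p i))))"
proof -
  obtain \<sigma> where \<sigma>: "\<sigma> \<noteq> 0" "posc n (pext n (\<lambda>i. \<sigma> *\<^sub>R hom (p i)))" using convex_posc[OF c n] by blast
  obtain \<tau> where \<tau>: "\<tau> \<noteq> 0" "posc n (\<lambda>i. \<tau> *\<^sub>R (M *v pext n (\<lambda>i. \<sigma> *\<^sub>R hom (p i)) i))" using posc_scale[OF \<sigma>(2) M] by blast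
  have "(\<lambda>i. \<tau> *\<^sub>R (M *v pext n (\<lambda>i. \<sigma> *\<^sub>R hom (p i)) i)) = pext n (\<lambda>i. (\<tau> * \<sigma>) *\<^sub>R (M *v hom (p i)))"
    by (simp add: fun_eq_iff pext_def matrix_vector_mult_scaleR)
  then show ?thesis using \<sigma> \<tau> by (intro exI[of _ "\<tau> * \<sigma>"]) simp
qed

lemma segment_image:
  assumes M: "invertible M"
  shows "(\<lambda>x. papply M (affine_pt x)) ` closed_segment p q = seg (M *v hom p) (M *v hom q)"
proof -
  have h: "papply M (affine_pt ((1 - u) *\<^sub>R p + u *\<^sub>R q)) = proj ((1 - u) *\<^sub>R (M *v hom p) + u *\<^sub>R (M *v hom q))" for u
    by (simp only: affine_pt_hom papply_proj[OF M hom_nonzero])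
       (simp add: hom_comb matrix_vector_right_distrib matrix_vector_mult_scaleR)
  show ?thesis
  proof (intro equalityI subsetI)
    fix y assume "y \<in> (\<lambda>x. papply M (affine_pt x)) ` closed_segment p q"
    then obtain u where u: "0 \<le> u" "u \<le> 1" "y = papply M (affine_pt ((1 - u) *\<^sub>R p + u *\<^sub>R q))"
      by (auto simp: in_segment)
    then show "y \<in> seg (M *v hom p) (M *v hom q)" unfolding seg_def h mem_Collect_eq
      by (intro exI[of _ "1 - u"] exI[of _ u]) auto
  next
    fix y assume "y \<in> seg (M *v hom p) (M *v hom q)"
    then obtain s t where st: "0 \<le> s" "0 \<le> t" "0 < s + t" "y = proj (s *\<^sub>R (M *v hom p) + t *\<^sub>R (M *v hom q))"
      by (auto simp: seg_def)
    define u where "u = t / (s + t)"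
    have u: "0 \<le> u" "u \<le> 1" "1 - u = s / (s + t)" using st by (auto simp: u_def field_simps)
    have "proj ((1 - u) *\<^sub>R (M *v hom p) + u *\<^sub>R (M *v hom q)) = proj ((1 / (s + t)) *\<^sub>R (s *\<^sub>R (M *v hom p) + t *\<^sub>R (M *v hom q)))"
      unfolding u(3) by (simp add: u_def scaleR_add_right)
    also have "\<dots> = y" unfolding st(4) by (rule proj_scale) (use st in auto)
    finally show "y \<in> (\<lambda>x. papply M (affine_pt x)) ` closed_segment p q"
      by (intro image_eqI[of _ _ "(1 - u) *\<^sub>R p + u *\<^sub>R q"]) (use h[of u] u(1,2) in \<open>auto simp: in_segment\<close>)
  qed
qed

text \<open>The affine vertices and the given vectors are positive lifts of the same points, so they
  differ by factors of one common sign, and the affine edge is the segment spanned by the given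
  vectors.\<close>

lemma polygon_edge:
  assumes v: "posc n v" and n: "4 \<le> n" and M: "invertible M" and c: "strictly_convex_polygon n p"
    and A: "\<forall>i\<in>{1..n}. proj (v i) = papply M (affine_pt (p i))" and i: "i \<in> {1..n}"
  shows "(\<lambda>x. papply M (affine_pt x)) ` closed_segment (p i) (p (nxt n i)) = seg (v i) (v (i + 1))"
proof -
  obtain \<rho> where \<rho>: "\<rho> \<noteq> 0" "posc n (pext n (\<lambda>i. \<rho> *\<^sub>R (M *v hom (p i))))"
    using conv_lift[OF c n M] by blast
  let ?u = "pext n (\<lambda>i. \<rho> *\<^sub>R (M *v hom (p i)))"
  have "proj (v i) = proj (?u i)" for i
  proof (rule range_extend[where P = "\<lambda>i. proj (v i) = proj (?u i)"])
    show "0 < n" using n by simp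
    fix i :: nat assume i: "1 \<le> i" "i \<le> n"
    then have "proj (v i) = papply M (affine_pt (p i))" using A by simp
    then show "proj (v i) = proj (?u i)"
      using i \<rho>(1) by (simp add: affine_pt_hom papply_proj[OF M] proj_scale)
  next
    fix i j :: nat assume "i mod n = j mod n" "proj (v i) = proj (?u i)"
    then show "proj (v j) = proj (?u j)"
      using period_cong[where v = v and n = n, OF posc_period[OF v]]
        period_cong[where v = ?u and n = n, OF posc_period[OF \<rho>(2)]] by metis
  qed
  then obtain c where c: "\<And>i. ?u i = c i *\<^sub>R v i" "\<And>i j. 0 < c i * c j"
    using posc_lift_unique[OF v \<rho>(2) n] by blast
  have "seg (M *v hom (p i)) (M *v hom (p (nxt n i))) = seg (\<rho> *\<^sub>R (M *v hom (p i))) (\<rho> *\<^sub>R (M *v hom (p (nxt n i))))"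
    by (rule seg_scale_sign[symmetric]) (use \<rho>(1) not_real_square_gt_zero in blast)
  also have "\<dots> = seg (c i *\<^sub>R v i) (c (i + 1) *\<^sub>R v (i + 1))"
    unfolding c(1)[symmetric] pext_nxt[OF i] using i by simp
  also have "\<dots> = seg (v i) (v (i + 1))" by (rule seg_scale_sign[OF c(2)])
  finally show ?thesis by (simp add: segment_image[OF M])
qed

lemma first_edge_lift:
  assumes l: "lift n k v w s" and n: "4 \<le> n" "1 \<le> k" "k \<le> n - 1"
  shows "first_edge n (fst s) = seg (v 1) (v 2)"
proof -
  have v: "posc n v" and s: "s = seed_of n k v w" using l by (auto simp: lift_def)
  have one: "(\<lambda>x. papply M (affine_pt x)) ` closed_segment (p 1) (p 2) = seg (v 1) (v 2)"
    if M: "invertible M" and c: "strictly_convex_polygon n p"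
      and A: "\<forall>i\<in>{1..n}. fst s i = papply M (affine_pt (p i))" for M p
  proof -
    have "\<forall>i\<in>{1..n}. proj (v i) = papply M (affine_pt (p i))" using A s by (simp add: seed_of_def)
    from polygon_edge[OF v n(1) M c this, of 1] show ?thesis using n by (simp add: nxt_def numeral_2_eq_2)
  qed
  have "s \<in> seeds n k" by (rule lift_seeds[OF l n])
  then obtain M p where "invertible M" "strictly_convex_polygon n p" "\<forall>i\<in>{1..n}. fst s i = papply M (affine_pt (p i))"
    unfolding seeds_def by auto
  then show ?thesis unfolding first_edge_def
    by (intro the_equality) (use one in \<open>metis, metis\<close>)
qed

section \<open>The spiral of a seed\<close>

text \<open>The index solves \<open>a + 1 - 3 * m / 2 = j + m / 2\<close>: it converts the label as
  stored by \<open>pentagram\<close> into the index of a seed.\<close>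

definition rowp :: "nat \<Rightarrow> nat \<Rightarrow> seed \<Rightarrow> nat \<Rightarrow> ppath" where
  "rowp n k s m = PPath (\<lambda>j. vtx n k s (j - 1 + 2 * int m) m) (\<lambda>j. edg n k s (j - 1 + 2 * int m) m)"

lemma rowp_0:
  assumes n: "4 \<le> n" "1 \<le> k" "k \<le> n - 1" and s: "s \<in> seeds n k"
  shows "rowp n k s 0 = seed_spiral n k s"
proof -
  have "edg n k s a 0 = first_edge n (fst (orb n k s a))" for a
  proof -
    obtain v w where l: "lift n k v w (orb n k s a)" using seeds_lift[OF orb_in[OF n s] n] by blast
    then have v: "posc n v" "adv n k v w" by (auto simp: lift_def)
    have "\<not> mut n k 1" using n by (subst mut_small) auto
    then have "w (n + 1) = v 2" "v (n + 1) = v 1"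
      using adv_imm[OF v(2), of 1] adv_period[OF v(2), of 1] posc_period[OF v(1), of 1]
      by (simp_all add: add.commute numeral_2_eq_2)
    then show ?thesis using edg_lift[OF l n, of 0] first_edge_lift[OF l n] by simp
  qed
  then show ?thesis by (simp add: rowp_def seed_spiral_def vtx_def orb_def)
qed

lemma row_k_vtx:
  assumes n: "4 \<le> n" "1 \<le> k" "k \<le> n - 1" and s: "s \<in> seeds n k"
  shows "vtx n k s a k = vtx n k s (a + int (n - k)) 0" "edg n k s a k = edg n k s (a + int (n - k)) 0"
proof -
  obtain H where H: "spiral_lift n k H"
    "\<And>q m. m \<le> k \<Longrightarrow> vtx n k s (a + int q) m = proj (H q (n + 1 - m))"
    "\<And>q m. edg n k s (a + int q) m = seg (H q (n + 1 - m)) (H (Suc q) (n + 1 - m))"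
    using local_lift[OF n s, of a thesis] by blast
  interpret spiral_lift n k H by (rule H(1))
  have "H 0 (n + 1 - k) = H (n - k) (n + 1)" "H (Suc 0) (n + 1 - k) = H (Suc (n - k)) (n + 1)"
    using row_k[of 0] row_k[of "Suc 0"] by simp_all
  then show "vtx n k s a k = vtx n k s (a + int (n - k)) 0" "edg n k s a k = edg n k s (a + int (n - k)) 0"
    using H(2)[of k 0] H(2)[of 0 "n - k"] H(3)[of 0 k] H(3)[of "n - k" 0] by simp_all
qed

lemma row_polygonal:
  assumes n: "4 \<le> n" "1 \<le> k" "k \<le> n - 1" and s: "s \<in> seeds n k" and m: "m \<le> k"
  shows "polygonal_path (rowp n k s m)"
proof -
  have "is_segment (vtx n k s a m) (vtx n k s (a + 1) m) (edg n k s a m)" for a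
  proof -
    obtain H where H: "spiral_lift n k H"
      "\<And>q m. m \<le> k \<Longrightarrow> vtx n k s (a + int q) m = proj (H q (n + 1 - m))"
      "\<And>q m. edg n k s (a + int q) m = seg (H q (n + 1 - m)) (H (Suc q) (n + 1 - m))"
      using local_lift[OF n s, of a thesis] by blast
    interpret spiral_lift n k H by (rule H(1))
    have i: "indep2 (H 0 (n + 1 - m)) (H (Suc 0) (n + 1 - m))" by (rule indep_step)
    then show ?thesis unfolding is_segment_def
      using H(2)[OF m, of 0] H(2)[OF m, of 1] H(3)[of 0 m] proj_neq_indep2 indep2_nonzero[OF i]
      by (intro conjI exI[of _ "H 0 (n + 1 - m)"] exI[of _ "H (Suc 0) (n + 1 - m)"]) auto
  qed
  then show ?thesis unfolding polygonal_path_def rowp_def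
    by (simp add: diff_add_eq) (metis (no_types, lifting) add.assoc add.commute add_diff_cancel_left' diff_add_cancel group_cancel.sub1)
qed

lemma seg_subset:
  assumes u: "ocone a b u" and v: "ocone a b v"
  shows "seg u v \<subseteq> seg a b"
proof
  fix x assume "x \<in> seg u v"
  then obtain s t where st: "0 \<le> s" "0 \<le> t" "0 < s + t" "x = proj (s *\<^sub>R u + t *\<^sub>R v)"
    by (auto simp: seg_def)
  obtain c d where u: "0 < c" "0 < d" "u = c *\<^sub>R a + d *\<^sub>R b" using u oconeE by metis
  obtain c' d' where v: "0 < c'" "0 < d'" "v = c' *\<^sub>R a + d' *\<^sub>R b" using v oconeE by metis
  have "s *\<^sub>R u + t *\<^sub>R v = (s * c + t * c') *\<^sub>R a + (s * d + t * d') *\<^sub>R b"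
    unfolding u v by (simp add: algebra_simps)
  moreover have "0 \<le> s * c + t * c'" "0 \<le> s * d + t * d'" using st u v by simp_all
  moreover have "0 < s * c + t * c'"
    using st u v by (cases "s = 0") (auto intro: add_pos_nonneg)
  ultimately show "x \<in> seg a b" using st(4) unfolding seg_def mem_Collect_eq
    by (intro exI conjI) (assumption | simp)+
qed

lemma vtx_meet:
  assumes n: "4 \<le> n" "1 \<le> k" "k \<le> n - 1" and s: "s \<in> seeds n k" and m: "m < k"
  shows "vtx n k s (a + 3) (m + 1) = pmeet (pline (vtx n k s a m) (vtx n k s (a + 2) m))
      (pline (vtx n k s (a + 1) m) (vtx n k s (a + 3) m))"
    and "vtx n k s a m \<noteq> vtx n k s (a + 2) m"
    and "pline (vtx n k s a m) (vtx n k s (a + 2) m) \<noteq> pline (vtx n k s (a + 1) m) (vtx n k s (a + 3) m)"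
    and "\<exists>u v w. u \<noteq> 0 \<and> v \<noteq> 0 \<and> w \<noteq> 0 \<and> proj u = vtx n k s a m \<and> proj v = vtx n k s (a + 1) m \<and>
      proj w = vtx n k s (a + 2) m \<and> edg n k s a m = seg u v \<and> edg n k s (a + 1) m = seg v w \<and>
      edg n k s (a + 2) (m + 1) \<subseteq> seg u w"
proof -
  obtain H where H: "spiral_lift n k H"
    "\<And>q m. m \<le> k \<Longrightarrow> vtx n k s (a + int q) m = proj (H q (n + 1 - m))"
    "\<And>q m. edg n k s (a + int q) m = seg (H q (n + 1 - m)) (H (Suc q) (n + 1 - m))"
    using local_lift[OF n s, of a thesis] by blast
  interpret spiral_lift n k H by (rule H(1))
  define i where "i = n - m"
  have i: "n + 1 - m = i + 1" "n + 1 - (m + 1) = i" "mut n k i" using mut_row[OF m] m n by (auto simp: i_def)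
  define p where "p q = H q (i + 1)" for q
  have v: "vtx n k s a m = proj (p 0)" "vtx n k s (a + 1) m = proj (p 1)" "vtx n k s (a + 2) m = proj (p 2)"
    "vtx n k s (a + 3) m = proj (p 3)" "vtx n k s (a + 3) (m + 1) = proj (H 3 i)"
    using H(2)[of m 0] H(2)[of m 1] H(2)[of m 2] H(2)[of m 3] H(2)[of "m+1" 3] m i(1,2) by (simp_all add: p_def)
  have e: "edg n k s a m = seg (p 0) (p 1)" "edg n k s (a + 1) m = seg (p 1) (p 2)"
    "edg n k s (a + 2) (m + 1) = seg (H 2 i) (H 3 i)"
    using H(3)[of 0 m] H(3)[of 1 m] H(3)[of 2 "m+1"] i(1,2) by (simp_all add: p_def eval_nat_numeral)
  have b: "0 < br (p 0) (p 1) (p 2)" "0 < br (p 0) (p 2) (p 3)" "0 < br (p 1) (p 2) (p 3)"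
    using row_pos[of 1 1 0 "i+1"] row_pos[of 2 1 0 "i+1"] row_pos[of 1 1 1 "i+1"] n by (simp_all add: p_def eval_nat_numeral)
  have in02: "indep2 (p 0) (p 2)" by (rule indep2I[where c = "p 3"]) (use b in auto)
  have in13: "indep2 (p 1) (p 3)" by (rule indep2I'[where c = "p 2"]) (use b in auto)
  have rm: "ocone (p 0) (p 2) (H 2 i)" "ocone (p 0) (p 2) (H 3 i)" "ocone (p 1) (p 3) (H 3 i)"
    using row_meet[OF i(3), of 0] by (simp_all add: p_def numeral_2_eq_2)
  have ne: "br (p 0) (p 2) (p 1) \<noteq> 0 \<or> br (p 0) (p 2) (p 3) \<noteq> 0" using b by auto
  have nz: "H 3 i \<noteq> 0" using posc_nonzero[OF pos] n by simp
  show "vtx n k s (a + 3) (m + 1) = pmeet (pline (vtx n k s a m) (vtx n k s (a + 2) m))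
      (pline (vtx n k s (a + 1) m) (vtx n k s (a + 3) m))"
    unfolding v
  proof (rule pmeet_eqI[OF in02 in13 nz _ _ ne, symmetric])
    show "br (p 0) (p 2) (H 3 i) = 0" using rm(2) ocone_br by blast
    show "br (p 1) (p 3) (H 3 i) = 0" using rm(3) ocone_br by blast
  qed
  show "vtx n k s a m \<noteq> vtx n k s (a + 2) m" unfolding v using in02 proj_neq_indep2 indep2_nonzero by blast
  show "pline (vtx n k s a m) (vtx n k s (a + 2) m) \<noteq> pline (vtx n k s (a + 1) m) (vtx n k s (a + 3) m)"
    unfolding v by (rule pline_neqI[OF in02 in13 ne])
  have "seg (H 2 i) (H 3 i) \<subseteq> seg (p 0) (p 2)" using rm(1,2) by (rule seg_subset)
  moreover have "p 0 \<noteq> 0" "p 1 \<noteq> 0" "p 2 \<noteq> 0" using b(1) br_nonzero_imp by (metis less_irrefl)+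
  ultimately show "\<exists>u v w. u \<noteq> 0 \<and> v \<noteq> 0 \<and> w \<noteq> 0 \<and> proj u = vtx n k s a m \<and> proj v = vtx n k s (a + 1) m \<and>
      proj w = vtx n k s (a + 2) m \<and> edg n k s a m = seg u v \<and> edg n k s (a + 1) m = seg v w \<and>
      edg n k s (a + 2) (m + 1) \<subseteq> seg u w"
    unfolding v e by blast
qed

lemma row_pentagram:
  assumes n: "4 \<le> n" "1 \<le> k" "k \<le> n - 1" and s: "s \<in> seeds n k" and m: "m < k"
  shows "pentagram (rowp n k s m) (rowp n k s (Suc m))"
proof -
  let ?P = "rowp n k s m" and ?Q = "rowp n k s (Suc m)"
  have main: "vert ?P (j - 1) \<noteq> vert ?P (j + 1) \<and> vert ?P j \<noteq> vert ?P (j + 2) \<and>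
          pline (vert ?P (j - 1)) (vert ?P (j + 1)) \<noteq> pline (vert ?P j) (vert ?P (j + 2)) \<and>
          vert ?Q j = pmeet (pline (vert ?P (j - 1)) (vert ?P (j + 1)))
                           (pline (vert ?P j) (vert ?P (j + 2))) \<and>
          (\<exists>D. diagonal ?P j D \<and> edge ?Q (j - 1) \<subseteq> D)" for j
  proof -
    define a where "a = j - 2 + 2 * int m"
    have v: "vert ?P (j - 1) = vtx n k s a m" "vert ?P j = vtx n k s (a + 1) m"
      "vert ?P (j + 1) = vtx n k s (a + 2) m" "vert ?P (j + 2) = vtx n k s (a + 3) m"
      "vert ?Q j = vtx n k s (a + 3) (m + 1)"
      "edge ?P (j - 1) = edg n k s a m" "edge ?P j = edg n k s (a + 1) m" "edge ?Q (j - 1) = edg n k s (a + 2) (m + 1)"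
      by (simp_all add: rowp_def a_def algebra_simps)
    obtain u w x where h: "u \<noteq> 0" "w \<noteq> 0" "x \<noteq> 0" "proj u = vtx n k s a m" "proj w = vtx n k s (a + 1) m"
      "proj x = vtx n k s (a + 2) m" "edg n k s a m = seg u w" "edg n k s (a + 1) m = seg w x"
      "edg n k s (a + 2) (m + 1) \<subseteq> seg u x" using vtx_meet(4)[OF assms, of a] by blast
    then have "diagonal ?P j (seg u x)" unfolding diagonal_def v by metis
    then show ?thesis unfolding v
      using vtx_meet(1,2,3)[OF assms, of a] vtx_meet(2)[OF assms, of "a + 1"] h(9) by (auto simp: add.assoc)
  qed
  show ?thesis unfolding pentagram_def
    using main row_polygonal[OF n s, of m] row_polygonal[OF n s, of "Suc m"] m by simp
qed

section \<open>The pentagram relation is single-valued\<close>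

lemma seg_coeff_sign:
  assumes i: "indep2 u v" and c: "c \<noteq> 0" "d \<noteq> 0" and e: "seg (c *\<^sub>R u) (d *\<^sub>R v) = seg u v"
  shows "0 < c * d"
proof -
  have nz: "u + v \<noteq> 0" using indep2_zero(1)[OF i, of 1 1] by auto
  have "proj (u + v) \<in> seg u v" unfolding seg_def by (intro CollectI exI[of _ 1]) simp
  then have "proj (u + v) \<in> seg (c *\<^sub>R u) (d *\<^sub>R v)" using e by simp
  moreover have "indep2 (c *\<^sub>R u) (d *\<^sub>R v)" using i c by (auto simp: indep2_def)
  ultimately obtain r s t where r: "r \<noteq> 0" "0 \<le> s" "0 \<le> t" "u + v = r *\<^sub>R (s *\<^sub>R c *\<^sub>R u + t *\<^sub>R d *\<^sub>R v)"
    using proj_in_seg_iff nz by metis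
  then have "1 *\<^sub>R u + 1 *\<^sub>R v = (r * s * c) *\<^sub>R u + (r * t * d) *\<^sub>R v" by (simp add: algebra_simps)
  from indep2_unique[OF i this] have "r * s * c = 1" "r * t * d = 1" by auto
  then have "(r * r) * (s * t) * (c * d) = 1" by algebra
  moreover have "0 \<le> (r * r) * (s * t)" using r by simp
  ultimately show ?thesis by (metis mult_nonneg_nonpos not_le zero_less_one)
qed

text \<open>The two edges at the middle vertex tie the signs of the lifts at both ends to the sign
  in the middle, and so to each other.\<close>

lemma diagonal_unique:
  assumes D: "diagonal P j D" "diagonal P j D'" and P: "polygonal_path P"
  shows "D = D'"
proof -
  obtain u v w where h: "u \<noteq> 0" "v \<noteq> 0" "w \<noteq> 0" "proj u = vert P (j - 1)" "proj v = vert P j"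
    "proj w = vert P (j + 1)" "edge P (j - 1) = seg u v" "edge P j = seg v w" "D = seg u w"
    using D(1) unfolding diagonal_def by blast
  obtain u' v' w' where h': "u' \<noteq> 0" "v' \<noteq> 0" "w' \<noteq> 0" "proj u' = vert P (j - 1)" "proj v' = vert P j"
    "proj w' = vert P (j + 1)" "edge P (j - 1) = seg u' v'" "edge P j = seg v' w'" "D' = seg u' w'"
    using D(2) unfolding diagonal_def by blast
  obtain c d e where c: "c \<noteq> 0" "u' = c *\<^sub>R u" and d: "d \<noteq> 0" "v' = d *\<^sub>R v" and e: "e \<noteq> 0" "w' = e *\<^sub>R w"
    using proj_eq_iff h h' by metis
  have "vert P (j - 1) \<noteq> vert P j" "vert P j \<noteq> vert P (j + 1)"
    using P unfolding polygonal_path_def is_segment_def by (metis diff_add_cancel, metis)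
  then have i: "indep2 u v" "indep2 v w" using proj_neq_indep2 h by metis+
  have "0 < c * d" by (rule seg_coeff_sign[OF i(1) c(1) d(1)]) (use h h' c d in metis)
  moreover have "0 < d * e" by (rule seg_coeff_sign[OF i(2) d(1) e(1)]) (use h h' d e in metis)
  ultimately have "0 < c * e" by (simp add: zero_less_mult_iff) argo
  then show ?thesis using seg_scale_sign h(9) h'(9) c e by metis
qed

text \<open>Of the two segments with given ends only one can stay inside \<open>seg u w\<close>; the
  other contains a point whose coordinates have opposite signs.\<close>

lemma subsegment_unique:
  assumes i: "indep2 u w" and S: "is_segment a b S" "S \<subseteq> seg u w" and S': "is_segment a b S'" "S' \<subseteq> seg u w"
  shows "S = S'"
proof -
  have form: "\<exists>x y. S = seg x y \<and> a = proj x \<and> b = proj y \<and> x \<noteq> 0 \<and> y \<noteq> 0 \<and>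
     (\<exists>s t s' t'. 0 \<le> s \<and> 0 \<le> t \<and> 0 \<le> s' \<and> 0 \<le> t' \<and> x = s *\<^sub>R u + t *\<^sub>R w \<and> y = s' *\<^sub>R u + t' *\<^sub>R w)"
    if S: "is_segment a b S" "S \<subseteq> seg u w" for S
  proof -
    obtain x y where xy: "a \<noteq> b" "x \<noteq> 0" "y \<noteq> 0" "proj x = a" "proj y = b" "S = seg x y"
      using S(1) unfolding is_segment_def by blast
    have ixy: "indep2 x y" using proj_neq_indep2 xy by metis
    have "proj x \<in> seg x y" unfolding seg_def by (intro CollectI exI[of _ 1] exI[of _ 0]) simp
    then obtain c s t where x: "c \<noteq> 0" "0 \<le> s" "0 \<le> t" "x = c *\<^sub>R (s *\<^sub>R u + t *\<^sub>R w)"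
      using S(2) xy proj_in_seg_iff[OF i xy(2)] by blast
    have "proj y \<in> seg x y" unfolding seg_def
      by (rule CollectI, rule exI[of _ 0], rule exI[of _ 1]) simp
    then obtain d s' t' where y: "d \<noteq> 0" "0 \<le> s'" "0 \<le> t'" "y = d *\<^sub>R (s' *\<^sub>R u + t' *\<^sub>R w)"
      using S(2) xy proj_in_seg_iff[OF i xy(3)] by blast
    have cd: "0 < c * d"
    proof (rule ccontr)
      assume "\<not> 0 < c * d"
      then have cd: "c * d < 0" using x y by (simp add: mult_less_0_iff zero_less_mult_iff) argo
      define \<Delta> where "\<Delta> = s * t' - s' * t"
      have D: "\<Delta> \<noteq> 0"
      proof
        assume "\<Delta> = 0"
        then have "br x y z = 0" for z
        proof -
          have "br x y z = c * d * \<Delta> * br u w z"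
            unfolding x y by (simp add: br_swap(1)[of w u] \<Delta>_def algebra_simps)
          then show ?thesis using \<open>\<Delta> = 0\<close> by simp
        qed
        then show False using ixy by (auto simp: indep2_def)
      qed
      have "0 < s + t" using x xy(2) by (cases "s = 0"; cases "t = 0") auto
      have "0 < s' + t'" using y xy(3) by (cases "s' = 0"; cases "t' = 0") auto
      \<comment> \<open>The weights make the two coordinates of \<open>p\<close> opposite to each
        other, so that \<open>p\<close> is a multiple of \<open>u - w\<close>.\<close>
      define p where "p = ((s' + t') * \<bar>d\<bar>) *\<^sub>R x + ((s + t) * \<bar>c\<bar>) *\<^sub>R y"
      have "0 < (s' + t') * \<bar>d\<bar>" "0 < (s + t) * \<bar>c\<bar>"
        using \<open>0 < s + t\<close> \<open>0 < s' + t'\<close> x y by simp_all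
      then have "proj p \<in> seg x y" unfolding seg_def p_def by (intro CollectI exI) (auto intro: add_pos_pos)
      moreover have "p \<noteq> 0"
        using indep2_zero(1)[OF ixy, of "(s' + t') * \<bar>d\<bar>" "(s + t) * \<bar>c\<bar>"] \<open>0 < (s' + t') * \<bar>d\<bar>\<close> by (auto simp: p_def)
      ultimately obtain r l l' where r: "r \<noteq> 0" "0 \<le> l" "0 \<le> l'" "p = r *\<^sub>R (l *\<^sub>R u + l' *\<^sub>R w)"
        using S(2) xy proj_in_seg_iff[OF i] by blast
      have pp: "p = (c * \<bar>d\<bar> * \<Delta>) *\<^sub>R u + (- (c * \<bar>d\<bar> * \<Delta>)) *\<^sub>R w"
      proof -
        have "\<bar>c\<bar> * d = - (c * \<bar>d\<bar>)" using cd by (auto simp: abs_if mult_less_0_iff)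
        then have e: "(s + t) * \<bar>c\<bar> * d = - ((s + t) * c * \<bar>d\<bar>)" by (simp add: mult.assoc)
        have "p = ((s' + t') * \<bar>d\<bar> * c * s + (s + t) * \<bar>c\<bar> * d * s') *\<^sub>R u
           + ((s' + t') * \<bar>d\<bar> * c * t + (s + t) * \<bar>c\<bar> * d * t') *\<^sub>R w"
          unfolding p_def x(4) y(4) by (simp add: algebra_simps)
        then show ?thesis unfolding e by (simp add: \<Delta>_def algebra_simps)
      qed
      have "(c * \<bar>d\<bar> * \<Delta>) *\<^sub>R u + (- (c * \<bar>d\<bar> * \<Delta>)) *\<^sub>R w = (r * l) *\<^sub>R u + (r * l') *\<^sub>R w"
        using pp r(4) by (simp add: scaleR_add_right)
      from indep2_unique[OF i this] have "r * l = c * \<bar>d\<bar> * \<Delta>" "r * l' = - (c * \<bar>d\<bar> * \<Delta>)" by auto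
      then have "r * (l + l') = 0" by (simp add: algebra_simps)
      then have "l = 0" "l' = 0" using r by auto
      then show False using r \<open>p \<noteq> 0\<close> by simp
    qed
    define x' where "x' = s *\<^sub>R u + t *\<^sub>R w"
    define y' where "y' = s' *\<^sub>R u + t' *\<^sub>R w"
    have "S = seg x' y'" using xy x y seg_scale_sign[OF cd] by (simp add: x'_def y'_def)
    moreover have "a = proj x'" "b = proj y'" using xy x y proj_scale by (simp_all add: x'_def y'_def)
    moreover have "x' \<noteq> 0" "y' \<noteq> 0" using xy x y by (auto simp: x'_def y'_def)
    ultimately show ?thesis using x y x'_def y'_def by blast
  qed
  obtain x y s t s' t' where h: "S = seg x y" "a = proj x" "b = proj y" "x \<noteq> 0" "y \<noteq> 0"
    "0 \<le> s" "0 \<le> t" "0 \<le> s'" "0 \<le> t'" "x = s *\<^sub>R u + t *\<^sub>R w" "y = s' *\<^sub>R u + t' *\<^sub>R w"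
    using form[OF S] by blast
  obtain x1 y1 s1 t1 s1' t1' where h1: "S' = seg x1 y1" "a = proj x1" "b = proj y1" "x1 \<noteq> 0" "y1 \<noteq> 0"
    "0 \<le> s1" "0 \<le> t1" "0 \<le> s1'" "0 \<le> t1'" "x1 = s1 *\<^sub>R u + t1 *\<^sub>R w" "y1 = s1' *\<^sub>R u + t1' *\<^sub>R w"
    using form[OF S'] by blast
  have pos: "0 < c" if "c *\<^sub>R (s *\<^sub>R u + t *\<^sub>R w) = s1 *\<^sub>R u + t1 *\<^sub>R w" "c \<noteq> 0" "0 \<le> s" "0 \<le> t" "0 \<le> s1" "0 \<le> t1"
     "s1 *\<^sub>R u + t1 *\<^sub>R w \<noteq> 0" for c s t s1 t1
  proof (rule ccontr)
    assume "\<not> 0 < c"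
    have "(c * s) *\<^sub>R u + (c * t) *\<^sub>R w = s1 *\<^sub>R u + t1 *\<^sub>R w" using that by (simp add: scaleR_add_right)
    from indep2_unique[OF i this] have "c * s = s1" "c * t = t1" by auto
    moreover have "c * s \<le> 0" "c * t \<le> 0" using \<open>\<not> 0 < c\<close> that by (simp_all add: mult_nonpos_nonneg)
    ultimately have "s1 = 0" "t1 = 0" using that by auto
    then show False using that by simp
  qed
  obtain c where c: "c \<noteq> 0" "x1 = c *\<^sub>R x" using proj_eq_iff h h1 by metis
  obtain d where d: "d \<noteq> 0" "y1 = d *\<^sub>R y" using proj_eq_iff h h1 by metis
  have "0 < c" by (rule pos[of c s t s1 t1]) (use c h h1 in auto)
  moreover have "0 < d" by (rule pos[of d s' t' s1' t1']) (use d h h1 in auto)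
  ultimately show ?thesis using h(1) h1(1) c d seg_scale by metis
qed

text \<open>The PLC condition speaks about every path related to \<open>P\<close> by iterates of
  \<open>pentagram\<close>. The vertices leave two candidates for each edge, and the inclusion in a
  diagonal selects one.\<close>

lemma pentagram_functional:
  assumes "pentagram P Q" "pentagram P Q'"
  shows "Q = Q'"
proof -
  have P: "polygonal_path P" and Q: "polygonal_path Q" "polygonal_path Q'" using assms by (auto simp: pentagram_def)
  have v: "vert Q j = vert Q' j" for j using assms unfolding pentagram_def by metis
  have e: "edge Q j = edge Q' j" for j
  proof -
    obtain D where D: "diagonal P (j + 1) D" "edge Q j \<subseteq> D" using assms(1) unfolding pentagram_def
      by (metis add_diff_cancel_right')
    obtain D' where D': "diagonal P (j + 1) D'" "edge Q' j \<subseteq> D'" using assms(2) unfolding pentagram_def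
      by (metis add_diff_cancel_right')
    have "D' = D" by (rule diagonal_unique[OF D'(1) D(1) P])
    obtain u w where uw: "u \<noteq> 0" "w \<noteq> 0" "proj u = vert P (j + 1 - 1)" "proj w = vert P (j + 1 + 1)" "D = seg u w"
      using D(1) unfolding diagonal_def by blast
    have "vert P (j + 1 - 1) \<noteq> vert P (j + 1 + 1)" using assms(1) unfolding pentagram_def by blast
    then have "indep2 u w" using proj_neq_indep2 uw by metis
    then show ?thesis
      using subsegment_unique[of u w "vert Q j" "vert Q (j + 1)" "edge Q j" "edge Q' j"] Q v D D' uw \<open>D' = D\<close>
      unfolding polygonal_path_def by metis
  qed
  show ?thesis using v e by (metis ext ppath.collapse)
qed

lemma pentagram_pow_functional:
  "(pentagram ^^ m) P Q \<Longrightarrow> (pentagram ^^ m) P Q' \<Longrightarrow> Q = Q'"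
proof (induction m arbitrary: Q Q')
  case (Suc m)
  then show ?case by (auto elim!: relpowp_Suc_E dest: pentagram_functional)
qed simp

section \<open>Edges at different times and in different rows\<close>

context spiral_lift
begin

text \<open>Later polygons lie in the cone over an earlier one, so a functional that is nonnegative
  on a polygon stays so on its future.\<close>

lemma future_nonneg:
  assumes "\<And>l. 0 \<le> br a b (H q l)"
  shows "0 \<le> br a b (H (q + d) l)"
proof (induction d arbitrary: l)
  case (Suc d)
  obtain c t where ct: "\<And>i. 0 \<le> c i" "\<And>i. 0 < t i" "\<And>i. H (Suc (q + d)) i = c i *\<^sub>R H (q + d) i + t i *\<^sub>R H (q + d) (i + 1)"
    using adv_coeffs[OF adv] by metis
  show ?case unfolding add_Suc_right ct(3)[of l] using Suc.IH ct(1)[of l] less_imp_le[OF ct(2)[of l]]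
    by (simp del: One_nat_def)
qed (use assms in simp)

lemma future_edge: "0 \<le> br (H q i) (H q (i + 1)) (H (q + d) l)"
  by (rule future_nonneg) (use posc_edge_nonneg[OF pos] n4 in auto)

lemma past_edge: "mut n k i \<Longrightarrow> br (H (Suc q) i) (H (Suc q) (i + 1)) (H q (i + 1)) < 0"
  using step_nondegenerate(1)[OF pos n4 adv adv, of i q] br_swap(2) by (metis neg_0_less_iff_less add.inverse_inverse)

lemma future_pos: "0 < br (H q 1) (H q 2) (H (q + d) l) + br (H q 3) (H q 4) (H (q + d) l)"
proof (induction d arbitrary: l)
  case 0
  show ?case using posc_functional[OF pos n4] by simp
next
  case (Suc d)
  obtain c t where ct: "\<And>i. 0 \<le> c i" "\<And>i. 0 < t i" "\<And>i. H (Suc (q + d)) i = c i *\<^sub>R H (q + d) i + t i *\<^sub>R H (q + d) (i + 1)"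
    using adv_coeffs[OF adv] by metis
  let ?g = "\<lambda>x. br (H q 1) (H q 2) x + br (H q 3) (H q 4) x"
  have "?g (H (q + Suc d) l) = c l * ?g (H (q + d) l) + t l * ?g (H (q + d) (l + 1))"
    unfolding add_Suc_right ct(3)[of l] by (simp add: algebra_simps)
  then show ?case using Suc.IH ct(1)[of l] ct(2)[of l] by (simp add: add_nonneg_pos less_imp_le)
qed

text \<open>The functional of \<open>future_pos\<close> is positive on the polygon at time
  \<open>q\<close> and on its whole future, which excludes a negative factor: all these points lie
  in one affine chart.\<close>

lemma coeff_pos:
  assumes "s *\<^sub>R H q a + t *\<^sub>R H (Suc q) b = c *\<^sub>R (s' *\<^sub>R H (q + d) a' + t' *\<^sub>R H (Suc (q + d)) b')"
    and "0 \<le> s" "0 \<le> t" "0 < s + t" "0 \<le> s'" "0 \<le> t'"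
  shows "0 < c"
proof -
  define g where "g x = br (H q 1) (H q 2) x + br (H q 3) (H q 4) x" for x
  have g: "g (s *\<^sub>R x + t *\<^sub>R y) = s * g x + t * g y" "g (r *\<^sub>R x) = r * g x" for s t x y r
    by (simp_all add: g_def algebra_simps)
  have gp: "0 < g (H (q + d) l)" for d l using future_pos by (simp add: g_def)
  have "0 < s * g (H q a) + t * g (H (Suc q) b)"
    using assms(2-4) gp[of 0 a] gp[of 1 b] by (cases "s = 0") (auto intro: add_pos_nonneg)
  also have "\<dots> = c * (s' * g (H (q + d) a') + t' * g (H (Suc (q + d)) b'))"
    using assms(1) g by metis
  finally have "0 < c * (s' * g (H (q + d) a') + t' * g (H (Suc (q + d)) b'))" .
  moreover have "0 \<le> s' * g (H (q + d) a') + t' * g (H (Suc (q + d)) b')"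
    using assms(5,6) gp[of d a'] gp[of "Suc d" b'] by simp
  ultimately show ?thesis by (simp add: zero_less_mult_iff)
qed

text \<open>An edge functional of the polygon at time 1 is nonnegative on everything from then on
  and negative at \<open>H 0 (i + 1)\<close>, which forces \<open>s = 0\<close>. The polygon at time
  2 excludes \<open>d \<ge> 2\<close> in the same way. What remains is a comparison within the
  polygon at time 1; its case \<open>i = i' + 1\<close> relies on a vertex being a moved
  one.\<close>

lemma cross_time:
  assumes i: "n - k < i" "i \<le> n" "n - k < i'" "i' \<le> n" and d: "1 \<le> d"
    and e: "s *\<^sub>R H 0 (i + 1) + t *\<^sub>R H 1 (i + 1) = c *\<^sub>R (s' *\<^sub>R H d (i' + 1) + t' *\<^sub>R H (Suc d) (i' + 1))"
    and st: "0 \<le> s" "0 \<le> t" "0 < s + t" "0 \<le> s'" "0 \<le> t'"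
  shows "d = 1 \<and> i = i' \<and> s = 0"
proof -
  have mi: "mut n k i" using i k1 by (subst mut_small) auto
  have cp: "0 < c" using coeff_pos[of s 0 "i+1" t "i+1" c s' d "i'+1" t' "i'+1"] e st by simp
  have s0: "s = 0"
  proof -
    let ?f = "br (H 1 i) (H 1 (i + 1))"
    have "0 \<le> ?f (H d (i'+1))" "0 \<le> ?f (H (Suc d) (i'+1))"
      using future_edge[of 1 i "d - 1" "i'+1"] future_edge[of 1 i d "i'+1"] d by simp_all
    then have "0 \<le> ?f (c *\<^sub>R (s' *\<^sub>R H d (i' + 1) + t' *\<^sub>R H (Suc d) (i' + 1)))" using cp st by simp
    moreover have "?f (s *\<^sub>R H 0 (i + 1) + t *\<^sub>R H 1 (i + 1)) = s * ?f (H 0 (i + 1))" by simp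
    moreover have "?f (H 0 (i + 1)) < 0" using past_edge[OF mi, of 0] by simp
    ultimately have "0 \<le> s * ?f (H 0 (i + 1))" "?f (H 0 (i + 1)) < 0" using e by metis+
    then show ?thesis using st(1) by (simp add: zero_le_mult_iff)
  qed
  then have t: "0 < t" using st by simp
  have e1: "t *\<^sub>R H 1 (i + 1) = c *\<^sub>R (s' *\<^sub>R H d (i' + 1) + t' *\<^sub>R H (Suc d) (i' + 1))" using e s0 by simp
  have d1: "d = 1"
  proof (rule ccontr)
    assume "d \<noteq> 1"
    let ?f = "br (H 2 i) (H 2 (i + 1))"
    obtain r where r: "d = 2 + r" using d \<open>d \<noteq> 1\<close> le_Suc_ex[of 2 d] by auto
    have "0 \<le> ?f (H d (i'+1))" "0 \<le> ?f (H (Suc d) (i'+1))"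
      using future_edge[of 2 i r "i'+1"] future_edge[of 2 i "Suc r" "i'+1"] r by simp_all
    then have "0 \<le> ?f (c *\<^sub>R (s' *\<^sub>R H d (i' + 1) + t' *\<^sub>R H (Suc d) (i' + 1)))" using cp st by simp
    then have "0 \<le> t * ?f (H 1 (i + 1))" using e1 by (metis br_scale(3))
    moreover have "?f (H 1 (i + 1)) < 0" using past_edge[OF mi, of 1] by (simp add: numeral_2_eq_2)
    ultimately show False using t by (simp add: zero_le_mult_iff)
  qed
  have "i = i'"
  proof (rule ccontr)
    assume ne: "i \<noteq> i'"
    define w where "w = H 1"
    have w: "posc n w" by (simp add: w_def pos)
    obtain c1 t1 where ct: "\<And>i. 0 \<le> c1 i" "\<And>i. 0 < t1 i" "\<And>i. H 2 i = c1 i *\<^sub>R w i + t1 i *\<^sub>R w (i + 1)"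
      "\<And>i. mut n k i \<Longrightarrow> 0 < c1 i"
      using adv_coeffs[OF adv[of 1]] unfolding w_def by (metis one_add_one plus_1_eq_Suc)
    define A where "A = c * (s' + t' * c1 (i' + 1))"
    define B where "B = c * t' * t1 (i' + 1)"
    have AB: "t *\<^sub>R w (i + 1) = A *\<^sub>R w (i' + 1) + B *\<^sub>R w (i' + 2)"
    proof -
      have h2: "H 2 (i' + 1) = c1 (i' + 1) *\<^sub>R w (i' + 1) + t1 (i' + 1) *\<^sub>R w (i' + 2)"
        using ct(3)[of "i' + 1"] by (simp add: numeral_2_eq_2)
      have "t *\<^sub>R w (i + 1) = c *\<^sub>R (s' *\<^sub>R w (i' + 1) + t' *\<^sub>R H 2 (i' + 1))"
        using e1 unfolding d1 w_def by (simp add: numeral_2_eq_2)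
      then show ?thesis unfolding h2 A_def B_def by (simp add: algebra_simps)
    qed
    have "t * br (w (i'+1)) (w (i'+2)) (w (i+1)) = 0"
      unfolding br_scale(3)[symmetric] AB by simp
    then have z: "br (w (i'+1)) (w (i'+2)) (w (i+1)) = 0" using t by simp
    consider "i < i'" | "i = i' + 1" | "i' + 1 < i" using ne by linarith
    then show False
    proof cases
      case 1
      have "0 < br (w (i'+1)) (w (i'+2)) (w (i + 1 + n))" by (rule poscD[OF w]) (use 1 i k1 kn n4 in auto)
      then show False using z posc_period[OF w, of "i+1"] by simp
    next
      case 3
      have "0 < br (w (i'+1)) (w (i'+2)) (w (i + 1))" by (rule poscD[OF w]) (use 3 i k1 kn n4 in auto)
      then show False using z by simp
    next
      case 2
      have "mut n k (i' + 1)" using 2 i k1 by (subst mut_small) auto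
      then have c1p: "0 < c1 (i' + 1)" by (rule ct(4))
      have "indep2 (w (i'+1)) (w (i'+2))" by (rule posc_indep2[OF w]) (use n4 in auto)
      moreover have "0 *\<^sub>R w (i'+1) + t *\<^sub>R w (i'+2) = A *\<^sub>R w (i' + 1) + B *\<^sub>R w (i' + 2)"
        using AB 2 by simp
      ultimately have "A = 0" "B = t" using indep2_unique by metis+
      then have "s' + t' * c1 (i' + 1) = 0" using cp by (simp add: A_def)
      then have "t' = 0" using st c1p by (metis add_nonneg_eq_0_iff less_imp_le mult_eq_0_iff mult_nonneg_nonneg less_irrefl)
      then show False using \<open>B = t\<close> t by (simp add: B_def)
    qed
  qed
  then show ?thesis using s0 d1 by simp
qed

text \<open>The functional of the polygon edge from \<open>i' + 1\<close> to \<open>i' + 2\<close>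
  vanishes on the whole segment of row \<open>i'\<close>, whose second end is on that edge. It is
  positive at both ends of the other segment, except that for \<open>i = i' + 1\<close> one of them
  is an end of the edge.\<close>

lemma same_time:
  assumes i: "n - k < i'" "i' < i" "i \<le> n"
    and e: "s *\<^sub>R H 0 (i + 1) + t *\<^sub>R H 1 (i + 1) = c *\<^sub>R (s' *\<^sub>R H 0 (i' + 1) + t' *\<^sub>R H 1 (i' + 1))"
    and st: "0 \<le> s" "0 \<le> t" "0 < s + t" "0 \<le> s'" "0 \<le> t'"
  shows False
proof -
  obtain c1 t1 where ct: "\<And>i. 0 \<le> c1 i" "\<And>i. 0 < t1 i" "\<And>i. H 1 i = c1 i *\<^sub>R H 0 i + t1 i *\<^sub>R H 0 (i + 1)"
    "\<And>i. mut n k i \<Longrightarrow> 0 < c1 i"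
    using adv_coeffs[OF adv[of 0]] by auto
  define f where "f = br (H 0 (i'+1)) (H 0 (i'+2))"
  have w1: "H 1 (i'+1) = c1 (i'+1) *\<^sub>R H 0 (i'+1) + t1 (i'+1) *\<^sub>R H 0 (i'+2)"
    "H 1 (i+1) = c1 (i+1) *\<^sub>R H 0 (i+1) + t1 (i+1) *\<^sub>R H 0 (i+2)"
    using ct(3)[of "i'+1"] ct(3)[of "i+1"] by (simp_all add: numeral_2_eq_2)
  have "f (s *\<^sub>R H 0 (i + 1) + t *\<^sub>R H 1 (i + 1)) = 0" unfolding e w1(1) f_def by simp
  then have z: "s * f (H 0 (i+1)) + t * (c1 (i+1) * f (H 0 (i+1)) + t1 (i+1) * f (H 0 (i+2))) = 0"
    unfolding w1(2) f_def by simp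
  have f2: "0 < f (H 0 (i+2))" unfolding f_def by (rule poscD[OF pos]) (use i k1 kn n4 in auto)
  show False
  proof (cases "i = i' + 1")
    case False
    have f1: "0 < f (H 0 (i+1))" unfolding f_def by (rule poscD[OF pos]) (use False i k1 kn n4 in auto)
    have "0 < c1 (i+1) * f (H 0 (i+1)) + t1 (i+1) * f (H 0 (i+2))"
      using f1 f2 ct(1)[of "i+1"] ct(2)[of "i+1"] by (simp add: add_nonneg_pos)
    then have "0 < s * f (H 0 (i+1)) + t * (c1 (i+1) * f (H 0 (i+1)) + t1 (i+1) * f (H 0 (i+2)))"
      using st f1 by (cases "s = 0") (auto intro: add_pos_nonneg)
    then show False using z by simp
  next
    case True
    have "f (H 0 (i+1)) = 0" unfolding f_def True by (simp add: numeral_2_eq_2)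
    then have t0: "t = 0" using z f2 ct(2)[of "i+1"] by simp
    then have sp: "0 < s" using st by simp
    have "mut n k (i' + 1)" using True i k1 by (subst mut_small) auto
    then have c1p: "0 < c1 (i' + 1)" by (rule ct(4))
    have "indep2 (H 0 (i'+1)) (H 0 (i'+2))" by (rule posc_indep2[OF pos]) (use n4 in auto)
    moreover have "0 *\<^sub>R H 0 (i'+1) + s *\<^sub>R H 0 (i'+2) =
      (c * (s' + t' * c1 (i'+1))) *\<^sub>R H 0 (i'+1) + (c * t' * t1 (i'+1)) *\<^sub>R H 0 (i'+2)"
      using e t0 unfolding w1(1) True by (simp add: algebra_simps)
    ultimately have A: "c * (s' + t' * c1 (i'+1)) = 0" "c * t' * t1 (i'+1) = s" using indep2_unique by metis+
    then have "c \<noteq> 0" using sp by auto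
    then have "s' + t' * c1 (i' + 1) = 0" using A by simp
    then have "t' = 0" using st c1p by (metis add_nonneg_eq_0_iff less_imp_le mult_eq_0_iff mult_nonneg_nonneg less_irrefl)
    then show False using A sp by simp
  qed
qed

end

lemma seg_common:
  assumes x: "x \<in> seg u v" "x \<in> seg u' v'" and i: "indep2 u v" "indep2 u' v'"
  shows "\<exists>s t c s' t'. 0 \<le> s \<and> 0 \<le> t \<and> 0 < s + t \<and> 0 \<le> s' \<and> 0 \<le> t' \<and>
    x = proj (s *\<^sub>R u + t *\<^sub>R v) \<and> s *\<^sub>R u + t *\<^sub>R v = c *\<^sub>R (s' *\<^sub>R u' + t' *\<^sub>R v')"
proof -
  obtain s t where st: "0 \<le> s" "0 \<le> t" "0 < s + t" "x = proj (s *\<^sub>R u + t *\<^sub>R v)"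
    using x(1) by (auto simp: seg_def)
  have nz: "s *\<^sub>R u + t *\<^sub>R v \<noteq> 0" using indep2_zero[OF i(1)] st by fastforce
  obtain c s' t' where "c \<noteq> 0" "0 \<le> s'" "0 \<le> t'" "s *\<^sub>R u + t *\<^sub>R v = c *\<^sub>R (s' *\<^sub>R u' + t' *\<^sub>R v')"
    using x(2) st(4) proj_in_seg_iff[OF i(2) nz] by blast
  then show ?thesis using st by blast
qed

lemma edg_disjoint:
  assumes n: "4 \<le> n" "1 \<le> k" "k \<le> n - 1" and s: "s \<in> seeds n k" and m: "m < k" "m' < k"
    and x: "x \<in> edg n k s a m" "x \<in> edg n k s a' m'" and a: "a < a'"
  shows "a' = a + 1 \<and> m = m' \<and> x = vtx n k s (a + 1) m"
proof -
  obtain H where H: "spiral_lift n k H"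
    "\<And>q m. m \<le> k \<Longrightarrow> vtx n k s (a + int q) m = proj (H q (n + 1 - m))"
    "\<And>q m. edg n k s (a + int q) m = seg (H q (n + 1 - m)) (H (Suc q) (n + 1 - m))"
    using local_lift[OF n s, of a thesis] by blast
  interpret spiral_lift n k H by (rule H(1))
  define d where "d = nat (a' - a)"
  have d: "a' = a + int d" "1 \<le> d" using a by (auto simp: d_def)
  define i where "i = n - m"
  define i' where "i' = n - m'"
  have i: "n + 1 - m = i + 1" "n + 1 - m' = i' + 1" "n - k < i" "i \<le> n" "n - k < i'" "i' \<le> n"
    using m n by (auto simp: i_def i'_def)
  have e: "edg n k s a m = seg (H 0 (i + 1)) (H 1 (i + 1))" "edg n k s a' m' = seg (H d (i' + 1)) (H (Suc d) (i' + 1))"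
    using H(3)[of 0 m] H(3)[of d m'] i(1,2) d by simp_all
  have is0: "indep2 (H 0 j) (H 1 j)" for j using indep_step[of 0 j] by simp
  obtain r t c r' t' where h: "0 \<le> r" "0 \<le> t" "0 < r + t" "0 \<le> r'" "0 \<le> t'"
    "x = proj (r *\<^sub>R H 0 (i + 1) + t *\<^sub>R H 1 (i + 1))"
    "r *\<^sub>R H 0 (i + 1) + t *\<^sub>R H 1 (i + 1) = c *\<^sub>R (r' *\<^sub>R H d (i' + 1) + t' *\<^sub>R H (Suc d) (i' + 1))"
    using seg_common[OF x[unfolded e] is0 indep_step] by auto
  from cross_time[OF i(3-6) d(2) h(7,1-5)] have c: "d = 1" "i = i'" "r = 0" by auto
  have "x = proj (t *\<^sub>R H 1 (i + 1))" using h(6) unfolding c(3) by simp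
  also have "\<dots> = proj (H 1 (i + 1))" by (rule proj_scale) (use h(3) c(3) in simp)
  finally have "x = proj (H 1 (i + 1))" .
  moreover have "m = m'" using c(2) m n by (simp add: i_def i'_def)
  ultimately show ?thesis using H(2)[of m 1] i(1) m c d by simp
qed

lemma edg_disjoint_same:
  assumes n: "4 \<le> n" "1 \<le> k" "k \<le> n - 1" and s: "s \<in> seeds n k" and m: "m < m'" "m' < k"
  shows "edg n k s a m \<inter> edg n k s a m' = {}"
proof (rule ccontr)
  assume "\<not> ?thesis"
  then obtain x where x: "x \<in> edg n k s a m" "x \<in> edg n k s a m'" by blast
  obtain H where H: "spiral_lift n k H"
    "\<And>q m. m \<le> k \<Longrightarrow> vtx n k s (a + int q) m = proj (H q (n + 1 - m))"
    "\<And>q m. edg n k s (a + int q) m = seg (H q (n + 1 - m)) (H (Suc q) (n + 1 - m))"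
    using local_lift[OF n s, of a thesis] by blast
  interpret spiral_lift n k H by (rule H(1))
  define i where "i = n - m"
  define i' where "i' = n - m'"
  have i: "n + 1 - m = i + 1" "n + 1 - m' = i' + 1" "n - k < i'" "i' < i" "i \<le> n"
    using m n by (auto simp: i_def i'_def)
  have e: "edg n k s a m = seg (H 0 (i + 1)) (H 1 (i + 1))" "edg n k s a m' = seg (H 0 (i' + 1)) (H 1 (i' + 1))"
    using H(3)[of 0 m] H(3)[of 0 m'] i(1,2) by simp_all
  have is0: "indep2 (H 0 j) (H 1 j)" for j using indep_step[of 0 j] by simp
  obtain r t c r' t' where h: "0 \<le> r" "0 \<le> t" "0 < r + t" "0 \<le> r'" "0 \<le> t'"
    "r *\<^sub>R H 0 (i + 1) + t *\<^sub>R H 1 (i + 1) = c *\<^sub>R (r' *\<^sub>R H 0 (i' + 1) + t' *\<^sub>R H 1 (i' + 1))"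
    using seg_common[OF x[unfolded e] is0 is0] by auto
  from same_time[OF i(3-5) h(6,1-5)] show False .
qed

lemma vtx_in_edg:
  assumes n: "4 \<le> n" "1 \<le> k" "k \<le> n - 1" and s: "s \<in> seeds n k" and m: "m \<le> k"
  shows "vtx n k s a m \<in> edg n k s a m" "vtx n k s (a + 1) m \<in> edg n k s a m"
proof -
  obtain H where H: "spiral_lift n k H"
    "\<And>q m. m \<le> k \<Longrightarrow> vtx n k s (a + int q) m = proj (H q (n + 1 - m))"
    "\<And>q m. edg n k s (a + int q) m = seg (H q (n + 1 - m)) (H (Suc q) (n + 1 - m))"
    using local_lift[OF n s, of a thesis] by blast
  have "proj u \<in> seg u v" for u v
    unfolding seg_def by (rule CollectI, rule exI[of _ 1], rule exI[of _ 0]) simp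
  moreover have "proj v \<in> seg u v" for u v
    unfolding seg_def by (rule CollectI, rule exI[of _ 0], rule exI[of _ 1]) simp
  ultimately show "vtx n k s a m \<in> edg n k s a m" "vtx n k s (a + 1) m \<in> edg n k s a m"
    using H(2)[OF m, of 0] H(2)[OF m, of 1] H(3)[of 0 m] by simp_all
qed

lemma row_embedded:
  assumes n: "4 \<le> n" "1 \<le> k" "k \<le> n - 1" and s: "s \<in> seeds n k" and m: "m < k"
  shows "embedded (rowp n k s m)"
proof -
  have A: "edg n k s a m \<inter> edg n k s (a + 1) m = {vtx n k s (a + 1) m}" for a
    using edg_disjoint[OF n s m m, of _ a "a + 1"] vtx_in_edg[OF n s less_imp_le[OF m]] by fastforce
  have B: "edg n k s a m \<inter> edg n k s a' m = {}" if "a + 2 \<le> a'" for a a'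
    using edg_disjoint[OF n s m m, of _ a a'] that by fastforce
  have e: "j + 1 - 1 + 2 * int m = j - 1 + 2 * int m + 1" for j by simp
  show ?thesis unfolding embedded_def rowp_def ppath.sel e
    by (intro conjI allI impI A B) simp
qed

lemma row_disjoint:
  assumes n: "4 \<le> n" "1 \<le> k" "k \<le> n - 1" and s: "s \<in> seeds n k" and m: "m < k" "m' < k" "m \<noteq> m'"
  shows "path_set (rowp n k s m) \<inter> path_set (rowp n k s m') = {}"
proof -
  have "edg n k s a m \<inter> edg n k s a' m' = {}" for a a'
  proof (rule ccontr)
    assume "\<not> ?thesis"
    then obtain x where x: "x \<in> edg n k s a m" "x \<in> edg n k s a' m'" by blast
    consider "a < a'" | "a' < a" | "a = a'" by linarith
    then show False
    proof cases
      case 1 then show False using edg_disjoint[OF n s m(1,2) x] m by simp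
    next
      case 2 then show False using edg_disjoint[OF n s m(2,1) x(2,1)] m by simp
    next
      case 3
      then show False using edg_disjoint_same[OF n s, of m m' a] edg_disjoint_same[OF n s, of m' m a] m x
        by (cases "m < m'") auto
    qed
  qed
  then show ?thesis unfolding path_set_def rowp_def by auto
qed

section \<open>Local convexity\<close>

lemma posc_polygon:
  assumes v: "posc n v" and n: "4 \<le> n"
  obtains M p where "invertible M" "strictly_convex_polygon n p" "\<forall>i\<in>{1..n}. proj (v i) = papply M (affine_pt (p i))"
proof -
  \<comment> \<open>An arbitrary mark on one edge turns the polygon into a seed with
    \<open>k = 1\<close>, for which the affine chart is already available.\<close>
  define w where "w i = (if mut n 1 i then v i + v (i + 1) else v (i + 1))" for i
  have "adv n 1 v w"
    unfolding adv_def w_def using posc_period[OF v] posc_period[OF v, of "_ + 1"] oconeI[of 1 1]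
    by (auto simp: add_ac)
  then have "lift n 1 v w (seed_of n 1 v w)" using v by (simp add: lift_def)
  then have "seed_of n 1 v w \<in> seeds n 1" using lift_seeds n by fastforce
  then show thesis using that unfolding seeds_def seed_of_def by auto
qed

lemma convex_edge_frontier:
  assumes c: "strictly_convex_polygon n p" and i: "i \<in> {1..n}"
  shows "closed_segment (p i) (p (nxt n i)) \<subseteq> frontier (convex hull (p ` {1..n}))"
proof -
  let ?C = "convex hull (p ` {1..n})" and ?S = "closed_segment (p i) (p (nxt n i))"
  have n3: "3 \<le> n" using c by (simp add: strictly_convex_polygon_def)
  have f: "?S face_of ?C" using c i by (auto simp: strictly_convex_polygon_def edge_of_def)
  have "\<exists>j. j \<in> {1..n} - {i, nxt n i}"
  proof -
    have "card ({1..n} - {i, nxt n i}) \<ge> card {1..n} - card {i, nxt n i}" by (rule diff_card_le_card_Diff) simp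
    moreover have "card {i, nxt n i} \<le> 2" by (simp add: card_insert_if)
    ultimately have "0 < card ({1..n} - {i, nxt n i})" using n3 by simp
    then show ?thesis by (metis card.empty ex_in_conv less_irrefl)
  qed
  then obtain j where j: "j \<in> {1..n} - {i, nxt n i}" by blast
  have "?S \<noteq> ?C"
  proof
    assume e: "?S = ?C"
    have "p j \<in> ?C" using j by (auto intro: hull_inc)
    then have "p j \<in> ?S" unfolding e .
    then obtain t where "p j = (1 - t) *\<^sub>R p i + t *\<^sub>R p (nxt n i)" by (auto simp: in_segment)
    then have "hom (p j) = (1 - t) *\<^sub>R hom (p i) + t *\<^sub>R hom (p (nxt n i))" by (simp add: hom_comb)
    then have "br (hom (p i)) (hom (p (nxt n i))) (hom (p j)) = 0" by simp
    then show False using convex_edge_sign[OF c i j j] by simp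
  qed
  from face_of_disjoint_interior[OF f this] have "?S \<inter> interior ?C = {}" .
  moreover have "?S \<subseteq> closure ?C" using face_of_imp_subset[OF f] closure_subset by blast
  ultimately show ?thesis by (auto simp: frontier_def)
qed

lemma row_locally_convex:
  assumes n: "4 \<le> n" "1 \<le> k" "k \<le> n - 1" and s: "s \<in> seeds n k" and m: "m < k"
  shows "locally_convex_path (rowp n k s m)"
  unfolding locally_convex_path_def
proof
  fix j
  let ?P = "rowp n k s m"
  define a where "a = j - 2 + 2 * int m"
  obtain H where H: "spiral_lift n k H"
    "\<And>q m. m \<le> k \<Longrightarrow> vtx n k s (a + int q) m = proj (H q (n + 1 - m))"
    "\<And>q m. edg n k s (a + int q) m = seg (H q (n + 1 - m)) (H (Suc q) (n + 1 - m))"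
    using local_lift[OF n s, of a thesis] by blast
  interpret spiral_lift n k H by (rule H(1))
  define p where "p q = H q (n + 1 - m)" for q
  have v: "vert ?P (j - 1) = proj (p 0)" "vert ?P j = proj (p 1)" "vert ?P (j + 1) = proj (p 2)" "vert ?P (j + 1 + 1) = proj (p 3)"
    "edge ?P (j - 1) = seg (p 0) (p 1)" "edge ?P j = seg (p 1) (p 2)" "edge ?P (j + 1) = seg (p 2) (p 3)"
    using H(2)[of m 0] H(2)[of m 1] H(2)[of m 2] H(2)[of m 3] H(3)[of 0 m] H(3)[of 1 m] H(3)[of 2 m] m
    by (simp_all add: rowp_def a_def p_def algebra_simps eval_nat_numeral)
  have b: "0 < br (p 0) (p 1) (p 2)" "0 < br (p 0) (p 1) (p 3)" "0 < br (p 0) (p 2) (p 3)" "0 < br (p 1) (p 2) (p 3)"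
    using row_pos[of 1 1 0] row_pos[of 1 2 0] row_pos[of 2 1 0] row_pos[of 1 1 1] n by (simp_all add: p_def eval_nat_numeral)
  \<comment> \<open>Four consecutive points of a row are in convex position, so the boundary of one
    quadrilateral contains the three edges; the whole neighbouring edges serve as the short
    pieces.\<close>
  define u where "u = pext 4 (\<lambda>i. p (i - 1))"
  have u: "u 1 = p 0" "u 2 = p 1" "u 3 = p 2" "u 4 = p 3"
    by (simp_all add: u_def)
  have pu: "posc 4 u" unfolding u_def
  proof (rule posc_pext)
    fix i l r :: nat assume h: "1 \<le> i" "i < l" "l < r" "r \<le> 4"
    then have "i = 1 \<or> i = 2" "l = 2 \<or> l = 3" "r = 3 \<or> r = 4" by linarith+
    then show "0 < br (p (i - 1)) (p (l - 1)) (p (r - 1))" using b h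
      by (elim disjE) (simp_all add: numeral_2_eq_2)
  qed simp
  obtain M q where q: "invertible M" "strictly_convex_polygon 4 q" "\<forall>i\<in>{1..4}. proj (u i) = papply M (affine_pt (q i))"
    by (rule posc_polygon[OF pu order.refl])
  let ?F = "(\<lambda>x. papply M (affine_pt x)) ` frontier (convex hull (q ` {1..4}))"
  have fr: "seg (u i) (u (i + 1)) \<subseteq> ?F" if "i \<in> {1..4}" for i
    using polygon_edge[OF pu order.refl q that] convex_edge_frontier[OF q(2) that] by (metis image_mono)
  have fr': "seg (p 0) (p 1) \<subseteq> ?F" "seg (p 1) (p 2) \<subseteq> ?F" "seg (p 2) (p 3) \<subseteq> ?F"
    using fr[of 1] fr[of 2] fr[of 3] u by (simp_all add: eval_nat_numeral)
  have "vert ?P (j + 1) \<notin> pline (vert ?P (j - 1)) (vert ?P j)"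
    unfolding v using pline_iff[OF indep2I[of "p 0" "p 1" "p 2"]] b br_nonzero_imp(3)[of "p 0" "p 1" "p 2"] by auto
  moreover have "is_segment (proj (p 0)) (vert ?P j) (seg (p 0) (p 1))" "is_segment (vert ?P (j + 1)) (proj (p 3)) (seg (p 2) (p 3))"
    using row_polygonal[OF n s less_imp_le[OF m]] unfolding polygonal_path_def by (metis v diff_add_cancel)+
  moreover have "seg (p 0) (p 1) \<union> seg (p 1) (p 2) \<union> seg (p 2) (p 3) \<subseteq> ?F" using fr' by blast
  ultimately show "vert ?P (j + 1) \<notin> pline (vert ?P (j - 1)) (vert ?P j) \<and>
     (\<exists>a b S S' M (K :: (real^2) set).
        is_segment a (vert ?P j) S \<and> S \<subseteq> edge ?P (j - 1) \<and>
        is_segment (vert ?P (j + 1)) b S' \<and> S' \<subseteq> edge ?P (j + 1) \<and>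
        invertible M \<and> convex K \<and>
        S \<union> edge ?P j \<union> S' \<subseteq> (\<lambda>x. papply M (affine_pt x)) ` frontier K)"
    using q(1) v(5-7) convex_convex_hull[of "q ` {1..4}"]
    apply -
    apply (rule conjI, assumption)
    apply (rule exI[of _ "proj (p 0)"], rule exI[of _ "proj (p 3)"], rule exI[of _ "seg (p 0) (p 1)"])
    apply (rule exI[of _ "seg (p 2) (p 3)"], rule exI[of _ M], rule exI[of _ "convex hull (q ` {1..4})"])
    apply simp
    done
qed

section \<open>Every seed gives a PLC spiral\<close>

lemma row_pow:
  assumes n: "4 \<le> n" "1 \<le> k" "k \<le> n - 1" and s: "s \<in> seeds n k" and m: "m \<le> k"
  shows "(pentagram ^^ m) (seed_spiral n k s) (rowp n k s m)"
  using m
proof (induction m)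
  case 0 then show ?case using rowp_0[OF n s] by simp
next
  case (Suc m)
  then have "(pentagram ^^ m) (seed_spiral n k s) (rowp n k s m)" by simp
  moreover have "pentagram (rowp n k s m) (rowp n k s (Suc m))" using row_pentagram[OF n s] Suc by simp
  ultimately show ?case by (rule relpowp_Suc_I)
qed

definition shiftp :: "int \<Rightarrow> ppath \<Rightarrow> ppath" where
  "shiftp r P = PPath (\<lambda>j. vert P (j + r)) (\<lambda>j. edge P (j + r))"

lemma rowp_k:
  assumes n: "4 \<le> n" "1 \<le> k" "k \<le> n - 1" and s: "s \<in> seeds n k"
  shows "rowp n k s k = shiftp (int n + int k) (seed_spiral n k s)"
proof -
  have e: "j - 1 + 2 * int k + int (n - k) = j + (int n + int k) - 1" for j
    using n by (simp add: of_nat_diff)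
  show ?thesis
    unfolding rowp_0[OF n s, symmetric] rowp_def shiftp_def ppath.sel row_k_vtx[OF n s] e by simp
qed

lemma shiftp_pentagram:
  assumes "pentagram P Q"
  shows "pentagram (shiftp r P) (shiftp r Q)"
proof -
  have p: "polygonal_path (shiftp r P)" if "polygonal_path P" for P
    using that unfolding polygonal_path_def shiftp_def by (simp add: add.commute add.left_commute) (metis add.assoc add.commute)
  have d: "diagonal (shiftp r P) j D = diagonal P (j + r) D" for j D
    unfolding diagonal_def shiftp_def by (simp add: algebra_simps)
  have "vert (shiftp r P) (j - 1) = vert P (j + r - 1)" "vert (shiftp r P) (j + 1) = vert P (j + r + 1)"
    "vert (shiftp r P) j = vert P (j + r)" "vert (shiftp r P) (j + 2) = vert P (j + r + 2)"
    "vert (shiftp r Q) j = vert Q (j + r)" "edge (shiftp r Q) (j - 1) = edge Q (j + r - 1)" for j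
    by (simp_all add: shiftp_def algebra_simps)
  then show ?thesis using assms p unfolding pentagram_def d by simp
qed

lemma shiftp_pow: "(pentagram ^^ m) P Q \<Longrightarrow> (pentagram ^^ m) (shiftp r P) (shiftp r Q)"
proof (induction m arbitrary: Q)
  case (Suc m)
  then obtain R where R: "(pentagram ^^ m) P R" "pentagram R Q" by (auto elim: relpowp_Suc_E)
  from Suc.IH[OF R(1)] shiftp_pentagram[OF R(2)] show ?case by (rule relpowp_Suc_I)
qed simp

theorem seed_spiral_PLC:
  assumes n: "4 \<le> n" "1 \<le> k" "k \<le> n - 1" and s: "s \<in> seeds n k"
  shows "seed_spiral n k s \<in> labeled_PLC_spirals n k"
proof -
  let ?P = "seed_spiral n k s"
  have row: "Q = rowp n k s m" if "(pentagram ^^ m) ?P Q" "m \<le> k" for Q m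
    using pentagram_pow_functional row_pow[OF n s that(2)] that(1) by blast
  have ret: "returns k ?P"
    unfolding returns_def
  proof (intro exI conjI)
    show "(pentagram ^^ k) ?P (rowp n k s k)" by (rule row_pow[OF n s order.refl])
    show "same_unlabeled ?P (rowp n k s k)"
      unfolding same_unlabeled_def rowp_k[OF n s] shiftp_def
      by (intro exI[of _ "int n + int k"] disjI1) (simp add: add.commute)
  qed
  have nret: "\<not> returns j ?P" if "0 < j" "j < k" for j
  proof
    assume "returns j ?P"
    then obtain Q where Q: "(pentagram ^^ j) ?P Q" "same_unlabeled ?P Q" by (auto simp: returns_def)
    then have Qr: "Q = rowp n k s j" using row that by simp
    \<comment> \<open>Equality as unlabeled paths would put an edge of \<open>Q\<close> on the
      original path, so the minimality of \<open>k\<close> follows from disjointness.\<close>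
    have "path_set Q \<inter> path_set ?P = {}"
      unfolding Qr rowp_0[OF n s, symmetric] by (rule row_disjoint[OF n s]) (use that in auto)
    moreover obtain m where "edge Q 0 = edge ?P m" using Q(2) unfolding same_unlabeled_def by metis
    then have "edge Q 0 \<subseteq> path_set Q \<inter> path_set ?P" by (auto simp: path_set_def)
    moreover have "edge Q 0 \<noteq> {}" unfolding Qr rowp_def ppath.sel
      using vtx_in_edg(1)[OF n s, of j] that by auto
    ultimately show False by blast
  qed
  have "PLC_spiral k ?P"
    unfolding PLC_spiral_def weak_spiral_def
  proof (intro conjI allI impI)
    show "0 < k" using n by simp
    show "returns k ?P" by (rule ret)
    show "\<not> returns j ?P" if "0 < j \<and> j < k" for j using nret that by blast
    show "embedded Q" "locally_convex_path Q" if "j < k" "(pentagram ^^ j) ?P Q" for j Q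
      using row[OF that(2)] that(1) row_embedded[OF n s] row_locally_convex[OF n s] by auto
    show "path_set Q \<inter> path_set R = {}" if "i < k" "j < k" "i \<noteq> j" "(pentagram ^^ i) ?P Q" "(pentagram ^^ j) ?P R" for i j Q R
      using row[OF that(4)] row[OF that(5)] row_disjoint[OF n s that(1-3)] that by simp
  qed
  moreover have "labeled_type n k ?P"
    unfolding labeled_type_def
  proof (intro exI conjI allI)
    have 1: "(pentagram ^^ k) ?P (shiftp (int n + int k) ?P)" using row_pow[OF n s order.refl] rowp_k[OF n s] by simp
    have "(pentagram ^^ (k + k)) ?P (shiftp (int n + int k) (shiftp (int n + int k) ?P))"
      unfolding relpowp_add using 1 shiftp_pow[OF 1] by blast
    then show "(pentagram ^^ (2 * k)) ?P (shiftp (int n + int k) (shiftp (int n + int k) ?P))" by (simp add: mult_2)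
    \<comment> \<open>Each round of \<open>k\<close> steps shifts by \<open>n + k\<close>, and the
      labels after \<open>2 * k\<close> steps are stored with the offset \<open>k\<close>; hence
      \<open>M = 2 * n + k\<close>.\<close>
    show "vert (shiftp (int n + int k) (shiftp (int n + int k) ?P)) (j - int k) = vert ?P (j + (2 * int n + int k))" for j
      by (simp add: shiftp_def algebra_simps)
  qed simp
  ultimately show ?thesis by (simp add: labeled_PLC_spirals_def)
qed

section \<open>Projective equivalence\<close>

definition pact :: "nat \<Rightarrow> nat \<Rightarrow> real^3^3 \<Rightarrow> seed \<Rightarrow> seed" where
  "pact n k M s = (\<lambda>i\<in>{1..n}. papply M (fst s i), \<lambda>j\<in>{n - k + 1..n}. papply M (snd s j))"

lemma adv_indep:
  assumes v: "posc n v" and a: "adv n k v w" and n: "3 \<le> n"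
  shows "indep2 (v i) (w i)"
proof -
  obtain c t where ct: "0 < t" "w i = c *\<^sub>R v i + t *\<^sub>R v (i + 1)"
    using adv_coeffs[OF a] by metis
  have "0 < br (v i) (v (i+1)) (v (i+2))" using n by (intro poscD[OF v]) auto
  then show ?thesis using ct by (intro indep2I[where c = "v (i+2)"]) simp
qed

lemma pact_lift:
  assumes l: "lift n k v w s" and n: "4 \<le> n" "1 \<le> k" "k \<le> n - 1" and M: "invertible M"
  shows "\<exists>\<sigma>. \<sigma> \<noteq> 0 \<and> lift n k (\<lambda>i. \<sigma> *\<^sub>R (M *v v i)) (\<lambda>i. \<sigma> *\<^sub>R (M *v w i)) (pact n k M s)"
proof -
  have v: "posc n v" and a: "adv n k v w" and s: "s = seed_of n k v w" using l by (auto simp: lift_def)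
  obtain \<sigma> where \<sigma>: "\<sigma> \<noteq> 0" "posc n (\<lambda>i. \<sigma> *\<^sub>R (M *v v i))" using posc_scale[OF v M] by blast
  have a': "adv n k (\<lambda>i. \<sigma> *\<^sub>R (M *v v i)) (\<lambda>i. \<sigma> *\<^sub>R (M *v w i))"
    using a \<sigma>(1) unfolding adv_def by (auto intro: ocone_scale ocone_mult)
  have nz: "v i \<noteq> 0" "w i \<noteq> 0" for i using posc_nonzero[OF v] adv_nonzero[OF v a] n by auto
  have "pact n k M s = seed_of n k (\<lambda>i. \<sigma> *\<^sub>R (M *v v i)) (\<lambda>i. \<sigma> *\<^sub>R (M *v w i))"
    unfolding pact_def s seed_of_def
    by (auto simp: fun_eq_iff papply_proj[OF M] nz proj_scale \<sigma>(1))
  then show ?thesis using \<sigma> a' by (auto simp: lift_def)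
qed

lemma pact_seeds:
  assumes n: "4 \<le> n" "1 \<le> k" "k \<le> n - 1" and M: "invertible M" and s: "s \<in> seeds n k"
  shows "pact n k M s \<in> seeds n k"
  using seeds_lift[OF s n] pact_lift[OF _ n M] lift_seeds[OF _ n] by blast

lemma pact_seed_map:
  assumes n: "4 \<le> n" "1 \<le> k" "k \<le> n - 1" and M: "invertible M" and s: "s \<in> seeds n k"
  shows "seed_map n k (pact n k M s) = pact n k M (seed_map n k s)"
proof -
  obtain v w where l: "lift n k v w s" using seeds_lift[OF s n] by blast
  then obtain z where z: "adv n k w z" "diagc n k v z" using next_exists[OF _ n] by (auto simp: lift_def)
  have l2: "lift n k w z (seed_map n k s)" by (rule seed_map_lift[OF l n z])
  have v: "posc n v" "adv n k v w" and w: "posc n w" using l l2 by (auto simp: lift_def)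
  obtain \<sigma> where \<sigma>: "\<sigma> \<noteq> 0" "lift n k (\<lambda>i. \<sigma> *\<^sub>R (M *v v i)) (\<lambda>i. \<sigma> *\<^sub>R (M *v w i)) (pact n k M s)"
    using pact_lift[OF l n M] by blast
  have "adv n k (\<lambda>i. \<sigma> *\<^sub>R (M *v w i)) (\<lambda>i. \<sigma> *\<^sub>R (M *v z i))"
    using z(1) \<sigma>(1) unfolding adv_def by (auto intro: ocone_scale ocone_mult)
  moreover have "diagc n k (\<lambda>i. \<sigma> *\<^sub>R (M *v v i)) (\<lambda>i. \<sigma> *\<^sub>R (M *v z i))"
    using z(2) \<sigma>(1) unfolding diagc_def by (auto intro: ocone_scale ocone_mult)
  ultimately have "lift n k (\<lambda>i. \<sigma> *\<^sub>R (M *v w i)) (\<lambda>i. \<sigma> *\<^sub>R (M *v z i)) (seed_map n k (pact n k M s))"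
    using seed_map_lift[OF \<sigma>(2) n] by blast
  then have "seed_map n k (pact n k M s) = seed_of n k (\<lambda>i. \<sigma> *\<^sub>R (M *v w i)) (\<lambda>i. \<sigma> *\<^sub>R (M *v z i))"
    by (simp add: lift_def)
  also have "\<dots> = pact n k M (seed_map n k s)"
  proof -
    have nz: "w i \<noteq> 0" "z i \<noteq> 0" for i using posc_nonzero[OF w] adv_nonzero[OF w z(1)] n by auto
    have "seed_map n k s = seed_of n k w z" using l2 by (simp add: lift_def)
    then show ?thesis unfolding pact_def
      by (auto simp: seed_of_def fun_eq_iff papply_proj[OF M] nz proj_scale \<sigma>(1))
  qed
  finally show ?thesis .
qed

lemma pact_orb:
  assumes n: "4 \<le> n" "1 \<le> k" "k \<le> n - 1" and M: "invertible M" and s: "s \<in> seeds n k"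
  shows "orb n k (pact n k M s) q = pact n k M (orb n k s q)"
proof -
  have "pact n k M (orb n k s q) = int_iter (seeds n k) (seed_map n k) q (pact n k M (orb n k s 0))"
  proof (rule int_iter_unique[OF seed_map_bij[OF n]])
    show "pact n k M (orb n k s q) \<in> seeds n k" for q using pact_seeds[OF n M orb_in[OF n s]] .
    show "pact n k M (orb n k s (q + 1)) = seed_map n k (pact n k M (orb n k s q))" for q
      using pact_seed_map[OF n M orb_in[OF n s]] orb_add_nat[OF n s, of q 1] by simp
  qed
  then show ?thesis by (simp add: orb_def)
qed

lemma pact_vtx_edg:
  assumes n: "4 \<le> n" "1 \<le> k" "k \<le> n - 1" and M: "invertible M" and s: "s \<in> seeds n k" and m: "m \<le> k"
  shows "vtx n k (pact n k M s) a m = papply M (vtx n k s a m)"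
    "edg n k (pact n k M s) a m = papply M ` edg n k s a m"
proof -
  obtain v w where l: "lift n k v w (orb n k s a)" using seeds_lift[OF orb_in[OF n s] n] by blast
  have v: "posc n v" "adv n k v w" using l by (auto simp: lift_def)
  obtain \<sigma> where \<sigma>: "\<sigma> \<noteq> 0" "lift n k (\<lambda>i. \<sigma> *\<^sub>R (M *v v i)) (\<lambda>i. \<sigma> *\<^sub>R (M *v w i)) (orb n k (pact n k M s) a)"
    using pact_lift[OF l n M] pact_orb[OF n M s] by metis
  have nz: "v i \<noteq> 0" for i using posc_nonzero[OF v(1)] n by simp
  show "vtx n k (pact n k M s) a m = papply M (vtx n k s a m)"
    by (simp add: vtx_lift[OF \<sigma>(2) n m] vtx_lift[OF l n m] papply_proj[OF M nz] proj_scale \<sigma>(1))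
  have "0 < \<sigma> * \<sigma>" using \<sigma>(1) not_real_square_gt_zero by blast
  then show "edg n k (pact n k M s) a m = papply M ` edg n k s a m"
    using adv_indep[OF v] n
    by (simp add: edg_lift[OF \<sigma>(2) n] edg_lift[OF l n] papply_seg[OF M] seg_scale_sign)
qed

lemma papply_compose:
  assumes "invertible M" "invertible N"
  shows "papply N (papply M x) = papply (N ** M) x"
proof -
  obtain v where v: "v \<noteq> 0" "x = proj v" by (rule proj_cases)
  then show ?thesis using assms
    by (simp add: papply_proj invertible_mult invertible_mult_zero matrix_vector_mul_assoc)
qed

lemma papply_id: "papply (mat 1) x = x"
proof -
  obtain v where v: "v \<noteq> 0" "x = proj v" by (rule proj_cases)
  have "invertible (mat 1 :: real^3^3)" unfolding invertible_def by (rule exI[of _ "mat 1"]) simp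
  then show ?thesis using v by (simp add: papply_proj)
qed

lemma proj_class_sub:
  assumes M: "invertible M" and P: "\<And>j. vert P' j = papply M (vert P j) \<and> edge P' j = papply M ` edge P j"
  shows "proj_class P' \<subseteq> proj_class P"
proof
  fix Q assume "Q \<in> proj_class P'"
  then obtain N where N: "invertible N" "\<forall>j. vert Q j = papply N (vert P' j) \<and> edge Q j = papply N ` edge P' j"
    by (auto simp: proj_class_def)
  have "invertible (N ** M)" using M N(1) invertible_mult by blast
  moreover have "papply N ` papply M ` S = papply (N ** M) ` S" for S
    by (simp add: image_image papply_compose[OF M N(1)])
  ultimately show "Q \<in> proj_class P" unfolding proj_class_def
    using N P papply_compose[OF M N(1)] by (intro CollectI exI[of _ "N ** M"]) auto
qed

lemma proj_class_eq:
  assumes M: "invertible M" and P: "\<And>j. vert P' j = papply M (vert P j) \<and> edge P' j = papply M ` edge P j"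
  shows "proj_class P' = proj_class P"
proof
  show "proj_class P' \<subseteq> proj_class P" by (rule proj_class_sub[OF M P])
  obtain N where N: "M ** N = mat 1" "N ** M = mat 1" using M by (auto simp: invertible_def)
  then have Ni: "invertible N" by (auto simp: invertible_def)
  have "papply N (papply M x) = x" for x by (simp add: papply_compose[OF M Ni] N papply_id)
  then show "proj_class P \<subseteq> proj_class P'"
    by (intro proj_class_sub[OF Ni]) (simp add: P image_image)
qed

lemma proj_class_self: "P \<in> proj_class P"
proof -
  have "invertible (mat 1 :: real^3^3)" unfolding invertible_def by (rule exI[of _ "mat 1"]) simp
  moreover have "papply (mat 1) ` S = S" for S by (simp add: papply_id)
  ultimately show ?thesis unfolding proj_class_def by (intro CollectI exI[of _ "mat 1"]) (simp add: papply_id)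
qed

lemma spiral_sel:
  assumes n: "4 \<le> n" "1 \<le> k" "k \<le> n - 1" and s: "s \<in> seeds n k"
  shows "vert (seed_spiral n k s) j = vtx n k s (j - 1) 0" "edge (seed_spiral n k s) j = edg n k s (j - 1) 0"
  unfolding rowp_0[OF n s, symmetric] by (simp_all add: rowp_def)

lemma spiral_class_pact:
  assumes n: "4 \<le> n" "1 \<le> k" "k \<le> n - 1" and M: "invertible M" and s: "s \<in> seeds n k"
  shows "spiral_class n k (pact n k M s) = spiral_class n k s"
  unfolding spiral_class_def
  by (rule proj_class_eq[OF M])
     (simp add: spiral_sel[OF n s] spiral_sel[OF n pact_seeds[OF n M s]] pact_vtx_edg[OF n M s])

text \<open>The meets of \<open>vtx_meet\<close> carry equality from the vertices of
  \<open>P\<close> to those of the rows up to \<open>k\<close>, and each vertex or mark of a seed is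
  a vertex of one of these rows. The marks belong to the next polygon, hence the index 1 in
  \<open>form\<close>.\<close>

lemma seed_of_spiral:
  assumes n: "4 \<le> n" "1 \<le> k" "k \<le> n - 1" and s: "s \<in> seeds n k" and s': "s' \<in> seeds n k"
    and e: "\<And>a. vtx n k s a 0 = vtx n k s' a 0"
  shows "s = s'"
proof -
  have v: "vtx n k s a m = vtx n k s' a m" if "m \<le> k" for a m
    using that
  proof (induction m arbitrary: a)
    case 0 then show ?case using e by simp
  next
    case (Suc m)
    then have m: "m < k" by simp
    show ?case using vtx_meet(1)[OF n s m, of "a - 3"] vtx_meet(1)[OF n s' m, of "a - 3"] Suc by simp
  qed
  have form: "fst s i = (if i \<in> {1..n} then (if i \<le> n - k then vtx n k s (int i - 1) 0 else vtx n k s 0 (n + 1 - i)) else undefined)"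
    "snd s i = (if i \<in> {n - k + 1..n} then vtx n k s 1 (n + 1 - i) else undefined)" if s: "s \<in> seeds n k" for s i
  proof -
    obtain H where H: "spiral_lift n k H" "\<And>q. lift n k (H q) (H (Suc q)) (orb n k s (0 + int q))"
      "\<And>q m. m \<le> k \<Longrightarrow> vtx n k s (0 + int q) m = proj (H q (n + 1 - m))"
      using local_lift[OF n s, of 0 thesis] by blast
    interpret spiral_lift n k H by (rule H(1))
    have s0: "s = seed_of n k (H 0) (H 1)" using H(2)[of 0] by (simp add: lift_def orb_def)
    have 1: "proj (H 0 i) = vtx n k s (int i - 1) 0" if "1 \<le> i" "i \<le> n - k"
      using imm_shift[of "i - 1" 0] period[of "i - 1" 1] H(3)[of 0 "i - 1"] that by (simp add: of_nat_diff add.commute)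
    have 2: "proj (H 0 i) = vtx n k s 0 (n + 1 - i)" if "\<not> i \<le> n - k" "i \<le> n"
      using H(3)[of "n + 1 - i" 0] that n by simp
    have 3: "proj (H 1 i) = vtx n k s 1 (n + 1 - i)" if "\<not> i \<le> n - k" "i \<le> n"
      using H(3)[of "n + 1 - i" 1] that n by simp
    show "fst s i = (if i \<in> {1..n} then (if i \<le> n - k then vtx n k s (int i - 1) 0 else vtx n k s 0 (n + 1 - i)) else undefined)"
      by (subst s0) (use 1 2 in \<open>auto simp: seed_of_def\<close>)
    show "snd s i = (if i \<in> {n - k + 1..n} then vtx n k s 1 (n + 1 - i) else undefined)"
      by (subst s0) (use 3 in \<open>auto simp: seed_of_def\<close>)
  qed
  have "fst s = fst s'"
  proof
    fix i show "fst s i = fst s' i" unfolding form(1)[OF s] form(1)[OF s'] using v e n by auto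
  qed
  moreover have "snd s = snd s'"
  proof
    fix i show "snd s i = snd s' i" unfolding form(2)[OF s] form(2)[OF s'] using v n by auto
  qed
  ultimately show ?thesis by (rule prod_eqI)
qed

lemma spiral_class_eqD:
  assumes n: "4 \<le> n" "1 \<le> k" "k \<le> n - 1" and s: "s \<in> seeds n k" and s': "s' \<in> seeds n k"
    and e: "spiral_class n k s = spiral_class n k s'"
  shows "\<exists>M. invertible M \<and> s = pact n k M s'"
proof -
  have "seed_spiral n k s \<in> proj_class (seed_spiral n k s')"
    using e proj_class_self unfolding spiral_class_def by metis
  then obtain M where M: "invertible M" "\<And>j. vert (seed_spiral n k s) j = papply M (vert (seed_spiral n k s') j)"
    by (auto simp: proj_class_def)
  have "vtx n k s a 0 = vtx n k (pact n k M s') a 0" for a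
    using M(2)[of "a + 1"] pact_vtx_edg(1)[OF n M(1) s', of 0 a]
    by (simp add: spiral_sel[OF n s] spiral_sel[OF n s'])
  from seed_of_spiral[OF n s pact_seeds[OF n M(1) s'] this] show ?thesis using M(1) by blast
qed

lemma spiral_seeds_eq:
  assumes n: "4 \<le> n" "1 \<le> k" "k \<le> n - 1"
  shows "spiral_seeds n k = seeds n k" "spiral_space n k = spiral_class n k ` seeds n k"
  using seed_spiral_PLC[OF n] by (auto simp: spiral_seeds_def spiral_space_def spiral_class_def)

lemma shift_class_spiral:
  assumes n: "4 \<le> n" "1 \<le> k" "k \<le> n - 1" and s: "s \<in> seeds n k"
  shows "shift_class (spiral_class n k s) = spiral_class n k (seed_map n k s)"
proof -
  let ?s' = "seed_map n k s"
  have s': "?s' \<in> seeds n k" by (rule seed_map_in[OF n s])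
  have o: "orb n k ?s' q = orb n k s (q + 1)" for q
    using int_iter_add[OF seed_map_bij[OF n] s, of q 1] int_iter_Suc[OF seed_map_bij[OF n] s, of 0]
    by (simp add: orb_def)
  have "vtx n k ?s' a 0 = vtx n k s (a + 1) 0" "edg n k ?s' a 0 = edg n k s (a + 1) 0" for a
    by (simp_all add: vtx_def edg_def o)
  then have P: "vert (seed_spiral n k ?s') j = vert (seed_spiral n k s) (j + 1)"
    "edge (seed_spiral n k ?s') j = edge (seed_spiral n k s) (j + 1)" for j
    by (simp_all add: spiral_sel[OF n s] spiral_sel[OF n s'])
  show ?thesis
  proof (intro equalityI subsetI)
    fix Q assume "Q \<in> shift_class (spiral_class n k s)"
    then obtain R M where "Q = shift_path R" "invertible M"
      "\<forall>j. vert R j = papply M (vert (seed_spiral n k s) j) \<and> edge R j = papply M ` edge (seed_spiral n k s) j"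
      unfolding shift_class_def spiral_class_def proj_class_def by blast
    then show "Q \<in> spiral_class n k ?s'" unfolding spiral_class_def proj_class_def
      using P by (intro CollectI exI[of _ M]) (simp add: shift_path_def)
  next
    fix Q assume "Q \<in> spiral_class n k ?s'"
    then obtain M where M: "invertible M"
      "\<forall>j. vert Q j = papply M (vert (seed_spiral n k ?s') j) \<and> edge Q j = papply M ` edge (seed_spiral n k ?s') j"
      unfolding spiral_class_def proj_class_def by blast
    define R where "R = PPath (\<lambda>j. vert Q (j - 1)) (\<lambda>j. edge Q (j - 1))"
    have "Q = shift_path R" by (cases Q) (simp add: R_def shift_path_def)
    moreover have "R \<in> spiral_class n k s" unfolding spiral_class_def proj_class_def
      using M P by (intro CollectI exI[of _ M]) (simp add: R_def)
    ultimately show "Q \<in> shift_class (spiral_class n k s)" unfolding shift_class_def by blast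
  qed
qed

lemma shift_class_bij:
  assumes n: "4 \<le> n" "1 \<le> k" "k \<le> n - 1"
  shows "bij_betw shift_class (spiral_space n k) (spiral_space n k)"
  unfolding bij_betw_def
proof
  have "inj shift_path"
  proof (rule injI)
    fix P Q assume e: "shift_path P = shift_path Q"
    have "vert P j = vert Q j" "edge P j = edge Q j" for j
      using fun_cong[OF arg_cong[OF e, of vert], of "j - 1"] fun_cong[OF arg_cong[OF e, of edge], of "j - 1"]
      by (simp_all add: shift_path_def)
    then show "P = Q" by (metis ext ppath.collapse)
  qed
  then show "inj_on shift_class (spiral_space n k)"
    unfolding shift_class_def by (auto intro!: inj_onI simp: inj_image_eq_iff)
  show "shift_class ` spiral_space n k = spiral_space n k"
    unfolding spiral_seeds_eq(2)[OF n]
  proof (intro equalityI subsetI)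
    fix X assume "X \<in> shift_class ` spiral_class n k ` seeds n k"
    then obtain s where s: "s \<in> seeds n k" "X = shift_class (spiral_class n k s)" by blast
    then show "X \<in> spiral_class n k ` seeds n k"
      using shift_class_spiral[OF n s(1)] seed_map_in[OF n s(1)] by simp
  next
    fix X assume "X \<in> spiral_class n k ` seeds n k"
    then obtain s where s: "s \<in> seeds n k" "X = spiral_class n k s" by blast
    obtain s' where s': "s' \<in> seeds n k" "seed_map n k s' = s" using seed_map_surj[OF n s(1)] by blast
    then have "X = shift_class (spiral_class n k s')" using shift_class_spiral[OF n s'(1)] s by simp
    then show "X \<in> shift_class ` spiral_class n k ` seeds n k" using s' by blast
  qed
qed

lemma int_iter_spiral:
  assumes n: "4 \<le> n" "1 \<le> k" "k \<le> n - 1" and s: "s \<in> seeds n k"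
  shows "int_iter (spiral_space n k) shift_class q (spiral_class n k s) = spiral_class n k (orb n k s q)"
proof -
  have "spiral_class n k (orb n k s q) = int_iter (spiral_space n k) shift_class q (spiral_class n k (orb n k s 0))"
  proof (rule int_iter_unique[OF shift_class_bij[OF n]])
    show "spiral_class n k (orb n k s q) \<in> spiral_space n k" for q
      using orb_in[OF n s] spiral_seeds_eq(2)[OF n] by blast
    show "spiral_class n k (orb n k s (q + 1)) = shift_class (spiral_class n k (orb n k s q))" for q
      using shift_class_spiral[OF n orb_in[OF n s]] orb_add_nat[OF n s, of q 1] by simp
  qed
  then show ?thesis by (simp add: orb_def)
qed

section \<open>Cross ratios along the rows\<close>

text \<open>Of four consecutive points, leaving out the last, the third or the second gives
  \<open>al\<close>, \<open>be\<close> and \<open>ga\<close> at \<open>l\<close>; leaving out the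
  first gives \<open>al\<close> at \<open>l + 1\<close>.\<close>

definition al :: "(nat \<Rightarrow> real^3) \<Rightarrow> nat \<Rightarrow> real" where
  "al p l = br (p l) (p (l + 1)) (p (l + 2))"

definition be :: "(nat \<Rightarrow> real^3) \<Rightarrow> nat \<Rightarrow> real" where
  "be p l = br (p l) (p (l + 1)) (p (l + 3))"

definition ga :: "(nat \<Rightarrow> real^3) \<Rightarrow> nat \<Rightarrow> real" where
  "ga p l = br (p l) (p (l + 2)) (p (l + 3))"

definition ep :: "(nat \<Rightarrow> real^3) \<Rightarrow> nat \<Rightarrow> real" where
  "ep p l = br (p l) (p (l + 2)) (p (l + 4))"

text \<open>A lift of the pentagram image: the crossing of the diagonals from \<open>l\<close> to
  \<open>l + 2\<close> and from \<open>l + 1\<close> to \<open>l + 3\<close>. It is polynomial in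
  the row, which makes all iterates continuous.\<close>

definition nrow :: "(nat \<Rightarrow> real^3) \<Rightarrow> nat \<Rightarrow> real^3" where
  "nrow p l = ga p l *\<^sub>R p (l + 1) + al p l *\<^sub>R p (l + 3)"

lemma nrow_alt: "nrow p l = al p (l + 1) *\<^sub>R p l + be p l *\<^sub>R p (l + 2)"
  using br_quad_rel[of "p (l+1)" "p (l+2)" "p (l+3)" "p l"]
  by (simp add: nrow_def al_def be_def ga_def eval_nat_numeral)

lemma theta_pluecker: "ga p l * be p (l + 1) - al p l * al p (l + 2) = ep p l * al p (l + 1)"
  using br_pluecker[of "p (l+2)" "p l" "p (l+3)" "p (l+1)" "p (l+4)"]
  by (simp add: al_def be_def ga_def ep_def eval_nat_numeral br_def algebra_simps)

text \<open>Consecutive new points both lie on the diagonal from \<open>l + 1\<close> to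
  \<open>l + 3\<close>. As a consequence the brackets \<open>al\<close>, \<open>be\<close> and
  \<open>ga\<close> of the new row are monomials in brackets of the old one.\<close>

lemma nrow_br2: "br (nrow p l) (nrow p (l + 1)) x = ep p l * al p (l + 1) * br (p (l + 1)) (p (l + 3)) x"
proof -
  have e: "nrow p (l + 1) = al p (l + 2) *\<^sub>R p (l + 1) + be p (l + 1) *\<^sub>R p (l + 3)"
    using nrow_alt[of p "l + 1"] by (simp add: eval_nat_numeral)
  show ?thesis unfolding e nrow_def[of p l] theta_pluecker[symmetric]
    using br_swap(1)[of "p (l + 3)" "p (l + 1)" x] by (simp add: algebra_simps)
qed

lemma nrow_al: "al (nrow p) l = ep p l * ep p (l + 1) * al p (l + 1) * al p (l + 2)"
proof -
  have e: "nrow p (l + 2) = ga p (l + 2) *\<^sub>R p (l + 3) + al p (l + 2) *\<^sub>R p (l + 5)"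
    by (simp add: nrow_def eval_nat_numeral)
  show ?thesis unfolding al_def[of "nrow p"] nrow_br2 e
    by (simp add: ep_def eval_nat_numeral)
qed

lemma nrow_be: "be (nrow p) l = ep p l * ep p (l + 1) * al p (l + 1) * be p (l + 3)"
proof -
  have e: "nrow p (l + 3) = al p (l + 4) *\<^sub>R p (l + 3) + be p (l + 3) *\<^sub>R p (l + 5)"
    using nrow_alt[of p "l + 3"] by (simp add: eval_nat_numeral)
  show ?thesis unfolding be_def[of "nrow p"] nrow_br2 e
    by (simp add: ep_def eval_nat_numeral)
qed

lemma nrow_ga: "ga (nrow p) l = ep p (l + 1) * ep p (l + 2) * al p (l + 3) * ga p l"
proof -
  have "ga (nrow p) l = br (nrow p (l + 2)) (nrow p (l + 2 + 1)) (nrow p l)"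
    using br_rot[of "nrow p (l + 2)" "nrow p (l + 3)" "nrow p l"] by (simp add: ga_def eval_nat_numeral)
  also have "\<dots> = ep p (l + 2) * al p (l + 3) * br (p (l + 3)) (p (l + 5)) (nrow p l)"
    unfolding nrow_br2 by (simp add: eval_nat_numeral)
  also have "br (p (l + 3)) (p (l + 5)) (nrow p l) = ga p l * ep p (l + 1)"
    using br_rot[of "p (l + 3)" "p (l + 5)" "p (l + 1)"] unfolding nrow_def
    by (simp add: ep_def eval_nat_numeral)
  finally show ?thesis by simp
qed

text \<open>\<open>xi\<close> and \<open>eta\<close> are the two corner invariants of Schwartz, attached to
  the vertices \<open>j + 3\<close> and \<open>j + 1\<close>, and \<open>theta = 1 - eta * xi\<close> up to a shift of indices.\<close>

definition xi :: "(nat \<Rightarrow> real^3) \<Rightarrow> nat \<Rightarrow> real" where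
  "xi p j = be p j * al p (j + 2) / (ga p j * ga p (j + 1))"

definition eta :: "(nat \<Rightarrow> real^3) \<Rightarrow> nat \<Rightarrow> real" where
  "eta p j = ga p (j + 1) * al p j / (be p (j + 1) * be p j)"

definition theta :: "(nat \<Rightarrow> real^3) \<Rightarrow> nat \<Rightarrow> real" where
  "theta p j = ep p j * al p (j + 1) / (ga p j * be p (j + 1))"

text \<open>The balance equations behind the two conservation laws, obtained by substituting the
  monomial formulas.\<close>

lemma xi_nrow:
  assumes "\<And>j. al p j \<noteq> 0" "\<And>j. be p j \<noteq> 0" "\<And>j. ga p j \<noteq> 0" "\<And>j. ep p j \<noteq> 0"
  shows "xi (nrow p) j * theta p (j + 2) = xi p (j + 1) * theta p j"
    "eta (nrow p) j * theta p (j + 1) = eta p (j + 2) * theta p (j + 3)"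
proof -
  have e: "j + 2 + 1 = j + 3" "j + 1 + 1 = j + 2" "j + 2 + 2 = j + 4" "j + 1 + 2 = j + 3" "j + 3 + 1 = j + 4" "j + 1 + 3 = j + 4"
    by simp_all
  show "xi (nrow p) j * theta p (j + 2) = xi p (j + 1) * theta p j"
    unfolding xi_def theta_def nrow_al nrow_be nrow_ga e using assms by (simp add: field_simps)
  show "eta (nrow p) j * theta p (j + 1) = eta p (j + 2) * theta p (j + 3)"
    unfolding eta_def theta_def nrow_al nrow_be nrow_ga e using assms by (simp add: field_simps)
qed

text \<open>Each upper bound is a Pluecker relation for five consecutive points in which the
  remaining term is nonnegative.\<close>

lemma row_bounds:
  assumes a: "\<And>l. l \<le> 2 \<Longrightarrow> 0 < al p (j + l)" and b: "\<And>l. l \<le> 1 \<Longrightarrow> 0 < be p (j + l)"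
    and g: "\<And>l. l \<le> 1 \<Longrightarrow> 0 < ga p (j + l)" and e: "0 < ep p j"
    and w: "0 \<le> br (p j) (p (j + 1)) (p (j + 4))" "0 \<le> br (p j) (p (j + 3)) (p (j + 4))"
  shows "0 < xi p j" "xi p j \<le> 1" "0 < eta p j" "eta p j \<le> 1" "0 < theta p j" "theta p j \<le> 1"
proof -
  have pos: "0 < al p j" "0 < al p (j + 1)" "0 < al p (j + 2)" "0 < be p j" "0 < be p (j + 1)" "0 < ga p j" "0 < ga p (j + 1)"
    using a[of 0] a[of 1] a[of 2] b[of 0] b[of 1] g[of 0] g[of 1] by simp_all
  show "0 < xi p j" "0 < eta p j" "0 < theta p j"
    unfolding xi_def eta_def theta_def using pos e by simp_all
  have "ga p j * ga p (j + 1) = be p j * al p (j + 2) + br (p j) (p (j + 3)) (p (j + 4)) * al p (j + 1)"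
    using br_pluecker[of "p (j+3)" "p j" "p (j+2)" "p (j+1)" "p (j+4)"]
    by (simp add: al_def be_def ga_def eval_nat_numeral br_def algebra_simps)
  then have "be p j * al p (j + 2) \<le> ga p j * ga p (j + 1)" using w pos by simp
  then show "xi p j \<le> 1" unfolding xi_def using pos by (simp add: divide_le_eq_1_pos)
  have "be p (j + 1) * be p j = ga p (j + 1) * al p j + br (p j) (p (j + 1)) (p (j + 4)) * al p (j + 1)"
    using br_pluecker[of "p (j+1)" "p (j+4)" "p (j+2)" "p (j+3)" "p j"]
    by (simp add: al_def be_def ga_def eval_nat_numeral br_def algebra_simps)
  then have "ga p (j + 1) * al p j \<le> be p (j + 1) * be p j" using w pos by simp
  then show "eta p j \<le> 1" unfolding eta_def using pos by (simp add: divide_le_eq_1_pos)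
  have "ep p j * al p (j + 1) \<le> ga p j * be p (j + 1)" using theta_pluecker[of p j] pos
    by (metis diff_ge_0_iff_ge le_diff_eq mult_nonneg_nonneg less_imp_le add.commute diff_add_cancel le_add_same_cancel1)
  then show "theta p j \<le> 1" unfolding theta_def using pos by (simp add: divide_le_eq_1_pos)
qed

section \<open>Cross ratios as functions of projective points\<close>

definition cross :: "real^3 \<Rightarrow> real^3 \<Rightarrow> real^3 \<Rightarrow> real^3 \<Rightarrow> real^3 \<Rightarrow> real" where
  "cross p a b c d = br p a b * br p c d / (br p a c * br p b d)"

definition rep :: "rp2 \<Rightarrow> real^3" where
  "rep x = (SOME v. v \<noteq> 0 \<and> proj v = x)"

lemma rep: "rep x \<noteq> 0" "proj (rep x) = x"
proof -
  have "\<exists>v. v \<noteq> 0 \<and> proj v = x" using proj_cases[of x] by metis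
  from someI_ex[OF this] show "rep x \<noteq> 0" "proj (rep x) = x" by (auto simp: rep_def)
qed

lemma rep_proj: "v \<noteq> 0 \<Longrightarrow> \<exists>c. c \<noteq> 0 \<and> rep (proj v) = c *\<^sub>R v"
  using rep proj_eq_iff by metis

text \<open>Each vector occurs to the same degree in numerator and denominator, so arbitrary
  representatives may be used.\<close>

lemma cross_rep:
  assumes "p \<noteq> 0" "a \<noteq> 0" "b \<noteq> 0" "c \<noteq> 0" "d \<noteq> 0"
  shows "cross (rep (proj p)) (rep (proj a)) (rep (proj b)) (rep (proj c)) (rep (proj d)) = cross p a b c d"
proof -
  obtain rp ra rb rc rd where r: "rp \<noteq> 0" "ra \<noteq> 0" "rb \<noteq> 0" "rc \<noteq> 0" "rd \<noteq> 0" "rep (proj p) = rp *\<^sub>R p"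
    "rep (proj a) = ra *\<^sub>R a" "rep (proj b) = rb *\<^sub>R b" "rep (proj c) = rc *\<^sub>R c" "rep (proj d) = rd *\<^sub>R d"
    using rep_proj assms by metis
  have "cross (rp *\<^sub>R p) (ra *\<^sub>R a) (rb *\<^sub>R b) (rc *\<^sub>R c) (rd *\<^sub>R d) =
    ((rp * rp * ra * rb * rc * rd) * (br p a b * br p c d)) / ((rp * rp * ra * rb * rc * rd) * (br p a c * br p b d))"
    by (simp add: cross_def mult_ac)
  also have "\<dots> = cross p a b c d"
    unfolding cross_def using r by (subst mult_divide_mult_cancel_left) auto
  finally show ?thesis unfolding r .
qed

text \<open>The invariants are attached to points and to integer labels because a lift exists only
  from some label on, whereas the conservation laws are used at all labels.\<close>

definition rxi :: "(int \<Rightarrow> rp2) \<Rightarrow> int \<Rightarrow> real" where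
  "rxi f a = cross (rep (f (a + 3))) (rep (f a)) (rep (f (a + 1))) (rep (f (a + 2))) (rep (f (a + 4)))"

definition reta :: "(int \<Rightarrow> rp2) \<Rightarrow> int \<Rightarrow> real" where
  "reta f a = cross (rep (f (a + 1))) (rep (f (a + 4))) (rep (f (a + 3))) (rep (f (a + 2))) (rep (f a))"

definition rtheta :: "(int \<Rightarrow> rp2) \<Rightarrow> int \<Rightarrow> real" where
  "rtheta f a = cross (rep (f (a + 2))) (rep (f a)) (rep (f (a + 4))) (rep (f (a + 3))) (rep (f (a + 1)))"

lemma row_invariants:
  assumes f: "\<And>l. f (a + int l) = proj (p l)" and nz: "\<And>l. p l \<noteq> 0"
  shows "rxi f (a + int j) = xi p j" "reta f (a + int j) = eta p j" "rtheta f (a + int j) = theta p j"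
proof -
  have e: "f (a + int j) = proj (p j)" "f (a + int j + 1) = proj (p (j + 1))" "f (a + int j + 2) = proj (p (j + 2))"
    "f (a + int j + 3) = proj (p (j + 3))" "f (a + int j + 4) = proj (p (j + 4))"
    using f[of j] f[of "j + 1"] f[of "j + 2"] f[of "j + 3"] f[of "j + 4"] by (simp_all add: add_ac)
  have s: "br (p (j+3)) (p j) (p (j+1)) = be p j" "br (p (j+3)) (p (j+2)) (p (j+4)) = - al p (j+2)"
    "br (p (j+3)) (p j) (p (j+2)) = ga p j" "br (p (j+3)) (p (j+1)) (p (j+4)) = - ga p (j+1)"
    by (simp_all add: al_def be_def ga_def eval_nat_numeral br_def algebra_simps)
  show "rxi f (a + int j) = xi p j"
    unfolding rxi_def e cross_rep[OF nz nz nz nz nz] unfolding cross_def s xi_def by simp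
  have s: "br (p (j+1)) (p (j+4)) (p (j+3)) = - ga p (j+1)" "br (p (j+1)) (p (j+2)) (p j) = al p j"
    "br (p (j+1)) (p (j+4)) (p (j+2)) = - be p (j+1)" "br (p (j+1)) (p (j+3)) (p j) = be p j"
    by (simp_all add: al_def be_def ga_def eval_nat_numeral br_def algebra_simps)
  show "reta f (a + int j) = eta p j"
    unfolding reta_def e cross_rep[OF nz nz nz nz nz] unfolding cross_def s eta_def by simp
  have s: "br (p (j+2)) (p j) (p (j+4)) = - ep p j" "br (p (j+2)) (p (j+3)) (p (j+1)) = al p (j+1)"
    "br (p (j+2)) (p j) (p (j+3)) = - ga p j" "br (p (j+2)) (p (j+4)) (p (j+1)) = be p (j+1)"
    by (simp_all add: al_def be_def ga_def ep_def eval_nat_numeral br_def algebra_simps)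
  show "rtheta f (a + int j) = theta p j"
    unfolding rtheta_def e cross_rep[OF nz nz nz nz nz] unfolding cross_def s theta_def by simp
qed

context spiral_lift
begin

lemma row_positive:
  assumes m: "mut n k i"
  shows "0 < al (\<lambda>q. H q (i + 1)) j" "0 < be (\<lambda>q. H q (i + 1)) j" "0 < ga (\<lambda>q. H q (i + 1)) j" "0 < ep (\<lambda>q. H q (i + 1)) j"
    "0 \<le> br (H j (i + 1)) (H (j + 1) (i + 1)) (H (j + 4) (i + 1))" "0 \<le> br (H j (i + 1)) (H (j + 3) (i + 1)) (H (j + 4) (i + 1))"
  using row_pos[of 1 1 j "i+1"] row_pos[of 1 2 j "i+1"] row_pos[of 2 1 j "i+1"] row_eps[OF m, of j]
    row_nonneg[of 1 3 j "i+1"] row_nonneg[of 3 1 j "i+1"] n4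
  by (simp_all add: al_def be_def ga_def ep_def eval_nat_numeral)

text \<open>Both vectors lie on the same two diagonals of row \<open>i + 1\<close>, hence they are
  proportional; comparing coefficients at \<open>H q (i + 1)\<close> shows that the factor is
  positive.\<close>

lemma nrow_proj:
  assumes m: "mut n k i"
  shows "\<exists>c>0. nrow (\<lambda>q. H q (i + 1)) q = c *\<^sub>R H (q + 3) i"
proof -
  let ?p = "\<lambda>q. H q (i + 1)"
  have b: "0 < al ?p q" "0 < al ?p (q + 1)" "0 < be ?p q" "0 < ga ?p q" using row_positive[OF m] by auto
  have in02: "indep2 (?p q) (?p (q + 2))" by (rule indep2I[where c = "?p (q + 3)"]) (use b(4) in \<open>simp add: ga_def\<close>)
  have in13: "indep2 (?p (q + 1)) (?p (q + 3))"
    by (rule indep2I'(1)[where c = "?p (q + 2)"]) (use b(2) in \<open>simp add: al_def eval_nat_numeral\<close>)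
  obtain s t where st: "0 < s" "0 < t" "H (q + 3) i = s *\<^sub>R ?p q + t *\<^sub>R ?p (q + 2)"
    using row_meet(2)[OF m, of q] oconeE by metis
  obtain s' t' where st': "0 < s'" "0 < t'" "H (q + 3) i = s' *\<^sub>R ?p (q + 1) + t' *\<^sub>R ?p (q + 3)"
    using row_meet(3)[OF m, of q] oconeE by metis
  have "br (nrow ?p q) (H (q + 3) i) z = 0" for z
  proof -
    have 1: "br (nrow ?p q) (H (q + 3) i) z = (al ?p (q + 1) * t - be ?p q * s) * br (?p q) (?p (q + 2)) z" for z
      unfolding nrow_alt st(3) using br_swap(1)[of "?p (q + 2)" "?p q" z] by (simp add: algebra_simps)
    have 2: "br (nrow ?p q) (H (q + 3) i) (?p (q + 3)) = (ga ?p q * 0 - al ?p q * 0) + (ga ?p q * t' * 0) - al ?p q * s' * br (?p (q + 3)) (?p (q + 1)) (?p (q + 3))"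
      unfolding nrow_def st'(3) by simp
    have "(al ?p (q + 1) * t - be ?p q * s) * ga ?p q = 0"
      using 1[of "?p (q + 3)"] 2 by (simp add: ga_def)
    then show ?thesis using 1 b(4) by simp
  qed
  then have "\<not> indep2 (H (q + 3) i) (nrow ?p q)" unfolding indep2_def by (metis br_swap(1) neg_equal_0_iff_equal)
  moreover have "H (q + 3) i \<noteq> 0" using posc_nonzero[OF pos] n4 by simp
  ultimately obtain c where c: "nrow ?p q = c *\<^sub>R H (q + 3) i" using indep2_not by blast
  have "al ?p (q + 1) *\<^sub>R ?p q + be ?p q *\<^sub>R ?p (q + 2) = (c * s) *\<^sub>R ?p q + (c * t) *\<^sub>R ?p (q + 2)"
    using c unfolding nrow_alt st(3) by (simp add: scaleR_add_right)
  from indep2_unique(1)[OF in02 this] have "0 < c" using b(2) st(1) by (metis zero_less_mult_pos2)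
  then show ?thesis using c by blast
qed

end

lemma row_local:
  assumes n: "4 \<le> n" "1 \<le> k" "k \<le> n - 1" and s: "s \<in> seeds n k" and m: "m < k"
  defines "f \<equiv> \<lambda>m a. vtx n k s a m"
  shows "0 < rxi (f m) a" "rxi (f m) a \<le> 1" "0 < reta (f m) a" "reta (f m) a \<le> 1"
    "0 < rtheta (f m) a" "rtheta (f m) a \<le> 1"
    "rxi (f (m + 1)) (a + 3) * rtheta (f m) (a + 2) = rxi (f m) (a + 1) * rtheta (f m) a"
    "reta (f (m + 1)) (a + 3) * rtheta (f m) (a + 1) = reta (f m) (a + 2) * rtheta (f m) (a + 3)"
proof -
  obtain H where H: "spiral_lift n k H"
    "\<And>q m. m \<le> k \<Longrightarrow> vtx n k s (a + int q) m = proj (H q (n + 1 - m))"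
    using local_lift[OF n s, of a thesis] by blast
  interpret spiral_lift n k H by (rule H(1))
  define i where "i = n - m"
  have i: "n + 1 - m = i + 1" "n + 1 - (m + 1) = i" "mut n k i" using mut_row[OF m] m n by (auto simp: i_def)
  define p where "p q = H q (i + 1)" for q
  have pp: "(\<lambda>q. H q (i + 1)) = p" by (simp add: p_def fun_eq_iff)
  note rp = row_positive[OF i(3), unfolded pp]
  have fm: "f m (a + int l) = proj (p l)" for l using H(2)[of m l] m i by (simp add: f_def p_def)
  have nz: "p l \<noteq> 0" for l using posc_nonzero[OF pos] n by (simp add: p_def)
  have fm1: "f (m + 1) (a + 3 + int l) = proj (nrow p l)" "nrow p l \<noteq> 0" for l
  proof -
    obtain c where c: "0 < c" "nrow p l = c *\<^sub>R H (l + 3) i" using nrow_proj[OF i(3), of l] unfolding pp by blast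
    have "H (l + 3) i \<noteq> 0" using posc_nonzero[OF pos] n by simp
    then show "nrow p l \<noteq> 0" using c by simp
    have "f (m + 1) (a + int (l + 3)) = proj (H (l + 3) i)" using H(2)[of "m + 1" "l + 3"] m i(2) by (simp add: f_def)
    then show "f (m + 1) (a + 3 + int l) = proj (nrow p l)" using c proj_scale by (simp add: add_ac)
  qed
  note I = row_invariants[of "f m" a p, OF fm nz]
  note I1 = row_invariants[of "f (m + 1)" "a + 3" "nrow p", OF fm1]
  have I0: "rxi (f m) a = xi p 0" "reta (f m) a = eta p 0" "rtheta (f m) a = theta p 0" using I[of 0] by simp_all
  note b = row_bounds[of p 0, OF rp(1) rp(2) rp(3) rp(4) rp(5)[of 0, folded p_def] rp(6)[of 0, folded p_def]]
  show "0 < rxi (f m) a" "rxi (f m) a \<le> 1" "0 < reta (f m) a" "reta (f m) a \<le> 1"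
    "0 < rtheta (f m) a" "rtheta (f m) a \<le> 1"
    unfolding I0 using b by simp_all
  have ne: "al p j \<noteq> 0" "be p j \<noteq> 0" "ga p j \<noteq> 0" "ep p j \<noteq> 0" for j
    using rp(1)[of j] rp(2)[of j] rp(3)[of j] rp(4)[of j] by simp_all
  show "rxi (f (m + 1)) (a + 3) * rtheta (f m) (a + 2) = rxi (f m) (a + 1) * rtheta (f m) a"
    using xi_nrow(1)[of p 0, OF ne] I1(1)[of 0] I(3)[of 2] I(1)[of 1] I(3)[of 0] by (simp add: numeral_2_eq_2)
  show "reta (f (m + 1)) (a + 3) * rtheta (f m) (a + 1) = reta (f m) (a + 2) * rtheta (f m) (a + 3)"
    using xi_nrow(2)[of p 0, OF ne] I1(2)[of 0] I(3)[of 1] I(2)[of 2] I(3)[of 3] by (simp add: numeral_2_eq_2)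
qed

section \<open>Constants of motion and lower bounds\<close>

lemma prod_le_factor:
  fixes f :: "'a \<Rightarrow> real"
  assumes "finite I" "i \<in> I" "\<And>j. j \<in> I \<Longrightarrow> 0 < f j \<and> f j \<le> 1"
  shows "prod f I \<le> f i"
proof -
  have "prod f I = f i * prod f (I - {i})" using assms by (simp add: prod.remove)
  also have "\<dots> \<le> f i * 1" using assms by (intro mult_left_mono prod_le_1) (auto intro: less_imp_le)
  finally show ?thesis by simp
qed

lemma prod_window:
  fixes f :: "int \<Rightarrow> real"
  shows "(\<Prod>c<N. f (s + 1 + int c)) * f s = (\<Prod>c<N. f (s + int c)) * f (s + int N)"
  using prod.lessThan_Suc_shift[of "\<lambda>c. f (s + int c)" N] prod.lessThan_Suc[of "\<lambda>c. f (s + int c)" N]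
  by (simp add: add_ac)

text \<open>The laws say that the logarithms of \<open>X\<close> and \<open>Y\<close> are conserved densities with the current
  \<open>log \<Theta>\<close>. Integrating along a closed curve around the cylinder of all labels gives two invariants;
  for \<open>X\<close> all contributions have the same sign, so each of them is bounded, and then the
  invariant of \<open>Y\<close> bounds \<open>Y\<close>.\<close>

lemma invariants_bounded:
  fixes X Y \<Theta> :: "nat \<Rightarrow> int \<Rightarrow> real" and n k :: nat
  assumes X: "\<And>a. 0 < X 0 a \<and> X 0 a \<le> 1" and Y: "\<And>a. 0 < Y 0 a \<and> Y 0 a \<le> 1"
    and T: "\<And>m a. m < k \<Longrightarrow> 0 < \<Theta> m a \<and> \<Theta> m a \<le> 1"
    and lX: "\<And>m a. m < k \<Longrightarrow> X (m + 1) (a + 3) * \<Theta> m (a + 2) = X m (a + 1) * \<Theta> m a"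
    and lY: "\<And>m a. m < k \<Longrightarrow> Y (m + 1) (a + 3) * \<Theta> m (a + 1) = Y m (a + 2) * \<Theta> m (a + 3)"
    and cX: "\<And>a. X k a = X 0 (a + int (n - k))" and cY: "\<And>a. Y k a = Y 0 (a + int (n - k))"
    and n: "1 \<le> k" "k \<le> n"
  shows "\<exists>\<kappa>>0. \<forall>a. \<kappa> \<le> X 0 a \<and> \<kappa> \<le> Y 0 a \<and> (\<forall>m<k. \<kappa> \<le> \<Theta> m a)"
proof -
  \<comment> \<open>The curve follows row 0 from \<open>s\<close> to \<open>s + n + k\<close>. By
    \<open>cX\<close> this end is the label \<open>s + 2 * k\<close> of row \<open>k\<close>, from
    where the curve returns through the labels \<open>s + 2 * m\<close> of the rows
    \<open>m\<close>, with two current terms in each row.\<close>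
  define IX where "IX s = (\<Prod>m<k. \<Theta> m (s + 2 * int m - 1) * \<Theta> m (s + 2 * int m)) * (\<Prod>c<n + k. X 0 (s + int c))" for s
  have tX: "X m (s + 2 * int m) * (\<Prod>l<m. \<Theta> l (s + 2 * int l + 1)) = X 0 s * (\<Prod>l<m. \<Theta> l (s + 2 * int l - 1))"
    if "m \<le> k" for m s
    using that
  proof (induction m)
    case (Suc m)
    have "X (m + 1) (s + 2 * int (Suc m)) * \<Theta> m (s + 2 * int m + 1) = X m (s + 2 * int m) * \<Theta> m (s + 2 * int m - 1)"
      using lX[of m "s + 2 * int m - 1"] Suc by (simp add: algebra_simps)
    then have h: "X (Suc m) (s + 2 * int (Suc m)) * \<Theta> m (s + 2 * int m + 1) = X m (s + 2 * int m) * \<Theta> m (s + 2 * int m - 1)" by simp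
    have IH: "X m (s + 2 * int m) * (\<Prod>l<m. \<Theta> l (s + 2 * int l + 1)) = X 0 s * (\<Prod>l<m. \<Theta> l (s + 2 * int l - 1))" using Suc by simp
    have "X (Suc m) (s + 2 * int (Suc m)) * ((\<Prod>l<m. \<Theta> l (s + 2 * int l + 1)) * \<Theta> m (s + 2 * int m + 1)) = (X (Suc m) (s + 2 * int (Suc m)) * \<Theta> m (s + 2 * int m + 1)) * (\<Prod>l<m. \<Theta> l (s + 2 * int l + 1))" by (simp only: mult_ac)
    also have "\<dots> = (X m (s + 2 * int m) * (\<Prod>l<m. \<Theta> l (s + 2 * int l + 1))) * \<Theta> m (s + 2 * int m - 1)" unfolding h by (simp only: mult_ac)
    finally show ?case unfolding IH prod.lessThan_Suc by (simp only: mult_ac)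
  qed simp
  have IXs: "IX (s + 1) = IX s" for s
  proof -
    have XN: "X k (s + 2 * int k) = X 0 (s + int (n + k))" unfolding cX using n by (simp add: of_nat_diff algebra_simps)
    define A where "A = (\<Prod>m<k. \<Theta> m (s + 2 * int m))"
    define B where "B = (\<Prod>m<k. \<Theta> m (s + 2 * int m - 1))"
    define C where "C = (\<Prod>m<k. \<Theta> m (s + 2 * int m + 1))"
    define D where "D = (\<Prod>c<n + k. X 0 (s + int c))"
    define E where "E = (\<Prod>c<n + k. X 0 (s + 1 + int c))"
    have "IX s = B * A * D" by (simp add: IX_def A_def B_def D_def prod.distrib)
    moreover have "IX (s + 1) = A * C * E"
      by (simp add: IX_def A_def C_def E_def prod.distrib algebra_simps)
    moreover have "E * X 0 s = D * X 0 (s + int (n + k))" unfolding D_def E_def by (rule prod_window)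
    moreover have "X 0 (s + int (n + k)) * C = X 0 s * B" using tX[of k s] XN by (simp add: B_def C_def)
    ultimately have "IX (s + 1) * X 0 s = IX s * X 0 s" by algebra
    then show ?thesis using X[of s] by simp
  qed
  have IX: "IX s = IX 0" for s
  proof (induction s rule: int_induct[where k = 0])
    case (step2 i) then show ?case using IXs[of "i - 1"] by simp
  qed (use IXs in auto)
  define c0 where "c0 = IX 0"
  have TT: "0 < \<Theta> m a * \<Theta> m b \<and> \<Theta> m a * \<Theta> m b \<le> 1" if "m < k" for m a b
    using T[OF that, of a] T[OF that, of b] by (simp add: mult_le_one)
  have p1: "0 < (\<Prod>m<k. \<Theta> m (s + 2 * int m - 1) * \<Theta> m (s + 2 * int m))"
    "(\<Prod>m<k. \<Theta> m (s + 2 * int m - 1) * \<Theta> m (s + 2 * int m)) \<le> 1" for s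
    using TT by (auto intro!: prod_pos prod_le_1 simp: less_imp_le)
  have p2: "0 < (\<Prod>c<N. X 0 (s + int c))" "(\<Prod>c<N. X 0 (s + int c)) \<le> 1" for s N
    using X by (auto intro!: prod_pos prod_le_1 simp: less_imp_le)
  have c0: "0 < c0" unfolding c0_def IX_def using p1(1)[of 0] p2(1)[where s = 0] by simp
  have X0: "c0 \<le> X 0 a" for a
  proof -
    have "c0 = IX a" by (simp add: c0_def IX[of a])
    also have "\<dots> \<le> 1 * (\<Prod>c<n + k. X 0 (a + int c))" unfolding IX_def
      by (intro mult_right_mono p1 less_imp_le[OF p2(1)])
    also have "\<dots> \<le> X 0 (a + int 0)" unfolding mult_1
      by (rule prod_le_factor[where f = "\<lambda>c. X 0 (a + int c)"]) (use X n in auto)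
    finally show ?thesis by simp
  qed
  have T0: "c0 \<le> \<Theta> m a" if m: "m < k" for m a
  proof -
    define s where "s = a - 2 * int m"
    have "c0 = IX s" by (simp add: c0_def IX[of s])
    also have "\<dots> \<le> (\<Prod>m<k. \<Theta> m (s + 2 * int m - 1) * \<Theta> m (s + 2 * int m)) * 1" unfolding IX_def
      by (intro mult_left_mono p2 less_imp_le[OF p1(1)])
    also have "\<dots> \<le> \<Theta> m (s + 2 * int m - 1) * \<Theta> m (s + 2 * int m)" unfolding mult_1_right
      by (rule prod_le_factor[where f = "\<lambda>m. \<Theta> m (s + 2 * int m - 1) * \<Theta> m (s + 2 * int m)"]) (use TT m in auto)
    also have "\<dots> \<le> 1 * \<Theta> m (s + 2 * int m)" using T[OF m] by (intro mult_right_mono) (auto intro: less_imp_le)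
    finally show ?thesis by (simp add: s_def)
  qed
  \<comment> \<open>For \<open>Y\<close> the curve returns through the labels \<open>s + m\<close>,
    so that the window has length \<open>n\<close>. The current has the opposite sign and its
    product enters the denominator; a lower bound for \<open>Y\<close> therefore needs the bounds
    for \<open>\<Theta>\<close> first.\<close>
  define W where "W s = (\<Prod>m<k. \<Theta> m (s + int m - 1) * \<Theta> m (s + int m))" for s
  define IY where "IY s = (\<Prod>c<n. Y 0 (s + int c)) / W s" for s
  have Wp: "0 < W s" for s unfolding W_def using TT by (auto intro!: prod_pos)
  have tY: "Y m (s + int m) * (\<Prod>l<m. \<Theta> l (s + int l - 1)) = Y 0 s * (\<Prod>l<m. \<Theta> l (s + int l + 1))"
    if "m \<le> k" for m s
    using that
  proof (induction m)
    case (Suc m)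
    have "Y (m + 1) (s + int (Suc m)) * \<Theta> m (s + int m - 1) = Y m (s + int m) * \<Theta> m (s + int m + 1)"
      using lY[of m "s + int m - 2"] Suc by (simp add: algebra_simps)
    then have h: "Y (Suc m) (s + int (Suc m)) * \<Theta> m (s + int m - 1) = Y m (s + int m) * \<Theta> m (s + int m + 1)" by simp
    have IH: "Y m (s + int m) * (\<Prod>l<m. \<Theta> l (s + int l - 1)) = Y 0 s * (\<Prod>l<m. \<Theta> l (s + int l + 1))" using Suc by simp
    have "Y (Suc m) (s + int (Suc m)) * ((\<Prod>l<m. \<Theta> l (s + int l - 1)) * \<Theta> m (s + int m - 1)) = (Y (Suc m) (s + int (Suc m)) * \<Theta> m (s + int m - 1)) * (\<Prod>l<m. \<Theta> l (s + int l - 1))" by (simp only: mult_ac)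
    also have "\<dots> = (Y m (s + int m) * (\<Prod>l<m. \<Theta> l (s + int l - 1))) * \<Theta> m (s + int m + 1)" unfolding h by (simp only: mult_ac)
    finally show ?case unfolding IH prod.lessThan_Suc by (simp only: mult_ac)
  qed simp
  have IYs: "IY (s + 1) = IY s" for s
  proof -
    have YN: "Y k (s + int k) = Y 0 (s + int n)" unfolding cY using n by (simp add: of_nat_diff algebra_simps)
    define A where "A = (\<Prod>m<k. \<Theta> m (s + int m))"
    define B where "B = (\<Prod>m<k. \<Theta> m (s + int m - 1))"
    define C where "C = (\<Prod>m<k. \<Theta> m (s + int m + 1))"
    define D where "D = (\<Prod>c<n. Y 0 (s + int c))"
    define E where "E = (\<Prod>c<n. Y 0 (s + 1 + int c))"
    have W: "W s = B * A" by (simp add: W_def A_def B_def prod.distrib)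
    have W1: "W (s + 1) = A * C" by (simp add: W_def A_def C_def prod.distrib algebra_simps)
    have e1: "E * Y 0 s = D * Y 0 (s + int n)" unfolding D_def E_def by (rule prod_window)
    have e2: "Y 0 (s + int n) * B = Y 0 s * C" using tY[of k s] YN by (simp add: B_def C_def)
    have "(E * (B * A)) * Y 0 s = (D * (A * C)) * Y 0 s" using e1 e2 by algebra
    then have "E * W s = D * W (s + 1)" using Y[of s] by (simp add: W W1)
    then show ?thesis using Wp[of s] Wp[of "s + 1"] by (simp add: IY_def D_def E_def field_simps)
  qed
  have IY: "IY s = IY 0" for s
  proof (induction s rule: int_induct[where k = 0])
    case (step2 i) then show ?case using IYs[of "i - 1"] by simp
  qed (use IYs in auto)
  have IYp: "0 < IY 0" unfolding IY_def using Wp Y by (auto intro!: divide_pos_pos prod_pos)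
  define d0 where "d0 = IY 0 * (c0 * c0) ^ k"
  have d0: "0 < d0" unfolding d0_def using IYp c0 by simp
  have Y0: "d0 \<le> Y 0 a" for a
  proof -
    have "c0 * c0 \<le> \<Theta> m x * \<Theta> m y" if "m < k" for m x y
      by (intro mult_mono T0 that) (use c0 T[OF that] in \<open>auto intro: less_imp_le\<close>)
    then have "(\<Prod>m<k. c0 * c0) \<le> W a" unfolding W_def using c0 by (intro prod_mono) simp
    then have "(c0 * c0) ^ k \<le> W a" by simp
    then have "d0 \<le> IY a * W a" unfolding d0_def IY[of a] using IYp by (intro mult_left_mono) auto
    also have "\<dots> = (\<Prod>c<n. Y 0 (a + int c))" using Wp[of a] by (simp add: IY_def)
    also have "\<dots> \<le> Y 0 (a + int 0)"
      by (rule prod_le_factor[where f = "\<lambda>c. Y 0 (a + int c)"]) (use Y n in auto)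
    finally show ?thesis by simp
  qed
  show ?thesis
    by (rule exI[of _ "min c0 d0"]) (use c0 d0 X0 Y0 T0 in \<open>auto simp: min_le_iff_disj\<close>)
qed

lemma orbit_bounded:
  assumes n: "4 \<le> n" "1 \<le> k" "k \<le> n - 1" and s: "s \<in> seeds n k"
  shows "\<exists>\<kappa>>0. \<forall>a. \<kappa> \<le> rxi (\<lambda>a. vtx n k s a 0) a \<and> \<kappa> \<le> reta (\<lambda>a. vtx n k s a 0) a \<and>
    (\<forall>m<k. \<kappa> \<le> rtheta (\<lambda>a. vtx n k s a m) a)"
proof (rule invariants_bounded[where n = n and X = "\<lambda>m. rxi (\<lambda>a. vtx n k s a m)" and Y = "\<lambda>m. reta (\<lambda>a. vtx n k s a m)"
      and \<Theta> = "\<lambda>m. rtheta (\<lambda>a. vtx n k s a m)"])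
  have k0: "0 < k" using n by simp
  show "rxi (\<lambda>a. vtx n k s a k) a = rxi (\<lambda>a. vtx n k s a 0) (a + int (n - k))"
    "reta (\<lambda>a. vtx n k s a k) a = reta (\<lambda>a. vtx n k s a 0) (a + int (n - k))" for a
    unfolding rxi_def reta_def row_k_vtx(1)[OF n s] by (simp_all add: add_ac)
qed (use row_local[OF n s] n in auto)

section \<open>A compact set of normalized rows\<close>

text \<open>If a vertex were on the line of an edge, the weak inequalities with the two neighbours
  of that edge would force both of its coefficients to vanish.\<close>

lemma posc_of_weak:
  assumes per: "\<And>i. v (i + n) = v i" and n: "4 \<le> n"
    and weak: "\<And>i j k. 1 \<le> i \<Longrightarrow> i < j \<Longrightarrow> j < k \<Longrightarrow> k \<le> n \<Longrightarrow> 0 \<le> br (v i) (v j) (v k)"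
    and cons: "\<And>i. 0 < br (v i) (v (i + 1)) (v (i + 2))"
  shows "posc n v"
proof (rule posc_of_edges[where v = v and n = n, OF per])
  fix j l assume h: "j + 1 < l" "l < j + n"
  have w: "0 \<le> br (v i) (v j) (v k)" if "i < j" "j < k" "k < i + n" for i j k
    using cyclic_bracket[where Q = "\<lambda>x. 0 \<le> x" and v = v and n = n, OF per _ weak that] n by simp
  have vl: "v l \<noteq> 0" using cons[of l] br_nonzero_imp(1) by (metis less_irrefl)
  have prev: "0 < br (v (j + (n - 1))) (v j) (v (j + 1))"
    using cons[of "j + (n - 1)"] per[of j] per[of "j + 1"] n by (simp add: algebra_simps)
  show "0 < br (v j) (v (j + 1)) (v l)"
  proof (rule ccontr)
    assume c: "\<not> 0 < br (v j) (v (j + 1)) (v l)"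
    then have z: "br (v j) (v (j + 1)) (v l) = 0" using w[of j "j + 1" l] h by simp
    have "l \<noteq> j + 2" using cons[of j] z by auto
    have "l \<noteq> j + (n - 1)" using prev z br_rot[of "v j" "v (j + 1)" "v (j + (n - 1))"] by auto
    have l: "j + 2 < l" "l < j + (n - 1)" using h \<open>l \<noteq> j + 2\<close> \<open>l \<noteq> j + (n - 1)\<close> by auto
    obtain a b where ab: "v l = a *\<^sub>R v j + b *\<^sub>R v (j + 1)"
      using br_zero_span[OF z, of "v (j + 2)"] cons[of j] by auto
    have "0 \<le> br (v j) (v (j + 2)) (v l)" using w[of j "j + 2" l] l n by simp
    then have "b * br (v j) (v (j + 1)) (v (j + 2)) \<le> 0"
      unfolding ab using br_swap(2)[of "v j" "v (j + 2)" "v (j + 1)"] by simp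
    then have b1: "b \<le> 0" using cons[of j] by (simp add: mult_le_0_iff)
    have "0 \<le> br (v l) (v (j + (n - 1))) (v (j + n))" using w[of l "j + (n - 1)" "j + n"] l n by simp
    then have "0 \<le> b * br (v (j + 1)) (v (j + (n - 1))) (v j)" unfolding ab per by simp
    moreover have "br (v (j + 1)) (v (j + (n - 1))) (v j) = br (v (j + (n - 1))) (v j) (v (j + 1))"
      by (rule br_rot[symmetric])
    ultimately have b2: "0 \<le> b" using prev by (simp add: zero_le_mult_iff)
    have "0 \<le> br (v (j + 1)) (v (j + 2)) (v l)" using w[of "j + 1" "j + 2" l] l n by simp
    then have "0 \<le> a * br (v (j + 1)) (v (j + 2)) (v j)" unfolding ab by simp
    then have a1: "0 \<le> a" using cons[of j] br_rot[of "v (j + 1)" "v (j + 2)" "v j"] by (simp add: zero_le_mult_iff)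
    have "0 \<le> br (v (j + 1)) (v l) (v (j + (n - 1)))" using w[of "j + 1" l "j + (n - 1)"] l n by simp
    then have "0 \<le> a * br (v (j + 1)) (v j) (v (j + (n - 1)))" unfolding ab by simp
    moreover have "br (v (j + 1)) (v j) (v (j + (n - 1))) = - br (v (j + (n - 1))) (v j) (v (j + 1))"
      by (rule br_swap)
    ultimately have "a * br (v (j + (n - 1))) (v j) (v (j + 1)) \<le> 0" by simp
    then have "a \<le> 0" using prev by (simp add: mult_le_0_iff)
    then show False using vl ab a1 b1 b2 by simp
  qed
qed

definition e1 :: "real^3" where "e1 = vector [1, 0, 0]"
definition e2 :: "real^3" where "e2 = vector [0, 1, 0]"
definition e3 :: "real^3" where "e3 = vector [0, 0, 1]"

lemma br_e [simp]: "br e1 e2 e3 = 1" "br e1 e3 e2 = -1" "br e2 e3 e1 = 1"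
  by (simp_all add: br_def e1_def e2_def e3_def)

text \<open>The polygons of the seeds with indices \<open>3 k + 1\<close> and \<open>3 k + 2\<close>, read off from the row of \<open>P\<close>.
  Lowering a vertex index of the polygon by one passes to the next row, where \<open>nrow\<close> shifts
  the label by 3; the offset \<open>3 k\<close> keeps all labels nonnegative.\<close>

definition row_polygon :: "nat \<Rightarrow> nat \<Rightarrow> (nat \<Rightarrow> real^3) \<Rightarrow> nat \<Rightarrow> real^3" where
  "row_polygon n k v i = (if i \<le> n - k then v (3 * k + i) else (nrow ^^ (n + 1 - i)) v (3 * k + 1 - 3 * (n + 1 - i)))"

definition row_marks :: "nat \<Rightarrow> nat \<Rightarrow> (nat \<Rightarrow> real^3) \<Rightarrow> nat \<Rightarrow> real^3" where
  "row_marks n k v i = (if i \<le> n - k then row_polygon n k v (i + 1) else (nrow ^^ (n + 1 - i)) v (3 * k + 2 - 3 * (n + 1 - i)))"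

text \<open>Where \<open>al\<close> is 1, the inequalities amount to \<open>\<kappa> \<le> \<xi> \<le> 1\<close>, \<open>\<kappa> \<le> \<eta> \<le> 1\<close> and \<open>\<kappa> \<le> \<theta>\<close>, freed of divisions to be
  closed conditions; the conditions with \<open>nrow ^^ k\<close> say that \<open>T\<^sup>k(P)\<close> is a shift of \<open>P\<close>.\<close>

definition normal_rows :: "nat \<Rightarrow> nat \<Rightarrow> real \<Rightarrow> (nat \<Rightarrow> real^3) set" where
  "normal_rows n k \<kappa> = {v. v 0 = e1 \<and> v 1 = e2 \<and> v 2 = e3 \<and> v 3 = e1 - e2 + e3 \<and>
     (\<forall>j. al v j = 1 \<and>
        be v j \<le> ga v j * ga v (j + 1) \<and> \<kappa> * (ga v j * ga v (j + 1)) \<le> be v j \<and>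
        ga v (j + 1) \<le> be v (j + 1) * be v j \<and> \<kappa> * (be v (j + 1) * be v j) \<le> ga v (j + 1) \<and>
        (\<forall>m<k. \<kappa> * (ga ((nrow ^^ m) v) j * be ((nrow ^^ m) v) (j + 1))
            \<le> ep ((nrow ^^ m) v) j * al ((nrow ^^ m) v) (j + 1)) \<and>
        (\<forall>z. br ((nrow ^^ k) v j) (v (j + 2 * k + n)) z = 0) \<and>
        0 \<le> inner ((nrow ^^ k) v j) (v (j + 2 * k + n))) \<and>
     (\<forall>i j l. 1 \<le> i \<longrightarrow> i < j \<longrightarrow> j < l \<longrightarrow> l \<le> n \<longrightarrow>
        0 \<le> br (row_polygon n k v i) (row_polygon n k v j) (row_polygon n k v l))}"

lemma continuous_nrow: "continuous_on UNIV (\<lambda>v. (nrow ^^ m) v j)"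
proof (induction m arbitrary: j)
  case 0
  show ?case by (simp add: continuous_on_product_coordinates)
next
  case (Suc m)
  have "(\<lambda>v. (nrow ^^ Suc m) v j) = (\<lambda>v. let r = (nrow ^^ m) v in
      br (r j) (r (j + 2)) (r (j + 3)) *\<^sub>R r (j + 1) + br (r j) (r (j + 1)) (r (j + 2)) *\<^sub>R r (j + 3))"
    by (simp add: nrow_def al_def ga_def Let_def fun_eq_iff)
  then show ?case unfolding Let_def by (simp only:) (intro continuous_intros Suc)
qed

lemma continuous_coord: "continuous_on UNIV (\<lambda>v :: nat \<Rightarrow> real^3. v j)"
  using continuous_nrow[of 0 j] by simp

lemma continuous_row_polygon: "continuous_on UNIV (\<lambda>v. row_polygon n k v i)" "continuous_on UNIV (\<lambda>v. row_marks n k v i)"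
proof -
  show p: "continuous_on UNIV (\<lambda>v. row_polygon n k v i)" for i
    unfolding row_polygon_def by (cases "i \<le> n - k") (simp_all add: continuous_nrow continuous_coord)
  show "continuous_on UNIV (\<lambda>v. row_marks n k v i)"
    unfolding row_marks_def by (cases "i \<le> n - k") (simp_all add: continuous_nrow p)
qed

lemma closed_normal_rows: "closed (normal_rows n k \<kappa>)"
proof -
  have c: "continuous_on UNIV (\<lambda>v. al ((nrow ^^ m) v) j)" "continuous_on UNIV (\<lambda>v. be ((nrow ^^ m) v) j)"
    "continuous_on UNIV (\<lambda>v. ga ((nrow ^^ m) v) j)" "continuous_on UNIV (\<lambda>v. ep ((nrow ^^ m) v) j)" for m j
    unfolding al_def be_def ga_def ep_def by (intro continuous_intros continuous_nrow)+
  note c0 = c[of 0, simplified]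
  show ?thesis unfolding normal_rows_def
    by (intro closed_Collect_conj closed_Collect_all closed_Collect_imp closed_Collect_eq closed_Collect_le
        open_Collect_const continuous_intros continuous_nrow continuous_coord continuous_row_polygon c c0)
qed

text \<open>With consecutive brackets 1, the two expressions for the crossing of the diagonals turn
  into a recursion of third order: \<open>be\<close> and \<open>ga\<close> determine the
  row.\<close>

lemma nrow_recursion: "al v j = 1 \<Longrightarrow> al v (j + 1) = 1 \<Longrightarrow> v (j + 3) = v j + be v j *\<^sub>R v (j + 2) - ga v j *\<^sub>R v (j + 1)"
  using nrow_alt[of v j] nrow_def[of v j] by (simp add: algebra_simps)

text \<open>For \<open>al v = 1\<close> one has
  \<open>xi v j = be v j / (ga v j * ga v (j + 1))\<close> and
  \<open>eta v j = ga v (j + 1) / (be v (j + 1) * be v j)\<close>, so bounds pass from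
  \<open>j\<close> to \<open>j + 1\<close>. They may deteriorate with \<open>j\<close>, which is
  harmless in a product topology.\<close>

lemma normal_rows_bounds:
  assumes k: "0 < \<kappa>"
  shows "\<exists>l u. 0 < l \<and> 0 < u \<and> (\<forall>v\<in>normal_rows n k \<kappa>. l \<le> be v j \<and> be v j \<le> u \<and> l \<le> ga v j \<and> ga v j \<le> u)"
proof (induction j)
  case 0
  have "be v 0 = 1 \<and> ga v 0 = 1" if "v \<in> normal_rows n k \<kappa>" for v
    using that by (simp add: normal_rows_def be_def ga_def numeral_2_eq_2)
  then show ?case by (intro exI[of _ 1]) auto
next
  case (Suc j)
  then obtain l u where lu: "0 < l" "0 < u" "\<And>v. v \<in> normal_rows n k \<kappa> \<Longrightarrow> l \<le> be v j \<and> be v j \<le> u \<and> l \<le> ga v j \<and> ga v j \<le> u"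
    by blast
  show ?case
  proof (intro exI conjI ballI)
    fix v assume v: "v \<in> normal_rows n k \<kappa>"
    note b = lu(3)[OF v]
    note u = lu(2)
    have X: "be v j \<le> ga v j * ga v (j + 1)" "\<kappa> * (ga v j * ga v (j + 1)) \<le> be v j"
      "ga v (j + 1) \<le> be v (j + 1) * be v j" "\<kappa> * (be v (j + 1) * be v j) \<le> ga v (j + 1)"
      using v by (auto simp: normal_rows_def)
    have pos: "0 < ga v j" "0 < be v j" using b lu(1) by linarith+
    have g1: "be v j / ga v j \<le> ga v (j + 1)" using X(1) pos by (simp add: divide_le_eq mult.commute)
    have g2: "ga v (j + 1) \<le> be v j / (\<kappa> * ga v j)" using X(2) pos k by (simp add: le_divide_eq mult_ac)
    have "l / u \<le> be v j / ga v j" using b lu(1) u pos by (intro frac_le) auto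
    then have gl: "l / u \<le> ga v (j + 1)" using g1 by linarith
    have "be v j / (\<kappa> * ga v j) \<le> u / (\<kappa> * l)" using b lu(1) u pos k by (intro frac_le) auto
    then have gu: "ga v (j + 1) \<le> u / (\<kappa> * l)" using g2 by linarith
    have b1: "ga v (j + 1) / be v j \<le> be v (j + 1)" using X(3) pos by (simp add: divide_le_eq mult.commute)
    have b2: "be v (j + 1) \<le> ga v (j + 1) / (\<kappa> * be v j)" using X(4) pos k by (simp add: le_divide_eq mult_ac)
    have lup: "0 < l / u" using lu(1) u by simp
    have "(l / u) / u \<le> ga v (j + 1) / be v j" using b lup u pos gl by (intro frac_le) auto
    then have bl: "(l / u) / u \<le> be v (j + 1)" using b1 by linarith
    have "ga v (j + 1) / (\<kappa> * be v j) \<le> (u / (\<kappa> * l)) / (\<kappa> * l)"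
      using b lu(1) pos k gu gl lup u by (intro frac_le) auto
    then have bu: "be v (j + 1) \<le> (u / (\<kappa> * l)) / (\<kappa> * l)" using b2 by linarith
    show "min (l / u) ((l / u) / u) \<le> be v (Suc j)" "min (l / u) ((l / u) / u) \<le> ga v (Suc j)"
      using bl gl by simp_all
    show "be v (Suc j) \<le> max (u / (\<kappa> * l)) ((u / (\<kappa> * l)) / (\<kappa> * l))" "ga v (Suc j) \<le> max (u / (\<kappa> * l)) ((u / (\<kappa> * l)) / (\<kappa> * l))"
      using bu gu by simp_all
  next
    show "0 < min (l / u) ((l / u) / u)" "0 < max (u / (\<kappa> * l)) ((u / (\<kappa> * l)) / (\<kappa> * l))"
      using lu(1,2) k by (simp_all add: less_max_iff_disj)
  qed
qed

lemma normal_rows_norm: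
  assumes k: "0 < \<kappa>"
  shows "\<exists>R. \<forall>v\<in>normal_rows n k \<kappa>. norm (v j) \<le> R"
proof (induction j rule: less_induct)
  case (less j)
  show ?case
  proof (cases "j < 3")
    case True
    then have "j = 0 \<or> j = 1 \<or> j = 2" by linarith
    then have "norm (v j) \<le> norm e1 + norm e2 + norm e3" if "v \<in> normal_rows n k \<kappa>" for v
      using that by (auto simp: normal_rows_def)
    then show ?thesis by blast
  next
    case False
    define i where "i = j - 3"
    have j: "j = i + 3" using False by (simp add: i_def)
    obtain R0 where R0: "\<And>v. v \<in> normal_rows n k \<kappa> \<Longrightarrow> norm (v i) \<le> R0" using less[of i] j by auto
    obtain R1 where R1: "\<And>v. v \<in> normal_rows n k \<kappa> \<Longrightarrow> norm (v (i + 1)) \<le> R1" using less[of "i + 1"] j by auto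
    obtain R2 where R2: "\<And>v. v \<in> normal_rows n k \<kappa> \<Longrightarrow> norm (v (i + 2)) \<le> R2" using less[of "i + 2"] j by auto
    obtain l u where lu: "0 < l" "0 < u" "\<And>v. v \<in> normal_rows n k \<kappa> \<Longrightarrow> l \<le> be v i \<and> be v i \<le> u \<and> l \<le> ga v i \<and> ga v i \<le> u"
      using normal_rows_bounds[OF k, of n k i] by blast
    have "norm (v j) \<le> R0 + u * R2 + u * R1" if v: "v \<in> normal_rows n k \<kappa>" for v
    proof -
      have "v j = v i + be v i *\<^sub>R v (i + 2) - ga v i *\<^sub>R v (i + 1)"
        unfolding j using v by (intro nrow_recursion) (auto simp: normal_rows_def)
      then have "norm (v j) \<le> norm (v i) + \<bar>be v i\<bar> * norm (v (i + 2)) + \<bar>ga v i\<bar> * norm (v (i + 1))"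
        by (metis (no_types, opaque_lifting) norm_triangle_le_diff norm_triangle_ineq norm_scaleR add_right_mono)
      also have "\<dots> \<le> R0 + u * R2 + u * R1"
        using lu(3)[OF v] lu(1,2) R0[OF v] R1[OF v] R2[OF v] by (intro add_mono mult_mono) auto
      finally show ?thesis .
    qed
    then show ?thesis by blast
  qed
qed

lemma compact_normal_rows:
  assumes k: "0 < \<kappa>"
  shows "compact (normal_rows n k \<kappa>)"
proof -
  obtain R where R: "\<And>j v. v \<in> normal_rows n k \<kappa> \<Longrightarrow> norm (v j) \<le> R j"
    using normal_rows_norm[OF k] by metis
  let ?K = "PiE UNIV (\<lambda>j. cball (0 :: real^3) (R j))"
  have "compactin (product_topology (\<lambda>_. euclidean) UNIV) ?K"
    unfolding compactin_PiE by (simp add: compactin_euclidean_iff)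
  then have "compact ?K" unfolding euclidean_product_topology compactin_euclidean_iff .
  moreover have "normal_rows n k \<kappa> \<subseteq> ?K" using R by (auto simp: PiE_def)
  ultimately show ?thesis
    using closed_normal_rows[of n k \<kappa>] by (metis compact_Int_closed inf.absorb_iff2)
qed

section \<open>Normalized rows come from seeds\<close>

lemma nrow_next: "ga p j *\<^sub>R nrow p (j + 1) = al p (j + 2) *\<^sub>R nrow p j + (ep p j * al p (j + 1)) *\<^sub>R p (j + 3)"
proof -
  have e: "nrow p (j + 1) = al p (j + 2) *\<^sub>R p (j + 1) + be p (j + 1) *\<^sub>R p (j + 3)"
    using nrow_alt[of p "j + 1"] by (simp add: eval_nat_numeral)
  show ?thesis unfolding e nrow_def[of p j] theta_pluecker[symmetric] by (simp add: algebra_simps)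
qed

definition good :: "(nat \<Rightarrow> real^3) \<Rightarrow> bool" where
  "good p \<longleftrightarrow> (\<forall>j. 0 < al p j \<and> 0 < be p j \<and> 0 < ga p j)"

lemma good_nrow:
  assumes "good p" "\<And>j. 0 < ep p j"
  shows "good (nrow p)"
  using assms by (simp add: good_def nrow_al nrow_be nrow_ga)

text \<open>The two claims feed each other row by row: goodness and the lower bound for
  \<open>theta\<close> give a positive \<open>ep\<close>, and then the monomial formulas give
  goodness of the next row.\<close>

lemma normal_rows_good:
  assumes k: "0 < \<kappa>" and v: "v \<in> normal_rows n k \<kappa>"
  shows "m \<le> k \<Longrightarrow> good ((nrow ^^ m) v)" "m < k \<Longrightarrow> 0 < ep ((nrow ^^ m) v) j"
proof -
  have e: "0 < ep ((nrow ^^ m) v) j" if "good ((nrow ^^ m) v)" "m < k" for m j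
  proof -
    have "0 < \<kappa> * (ga ((nrow ^^ m) v) j * be ((nrow ^^ m) v) (j + 1))"
      using that(1) k by (simp add: good_def)
    also have "\<dots> \<le> ep ((nrow ^^ m) v) j * al ((nrow ^^ m) v) (j + 1)"
      using v that(2) by (auto simp: normal_rows_def)
    finally show ?thesis using that(1) unfolding good_def by (metis zero_less_mult_pos2)
  qed
  have g: "good ((nrow ^^ m) v)" if "m \<le> k" for m
    using that
  proof (induction m)
    case 0
    have "0 < be v j \<and> 0 < ga v j" for j
    proof -
      obtain l u where "0 < l" "l \<le> be v j" "l \<le> ga v j" using normal_rows_bounds[OF k, of n k j] v by blast
      then show ?thesis by linarith
    qed
    moreover have "al v j = 1" for j using v by (simp add: normal_rows_def)
    ultimately show ?case by (simp add: good_def)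
  next
    case (Suc m)
    then show ?case using good_nrow e by simp
  qed
  show "m \<le> k \<Longrightarrow> good ((nrow ^^ m) v)" "m < k \<Longrightarrow> 0 < ep ((nrow ^^ m) v) j"
    using g e by simp_all
qed

text \<open>Positive proportionality is not a closed condition. Dependence together with a
  nonnegative inner product is closed, and for nonzero vectors it means the same.\<close>

lemma nonneg_dependent:
  assumes "\<And>z. br a b z = 0" "0 \<le> inner a b" "a \<noteq> 0" "b \<noteq> 0"
  shows "\<exists>c>0. b = c *\<^sub>R a"
proof -
  obtain c where c: "b = c *\<^sub>R a" using dep_or_third assms(1,3) by blast
  have "0 < inner a a" using assms(3) by simp
  moreover have "0 \<le> c * inner a a" using assms(2) unfolding c by (simp only: inner_scaleR_right)
  ultimately have "0 \<le> c" by (metis mult_neg_pos not_le)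
  then show ?thesis using c assms(4) by (intro exI[of _ c]) auto
qed

lemma good_nonzero: "good p \<Longrightarrow> p j \<noteq> 0"
  unfolding good_def al_def using br_nonzero_imp(1) by (metis less_irrefl)

text \<open>By closedness only weak convexity of the polygon is available; the bounds on the cross ratios
  make consecutive triples of vertices nondegenerate, which is enough by \<open>posc_of_weak\<close>.\<close>

lemma normal_rows_lift:
  assumes n: "4 \<le> n" "1 \<le> k" "k \<le> n - 1" and k: "0 < \<kappa>" and v: "v \<in> normal_rows n k \<kappa>"
  shows "lift n k (pext n (row_polygon n k v)) (pext n (row_marks n k v)) (seed_of n k (row_polygon n k v) (row_marks n k v))"
proof -
  define r where "r m = (nrow ^^ m) v" for m
  have r0: "r 0 = v" and rS: "r (Suc m) = nrow (r m)" for m by (simp_all add: r_def)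
  have g: "good (r m)" if "m \<le> k" for m using normal_rows_good(1)[OF k v that] by (simp add: r_def)
  have ep: "0 < ep (r m) j" if "m < k" for m j using normal_rows_good(2)[OF k v that] by (simp add: r_def)
  have pos: "0 < al (r m) j" "0 < be (r m) j" "0 < ga (r m) j" if "m \<le> k" for m j
    using g[OF that] by (simp_all add: good_def)
  define N where "N = n - k"
  have N: "1 \<le> N" "N + k = n" using n by (auto simp: N_def)
  have wrap: "\<exists>c>0. v (j + 2 * k + n) = c *\<^sub>R r k j" for j
  proof (rule nonneg_dependent)
    show "br (r k j) (v (j + 2 * k + n)) z = 0" for z using v by (auto simp: normal_rows_def r_def)
    show "0 \<le> inner (r k j) (v (j + 2 * k + n))" using v by (auto simp: normal_rows_def r_def)
    show "r k j \<noteq> 0" using good_nonzero[OF g[of k]] by simp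
    show "v (j + 2 * k + n) \<noteq> 0" using good_nonzero[OF g[of 0]] by (simp add: r0)
  qed
  let ?V = "pext n (row_polygon n k v)" and ?W = "pext n (row_marks n k v)"
  have V1: "?V i = v (3 * k + i)" if "1 \<le> i" "i \<le> N" for i using that N by (simp add: row_polygon_def N_def)
  have V2: "?V (n + 1 - m) = r m (3 * k + 1 - 3 * m)" if "m \<le> k" for m
  proof (cases "m = 0")
    case True
    have "?V (1 + n) = ?V 1" by (rule pext_period)
    then show ?thesis using True V1[of 1] N by (simp add: r0)
  next
    case False
    then have "\<not> n + 1 - m \<le> n - k" "n + 1 - (n + 1 - m) = m" "1 \<le> n + 1 - m" "n + 1 - m \<le> n" using that n by auto
    then show ?thesis by (simp add: row_polygon_def r_def)
  qed
  have V3: "\<exists>c>0. v (3 * k + 1 + N) = c *\<^sub>R ?V (N + 1)"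
  proof -
    have e: "N + 1 = n + 1 - k" "3 * k + 1 + N = 1 + 2 * k + n" using N by auto
    have "?V (N + 1) = r k 1" unfolding e(1) using V2[of k] by simp
    then show ?thesis unfolding e(2) using wrap[of 1] by simp
  qed
  have per: "?V (i + n) = ?V i" for i by simp
  have alv: "0 < al v j" "0 < ga v j" for j using pos[of 0 j] by (simp_all add: r0)
  have cons: "0 < br (?V i) (?V (i + 1)) (?V (i + 2))" if i: "1 \<le> i" "i \<le> n" for i
  proof -
    \<comment> \<open>The cases follow the triple around the polygon: inside row 0, across the seam
      between row 0 and row \<open>k\<close> (two cases), through three successive rows, and from
      row 1 back into row 0.\<close>
    consider "i + 2 \<le> N" | "i + 1 = N" | "i = N" | "N < i" "i < n" | "i = n" using i N by linarith
    then show ?thesis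
    proof cases
      case 1
      then show ?thesis using V1[of i] V1[of "i+1"] V1[of "i+2"] i alv(1)[of "3 * k + i"] by (simp add: al_def add_ac)
    next
      case 2
      obtain c where c: "0 < c" "v (3 * k + 1 + N) = c *\<^sub>R ?V (N + 1)" using V3 by blast
      have "3 * k + 1 + N = 3 * k + i + 2" "N + 1 = i + 2" using 2 by auto
      then have "v (3 * k + i + 2) = c *\<^sub>R ?V (i + 2)" using c(2) by simp
      then have "al v (3 * k + i) = c * br (?V i) (?V (i + 1)) (?V (i + 2))"
        using V1[of i] V1[of "i+1"] i 2 by (simp add: al_def add_ac)
      then show ?thesis using alv(1)[of "3 * k + i"] c(1) by (metis zero_less_mult_pos)
    next
      case 3
      define p where "p = r (k - 1)"
      have rk: "r k = nrow p" using rS[of "k - 1"] n by (simp add: p_def)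
      obtain c where c: "0 < c" "v (0 + 2 * k + n) = c *\<^sub>R r k 0" using wrap[of 0] by blast
      have e: "3 * k + i = 0 + 2 * k + n" using 3 N by simp
      have "?V i = v (3 * k + i)" using V1[of i] 3 N by simp
      then have Vi: "?V i = c *\<^sub>R nrow p 0" unfolding e c(2) rk .
      have Vi1: "?V (i + 1) = nrow p 1"
      proof -
        have "i + 1 = n + 1 - k" using 3 N by simp
        then show ?thesis using V2[of k] rk by simp
      qed
      have Vi2: "?V (i + 2) = p 4"
      proof -
        have "i + 2 = n + 1 - (k - 1)" "3 * k + 1 - 3 * (k - 1) = 4" using 3 N n by auto
        then show ?thesis using V2[of "k - 1"] n by (simp add: p_def)
      qed
      have pp: "0 < al p j" "0 < ga p j" "0 < ep p j" for j using pos[of "k - 1"] ep[of "k - 1"] n by (simp_all add: p_def)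
      have "br (nrow p 0) (nrow p (0 + 1)) (p 4) = ep p 0 * al p (0 + 1) * br (p (0 + 1)) (p (0 + 3)) (p 4)" by (rule nrow_br2)
      also have "br (p (0 + 1)) (p (0 + 3)) (p 4) = ga p 1" by (simp add: ga_def eval_nat_numeral)
      finally have "0 < br (nrow p 0) (nrow p 1) (p 4)" using pp by simp
      then show ?thesis unfolding Vi Vi1 Vi2 using c(1) by simp
    next
      case 4
      define m where "m = n - 1 - i"
      define p where "p = r m"
      define u where "u = nrow p"
      have m: "m + 2 \<le> k" "i = n + 1 - (m + 2)" "i + 1 = n + 1 - (m + 1)" "i + 2 = n + 1 - m" using 4 N by (auto simp: m_def)
      define j where "j = 3 * k + 1 - 3 * (m + 2)"
      have j: "3 * k + 1 - 3 * (m + 1) = j + 3" "3 * k + 1 - 3 * m = j + 6" using m by (auto simp: j_def)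
      have Vs: "?V i = nrow u j" "?V (i + 1) = u (j + 3)" "?V (i + 2) = p (j + 6)"
        using V2[of "m + 2"] V2[of "m + 1"] V2[of m] m j rS by (simp_all add: p_def u_def j_def numeral_2_eq_2)
      have pp: "0 < al p l" "0 < ga p l" "0 < ep p l" "0 < ga u l" for l
        using pos[of m] pos[of "Suc m"] ep[of m] m by (simp_all add: p_def u_def rS)
      have e1: "br (nrow u j) (u (j + 3)) x = ga u j * br (u (j + 1)) (u (j + 3)) x" for x
        by (simp add: nrow_def)
      \<comment> \<open>\<open>nrow_next\<close> expresses the point of the old row through the new
        one, so that all three vectors of the bracket come from \<open>u\<close>.\<close>
      have e2: "(ep p (j + 3) * al p (j + 4)) *\<^sub>R p (j + 6) = ga p (j + 3) *\<^sub>R u (j + 4) - al p (j + 5) *\<^sub>R u (j + 3)"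
        using nrow_next[of p "j + 3"] by (simp add: u_def eval_nat_numeral)
      have "(ep p (j + 3) * al p (j + 4)) * br (u (j + 1)) (u (j + 3)) (p (j + 6)) = ga p (j + 3) * br (u (j + 1)) (u (j + 3)) (u (j + 4))"
        unfolding br_scale(3)[symmetric] e2 by simp
      also have "br (u (j + 1)) (u (j + 3)) (u (j + 4)) = ga u (j + 1)" by (simp add: ga_def eval_nat_numeral)
      finally have "0 < (ep p (j + 3) * al p (j + 4)) * br (u (j + 1)) (u (j + 3)) (p (j + 6))" using pp by simp
      then have "0 < br (u (j + 1)) (u (j + 3)) (p (j + 6))" using pp by (metis mult_pos_pos zero_less_mult_pos)
      then show ?thesis unfolding Vs e1 using pp by simp
    next
      case 5
      define j where "j = 3 * k - 2"
      have j: "3 * k + 1 - 3 * 1 = j" "3 * k + 1 = j + 3" using n by (auto simp: j_def)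
      have Vi: "?V i = nrow v j" using V2[of 1] 5 n j rS[of 0] r0 by simp
      have Vi1: "?V (i + 1) = v (j + 3)" using V2[of 0] 5 j r0 by (simp add: numeral_3_eq_3)
      have "0 < br (v (j + 1)) (v (j + 3)) (v (j + 4))" using alv(2)[of "j + 1"] by (simp add: ga_def eval_nat_numeral)
      then have b: "0 < br (nrow v j) (v (j + 3)) (v (j + 4))" using alv(2)[of j] by (simp add: nrow_def)
      have per2: "?V (i + 2) = ?V 2" using per[of 2] 5 by (simp add: add.commute)
      show ?thesis
      proof (cases "N = 1")
        case False
        then have "?V 2 = v (j + 4)" using V1[of 2] N j by (simp add: eval_nat_numeral)
        then show ?thesis using b Vi Vi1 per2 by simp
      next
        \<comment> \<open>For \<open>n - k = 1\<close> the label 2 already belongs to row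
          \<open>k\<close>, and the return condition carries its vertex back to row 0.\<close>
        case True
        obtain c where c: "0 < c" "v (3 * k + 1 + N) = c *\<^sub>R ?V (N + 1)" using V3 by blast
        then have "v (j + 4) = c *\<^sub>R ?V 2" using True j by (simp add: eval_nat_numeral)
        then have "0 < c * br (?V i) (?V (i + 1)) (?V (i + 2))" using b Vi Vi1 per2 by simp
        then show ?thesis using c(1) by (metis zero_less_mult_pos)
      qed
    qed
  qed
  have consA: "0 < br (?V i) (?V (i + 1)) (?V (i + 2))" for i
  proof (rule range_extend[where P = "\<lambda>i. 0 < br (?V i) (?V (i + 1)) (?V (i + 2))" and n = n])
    fix i j :: nat assume h: "i mod n = j mod n" and p: "0 < br (?V i) (?V (i + 1)) (?V (i + 2))"
    have "(i + 1) mod n = (j + 1) mod n" "(i + 2) mod n = (j + 2) mod n" using h by (metis mod_add_left_eq)+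
    then show "0 < br (?V j) (?V (j + 1)) (?V (j + 2))"
      using p h period_cong[where v = ?V and n = n, OF per] by metis
  qed (use cons n in auto)
  have posV: "posc n ?V"
  proof (rule posc_of_weak[where v = ?V and n = n, OF per n(1) _ consA])
    fix i j l :: nat assume "1 \<le> i" "i < j" "j < l" "l \<le> n"
    then show "0 \<le> br (?V i) (?V j) (?V l)" using v by (simp add: normal_rows_def)
  qed
  have a: "adv n k ?V ?W"
  proof (rule adv_rangeI)
    fix i assume i: "n - k < i" "1 \<le> i" "i \<le> n"
    define m where "m = n - i"
    have m: "m < k" "i = n + 1 - (m + 1)" "i + 1 = n + 1 - m" using i by (auto simp: m_def)
    define p where "p = r m"
    define j where "j = 3 * k + 1 - 3 * (m + 1)"
    have j: "3 * k + 1 - 3 * m = j + 3" "3 * k + 2 - 3 * (m + 1) = j + 1" using m by (auto simp: j_def)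
    have V: "?V i = nrow p j" "?V (i + 1) = p (j + 3)" using V2[of "m + 1"] V2[of m] m j rS by (simp_all add: p_def j_def)
    have "\<not> i \<le> n - k" "n + 1 - i = m + 1" using i by (auto simp: m_def)
    then have W: "?W i = nrow p (j + 1)" using i j rS[of m] by (simp add: row_marks_def p_def r_def)
    have pp: "0 < al p l" "0 < ga p l" "0 < ep p l" for l using pos[of m] ep[of m] m by (simp_all add: p_def)
    have "?W i = (1 / ga p j) *\<^sub>R (ga p j *\<^sub>R nrow p (j + 1))" using pp(2)[of j] by (simp add: W)
    also have "\<dots> = (al p (j + 2) / ga p j) *\<^sub>R nrow p j + (ep p j * al p (j + 1) / ga p j) *\<^sub>R p (j + 3)"
      unfolding nrow_next by (simp add: scaleR_add_right)
    finally show "ocone (?V i) (?V (i + 1)) (?W i)" unfolding V using pp by (auto intro: oconeI)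
  next
    fix i assume "1 \<le> i" "i \<le> n - k"
    then show "?W i = ?V (i + 1)" using n by (simp add: row_marks_def)
  qed (use n in auto)
  have "seed_of n k (row_polygon n k v) (row_marks n k v) = seed_of n k ?V ?W"
    unfolding seed_of_def by (auto simp: fun_eq_iff)
  then show ?thesis using posV a by (simp add: lift_def)
qed

section \<open>Bringing an orbit into normalized form\<close>

lemma brackets_scaled:
  assumes p: "\<And>j. p j = c j *\<^sub>R (M *v p' j)"
  shows "al p j = det M * (c j * c (j + 1) * c (j + 2)) * al p' j"
    "be p j = det M * (c j * c (j + 1) * c (j + 3)) * be p' j"
    "ga p j = det M * (c j * c (j + 2) * c (j + 3)) * ga p' j"
    "ep p j = det M * (c j * c (j + 2) * c (j + 4)) * ep p' j"
  unfolding al_def be_def ga_def ep_def p by (simp_all add: br_mult mult_ac)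

lemma nrow_scaled:
  assumes p: "\<And>j. p j = c j *\<^sub>R (M *v p' j)"
  shows "nrow p j = (det M * (c j * c (j + 1) * c (j + 2) * c (j + 3))) *\<^sub>R (M *v nrow p' j)"
  unfolding nrow_def brackets_scaled[OF p] p[of "j + 1"] p[of "j + 3"]
  by (simp add: matrix_vector_right_distrib matrix_vector_mult_scaleR scaleR_add_right mult_ac)

lemma invariants_scaled:
  assumes p: "\<And>j. p j = c j *\<^sub>R (M *v p' j)" and c: "\<And>j. 0 < c j" and M: "0 < det M"
  shows "xi p j = xi p' j" "eta p j = eta p' j" "theta p j = theta p' j"
proof -
  have nz: "c j \<noteq> 0" "det M \<noteq> 0" for j using c[of j] M by auto
  have i: "j + 2 + 1 = j + 3" "j + 2 + 2 = j + 4" "j + 1 + 2 = j + 3" "j + 1 + 3 = j + 4" "j + 1 + 1 = j + 2" for j :: nat by simp_all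
  have "xi p j = ((det M * det M * (c j * c (j+1) * c (j+2) * (c (j+3) * c (j+3)) * c (j+4))) * (be p' j * al p' (j + 2))) /
     ((det M * det M * (c j * c (j+1) * c (j+2) * (c (j+3) * c (j+3)) * c (j+4))) * (ga p' j * ga p' (j + 1)))"
    unfolding xi_def brackets_scaled[OF p] i by (simp only: mult_ac)
  also have "\<dots> = xi p' j" unfolding xi_def by (rule mult_divide_mult_cancel_left) (simp add: nz)
  finally show "xi p j = xi p' j" .
  have "eta p j = ((det M * det M * (c j * (c (j+1) * c (j+1)) * c (j+2) * c (j+3) * c (j+4))) * (ga p' (j + 1) * al p' j)) /
     ((det M * det M * (c j * (c (j+1) * c (j+1)) * c (j+2) * c (j+3) * c (j+4))) * (be p' (j + 1) * be p' j))"
    unfolding eta_def brackets_scaled[OF p] i by (simp only: mult_ac)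
  also have "\<dots> = eta p' j" unfolding eta_def by (rule mult_divide_mult_cancel_left) (simp add: nz)
  finally show "eta p j = eta p' j" .
  have "theta p j = ((det M * det M * (c j * c (j+1) * (c (j+2) * c (j+2)) * c (j+3) * c (j+4))) * (ep p' j * al p' (j + 1))) /
     ((det M * det M * (c j * c (j+1) * (c (j+2) * c (j+2)) * c (j+3) * c (j+4))) * (ga p' j * be p' (j + 1)))"
    unfolding theta_def brackets_scaled[OF p] i by (simp only: mult_ac)
  also have "\<dots> = theta p' j" unfolding theta_def by (rule mult_divide_mult_cancel_left) (simp add: nz)
  finally show "theta p j = theta p' j" .
qed

lemma frame_map:
  assumes b: "0 < br a b c"
  shows "\<exists>M. 0 < det M \<and> M *v a = e1 \<and> M *v b = e2 \<and> M *v c = e3"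
proof -
  define L :: "real^3 \<Rightarrow> real^3" where "L x = vector [br x b c / br a b c, br a x c / br a b c, br a b x / br a b c]" for x
  have lin: "linear L" by (rule linearI) (simp_all add: L_def vec_eq_iff forall_3 add_divide_distrib)
  have M: "matrix L *v x = L x" for x using matrix_works[of L x] lin by (simp add: linear_matrix_vector_mul_eq)
  have e: "matrix L *v a = e1" "matrix L *v b = e2" "matrix L *v c = e3"
    unfolding M using b by (simp_all add: L_def e1_def e2_def e3_def)
  have "br e1 e2 e3 = det (matrix L) * br a b c" unfolding e[symmetric] by (rule br_mult)
  then have "0 < det (matrix L)" using b by (metis br_e(1) zero_less_mult_pos2 zero_less_one)
  then show ?thesis using e by blast
qed

lemma recursive_seq:
  fixes F :: "nat \<Rightarrow> real \<Rightarrow> real \<Rightarrow> real"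
  shows "\<exists>l. l 0 = a \<and> l 1 = b \<and> l 2 = c \<and> l 3 = d \<and> (\<forall>j. l (j + 4) = F j (l (j + 2)) (l (j + 3)))"
proof -
  define h where "h = rec_nat (c, d) (\<lambda>j x. (snd x, F j (fst x) (snd x)))"
  have h: "h 0 = (c, d)" "h (Suc j) = (snd (h j), F j (fst (h j)) (snd (h j)))" for j by (simp_all add: h_def)
  define l where "l j = (if j = 0 then a else if j = 1 then b else fst (h (j - 2)))" for j
  have l2: "l (j + 2) = fst (h j)" for j by (simp add: l_def)
  have l3: "l (j + 3) = snd (h j)" for j using l2[of "Suc j"] h(2)[of j] by (simp add: eval_nat_numeral)
  have "l (j + 4) = F j (l (j + 2)) (l (j + 3))" for j
    using l3[of "Suc j"] h(2)[of j] l2 l3 by (simp add: eval_nat_numeral)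
  then show ?thesis using l2[of 0] l3[of 0] h(1) by (intro exI[of _ l]) (simp add: l_def numeral_2_eq_2)
qed

lemma theta_shift: "theta (\<lambda>j. p (j + d)) j = theta p (j + d)"
  by (simp add: theta_def al_def be_def ga_def ep_def add_ac)

lemma nrow_shift: "nrow (\<lambda>j. p (j + d)) j = nrow p (j + d)"
  by (simp add: nrow_def al_def ga_def add_ac)

text \<open>One matrix and positive factors are applied to a row of \<open>P\<close>: the matrix and
  the first four factors normalize the first four vectors, and the later factors are determined by
  the condition that consecutive brackets are 1.\<close>

lemma orbit_normal:
  assumes n: "4 \<le> n" "1 \<le> k" "k \<le> n - 1" and s: "s \<in> seeds n k"
    and bound: "\<And>a. \<kappa> \<le> rxi (\<lambda>a. vtx n k s a 0) a \<and> \<kappa> \<le> reta (\<lambda>a. vtx n k s a 0) a \<and>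
      (\<forall>m<k. \<kappa> \<le> rtheta (\<lambda>a. vtx n k s a m) a)"
  shows "\<exists>v\<in>normal_rows n k \<kappa>. \<exists>M. invertible M \<and>
    seed_of n k (row_polygon n k v) (row_marks n k v) = pact n k M (orb n k s q)"
proof -
  \<comment> \<open>\<open>row_polygon\<close> reads off the polygon with index
    \<open>3 * k + 1\<close>, so the row has to start that far before \<open>q\<close>.\<close>
  define a where "a = q - (3 * int k + 1)"
  obtain H where H: "spiral_lift n k H" "\<And>q. lift n k (H q) (H (Suc q)) (orb n k s (a + int q))"
    "\<And>q m. m \<le> k \<Longrightarrow> vtx n k s (a + int q) m = proj (H q (n + 1 - m))"
    using local_lift[OF n s, of a thesis] by blast
  interpret spiral_lift n k H by (rule H(1))
  have k0: "0 < k" using n by simp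
  \<comment> \<open>The time shift by \<open>3 * m\<close> is that of \<open>nrow_proj\<close>: it
    makes \<open>nrow (G m)\<close> proportional to \<open>G (m + 1)\<close> at equal
    labels.\<close>
  define G where "G m j = H (j + 3 * m) (n + 1 - m)" for m j
  define g where "g = G 0"
  have mutn: "mut n k n" using mut_row[of 0] k0 by simp
  have g: "g = (\<lambda>q. H q (n + 1))" by (simp add: g_def G_def fun_eq_iff)
  have gp: "0 < al g j" "0 < be g j" "0 < ga g j" for j
    using row_positive[OF mutn, of j] unfolding g by simp_all
  \<comment> \<open>The coefficients of \<open>g 3\<close> in the basis \<open>g 0\<close>,
    \<open>g 1\<close>, \<open>g 2\<close>, up to the sign of the middle one. Sending the rescaled
    basis to \<open>e1\<close>, \<open>e2\<close>, \<open>e3\<close> sends \<open>g 3\<close> to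
    \<open>e1 - e2 + e3\<close>.\<close>
  define l0 l1 l2 where "l0 = al g 1 / al g 0" "l1 = ga g 0 / al g 0" "l2 = be g 0 / al g 0"
  have lp: "0 < l0" "0 < l1" "0 < l2" using gp by (simp_all add: l0_l1_l2_def)
  have g3: "g 3 = l0 *\<^sub>R g 0 - l1 *\<^sub>R g 1 + l2 *\<^sub>R g 2"
  proof -
    have "ga g 0 *\<^sub>R g 1 + al g 0 *\<^sub>R g 3 = al g 1 *\<^sub>R g 0 + be g 0 *\<^sub>R g 2"
      using nrow_alt[of g 0] nrow_def[of g 0] by (simp add: numeral_2_eq_2)
    then have "al g 0 *\<^sub>R g 3 = al g 1 *\<^sub>R g 0 - ga g 0 *\<^sub>R g 1 + be g 0 *\<^sub>R g 2" by (simp add: algebra_simps)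
    then have "(1 / al g 0) *\<^sub>R (al g 0 *\<^sub>R g 3) = (1 / al g 0) *\<^sub>R (al g 1 *\<^sub>R g 0 - ga g 0 *\<^sub>R g 1 + be g 0 *\<^sub>R g 2)" by simp
    then show ?thesis using gp(1)[of 0] by (simp add: l0_l1_l2_def scaleR_add_right scaleR_diff_right)
  qed
  have "0 < br (l0 *\<^sub>R g 0) (l1 *\<^sub>R g 1) (l2 *\<^sub>R g 2)"
    using lp gp(1)[of 0] by (simp add: al_def numeral_2_eq_2)
  from frame_map[OF this] obtain M where M: "0 < det M" "M *v (l0 *\<^sub>R g 0) = e1" "M *v (l1 *\<^sub>R g 1) = e2" "M *v (l2 *\<^sub>R g 2) = e3"
    by blast
  have Mi: "invertible M" using M(1) by (simp add: invertible_det_nz)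
  \<comment> \<open>The recursion solves \<open>al v (j + 2) = 1\<close> for the factor of the last
    vector; the first two brackets are 1 by the choice of the frame.\<close>
  obtain l where l: "l 0 = l0" "l 1 = l1" "l 2 = l2" "l 3 = 1"
    "\<And>j. l (j + 4) = 1 / (det M * l (j + 2) * l (j + 3) * al g (j + 2))"
    using recursive_seq[of l0 l1 l2 1 "\<lambda>j x y. 1 / (det M * x * y * al g (j + 2))"] by blast
  have lpos: "0 < l j" for j
  proof (induction j rule: less_induct)
    case (less j)
    show ?case
    proof (cases "j < 4")
      case True
      then have "j = 0 \<or> j = 1 \<or> j = 2 \<or> j = 3" by linarith
      then show ?thesis using l lp by auto
    next
      case False
      then obtain i where i: "j = i + 4" by (metis add.commute le_Suc_ex not_less)
      then show ?thesis using less[of "i + 2"] less[of "i + 3"] M(1) gp(1)[of "i + 2"] by (simp add: l(5))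
    qed
  qed
  define v where "v j = l j *\<^sub>R (M *v g j)" for j
  have v0: "v 0 = e1" "v 1 = e2" "v 2 = e3" "v 3 = e1 - e2 + e3"
  proof -
    show v012: "v 0 = e1" "v 1 = e2" "v 2 = e3" using M l by (simp_all add: v_def matrix_vector_mult_scaleR)
    have "v 3 = M *v (l0 *\<^sub>R g 0) - M *v (l1 *\<^sub>R g 1) + M *v (l2 *\<^sub>R g 2)"
      unfolding v_def l(4) g3 by (simp add: matrix_vector_right_distrib matrix_vector_mult_diff_distrib)
    then show "v 3 = e1 - e2 + e3" unfolding M .
  qed
  note sc = brackets_scaled[of v l M g, OF v_def]
  note inv = invariants_scaled[of v l M g, OF v_def lpos M(1)]
  have al1: "al v j = 1" for j
  proof -
    consider "j = 0" | "j = 1" | i where "j = i + 2" by (metis One_nat_def add_2_eq_Suc' not0_implies_Suc)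
    then show ?thesis
    proof cases
      case 1 then show ?thesis using v0 by (simp add: al_def numeral_2_eq_2)
    next
      case 2
      then have "al v j = br e2 e3 (e1 - e2 + e3)" using v0 by (simp add: al_def numeral_2_eq_2 numeral_3_eq_3)
      then show ?thesis by simp
    next
      case 3
      have "al v j = det M * (l (i + 2) * l (i + 3) * l (i + 4)) * al g (i + 2)"
        using sc(1)[of j] 3 by (simp add: eval_nat_numeral)
      then show ?thesis unfolding l(5) using M(1) lpos[of "i+2"] lpos[of "i+3"] gp(1)[of "i+2"] by (simp add: field_simps)
    qed
  qed
  have vp: "0 < be v j" "0 < ga v j" for j
    unfolding sc using M(1) lpos gp by simp_all
  have nzH: "H q i \<noteq> 0" for q i using posc_nonzero[OF pos] n by simp
  have f0: "vtx n k s (a + int j) 0 = proj (g j)" for j using H(3)[of 0 j] by (simp add: g)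
  have I0: "rxi (\<lambda>a. vtx n k s a 0) (a + int j) = xi g j" "reta (\<lambda>a. vtx n k s a 0) (a + int j) = eta g j" for j
    using row_invariants[of "\<lambda>a. vtx n k s a 0" a g, OF f0] nzH by (simp_all add: g)
  have X: "\<kappa> \<le> xi v j" "xi v j \<le> 1" "\<kappa> \<le> eta v j" "eta v j \<le> 1" for j
    using bound[of "a + int j"] row_local(2,4)[OF n s k0, of "a + int j"] unfolding inv I0 by simp_all
  have B: "be v j \<le> ga v j * ga v (j + 1)" "\<kappa> * (ga v j * ga v (j + 1)) \<le> be v j"
    "ga v (j + 1) \<le> be v (j + 1) * be v j" "\<kappa> * (be v (j + 1) * be v j) \<le> ga v (j + 1)" for j
    using X[of j] vp[of j] vp[of "j + 1"] unfolding xi_def eta_def al1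
    by (simp_all add: le_divide_eq divide_le_eq)
  have rows: "\<exists>c. (\<forall>j. 0 < c j) \<and> (\<forall>j. (nrow ^^ m) v j = c j *\<^sub>R (M *v G m j))" if "m \<le> k" for m
    using that
  proof (induction m)
    case 0
    show ?case using lpos v_def by (intro exI[of _ l]) (simp add: g_def)
  next
    case (Suc m)
    then obtain c where c: "\<And>j. 0 < c j" "\<And>j. (nrow ^^ m) v j = c j *\<^sub>R (M *v G m j)" by auto
    define i where "i = n - m"
    have i: "n + 1 - m = i + 1" "n + 1 - Suc m = i" "mut n k i" using mut_row[of m] Suc n by (auto simp: i_def)
    have Gm: "G m = (\<lambda>j. H (j + 3 * m) (i + 1))" by (rule ext) (simp only: G_def i)
    have "\<exists>d>0. nrow (G m) j = d *\<^sub>R G (Suc m) j" for j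
      using nrow_proj[OF i(3), of "j + 3 * m"] nrow_shift[of "\<lambda>q. H q (i + 1)" "3 * m" j]
      unfolding Gm by (simp add: G_def i_def[symmetric] add_ac)
    then obtain d where d: "\<And>j. 0 < d j" "\<And>j. nrow (G m) j = d j *\<^sub>R G (Suc m) j" by metis
    have "(nrow ^^ Suc m) v j = (det M * (c j * c (j + 1) * c (j + 2) * c (j + 3)) * d j) *\<^sub>R (M *v G (Suc m) j)" for j
      using nrow_scaled[of "(nrow ^^ m) v" c M "G m" j, OF c(2)] d(2)[of j] by (simp add: matrix_vector_mult_scaleR)
    moreover have "0 < det M * (c j * c (j + 1) * c (j + 2) * c (j + 3)) * d j" for j using c(1) d(1) M(1) by simp
    ultimately show ?case by (intro exI[of _ "\<lambda>j. det M * (c j * c (j + 1) * c (j + 2) * c (j + 3)) * d j"]) blast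
  qed
  have T: "\<kappa> * (ga ((nrow ^^ m) v) j * be ((nrow ^^ m) v) (j + 1)) \<le> ep ((nrow ^^ m) v) j * al ((nrow ^^ m) v) (j + 1)"
    if m: "m < k" for m j
  proof -
    obtain c where c: "\<And>j. 0 < c j" "\<And>j. (nrow ^^ m) v j = c j *\<^sub>R (M *v G m j)" using rows[of m] m by auto
    define i where "i = n - m"
    have i: "n + 1 - m = i + 1" "mut n k i" using mut_row[OF m] m n by (auto simp: i_def)
    define p where "p = (\<lambda>q. H q (i + 1))"
    have Gm: "G m = (\<lambda>j. p (j + 3 * m))" by (rule ext) (simp only: G_def i p_def)
    have fm: "vtx n k s (a + int j) m = proj (p j)" for j using H(3)[of m j] m unfolding p_def i(1) by simp
    have "theta ((nrow ^^ m) v) j = theta (G m) j" by (rule invariants_scaled(3)[OF c(2,1) M(1)])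
    also have "\<dots> = theta p (j + 3 * m)" unfolding Gm by (rule theta_shift)
    also have "\<dots> = rtheta (\<lambda>a. vtx n k s a m) (a + int (j + 3 * m))"
      by (rule row_invariants(3)[where f = "\<lambda>b. vtx n k s b m" and p = p, symmetric]) (simp_all add: fm, simp add: p_def nzH)
    finally have "\<kappa> \<le> theta ((nrow ^^ m) v) j" using bound m by simp
    moreover have "0 < ga (G m) j" "0 < be (G m) (j + 1)"
      using row_positive(3)[OF i(2), of "j + 3 * m"] row_positive(2)[OF i(2), of "j + 1 + 3 * m"]
      unfolding Gm p_def by (simp_all add: ga_def be_def add_ac)
    then have "0 < ga ((nrow ^^ m) v) j" "0 < be ((nrow ^^ m) v) (j + 1)"
      unfolding brackets_scaled[OF c(2)] using c(1) M(1) by simp_all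
    ultimately show ?thesis unfolding theta_def by (simp add: le_divide_eq)
  qed
  have C: "(\<forall>z. br ((nrow ^^ k) v j) (v (j + 2 * k + n)) z = 0) \<and> 0 \<le> inner ((nrow ^^ k) v j) (v (j + 2 * k + n))" for j
  proof -
    obtain c where c: "\<And>j. 0 < c j" "\<And>j. (nrow ^^ k) v j = c j *\<^sub>R (M *v G k j)" using rows[of k] by auto
    have e: "j + 3 * k + (n - k) = j + 2 * k + n" using n by simp
    have "G k j = g (j + 2 * k + n)" unfolding G_def row_k e g ..
    then have 1: "(nrow ^^ k) v j = c j *\<^sub>R (M *v g (j + 2 * k + n))" using c(2) by simp
    have "0 \<le> c j * (l (j + 2 * k + n) * inner (M *v g (j + 2 * k + n)) (M *v g (j + 2 * k + n)))"
      by (intro mult_nonneg_nonneg less_imp_le[OF c(1)] less_imp_le[OF lpos] inner_ge_zero)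
    then show ?thesis unfolding 1 by (simp add: v_def mult.left_commute)
  qed
  define a0 where "a0 = 3 * k + 1"
  have P: "\<exists>c>0. row_polygon n k v i = c *\<^sub>R (M *v H a0 i)" if i: "1 \<le> i" "i \<le> n" for i
  proof (cases "i \<le> n - k")
    case True
    have "H a0 (1 + (i - 1)) = H (a0 + (i - 1)) 1" by (rule imm_shift) (use True i in simp)
    moreover have "H (a0 + (i - 1)) (1 + n) = H (a0 + (i - 1)) 1" by (rule period)
    moreover have "a0 + (i - 1) = 3 * k + i" using i by (simp add: a0_def)
    ultimately have "H a0 i = g (3 * k + i)" using i by (simp add: g)
    then show ?thesis using lpos True by (intro exI[of _ "l (3 * k + i)"]) (simp add: row_polygon_def v_def)
  next
    case False
    define m where "m = n + 1 - i"
    have m: "m \<le> k" "n + 1 - m = i" using False i n by (auto simp: m_def)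
    obtain c where c: "\<And>j. 0 < c j" "\<And>j. (nrow ^^ m) v j = c j *\<^sub>R (M *v G m j)" using rows[OF m(1)] by auto
    have "G m (3 * k + 1 - 3 * m) = H a0 i" unfolding G_def m(2) using m(1) by (simp add: a0_def)
    moreover have "row_polygon n k v i = (nrow ^^ m) v (3 * k + 1 - 3 * m)" using False by (simp only: row_polygon_def m_def if_False)
    ultimately show ?thesis using c by metis
  qed
  have PB: "\<exists>c>0. row_marks n k v i = c *\<^sub>R (M *v H (Suc a0) i)" if i: "n - k + 1 \<le> i" "i \<le> n" for i
  proof -
    define m where "m = n + 1 - i"
    have m: "m \<le> k" "n + 1 - m = i" using i n by (auto simp: m_def)
    obtain c where c: "\<And>j. 0 < c j" "\<And>j. (nrow ^^ m) v j = c j *\<^sub>R (M *v G m j)" using rows[OF m(1)] by auto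
    have "G m (3 * k + 2 - 3 * m) = H (Suc a0) i" unfolding G_def m(2) using m(1) by (simp add: a0_def)
    moreover have "\<not> i \<le> n - k" using i by simp
    then have "row_marks n k v i = (nrow ^^ m) v (3 * k + 2 - 3 * m)" by (simp only: row_marks_def m_def if_False)
    ultimately show ?thesis using c by metis
  qed
  have W: "0 \<le> br (row_polygon n k v i) (row_polygon n k v j) (row_polygon n k v r)" if h: "1 \<le> i" "i < j" "j < r" "r \<le> n" for i j r
  proof -
    obtain c1 c2 c3 where c: "0 < c1" "0 < c2" "0 < c3" "row_polygon n k v i = c1 *\<^sub>R (M *v H a0 i)"
      "row_polygon n k v j = c2 *\<^sub>R (M *v H a0 j)" "row_polygon n k v r = c3 *\<^sub>R (M *v H a0 r)"
      using P[of i] P[of j] P[of r] h by auto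
    have "0 < br (H a0 i) (H a0 j) (H a0 r)" by (rule poscD[OF pos]) (use h in auto)
    then show ?thesis unfolding c(4-6) using c(1-3) M(1) by (simp add: br_mult less_imp_le)
  qed
  have "v \<in> normal_rows n k \<kappa>"
    unfolding normal_rows_def using v0 al1 B T C W by simp
  moreover have "seed_of n k (row_polygon n k v) (row_marks n k v) = pact n k M (orb n k s q)"
  proof -
    have e: "a + int a0 = q" by (simp add: a_def a0_def)
    have o: "orb n k s q = seed_of n k (H a0) (H (Suc a0))" using H(2)[of a0] unfolding e by (simp add: lift_def)
    have "proj (row_polygon n k v i) = papply M (proj (H a0 i))" if i: "1 \<le> i" "i \<le> n" for i
      using P[OF i] by (auto simp: papply_proj[OF Mi nzH] proj_scale)
    moreover have "proj (row_marks n k v i) = papply M (proj (H (Suc a0) i))" if i: "n - k + 1 \<le> i" "i \<le> n" for i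
      using PB[OF i] by (auto simp: papply_proj[OF Mi nzH] proj_scale)
    ultimately show ?thesis unfolding o pact_def seed_of_def by (auto simp: fun_eq_iff)
  qed
  ultimately show ?thesis using Mi by blast
qed

section \<open>The space of spirals\<close>

lemma continuous_on_proj: "continuous_on (- {0}) proj"
proof -
  have "open (proj -` B \<inter> - {0})" if "open B" for B
  proof -
    have "{v. v \<noteq> 0 \<and> proj v \<in> B} = proj -` B \<inter> - {0}" by auto
    then show ?thesis using that unfolding open_rp2_def by metis
  qed
  then show ?thesis by (subst continuous_on_open_vimage) auto
qed

text \<open>The complement of a projective line, hence an affine chart.\<close>

definition dual_chart :: "real^3 \<Rightarrow> rp2 set" where
  "dual_chart z = {x. rep x \<bullet> z \<noteq> 0}"

lemma dual_chart_iff: "v \<noteq> 0 \<Longrightarrow> proj v \<in> dual_chart z \<longleftrightarrow> v \<bullet> z \<noteq> 0"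
  using rep_proj[of v] by (auto simp: dual_chart_def)

lemma open_dual_chart: "open (dual_chart z)"
proof -
  have "v \<noteq> 0 \<and> proj v \<in> dual_chart z \<longleftrightarrow> v \<bullet> z \<noteq> 0" for v
    by (cases "v = 0") (auto simp: dual_chart_iff)
  then have "{v. v \<noteq> 0 \<and> proj v \<in> dual_chart z} = {v. v \<bullet> z \<noteq> 0}" by simp
  moreover have "open {v. v \<bullet> z \<noteq> 0}" by (intro open_Collect_neq continuous_intros)
  ultimately show ?thesis unfolding open_rp2_def by simp
qed

text \<open>\<open>rep\<close> is an arbitrary choice of representatives; normalizing the inner
  product with \<open>z\<close> to 1 makes it a continuous local section.\<close>

lemma continuous_on_section: "continuous_on (dual_chart z) (\<lambda>x. (1 / (rep x \<bullet> z)) *\<^sub>R rep x)"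
proof -
  let ?s = "\<lambda>x. (1 / (rep x \<bullet> z)) *\<^sub>R rep x"
  have s: "?s (proj v) = (1 / (v \<bullet> z)) *\<^sub>R v" if v: "v \<noteq> 0" for v
  proof -
    obtain c where "c \<noteq> 0" "rep (proj v) = c *\<^sub>R v" using rep_proj[OF v] by blast
    then show ?thesis by simp
  qed
  have "open (?s -` B \<inter> dual_chart z)" if B: "open B" for B
  proof -
    have "v \<noteq> 0 \<and> proj v \<in> ?s -` B \<inter> dual_chart z \<longleftrightarrow> v \<bullet> z \<noteq> 0 \<and> (1 / (v \<bullet> z)) *\<^sub>R v \<in> B" for v
      by (cases "v = 0") (simp_all add: dual_chart_iff s conj_commute del: vimage_Int)
    then have "{v. v \<noteq> 0 \<and> proj v \<in> ?s -` B \<inter> dual_chart z} = {v. v \<bullet> z \<noteq> 0} \<inter> (\<lambda>v. (1 / (v \<bullet> z)) *\<^sub>R v) -` B"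
      by blast
    moreover have o: "open {v. v \<bullet> z \<noteq> 0}" by (intro open_Collect_neq continuous_intros)
    have "continuous_on {v. v \<bullet> z \<noteq> 0} (\<lambda>v. (1 / (v \<bullet> z)) *\<^sub>R v)" by (intro continuous_intros) auto
    then have "open ((\<lambda>v. (1 / (v \<bullet> z)) *\<^sub>R v) -` B \<inter> {v. v \<bullet> z \<noteq> 0})"
      using B continuous_on_open_vimage[OF o] by blast
    ultimately show ?thesis unfolding open_rp2_def by (simp only: Int_commute)
  qed
  then show ?thesis by (subst continuous_on_open_vimage[OF open_dual_chart]) auto
qed

section \<open>Frame coordinates and their continuity\<close>

lemma continuous_map_local:
  assumes "\<And>x. x \<in> topspace X \<Longrightarrow> \<exists>U. openin X U \<and> x \<in> U \<and> continuous_map (subtopology X U) Y f"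
  shows "continuous_map X Y f"
  unfolding continuous_map_def
proof (intro conjI allI impI)
  show "f \<in> topspace X \<rightarrow> topspace Y"
  proof
    fix x assume x: "x \<in> topspace X"
    then obtain U where "openin X U" "x \<in> U" "continuous_map (subtopology X U) Y f" using assms by blast
    then show "f x \<in> topspace Y" using x by (auto simp: continuous_map_def)
  qed
  fix V assume V: "openin Y V"
  show "openin X {x \<in> topspace X. f x \<in> V}"
  proof (subst openin_subopen, intro ballI)
    fix x assume x: "x \<in> {x \<in> topspace X. f x \<in> V}"
    then obtain U where U: "openin X U" "x \<in> U" "continuous_map (subtopology X U) Y f" using assms by blast
    let ?T = "{y \<in> topspace (subtopology X U). f y \<in> V}"
    have "openin (subtopology X U) ?T" using U(3) V by (rule openin_continuous_map_preimage)
    then have "openin X ?T" using U(1) openin_trans_full by blast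
    then show "\<exists>T. openin X T \<and> x \<in> T \<and> T \<subseteq> {x \<in> topspace X. f x \<in> V}"
      using x U(2) by (intro exI[of _ ?T]) auto
  qed
qed

lemma continuous_map_Pair_euclidean:
  assumes "continuous_map X euclidean f" "continuous_map X euclidean g"
  shows "continuous_map X euclidean (\<lambda>x. (f x, g x))"
  using continuous_map_pairedI[OF assms] prod_topology_subtopology_eu[of UNIV UNIV] by simp

text \<open>\<open>frame a b c d x\<close> are homogeneous coordinates of \<open>x\<close> with respect to the projective frame
  \<open>a, b, c, d\<close>, with denominators cleared.\<close>

definition frame :: "real^3 \<Rightarrow> real^3 \<Rightarrow> real^3 \<Rightarrow> real^3 \<Rightarrow> real^3 \<Rightarrow> real^3" where
  "frame a b c d x = vector [br x b c * br a d c * br a b d, br a x c * br d b c * br a b d, br a b x * br d b c * br a d c]"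

text \<open>The orthogonal projection onto the line spanned by \<open>w\<close> represents the projective point of \<open>w\<close>
  in a Hausdorff space.\<close>

definition outer :: "real^3 \<Rightarrow> real^3^3" where
  "outer w = (\<chi> i j. w $ i * w $ j / (w \<bullet> w))"

lemma outer_mult: "outer w *v y = ((w \<bullet> y) / (w \<bullet> w)) *\<^sub>R w"
  by (simp add: outer_def matrix_vector_mult_def vec_eq_iff inner_vec_def sum_divide_distrib sum_distrib_left mult_ac)

lemma outer_scale: "r \<noteq> 0 \<Longrightarrow> outer (r *\<^sub>R w) = outer w"
  by (simp add: outer_def vec_eq_iff)

lemma outer_eqD:
  assumes "outer w = outer w'" "w \<noteq> 0" "w' \<noteq> 0"
  shows "proj w = proj w'"
proof -
  have "w' = outer w' *v w'" using assms(3) by (simp add: outer_mult)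
  also have "\<dots> = ((w \<bullet> w') / (w \<bullet> w)) *\<^sub>R w" unfolding assms(1)[symmetric] outer_mult ..
  finally show ?thesis using assms(3) proj_scale by (metis scale_eq_0_iff)
qed

lemma continuous_on_outer: "continuous_on (- {0}) outer"
  unfolding outer_def by (intro continuous_intros) auto

definition nondeg :: "real^3 \<Rightarrow> real^3 \<Rightarrow> real^3 \<Rightarrow> real^3 \<Rightarrow> bool" where
  "nondeg a b c d \<longleftrightarrow> br a b c \<noteq> 0 \<and> br a d c \<noteq> 0 \<and> br a b d \<noteq> 0 \<and> br d b c \<noteq> 0"

lemma frame_nonzero:
  assumes "nondeg a b c d" "x \<noteq> 0"
  shows "frame a b c d x \<noteq> 0"
proof
  assume z: "frame a b c d x = 0"
  have "br x b c = 0" "br a x c = 0" "br a b x = 0"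
    using assms(1) arg_cong[OF z, of "\<lambda>w. w $ 1"] arg_cong[OF z, of "\<lambda>w. w $ 2"] arg_cong[OF z, of "\<lambda>w. w $ 3"]
    by (auto simp: frame_def nondeg_def)
  then have "x = 0" using br_basis[of a b c x] assms(1) by (simp add: nondeg_def)
  then show False using assms(2) by simp
qed

lemma frame_scale:
  "frame (ra *\<^sub>R a) (rb *\<^sub>R b) (rc *\<^sub>R c) (rd *\<^sub>R d) (rx *\<^sub>R x) =
     (ra * ra * (rb * rb) * (rc * rc) * (rd * rd) * rx) *\<^sub>R frame a b c d x"
  by (simp add: frame_def vec_eq_iff forall_3 mult_ac)

lemma frame_mult: "frame (M *v a) (M *v b) (M *v c) (M *v d) (M *v x) = (det M * det M * det M) *\<^sub>R frame a b c d x"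
  by (simp add: frame_def vec_eq_iff forall_3 br_mult mult_ac)

lemma frame_matrix:
  assumes "nondeg a b c d"
  shows "\<exists>M. invertible M \<and> (\<forall>x. M *v x = frame a b c d x)"
proof -
  have lin: "linear (frame a b c d)"
    by (rule linearI) (simp_all add: frame_def vec_eq_iff forall_3 algebra_simps)
  show ?thesis using injective_matrix[OF lin] frame_nonzero[OF assms] by metis
qed

lemma vector_axis: "vector [x, y, z] = x *\<^sub>R axis 1 1 + y *\<^sub>R axis 2 1 + z *\<^sub>R (axis 3 1 :: real^3)"
  by (simp add: vec_eq_iff forall_3 axis_def)

lemma continuous_frame:
  "continuous_on {(a, b, c, d, x). nondeg a b c d \<and> x \<noteq> 0} (\<lambda>(a, b, c, d, x). outer (frame a b c d x))"
proof -
  have "continuous_on UNIV (\<lambda>y :: (real^3) \<times> (real^3) \<times> (real^3) \<times> (real^3) \<times> (real^3).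
      frame (fst y) (fst (snd y)) (fst (snd (snd y))) (fst (snd (snd (snd y)))) (snd (snd (snd (snd y)))))"
    unfolding frame_def vector_axis by (intro continuous_intros)
  then have "continuous_on {(a, b, c, d, x). nondeg a b c d \<and> x \<noteq> 0} (\<lambda>(a, b, c, d, x). frame a b c d x)"
    by (auto simp: case_prod_unfold intro: continuous_on_subset)
  then have "continuous_on {(a, b, c, d, x). nondeg a b c d \<and> x \<noteq> 0} (\<lambda>y. outer ((\<lambda>(a, b, c, d, x). frame a b c d x) y))"
    by (rule continuous_on_compose2[OF continuous_on_outer]) (auto simp: frame_nonzero)
  then show ?thesis by (simp add: case_prod_unfold)
qed

definition rframe :: "rp2 \<Rightarrow> rp2 \<Rightarrow> rp2 \<Rightarrow> rp2 \<Rightarrow> rp2 \<Rightarrow> real^3^3" where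
  "rframe a b c d x = outer (frame (rep a) (rep b) (rep c) (rep d) (rep x))"

lemma nondeg_scale:
  "ra \<noteq> 0 \<Longrightarrow> rb \<noteq> 0 \<Longrightarrow> rc \<noteq> 0 \<Longrightarrow> rd \<noteq> 0 \<Longrightarrow>
    nondeg (ra *\<^sub>R a) (rb *\<^sub>R b) (rc *\<^sub>R c) (rd *\<^sub>R d) = nondeg a b c d"
  by (simp add: nondeg_def)

lemma rframe_proj:
  assumes "a \<noteq> 0" "b \<noteq> 0" "c \<noteq> 0" "d \<noteq> 0" "x \<noteq> 0"
  shows "rframe (proj a) (proj b) (proj c) (proj d) (proj x) = outer (frame a b c d x)"
proof -
  obtain ra rb rc rd rx where r: "ra \<noteq> 0" "rb \<noteq> 0" "rc \<noteq> 0" "rd \<noteq> 0" "rx \<noteq> 0" "rep (proj a) = ra *\<^sub>R a"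
    "rep (proj b) = rb *\<^sub>R b" "rep (proj c) = rc *\<^sub>R c" "rep (proj d) = rd *\<^sub>R d" "rep (proj x) = rx *\<^sub>R x"
    using rep_proj assms by metis
  show ?thesis unfolding rframe_def r frame_scale by (rule outer_scale) (use r in simp)
qed

text \<open>No continuity of \<open>rep\<close> is available, but \<open>outer\<close> of
  \<open>frame\<close> ignores rescaling of all five vectors. Near each point the representatives
  may thus be replaced by continuous local sections.\<close>

lemma continuous_map_rframe:
  assumes p: "continuous_map X euclidean pa" "continuous_map X euclidean pb" "continuous_map X euclidean pc"
     "continuous_map X euclidean pd" "continuous_map X euclidean px"
    and nd: "\<And>s. s \<in> topspace X \<Longrightarrow> nondeg (rep (pa s)) (rep (pb s)) (rep (pc s)) (rep (pd s))"
  shows "continuous_map X euclidean (\<lambda>s. rframe (pa s) (pb s) (pc s) (pd s) (px s))"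
proof (rule continuous_map_local)
  fix s0 assume s0: "s0 \<in> topspace X"
  define sec where "sec z x = (1 / (rep x \<bullet> z)) *\<^sub>R rep x" for z :: "real^3" and x
  define za zb zc zd zx where "za = rep (pa s0)" "zb = rep (pb s0)" "zc = rep (pc s0)" "zd = rep (pd s0)" "zx = rep (px s0)"
  define U where "U = {s \<in> topspace X. pa s \<in> dual_chart za} \<inter> {s \<in> topspace X. pb s \<in> dual_chart zb} \<inter>
    {s \<in> topspace X. pc s \<in> dual_chart zc} \<inter> {s \<in> topspace X. pd s \<in> dual_chart zd} \<inter> {s \<in> topspace X. px s \<in> dual_chart zx}"
  have U: "openin X U" unfolding U_def
    by (intro openin_Int openin_continuous_map_preimage[where Y = euclidean] p) (simp_all add: open_dual_chart)
  have self: "y \<in> dual_chart (rep y)" for y using rep(1)[of y] by (simp add: dual_chart_def)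
  have "s0 \<in> U" unfolding U_def za_zb_zc_zd_zx_def using s0 self by simp
  have sc: "continuous_map (subtopology X U) euclidean (\<lambda>s. sec z (q s))"
    if q: "continuous_map X euclidean q" "U \<subseteq> {s \<in> topspace X. q s \<in> dual_chart z}" for q z
  proof -
    have "continuous_map (subtopology X U) (top_of_set (dual_chart z)) q"
      using q(2) by (intro continuous_map_into_subtopology continuous_map_from_subtopology[OF q(1)]) auto
    moreover have "continuous_map (top_of_set (dual_chart z)) euclidean (sec z)"
      using continuous_on_section[of z] by (simp add: sec_def[abs_def])
    ultimately have "continuous_map (subtopology X U) euclidean (sec z \<circ> q)" by (rule continuous_map_compose)
    then show ?thesis by (simp add: o_def)
  qed
  have c: "continuous_map (subtopology X U) euclidean (\<lambda>s. (sec za (pa s), sec zb (pb s), sec zc (pc s), sec zd (pd s), sec zx (px s)))"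
    by (intro continuous_map_Pair_euclidean sc p) (auto simp: U_def)
  have ne: "rep (pa s) \<bullet> za \<noteq> 0" "rep (pb s) \<bullet> zb \<noteq> 0" "rep (pc s) \<bullet> zc \<noteq> 0" "rep (pd s) \<bullet> zd \<noteq> 0" "rep (px s) \<bullet> zx \<noteq> 0"
    if "s \<in> U" for s using that by (auto simp: U_def dual_chart_def)
  let ?D = "{(a, b, c, d, x). nondeg a b c d \<and> x \<noteq> (0 :: real^3)}"
  have "(sec za (pa s), sec zb (pb s), sec zc (pc s), sec zd (pd s), sec zx (px s)) \<in> ?D" if "s \<in> U" for s
    using ne[OF that] nd[of s] that rep(1)[of "px s"] by (simp add: sec_def nondeg_scale U_def)
  then have "continuous_map (subtopology X U) (top_of_set ?D) (\<lambda>s. (sec za (pa s), sec zb (pb s), sec zc (pc s), sec zd (pd s), sec zx (px s)))"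
    by (intro continuous_map_into_subtopology c) auto
  moreover have "continuous_map (top_of_set ?D) euclidean (\<lambda>(a, b, c, d, x). outer (frame a b c d x))"
    using continuous_frame by simp
  ultimately have "continuous_map (subtopology X U) euclidean
     ((\<lambda>(a, b, c, d, x). outer (frame a b c d x)) \<circ> (\<lambda>s. (sec za (pa s), sec zb (pb s), sec zc (pc s), sec zd (pd s), sec zx (px s))))"
    by (rule continuous_map_compose)
  then have "continuous_map (subtopology X U) euclidean (\<lambda>s. rframe (pa s) (pb s) (pc s) (pd s) (px s))"
  proof (rule continuous_map_eq)
    fix s assume "s \<in> topspace (subtopology X U)"
    then have "s \<in> U" by simp
    from ne[OF this] show "((\<lambda>(a, b, c, d, x). outer (frame a b c d x)) \<circ> (\<lambda>s. (sec za (pa s), sec zb (pb s), sec zc (pc s), sec zd (pd s), sec zx (px s)))) s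
       = rframe (pa s) (pb s) (pc s) (pd s) (px s)"
      by (simp add: sec_def rframe_def frame_scale outer_scale)
  qed
  then show "\<exists>U. openin X U \<and> s0 \<in> U \<and> continuous_map (subtopology X U) euclidean (\<lambda>s. rframe (pa s) (pb s) (pc s) (pd s) (px s))"
    using U \<open>s0 \<in> U\<close> by blast
qed

text \<open>A complete invariant of projective classes: \<open>normal_form_pact\<close> and
  \<open>normal_form_eqD\<close>.\<close>

definition normal_form :: "nat \<Rightarrow> nat \<Rightarrow> seed \<Rightarrow> (nat \<Rightarrow> real^3^3) \<times> (nat \<Rightarrow> real^3^3)" where
  "normal_form n k s =
     (\<lambda>i\<in>{1..n}. rframe (fst s 1) (fst s 2) (fst s 3) (fst s 4) (fst s i),
      \<lambda>j\<in>{n - k + 1..n}. rframe (fst s 1) (fst s 2) (fst s 3) (fst s 4) (snd s j))"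

abbreviation normal_form_topology :: "nat \<Rightarrow> nat \<Rightarrow> ((nat \<Rightarrow> real^3^3) \<times> (nat \<Rightarrow> real^3^3)) topology" where
  "normal_form_topology n k \<equiv> prod_topology (product_topology (\<lambda>_. euclidean) {1..n})
     (product_topology (\<lambda>_. euclidean) {n - k + 1..n})"

lemma topspace_seed_topology: "topspace (seed_topology n k) = seeds n k"
  by (auto simp: seed_topology_def seeds_def PiE_def)

lemma seed_nondeg:
  assumes n: "4 \<le> n" "1 \<le> k" "k \<le> n - 1" and l: "lift n k v w s"
  shows "nondeg (v 1) (v 2) (v 3) (v 4)"
proof -
  have v: "posc n v" using l by (simp add: lift_def)
  have "0 < br (v 1) (v 2) (v 3)" "0 < br (v 1) (v 3) (v 4)" "0 < br (v 1) (v 2) (v 4)" "0 < br (v 2) (v 3) (v 4)"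
    using n by (intro poscD[OF v]; simp)+
  then show ?thesis using br_swap(2)[of "v 1" "v 4" "v 3"] br_rot[of "v 2" "v 3" "v 4"]
    by (simp add: nondeg_def)
qed

lemma seed_nondeg_rep:
  assumes n: "4 \<le> n" "1 \<le> k" "k \<le> n - 1" and s: "s \<in> seeds n k"
  shows "nondeg (rep (fst s 1)) (rep (fst s 2)) (rep (fst s 3)) (rep (fst s 4))"
proof -
  obtain v w where l: "lift n k v w s" using seeds_lift[OF s n] by blast
  then have v: "posc n v" "s = seed_of n k v w" by (auto simp: lift_def)
  have c: "\<exists>c. c \<noteq> 0 \<and> rep (fst s i) = c *\<^sub>R v i" if "1 \<le> i" "i \<le> n" for i
    using rep_proj[OF posc_nonzero[OF v(1)]] that n by (simp add: v(2) seed_of_def)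
  obtain c1 c2 c3 c4 where "c1 \<noteq> 0" "c2 \<noteq> 0" "c3 \<noteq> 0" "c4 \<noteq> 0" "rep (fst s 1) = c1 *\<^sub>R v 1"
    "rep (fst s 2) = c2 *\<^sub>R v 2" "rep (fst s 3) = c3 *\<^sub>R v 3" "rep (fst s 4) = c4 *\<^sub>R v 4"
    using n c[of 1] c[of 2] c[of 3] c[of 4] by (auto simp del: One_nat_def)
  then show ?thesis using seed_nondeg[OF n l] by (simp add: nondeg_scale)
qed

lemma continuous_normal_form:
  assumes n: "4 \<le> n" "1 \<le> k" "k \<le> n - 1"
  shows "continuous_map (seed_topology n k) (normal_form_topology n k) (normal_form n k)"
proof -
  have A: "continuous_map (seed_topology n k) euclidean (\<lambda>s. fst s i)" if "i \<in> {1..n}" for i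
    unfolding seed_topology_def
    using continuous_map_compose[OF continuous_map_fst continuous_map_product_projection[OF that]]
    by (intro continuous_map_from_subtopology) (simp add: o_def)
  have B: "continuous_map (seed_topology n k) euclidean (\<lambda>s. snd s i)" if "i \<in> {n - k + 1..n}" for i
    unfolding seed_topology_def
    using continuous_map_compose[OF continuous_map_snd continuous_map_product_projection[OF that]]
    by (intro continuous_map_from_subtopology) (simp add: o_def)
  have "continuous_map (seed_topology n k) euclidean (\<lambda>s. rframe (fst s 1) (fst s 2) (fst s 3) (fst s 4) (q s))"
    if "continuous_map (seed_topology n k) euclidean q" for q
    by (intro continuous_map_rframe A that) (use n seed_nondeg_rep[OF n] in \<open>auto simp: topspace_seed_topology\<close>)
  then show ?thesis using A B
    unfolding normal_form_def continuous_map_pairwise o_def fst_conv snd_conv continuous_map_componentwise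
    by (auto simp: topspace_seed_topology)
qed

lemma Hausdorff_normal_form: "Hausdorff_space (normal_form_topology n k)"
  by (simp add: Hausdorff_space_prod_topology Hausdorff_space_product_topology)

lemma normal_form_pact:
  assumes n: "4 \<le> n" "1 \<le> k" "k \<le> n - 1" and M: "invertible M" and s: "s \<in> seeds n k"
  shows "normal_form n k (pact n k M s) = normal_form n k s"
proof -
  have p: "rframe (papply M a) (papply M b) (papply M c) (papply M d) (papply M x) = rframe a b c d x" for a b c d x
  proof -
    have "papply M y = proj (M *v rep y)" for y using papply_proj[OF M rep(1)[of y]] by (simp add: rep(2))
    moreover have "det M * det M * det M \<noteq> 0" using M by (simp add: invertible_det_nz)
    ultimately show ?thesis
      by (simp only: rframe_proj invertible_mult_zero[OF M] rep(1) not_False_eq_True frame_mult outer_scale rframe_def[of a b c d x])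
  qed
  have "fst (pact n k M s) i = papply M (fst s i)" if "i \<in> {1..n}" for i using that by (simp add: pact_def)
  moreover have "snd (pact n k M s) i = papply M (snd s i)" if "i \<in> {n - k + 1..n}" for i using that by (simp add: pact_def)
  ultimately show ?thesis unfolding normal_form_def using n by (auto simp: fun_eq_iff p)
qed

text \<open>Taking frame coordinates is the action of an invertible matrix. Equal coordinates mean
  that two such matrices carry the two seeds to one and the same seed.\<close>

lemma normal_form_eqD:
  assumes n: "4 \<le> n" "1 \<le> k" "k \<le> n - 1" and s: "s \<in> seeds n k" "s' \<in> seeds n k"
    and e: "normal_form n k s = normal_form n k s'"
  shows "spiral_class n k s = spiral_class n k s'"
proof -
  have m: "\<exists>M. invertible M \<and> (\<forall>x. rframe (fst s 1) (fst s 2) (fst s 3) (fst s 4) x = outer (M *v rep x)) "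
    if s: "s \<in> seeds n k" for s
  proof -
    obtain M where "invertible M" "\<forall>x. M *v x = frame (rep (fst s 1)) (rep (fst s 2)) (rep (fst s 3)) (rep (fst s 4)) x"
      using frame_matrix[OF seed_nondeg_rep[OF n s]] by blast
    then show ?thesis by (intro exI[of _ M]) (simp add: rframe_def)
  qed
  obtain M where M: "invertible M" "\<And>x. rframe (fst s 1) (fst s 2) (fst s 3) (fst s 4) x = outer (M *v rep x)" using m[OF s(1)] by blast
  obtain M' where M': "invertible M'" "\<And>x. rframe (fst s' 1) (fst s' 2) (fst s' 3) (fst s' 4) x = outer (M' *v rep x)" using m[OF s(2)] by blast
  have eq: "papply M x = papply M' y" if "outer (M *v rep x) = outer (M' *v rep y)" for x y
  proof -
    have nz: "M *v rep x \<noteq> 0" "M' *v rep y \<noteq> 0"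
      using rep(1) by (simp_all add: invertible_mult_zero[OF M(1)] invertible_mult_zero[OF M'(1)])
    have "papply M x = proj (M *v rep x)" "papply M' y = proj (M' *v rep y)"
      using papply_proj[OF M(1) rep(1)[of x]] papply_proj[OF M'(1) rep(1)[of y]] rep(2) by simp_all
    then show ?thesis using outer_eqD[OF that nz] by simp
  qed
  have "papply M (fst s i) = papply M' (fst s' i)" if "i \<in> {1..n}" for i
    using fun_cong[OF arg_cong[OF e, of fst], of i] that by (intro eq) (simp add: normal_form_def M(2) M'(2) del: One_nat_def)
  moreover have "papply M (snd s i) = papply M' (snd s' i)" if "i \<in> {n - k + 1..n}" for i
    using fun_cong[OF arg_cong[OF e, of snd], of i] that by (intro eq) (simp add: normal_form_def M(2) M'(2) del: One_nat_def)
  ultimately have "pact n k M s = pact n k M' s'" unfolding pact_def by (auto simp: fun_eq_iff)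
  then show ?thesis using spiral_class_pact[OF n M(1) s(1)] spiral_class_pact[OF n M'(1) s(2)] by simp
qed

theorem theorem1p2:
  fixes n k :: nat and x :: "ppath set"
  assumes "4 \<le> n" and "1 \<le> k" and "k \<le> n - 1"
    and "x \<in> spiral_space n k"
  shows "compactin (spiral_topology n k)
    (spiral_topology n k closure_of {int_iter (spiral_space n k) shift_class m x | m. True})"
proof -
  note n = assms(1-3)
  obtain s where s: "s \<in> seeds n k" "x = spiral_class n k s"
    using assms(4) unfolding spiral_seeds_eq(2)[OF n] by blast
  obtain \<kappa> where \<kappa>: "0 < \<kappa>" "\<And>a. \<kappa> \<le> rxi (\<lambda>a. vtx n k s a 0) a \<and> \<kappa> \<le> reta (\<lambda>a. vtx n k s a 0) a \<and>
      (\<forall>m<k. \<kappa> \<le> rtheta (\<lambda>a. vtx n k s a m) a)"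
    using orbit_bounded[OF n s(1)] by blast
  define V where "V = normal_rows n k \<kappa>"
  define \<Psi> where "\<Psi> v = seed_of n k (row_polygon n k v) (row_marks n k v)" for v
  \<comment> \<open>Compactness and closedness of \<open>K\<close> are two tasks, since the quotient
    is not known to be Hausdorff. The closure of the orbit is then a closed subset of a compact
    set.\<close>
  define K where "K = spiral_class n k ` \<Psi> ` V"
  have lift: "lift n k (pext n (row_polygon n k v)) (pext n (row_marks n k v)) (\<Psi> v)" if "v \<in> V" for v
    using normal_rows_lift[OF n \<kappa>(1)] that by (simp add: V_def \<Psi>_def)
  have \<Psi>s: "\<Psi> v \<in> seeds n k" if "v \<in> V" for v by (rule lift_seeds[OF lift[OF that] n])
  have \<Psi>c: "continuous_map (top_of_set V) (seed_topology n k) \<Psi>"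
  proof -
    have nz: "row_polygon n k v i \<noteq> 0" if "v \<in> V" "i \<in> {1..n}" for v i
      using posc_nonzero[of n "pext n (row_polygon n k v)" i] lift[OF that(1)] that(2) n by (simp add: lift_def)
    have nz': "row_marks n k v i \<noteq> 0" if "v \<in> V" "i \<in> {n - k + 1..n}" for v i
      using adv_nonzero[of n "pext n (row_polygon n k v)" k "pext n (row_marks n k v)" i] lift[OF that(1)] that(2) n by (simp add: lift_def)
    have "continuous_on V (\<lambda>v. proj (row_polygon n k v i))" if "i \<in> {1..n}" for i
      by (rule continuous_on_compose2[OF continuous_on_proj continuous_on_subset[OF continuous_row_polygon(1)]]) (use nz that in auto)
    moreover have "continuous_on V (\<lambda>v. proj (row_marks n k v i))" if "i \<in> {n - k + 1..n}" for i
      by (rule continuous_on_compose2[OF continuous_on_proj continuous_on_subset[OF continuous_row_polygon(2)]]) (use nz' that in auto)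
    ultimately show ?thesis
      unfolding seed_topology_def continuous_map_in_subtopology continuous_map_pairwise continuous_map_componentwise
      using \<Psi>s by (auto simp: \<Psi>_def seed_of_def o_def)
  qed
  \<comment> \<open>This is the defining property of the quotient topology, as
    \<open>spiral_seeds\<close> consists of all seeds.\<close>
  have cc: "continuous_map (seed_topology n k) (spiral_topology n k) (spiral_class n k)"
    unfolding continuous_map_def topspace_seed_topology topspace_spiral_topology openin_spiral_topology
    using spiral_seeds_eq[OF n] subtopology_topspace[of "seed_topology n k"]
    by (auto simp: topspace_seed_topology)
  have Vc: "compactin (top_of_set V) V"
    using compact_normal_rows[OF \<kappa>(1)] by (simp add: V_def compactin_subtopology compactin_euclidean_iff)
  have "compactin (seed_topology n k) (\<Psi> ` V)" by (rule image_compactin[OF Vc \<Psi>c])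
  then have Kc: "compactin (spiral_topology n k) K" unfolding K_def by (rule image_compactin[OF _ cc])
  \<comment> \<open>Closedness of \<open>K\<close> is checked on seeds: its full preimage there is
    the preimage under \<open>normal_form\<close> of a compact subset of a Hausdorff space.\<close>
  have "compactin (normal_form_topology n k) (normal_form n k ` \<Psi> ` V)"
    by (rule image_compactin[OF image_compactin[OF Vc \<Psi>c] continuous_normal_form[OF n]])
  then have "closedin (normal_form_topology n k) (normal_form n k ` \<Psi> ` V)"
    using Hausdorff_normal_form compactin_imp_closedin by blast
  then have cl: "closedin (seed_topology n k) {t \<in> seeds n k. normal_form n k t \<in> normal_form n k ` \<Psi> ` V}"
    using closedin_continuous_map_preimage[OF continuous_normal_form[OF n]] by (simp add: topspace_seed_topology)
  have sat: "normal_form n k t \<in> normal_form n k ` \<Psi> ` V \<longleftrightarrow> spiral_class n k t \<in> K" if t: "t \<in> seeds n k" for t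
  proof
    assume "normal_form n k t \<in> normal_form n k ` \<Psi> ` V"
    then obtain v where "v \<in> V" "normal_form n k t = normal_form n k (\<Psi> v)" by blast
    then show "spiral_class n k t \<in> K" using normal_form_eqD[OF n t \<Psi>s] by (auto simp: K_def)
  next
    assume "spiral_class n k t \<in> K"
    then obtain v where v: "v \<in> V" "spiral_class n k t = spiral_class n k (\<Psi> v)" by (auto simp: K_def)
    then obtain M where "invertible M" "t = pact n k M (\<Psi> v)" using spiral_class_eqD[OF n t \<Psi>s] by blast
    then show "normal_form n k t \<in> normal_form n k ` \<Psi> ` V" using normal_form_pact[OF n _ \<Psi>s] v by simp
  qed
  have "openin (seed_topology n k) {t \<in> seeds n k. spiral_class n k t \<in> spiral_space n k - K}"
  proof -
    have "{t \<in> seeds n k. spiral_class n k t \<in> spiral_space n k - K}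
      = seeds n k - {t \<in> seeds n k. normal_form n k t \<in> normal_form n k ` \<Psi> ` V}"
      using sat spiral_seeds_eq(2)[OF n] by auto
    then show ?thesis using cl by (simp add: closedin_def topspace_seed_topology)
  qed
  then have "openin (spiral_topology n k) (spiral_space n k - K)"
    unfolding openin_spiral_topology spiral_seeds_eq(1)[OF n]
    using subtopology_topspace[of "seed_topology n k"] by (simp add: topspace_seed_topology)
  moreover have "K \<subseteq> spiral_space n k" unfolding K_def spiral_seeds_eq(2)[OF n] using \<Psi>s by blast
  ultimately have Kcl: "closedin (spiral_topology n k) K" by (simp add: closedin_def topspace_spiral_topology)
  have "{int_iter (spiral_space n k) shift_class m x | m. True} \<subseteq> K"
  proof clarify
    fix m
    obtain v M where v: "v \<in> V" "invertible M" "\<Psi> v = pact n k M (orb n k s m)"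
      using orbit_normal[OF n s(1) \<kappa>(2), of m] unfolding V_def \<Psi>_def by blast
    have "int_iter (spiral_space n k) shift_class m x = spiral_class n k (orb n k s m)"
      unfolding s(2) by (rule int_iter_spiral[OF n s(1)])
    also have "\<dots> = spiral_class n k (\<Psi> v)" unfolding v(3) by (rule spiral_class_pact[OF n v(2) orb_in[OF n s(1)], symmetric])
    finally show "int_iter (spiral_space n k) shift_class m x \<in> K" using v(1) by (auto simp: K_def)
  qed
  then have "spiral_topology n k closure_of {int_iter (spiral_space n k) shift_class m x | m. True} \<subseteq> K"
    by (rule closure_of_minimal[OF _ Kcl])
  then show ?thesis by (rule closed_compactin[OF Kc _ closedin_closure_of])
qed

end
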